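(* Let $\mathcal{A}$ be a regular category, $\delta$ a degree function on $\mathcal{A}$, and $x_0\in\mathcal{A}$. Let $\mathcal{A}/x_0$ be the slice category over $x_0$, with the induced degree function $\delta'$, and let $F:=(-)\times x_0:\mathcal{A}\to\mathcal{A}/x_0$, $x\mapsto(x\times x_0,\mathrm{pr}_{x_0})$. Then the functor $F$ preserves finite limits, and the induced $\mathbb{K}$-linear symmetric monoidal functor $\overline{F}:\mathcal{T}(\mathcal{A},\delta)\to\mathcal{T}(\mathcal{A}/x_0,\delta')$ preserves finite limits.
   Context: $\mathbb{K}$ is a fixed field; all categories considered are well-powered. Following Knop, a category $\mathcal{A}$ is called regular if: it has a terminal object $\mathbf{1}_{\mathcal{A}}$; all morphisms have images (epi-mono factorizations, unique up to isomorphism); the pullback $x\times_z y$ exists whenever $x\to z\leftarrow y$ can be completed to a commutative square by some $w\to x$, $w\to y$; for any epimorphism $x\twoheadrightarrow z$ and any $y\to z$ the pullback $x\times_z y$ exists; epimorphisms are preserved under pullbacks. A degree function on $\mathcal{A}$ is a map $\delta:Epi(\mathcal{A})\to\mathbb{K}$ on the epimorphisms of $\mathcal{A}$ with $\delta(\mathrm{Id}_x)=1$, $\delta(e'e)=\delta(e')\delta(e)$ for composable epimorphisms, and $\delta(e')=\delta(e)$ whenever $e'$ is a pullback of $e$. A relation between $x$ and $y$ is a subobject $r\subset x\times y$. For relations $r\subset x\times y$, $s\subset y\times z$, their product is $r\star s:=\mathrm{im}(r\times_y s\to x\times z)$. The $\mathbb{K}$-linear category $\mathcal{T}^0(\mathcal{A},\delta)$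 has objects $[x]$ for $x\in\mathcal{A}$; morphisms $[x]\to[y]$ are formal $\mathbb{K}$-linear combinations of symbols $\langle r\rangle$, $r\subset x\times y$ a relation; composition is $\langle s\rangle\circ\langle r\rangle:=\delta(e)\langle r\star s\rangle$ if $r\times_y s$ exists, where $e:r\times_y s\twoheadrightarrow r\star s$, and $0$ otherwise. $\mathcal{T}(\mathcal{A},\delta)$ is the additive Karoubi completion of $\mathcal{T}^0(\mathcal{A},\delta)$, with symmetric monoidal structure $[x]\otimes[y]:=[x\times y]$. The objects of $\mathcal{A}/x_0$ are pairs $(x,p_x)$ with $p_x:x\to x_0$ a morphism of $\mathcal{A}$; a morphism $(x,p_x)\to(y,p_y)$ is $f:x\to y$ with $p_y\circ f=p_x$. This category is again regular (Knop). The induced degree function is $\delta'(e):=\delta(e)$, where for an epimorphism $e:(x,p_x)\twoheadrightarrow(y,p_y)$ in $\mathcal{A}/x_0$ the right-hand $e$ is the underlying epimorphism $x\twoheadrightarrow y$ in $\mathcal{A}$. The functor $F$ is right adjoint to the forgetful functor $(x,p_x)\mapsto x$; it preserves pullbacks, terminal objects and the degree functions ($F$ preserves epimorphisms and $\delta'(F(e))=\delta(e)$). The induced functor $\overline{F}$ is the $\mathbb{K}$-linear extension to Karoubi completions of $[x]\mapsto[F(x)]$, $\langle r\rangle\mapsto\langle F(r)\rangle$, where for $r\subset x\times y$ one views $F(r)\subset F(x\times y)$ as a subobject of $F(x)\times F(y)$ via the natural map $F(x\times y)\to F(x)\times F(y)$. *)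

theory Defs
  imports
    Complex_Main
    "HOL-Library.Poly_Mapping"
    "HOL-Library.Function_Algebras"
    "HOL-Library.Nat_Bijection"
begin

section \<open>Categories\<close>

text \<open>
  Morphisms carry no source and target: hom-sets are indexed by pairs of objects and need not be
  disjoint, so whatever depends on a morphism takes its source and target as arguments.
  \<open>Cmp C x y z g f\<close> is the composite of \<open>f : x \<rightarrow> y\<close> followed by \<open>g : y \<rightarrow> z\<close>. Hom-sets are
  sets in the sense of HOL, and so are the subobjects of an object: every category here is
  well-powered.
\<close>

record ('o, 'a) cat =
  Obj :: "'o set"
  Hom :: "'o \<Rightarrow> 'o \<Rightarrow> 'a set"
  Idn :: "'o \<Rightarrow> 'a"
  Cmp :: "'o \<Rightarrow> 'o \<Rightarrow> 'o \<Rightarrow> 'a \<Rightarrow> 'a \<Rightarrow> 'a"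

locale category =
  fixes C :: "('o, 'a, 'r) cat_scheme"
  assumes id_in_hom: "x \<in> Obj C \<Longrightarrow> Idn C x \<in> Hom C x x"
    and comp_in_hom: "\<lbrakk>x \<in> Obj C; y \<in> Obj C; z \<in> Obj C; f \<in> Hom C x y; g \<in> Hom C y z\<rbrakk>
      \<Longrightarrow> Cmp C x y z g f \<in> Hom C x z"
    and comp_id_left: "\<lbrakk>x \<in> Obj C; y \<in> Obj C; f \<in> Hom C x y\<rbrakk> \<Longrightarrow> Cmp C x y y (Idn C y) f = f"
    and comp_id_right: "\<lbrakk>x \<in> Obj C; y \<in> Obj C; f \<in> Hom C x y\<rbrakk> \<Longrightarrow> Cmp C x x y f (Idn C x) = f"
    and comp_assoc: "\<lbrakk>w \<in> Obj C; x \<in> Obj C; y \<in> Obj C; z \<in> Obj C;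
        f \<in> Hom C w x; g \<in> Hom C x y; h \<in> Hom C y z\<rbrakk>
      \<Longrightarrow> Cmp C w y z h (Cmp C w x y g f) = Cmp C w x z (Cmp C x y z h g) f"

definition monic :: "('o, 'a, 'r) cat_scheme \<Rightarrow> 'o \<Rightarrow> 'o \<Rightarrow> 'a \<Rightarrow> bool" where
  "monic C x y f \<longleftrightarrow> f \<in> Hom C x y \<and>
     (\<forall>w \<in> Obj C. \<forall>g \<in> Hom C w x. \<forall>h \<in> Hom C w x. Cmp C w x y f g = Cmp C w x y f h \<longrightarrow> g = h)"

definition epic :: "('o, 'a, 'r) cat_scheme \<Rightarrow> 'o \<Rightarrow> 'o \<Rightarrow> 'a \<Rightarrow> bool" where
  "epic C x y f \<longleftrightarrow> f \<in> Hom C x y \<and>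
     (\<forall>z \<in> Obj C. \<forall>g \<in> Hom C y z. \<forall>h \<in> Hom C y z. Cmp C x y z g f = Cmp C x y z h f \<longrightarrow> g = h)"

definition iso :: "('o, 'a, 'r) cat_scheme \<Rightarrow> 'o \<Rightarrow> 'o \<Rightarrow> 'a \<Rightarrow> bool" where
  "iso C x y f \<longleftrightarrow> f \<in> Hom C x y \<and>
     (\<exists>g \<in> Hom C y x. Cmp C x y x g f = Idn C x \<and> Cmp C y x y f g = Idn C y)"

definition terminal :: "('o, 'a, 'r) cat_scheme \<Rightarrow> 'o \<Rightarrow> bool" where
  "terminal C t \<longleftrightarrow> t \<in> Obj C \<and> (\<forall>x \<in> Obj C. \<exists>!f. f \<in> Hom C x t)"

definition is_product :: "('o, 'a, 'r) cat_scheme \<Rightarrow> 'o \<Rightarrow> 'o \<Rightarrow> 'o \<Rightarrow> 'a \<Rightarrow> 'a \<Rightarrow> bool" where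
  "is_product C x y p a b \<longleftrightarrow> p \<in> Obj C \<and> a \<in> Hom C p x \<and> b \<in> Hom C p y \<and>
     (\<forall>w \<in> Obj C. \<forall>f \<in> Hom C w x. \<forall>g \<in> Hom C w y.
        \<exists>!h. h \<in> Hom C w p \<and> Cmp C w p x a h = f \<and> Cmp C w p y b h = g)"

definition is_pullback ::
  "('o, 'a, 'r) cat_scheme \<Rightarrow> 'o \<Rightarrow> 'o \<Rightarrow> 'o \<Rightarrow> 'a \<Rightarrow> 'a \<Rightarrow> 'o \<Rightarrow> 'a \<Rightarrow> 'a \<Rightarrow> bool" where
  "is_pullback C x y z f g p a b \<longleftrightarrow>
     p \<in> Obj C \<and> a \<in> Hom C p x \<and> b \<in> Hom C p y \<and> Cmp C p x z f a = Cmp C p y z g b \<and>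
     (\<forall>w \<in> Obj C. \<forall>u \<in> Hom C w x. \<forall>v \<in> Hom C w y. Cmp C w x z f u = Cmp C w y z g v \<longrightarrow>
        (\<exists>!h. h \<in> Hom C w p \<and> Cmp C w p x a h = u \<and> Cmp C w p y b h = v))"

definition has_product :: "('o, 'a, 'r) cat_scheme \<Rightarrow> 'o \<Rightarrow> 'o \<Rightarrow> bool" where
  "has_product C x y \<longleftrightarrow> (\<exists>p a b. is_product C x y p a b)"

definition has_pullback ::
  "('o, 'a, 'r) cat_scheme \<Rightarrow> 'o \<Rightarrow> 'o \<Rightarrow> 'o \<Rightarrow> 'a \<Rightarrow> 'a \<Rightarrow> bool" where
  "has_pullback C x y z f g \<longleftrightarrow> (\<exists>p a b. is_pullback C x y z f g p a b)"

definition epi_mono ::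
  "('o, 'a, 'r) cat_scheme \<Rightarrow> 'o \<Rightarrow> 'o \<Rightarrow> 'a \<Rightarrow> 'o \<Rightarrow> 'a \<Rightarrow> 'a \<Rightarrow> bool" where
  "epi_mono C x y f q e m \<longleftrightarrow>
     q \<in> Obj C \<and> epic C x q e \<and> monic C q y m \<and> Cmp C x q y m e = f"


subsection \<open>Regular categories and degree functions\<close>

locale regular_category = category C for C :: "('o, 'a, 'r) cat_scheme" +
  assumes terminal_exists: "\<exists>t. terminal C t"
    and image_exists: "\<lbrakk>x \<in> Obj C; y \<in> Obj C; f \<in> Hom C x y\<rbrakk> \<Longrightarrow> \<exists>q e m. epi_mono C x y f q e m"
    and image_unique: "\<lbrakk>x \<in> Obj C; y \<in> Obj C; f \<in> Hom C x y;
        epi_mono C x y f q e m; epi_mono C x y f q' e' m'\<rbrakk>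
      \<Longrightarrow> \<exists>h. iso C q q' h \<and> Cmp C x q q' h e = e' \<and> Cmp C q q' y m' h = m"
    and pullback_of_completable:
      "\<lbrakk>x \<in> Obj C; y \<in> Obj C; z \<in> Obj C; f \<in> Hom C x z; g \<in> Hom C y z;
        w \<in> Obj C; u \<in> Hom C w x; v \<in> Hom C w y; Cmp C w x z f u = Cmp C w y z g v\<rbrakk>
      \<Longrightarrow> has_pullback C x y z f g"
    and pullback_of_epi:
      "\<lbrakk>x \<in> Obj C; y \<in> Obj C; z \<in> Obj C; epic C x z f; g \<in> Hom C y z\<rbrakk> \<Longrightarrow> has_pullback C x y z f g"
    and epi_stable:
      "\<lbrakk>x \<in> Obj C; y \<in> Obj C; z \<in> Obj C; epic C x z f; g \<in> Hom C y z; is_pullback C x y z f g p a b\<rbrakk>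
      \<Longrightarrow> epic C p y b"

text \<open>The values of \<open>\<delta> x y e\<close> matter only when \<open>e : x \<rightarrow> y\<close> is an epimorphism.\<close>

definition degree_function ::
  "('o, 'a, 'r) cat_scheme \<Rightarrow> ('o \<Rightarrow> 'o \<Rightarrow> 'a \<Rightarrow> 'k::field) \<Rightarrow> bool" where
  "degree_function C \<delta> \<longleftrightarrow>
     (\<forall>x \<in> Obj C. \<delta> x x (Idn C x) = 1) \<and>
     (\<forall>x \<in> Obj C. \<forall>y \<in> Obj C. \<forall>z \<in> Obj C. \<forall>e e'. epic C x y e \<longrightarrow> epic C y z e' \<longrightarrow>
        \<delta> x z (Cmp C x y z e' e) = \<delta> y z e' * \<delta> x y e) \<and>
     (\<forall>x \<in> Obj C. \<forall>y \<in> Obj C. \<forall>z \<in> Obj C. \<forall>e. \<forall>g \<in> Hom C y z. \<forall>p a e'.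
        epic C x z e \<longrightarrow> is_pullback C x y z e g p a e' \<longrightarrow> \<delta> p y e' = \<delta> x z e)"


subsection \<open>Functors and finite limits\<close>

locale cat_functor = C: category C + D: category D
  for C :: "('o, 'a, 'r) cat_scheme" and D :: "('p, 'b, 's) cat_scheme" +
  fixes Fo :: "'o \<Rightarrow> 'p" and Fm :: "'o \<Rightarrow> 'o \<Rightarrow> 'a \<Rightarrow> 'b"
  assumes F_obj: "x \<in> Obj C \<Longrightarrow> Fo x \<in> Obj D"
    and F_hom: "\<lbrakk>x \<in> Obj C; y \<in> Obj C; f \<in> Hom C x y\<rbrakk> \<Longrightarrow> Fm x y f \<in> Hom D (Fo x) (Fo y)"
    and F_id: "x \<in> Obj C \<Longrightarrow> Fm x x (Idn C x) = Idn D (Fo x)"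
    and F_comp: "\<lbrakk>x \<in> Obj C; y \<in> Obj C; z \<in> Obj C; f \<in> Hom C x y; g \<in> Hom C y z\<rbrakk>
      \<Longrightarrow> Fm x z (Cmp C x y z g f) = Cmp D (Fo x) (Fo y) (Fo z) (Fm y z g) (Fm x y f)"

definition finite_category :: "('o, 'a, 'r) cat_scheme \<Rightarrow> bool" where
  "finite_category J \<longleftrightarrow>
     category J \<and> finite (Obj J) \<and> (\<forall>i \<in> Obj J. \<forall>j \<in> Obj J. finite (Hom J i j))"

definition is_cone ::
  "('j, 'b, 's) cat_scheme \<Rightarrow> ('o, 'a, 'r) cat_scheme \<Rightarrow> ('j \<Rightarrow> 'o) \<Rightarrow> ('j \<Rightarrow> 'j \<Rightarrow> 'b \<Rightarrow> 'a)
    \<Rightarrow> 'o \<Rightarrow> ('j \<Rightarrow> 'a) \<Rightarrow> bool" where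
  "is_cone J C Do Dm L l \<longleftrightarrow> L \<in> Obj C \<and> (\<forall>j \<in> Obj J. l j \<in> Hom C L (Do j)) \<and>
     (\<forall>i \<in> Obj J. \<forall>j \<in> Obj J. \<forall>u \<in> Hom J i j. Cmp C L (Do i) (Do j) (Dm i j u) (l i) = l j)"

definition is_limit ::
  "('j, 'b, 's) cat_scheme \<Rightarrow> ('o, 'a, 'r) cat_scheme \<Rightarrow> ('j \<Rightarrow> 'o) \<Rightarrow> ('j \<Rightarrow> 'j \<Rightarrow> 'b \<Rightarrow> 'a)
    \<Rightarrow> 'o \<Rightarrow> ('j \<Rightarrow> 'a) \<Rightarrow> bool" where
  "is_limit J C Do Dm L l \<longleftrightarrow> is_cone J C Do Dm L l \<and>
     (\<forall>Z m. is_cone J C Do Dm Z m \<longrightarrow>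
        (\<exists>!h. h \<in> Hom C Z L \<and> (\<forall>j \<in> Obj J. Cmp C Z L (Do j) (l j) h = m j)))"

text \<open>
  The index categories have natural numbers as objects and morphisms; up to isomorphism
  these are all finite categories. The target need not have finite limits.
\<close>

definition preserves_finite_limits ::
  "('o, 'a, 'r) cat_scheme \<Rightarrow> ('p, 'b, 's) cat_scheme \<Rightarrow> ('o \<Rightarrow> 'p) \<Rightarrow> ('o \<Rightarrow> 'o \<Rightarrow> 'a \<Rightarrow> 'b) \<Rightarrow> bool"
  where
  "preserves_finite_limits C D Fo Fm \<longleftrightarrow> cat_functor C D Fo Fm \<and>
     (\<forall>(J :: (nat, nat) cat) Do Dm L l.
        finite_category J \<longrightarrow> cat_functor J C Do Dm \<longrightarrow> is_limit J C Do Dm L l \<longrightarrow>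
        is_limit J D (\<lambda>j. Fo (Do j)) (\<lambda>i j u. Fm (Do i) (Do j) (Dm i j u)) (Fo L) (\<lambda>j. Fm L (Do j) (l j)))"


section \<open>Chosen products, pullbacks, images and subobjects\<close>

text \<open>
  Products need not exist in a regular category. The constants \<open>prd\<close>, \<open>pr1\<close>, \<open>pr2\<close>, \<open>pair\<close> are
  meaningful only if \<open>has_product\<close> holds, and \<open>pullback_of\<close> only if \<open>has_pullback\<close> holds.
\<close>

definition product_of :: "('o, 'a, 'r) cat_scheme \<Rightarrow> 'o \<Rightarrow> 'o \<Rightarrow> 'o \<times> 'a \<times> 'a" where
  "product_of C x y = (SOME t. case t of (p, a, b) \<Rightarrow> is_product C x y p a b)"

definition prd :: "('o, 'a, 'r) cat_scheme \<Rightarrow> 'o \<Rightarrow> 'o \<Rightarrow> 'o" where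
  "prd C x y = fst (product_of C x y)"

definition pr1 :: "('o, 'a, 'r) cat_scheme \<Rightarrow> 'o \<Rightarrow> 'o \<Rightarrow> 'a" where
  "pr1 C x y = fst (snd (product_of C x y))"

definition pr2 :: "('o, 'a, 'r) cat_scheme \<Rightarrow> 'o \<Rightarrow> 'o \<Rightarrow> 'a" where
  "pr2 C x y = snd (snd (product_of C x y))"

definition pair :: "('o, 'a, 'r) cat_scheme \<Rightarrow> 'o \<Rightarrow> 'o \<Rightarrow> 'o \<Rightarrow> 'a \<Rightarrow> 'a \<Rightarrow> 'a" where
  "pair C w x y f g = (THE h. h \<in> Hom C w (prd C x y) \<and>
     Cmp C w (prd C x y) x (pr1 C x y) h = f \<and> Cmp C w (prd C x y) y (pr2 C x y) h = g)"

definition pullback_of ::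
  "('o, 'a, 'r) cat_scheme \<Rightarrow> 'o \<Rightarrow> 'o \<Rightarrow> 'o \<Rightarrow> 'a \<Rightarrow> 'a \<Rightarrow> 'o \<times> 'a \<times> 'a" where
  "pullback_of C x y z f g = (SOME t. case t of (p, a, b) \<Rightarrow> is_pullback C x y z f g p a b)"

definition image_of :: "('o, 'a, 'r) cat_scheme \<Rightarrow> 'o \<Rightarrow> 'o \<Rightarrow> 'a \<Rightarrow> 'o \<times> 'a \<times> 'a" where
  "image_of C x y f = (SOME t. case t of (q, e, m) \<Rightarrow> epi_mono C x y f q e m)"

definition terminal_of :: "('o, 'a, 'r) cat_scheme \<Rightarrow> 'o" where
  "terminal_of C = (SOME t. terminal C t)"

text \<open>\<open>subobj C z r m\<close> is the isomorphism class of the monomorphism \<open>m : r \<rightarrow> z\<close>.\<close>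

definition subobj :: "('o, 'a, 'r) cat_scheme \<Rightarrow> 'o \<Rightarrow> 'o \<Rightarrow> 'a \<Rightarrow> ('o \<times> 'a) set" where
  "subobj C z r m = {(s, n). s \<in> Obj C \<and> monic C s z n \<and> (\<exists>h. iso C r s h \<and> Cmp C r s z n h = m)}"

definition Subobj :: "('o, 'a, 'r) cat_scheme \<Rightarrow> 'o \<Rightarrow> ('o \<times> 'a) set set" where
  "Subobj C z = {subobj C z r m | r m. r \<in> Obj C \<and> monic C r z m}"

definition rep :: "('o \<times> 'a) set \<Rightarrow> 'o \<times> 'a" where
  "rep R = (SOME t. t \<in> R)"

definition Rel :: "('o, 'a, 'r) cat_scheme \<Rightarrow> 'o \<Rightarrow> 'o \<Rightarrow> ('o \<times> 'a) set set" where
  "Rel C x y = (if has_product C x y then Subobj C (prd C x y) else {})"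


section \<open>The category of relations \<open>\<T>\<^sup>0\<close>\<close>

text \<open>
  In a linear category the additive structure of the hom-sets is that of the ambient type of
  morphisms.
\<close>

record ('o, 'a, 'k) lincat = "('o, 'a) cat" +
  Scl :: "'k \<Rightarrow> 'a \<Rightarrow> 'a"

definition rel_comp ::
  "('o, 'a, 'r) cat_scheme \<Rightarrow> ('o \<Rightarrow> 'o \<Rightarrow> 'a \<Rightarrow> 'k::field) \<Rightarrow> 'o \<Rightarrow> 'o \<Rightarrow> 'o
    \<Rightarrow> ('o \<times> 'a) set \<Rightarrow> ('o \<times> 'a) set \<Rightarrow> ('o \<times> 'a) set \<Rightarrow>\<^sub>0 'k" where
  "rel_comp C \<delta> x y z S R =
     (let (r, m) = rep R; (s, n) = rep S;
          r1 = Cmp C r (prd C x y) x (pr1 C x y) m;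
          r2 = Cmp C r (prd C x y) y (pr2 C x y) m;
          s1 = Cmp C s (prd C y z) y (pr1 C y z) n;
          s2 = Cmp C s (prd C y z) z (pr2 C y z) n
      in if has_pullback C r s y r2 s1
         then let (p, u, v) = pullback_of C r s y r2 s1;
                  (q, e, i) = image_of C p (prd C x z)
                                (pair C p x z (Cmp C p r x r1 u) (Cmp C p s z s2 v))
              in Poly_Mapping.single (subobj C (prd C x z) q i) (\<delta> p q e)
         else 0)"

definition graph_rel :: "('o, 'a, 'r) cat_scheme \<Rightarrow> 'o \<Rightarrow> 'o \<Rightarrow> 'a \<Rightarrow> ('o \<times> 'a) set \<Rightarrow>\<^sub>0 'k::field" where
  "graph_rel C x y f = Poly_Mapping.single (subobj C (prd C x y) x (pair C x x y (Idn C x) f)) 1"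

definition T0 ::
  "('o, 'a, 'r) cat_scheme \<Rightarrow> ('o \<Rightarrow> 'o \<Rightarrow> 'a \<Rightarrow> 'k::field)
    \<Rightarrow> ('o, ('o \<times> 'a) set \<Rightarrow>\<^sub>0 'k, 'k) lincat" where
  "T0 C \<delta> = \<lparr>
     Obj = Obj C,
     Hom = (\<lambda>x y. {\<phi>. Poly_Mapping.keys \<phi> \<subseteq> Rel C x y}),
     Idn = (\<lambda>x. graph_rel C x x (Idn C x)),
     Cmp = (\<lambda>x y z \<psi> \<phi>. \<Sum>R \<in> Poly_Mapping.keys \<phi>. \<Sum>S \<in> Poly_Mapping.keys \<psi>.
              Poly_Mapping.map ((*) (Poly_Mapping.lookup \<psi> S * Poly_Mapping.lookup \<phi> R))
                (rel_comp C \<delta> x y z S R)),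
     Scl = (\<lambda>c. Poly_Mapping.map ((*) c))\<rparr>"


section \<open>Additive and Karoubi completion\<close>

text \<open>
  The objects of the additive completion are the finite families of objects of \<open>C\<close> indexed by
  natural numbers, its morphisms are the matrices; the entry \<open>f i j\<close> goes from the \<open>i\<close>-th to the
  \<open>j\<close>-th summand, and entries outside the index sets are \<open>0\<close>.
\<close>

definition additive ::
  "('o, 'v::ab_group_add, 'k) lincat \<Rightarrow> (nat \<rightharpoonup> 'o, nat \<Rightarrow> nat \<Rightarrow> 'v, 'k) lincat" where
  "additive C = \<lparr>
     Obj = {X. finite (dom X) \<and> ran X \<subseteq> Obj C},
     Hom = (\<lambda>X Y. {f. \<forall>i j. if i \<in> dom X \<and> j \<in> dom Y
                              then f i j \<in> Hom C (the (X i)) (the (Y j)) else f i j = 0}),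
     Idn = (\<lambda>X i j. if i \<in> dom X \<and> j = i then Idn C (the (X i)) else 0),
     Cmp = (\<lambda>X Y Z g f i k. if i \<in> dom X \<and> k \<in> dom Z
              then \<Sum>j \<in> dom Y. Cmp C (the (X i)) (the (Y j)) (the (Z k)) (g j k) (f i j) else 0),
     Scl = (\<lambda>c f i j. Scl C c (f i j))\<rparr>"

definition karoubi :: "('o, 'v, 'k) lincat \<Rightarrow> ('o \<times> 'v, 'v, 'k) lincat" where
  "karoubi C = \<lparr>
     Obj = {(x, e). x \<in> Obj C \<and> e \<in> Hom C x x \<and> Cmp C x x x e e = e},
     Hom = (\<lambda>(x, e) (y, d). {f \<in> Hom C x y. Cmp C x x y (Cmp C x y y d f) e = f}),
     Idn = (\<lambda>(x, e). e),
     Cmp = (\<lambda>(x, _) (y, _) (z, _). Cmp C x y z),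
     Scl = Scl C\<rparr>"

definition T ::
  "('o, 'a, 'r) cat_scheme \<Rightarrow> ('o \<Rightarrow> 'o \<Rightarrow> 'a \<Rightarrow> 'k::field)
    \<Rightarrow> ((nat \<rightharpoonup> 'o) \<times> (nat \<Rightarrow> nat \<Rightarrow> ('o \<times> 'a) set \<Rightarrow>\<^sub>0 'k),
        nat \<Rightarrow> nat \<Rightarrow> ('o \<times> 'a) set \<Rightarrow>\<^sub>0 'k, 'k) lincat" where
  "T C \<delta> = karoubi (additive (T0 C \<delta>))"

definition linear_functor ::
  "('o, 'v::ab_group_add, 'k) lincat \<Rightarrow> ('p, 'w::ab_group_add, 'k) lincat
    \<Rightarrow> ('o \<Rightarrow> 'p) \<Rightarrow> ('o \<Rightarrow> 'o \<Rightarrow> 'v \<Rightarrow> 'w) \<Rightarrow> bool" where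
  "linear_functor C D Fo Fm \<longleftrightarrow> cat_functor C D Fo Fm \<and>
     (\<forall>x \<in> Obj C. \<forall>y \<in> Obj C. \<forall>f \<in> Hom C x y.
        (\<forall>g \<in> Hom C x y. Fm x y (f + g) = Fm x y f + Fm x y g) \<and>
        (\<forall>c. Fm x y (Scl C c f) = Scl D c (Fm x y f)))"


section \<open>The symmetric monoidal structure\<close>

text \<open>
  \<open>tmor x x' y y' f g\<close> is the tensor product of \<open>f : x \<rightarrow> x'\<close> and \<open>g : y \<rightarrow> y'\<close>;
  \<open>tassoc x y z\<close> goes from \<open>(x \<otimes> y) \<otimes> z\<close> to \<open>x \<otimes> (y \<otimes> z)\<close>.
\<close>

record ('o, 'v) tensor =
  tobj :: "'o \<Rightarrow> 'o \<Rightarrow> 'o"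
  tmor :: "'o \<Rightarrow> 'o \<Rightarrow> 'o \<Rightarrow> 'o \<Rightarrow> 'v \<Rightarrow> 'v \<Rightarrow> 'v"
  tunit :: "'o"
  tassoc :: "'o \<Rightarrow> 'o \<Rightarrow> 'o \<Rightarrow> 'v"
  tlunit :: "'o \<Rightarrow> 'v"
  trunit :: "'o \<Rightarrow> 'v"
  tbraid :: "'o \<Rightarrow> 'o \<Rightarrow> 'v"

text \<open>
  The tensor product of the relations \<open>r \<subseteq> x \<times> x'\<close> and \<open>s \<subseteq> y \<times> y'\<close> is
  \<open>r \<times> s \<subseteq> (x \<times> y) \<times> (x' \<times> y')\<close>, or \<open>0\<close> if \<open>r \<times> s\<close> does not exist.
\<close>

definition rel_tensor ::
  "('o, 'a, 'r) cat_scheme \<Rightarrow> 'o \<Rightarrow> 'o \<Rightarrow> 'o \<Rightarrow> 'o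
    \<Rightarrow> ('o \<times> 'a) set \<Rightarrow> ('o \<times> 'a) set \<Rightarrow> ('o \<times> 'a) set \<Rightarrow>\<^sub>0 'k::field" where
  "rel_tensor C x x' y y' R S =
     (let (r, m) = rep R; (s, n) = rep S;
          p = prd C r s;
          m' = Cmp C p r (prd C x x') m (pr1 C r s);
          n' = Cmp C p s (prd C y y') n (pr2 C r s);
          a = pair C p x y (Cmp C p (prd C x x') x (pr1 C x x') m')
                           (Cmp C p (prd C y y') y (pr1 C y y') n');
          b = pair C p x' y' (Cmp C p (prd C x x') x' (pr2 C x x') m')
                             (Cmp C p (prd C y y') y' (pr2 C y y') n')
      in if has_product C r s
         then Poly_Mapping.single
                (subobj C (prd C (prd C x y) (prd C x' y')) p (pair C p (prd C x y) (prd C x' y') a b)) 1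
         else 0)"

definition prd_assoc :: "('o, 'a, 'r) cat_scheme \<Rightarrow> 'o \<Rightarrow> 'o \<Rightarrow> 'o \<Rightarrow> 'a" where
  "prd_assoc C x y z =
     (let xy = prd C x y; p = prd C xy z; q = pr1 C xy z
      in pair C p x (prd C y z) (Cmp C p xy x (pr1 C x y) q)
           (pair C p y z (Cmp C p xy y (pr2 C x y) q) (pr2 C xy z)))"

text \<open>Partial structure: \<open>[x] \<otimes> [y]\<close> is meaningful only if \<open>x \<times> y\<close> exists.\<close>

definition T0_tensor ::
  "('o, 'a, 'r) cat_scheme \<Rightarrow> ('o, ('o \<times> 'a) set \<Rightarrow>\<^sub>0 'k::field) tensor" where
  "T0_tensor C = \<lparr>
     tobj = prd C,
     tmor = (\<lambda>x x' y y' \<phi> \<psi>. \<Sum>R \<in> Poly_Mapping.keys \<phi>. \<Sum>S \<in> Poly_Mapping.keys \<psi>.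
               Poly_Mapping.map ((*) (Poly_Mapping.lookup \<phi> R * Poly_Mapping.lookup \<psi> S))
                 (rel_tensor C x x' y y' R S)),
     tunit = terminal_of C,
     tassoc = (\<lambda>x y z. graph_rel C (prd C (prd C x y) z) (prd C x (prd C y z)) (prd_assoc C x y z)),
     tlunit = (\<lambda>x. graph_rel C (prd C (terminal_of C) x) x (pr2 C (terminal_of C) x)),
     trunit = (\<lambda>x. graph_rel C (prd C x (terminal_of C)) x (pr1 C x (terminal_of C))),
     tbraid = (\<lambda>x y. graph_rel C (prd C x y) (prd C y x)
                       (pair C (prd C x y) y x (pr2 C x y) (pr1 C x y)))\<rparr>"

text \<open>
  The tensor product of two families is indexed by the (encoded) pairs \<open>(i, j)\<close> of indices for
  which \<open>ex (X i) (Y j)\<close> holds; the other pairs contribute a zero object.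
\<close>

definition fam_tensor ::
  "('o \<Rightarrow> 'o \<Rightarrow> bool) \<Rightarrow> ('o \<Rightarrow> 'o \<Rightarrow> 'o) \<Rightarrow> (nat \<rightharpoonup> 'o) \<Rightarrow> (nat \<rightharpoonup> 'o) \<Rightarrow> (nat \<rightharpoonup> 'o)" where
  "fam_tensor ex t X Y k =
     (let (i, j) = prod_decode k
      in if i \<in> dom X \<and> j \<in> dom Y \<and> ex (the (X i)) (the (Y j))
         then Some (t (the (X i)) (the (Y j))) else None)"

definition additive_tensor ::
  "('o \<Rightarrow> 'o \<Rightarrow> bool) \<Rightarrow> ('o, 'v::ab_group_add) tensor \<Rightarrow> (nat \<rightharpoonup> 'o, nat \<Rightarrow> nat \<Rightarrow> 'v) tensor" where
  "additive_tensor ex S =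
     (let ten = fam_tensor ex (tobj S)
      in \<lparr>
     tobj = ten,
     tmor = (\<lambda>X X' Y Y' f g k l.
               let (i, j) = prod_decode k; (i', j') = prod_decode l
               in if k \<in> dom (ten X Y) \<and> l \<in> dom (ten X' Y')
                  then tmor S (the (X i)) (the (X' i')) (the (Y j)) (the (Y' j')) (f i i') (g j j')
                  else 0),
     tunit = [0 \<mapsto> tunit S],
     tassoc = (\<lambda>X Y Z k l.
               let (h, m) = prod_decode k; (i, j) = prod_decode h
               in if k \<in> dom (ten (ten X Y) Z) \<and> l = prod_encode (i, prod_encode (j, m))
                  then tassoc S (the (X i)) (the (Y j)) (the (Z m)) else 0),
     tlunit = (\<lambda>X k l. if l \<in> dom X \<and> k = prod_encode (0, l) then tlunit S (the (X l)) else 0),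
     trunit = (\<lambda>X k l. if l \<in> dom X \<and> k = prod_encode (l, 0) then trunit S (the (X l)) else 0),
     tbraid = (\<lambda>X Y k l.
               let (i, j) = prod_decode k
               in if k \<in> dom (ten X Y) \<and> l = prod_encode (j, i)
                  then tbraid S (the (X i)) (the (Y j)) else 0)\<rparr>)"

text \<open>
  The structural isomorphisms at objects \<open>(x, e)\<close> are those of \<open>C\<close>, precomposed with the
  idempotent that defines their source.
\<close>

definition karoubi_tensor ::
  "('o, 'v, 'k) lincat \<Rightarrow> ('o, 'v) tensor \<Rightarrow> ('o \<times> 'v, 'v) tensor" where
  "karoubi_tensor C S =
     (let u = tunit S; ten = tobj S
      in \<lparr>
     tobj = (\<lambda>(x, e) (y, d). (ten x y, tmor S x x y y e d)),
     tmor = (\<lambda>(x, _) (x', _) (y, _) (y', _). tmor S x x' y y'),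
     tunit = (u, Idn C u),
     tassoc = (\<lambda>(x, e) (y, d) (z, c).
                 Cmp C (ten (ten x y) z) (ten (ten x y) z) (ten x (ten y z)) (tassoc S x y z)
                   (tmor S (ten x y) (ten x y) z z (tmor S x x y y e d) c)),
     tlunit = (\<lambda>(x, e). Cmp C (ten u x) (ten u x) x (tlunit S x) (tmor S u u x x (Idn C u) e)),
     trunit = (\<lambda>(x, e). Cmp C (ten x u) (ten x u) x (trunit S x) (tmor S x x u u e (Idn C u))),
     tbraid = (\<lambda>(x, e) (y, d).
                 Cmp C (ten x y) (ten x y) (ten y x) (tbraid S x y) (tmor S x x y y e d))\<rparr>)"

definition T_tensor ::
  "('o, 'a, 'r) cat_scheme \<Rightarrow> ('o \<Rightarrow> 'o \<Rightarrow> 'a \<Rightarrow> 'k::field)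
    \<Rightarrow> ((nat \<rightharpoonup> 'o) \<times> (nat \<Rightarrow> nat \<Rightarrow> ('o \<times> 'a) set \<Rightarrow>\<^sub>0 'k),
        nat \<Rightarrow> nat \<Rightarrow> ('o \<times> 'a) set \<Rightarrow>\<^sub>0 'k) tensor" where
  "T_tensor C \<delta> =
     karoubi_tensor (additive (T0 C \<delta>)) (additive_tensor (has_product C) (T0_tensor C))"

text \<open>
  A strong symmetric monoidal functor \<open>F\<close>, with coherence isomorphisms
  \<open>\<mu> x y : F x \<otimes> F y \<rightarrow> F (x \<otimes> y)\<close> and \<open>\<epsilon> : \<one> \<rightarrow> F \<one>\<close>.
\<close>

locale symmetric_monoidal_functor = cat_functor C D Fo Fm
  for C :: "('o, 'a, 'r) cat_scheme" and S :: "('o, 'a) tensor"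
    and D :: "('p, 'b, 's) cat_scheme" and S' :: "('p, 'b) tensor"
    and Fo :: "'o \<Rightarrow> 'p" and Fm :: "'o \<Rightarrow> 'o \<Rightarrow> 'a \<Rightarrow> 'b" +
  fixes \<mu> :: "'o \<Rightarrow> 'o \<Rightarrow> 'b" and \<epsilon> :: 'b
  assumes unit_iso: "iso D (tunit S') (Fo (tunit S)) \<epsilon>"
    and mult_iso: "\<lbrakk>x \<in> Obj C; y \<in> Obj C\<rbrakk>
      \<Longrightarrow> iso D (tobj S' (Fo x) (Fo y)) (Fo (tobj S x y)) (\<mu> x y)"
    and mult_natural:
      "\<lbrakk>x \<in> Obj C; x' \<in> Obj C; y \<in> Obj C; y' \<in> Obj C; f \<in> Hom C x x'; g \<in> Hom C y y'\<rbrakk>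
      \<Longrightarrow> Cmp D (tobj S' (Fo x) (Fo y)) (tobj S' (Fo x') (Fo y')) (Fo (tobj S x' y'))
            (\<mu> x' y') (tmor S' (Fo x) (Fo x') (Fo y) (Fo y') (Fm x x' f) (Fm y y' g))
        = Cmp D (tobj S' (Fo x) (Fo y)) (Fo (tobj S x y)) (Fo (tobj S x' y'))
            (Fm (tobj S x y) (tobj S x' y') (tmor S x x' y y' f g)) (\<mu> x y)"
    and mult_assoc:
      "\<lbrakk>x \<in> Obj C; y \<in> Obj C; z \<in> Obj C\<rbrakk>
      \<Longrightarrow> Cmp D (tobj S' (tobj S' (Fo x) (Fo y)) (Fo z)) (Fo (tobj S (tobj S x y) z))
              (Fo (tobj S x (tobj S y z)))
            (Fm (tobj S (tobj S x y) z) (tobj S x (tobj S y z)) (tassoc S x y z))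
            (Cmp D (tobj S' (tobj S' (Fo x) (Fo y)) (Fo z)) (tobj S' (Fo (tobj S x y)) (Fo z))
                (Fo (tobj S (tobj S x y) z))
              (\<mu> (tobj S x y) z)
              (tmor S' (tobj S' (Fo x) (Fo y)) (Fo (tobj S x y)) (Fo z) (Fo z)
                (\<mu> x y) (Idn D (Fo z))))
        = Cmp D (tobj S' (tobj S' (Fo x) (Fo y)) (Fo z)) (tobj S' (Fo x) (Fo (tobj S y z)))
              (Fo (tobj S x (tobj S y z)))
            (\<mu> x (tobj S y z))
            (Cmp D (tobj S' (tobj S' (Fo x) (Fo y)) (Fo z)) (tobj S' (Fo x) (tobj S' (Fo y) (Fo z)))
                (tobj S' (Fo x) (Fo (tobj S y z)))
              (tmor S' (Fo x) (Fo x) (tobj S' (Fo y) (Fo z)) (Fo (tobj S y z))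
                (Idn D (Fo x)) (\<mu> y z))
              (tassoc S' (Fo x) (Fo y) (Fo z)))"
    and mult_lunit:
      "x \<in> Obj C
      \<Longrightarrow> Cmp D (tobj S' (tunit S') (Fo x)) (Fo (tobj S (tunit S) x)) (Fo x)
            (Fm (tobj S (tunit S) x) x (tlunit S x))
            (Cmp D (tobj S' (tunit S') (Fo x)) (tobj S' (Fo (tunit S)) (Fo x))
                (Fo (tobj S (tunit S) x))
              (\<mu> (tunit S) x)
              (tmor S' (tunit S') (Fo (tunit S)) (Fo x) (Fo x) \<epsilon> (Idn D (Fo x))))
        = tlunit S' (Fo x)"
    and mult_runit:
      "x \<in> Obj C
      \<Longrightarrow> Cmp D (tobj S' (Fo x) (tunit S')) (Fo (tobj S x (tunit S))) (Fo x)
            (Fm (tobj S x (tunit S)) x (trunit S x))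
            (Cmp D (tobj S' (Fo x) (tunit S')) (tobj S' (Fo x) (Fo (tunit S)))
                (Fo (tobj S x (tunit S)))
              (\<mu> x (tunit S))
              (tmor S' (Fo x) (Fo x) (tunit S') (Fo (tunit S)) (Idn D (Fo x)) \<epsilon>))
        = trunit S' (Fo x)"
    and mult_braid:
      "\<lbrakk>x \<in> Obj C; y \<in> Obj C\<rbrakk>
      \<Longrightarrow> Cmp D (tobj S' (Fo x) (Fo y)) (Fo (tobj S x y)) (Fo (tobj S y x))
            (Fm (tobj S x y) (tobj S y x) (tbraid S x y)) (\<mu> x y)
        = Cmp D (tobj S' (Fo x) (Fo y)) (tobj S' (Fo y) (Fo x)) (Fo (tobj S y x))
            (\<mu> y x) (tbraid S' (Fo x) (Fo y))"


section \<open>The functor between tensor envelopes induced by a functor of regular categories\<close>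

text \<open>
  \<open>F(r) \<subseteq> F(x \<times> y)\<close> is regarded as a subobject of \<open>F(x) \<times> F(y)\<close> via the natural map from
  \<open>F(x \<times> y)\<close> to \<open>F(x) \<times> F(y)\<close>.
\<close>

definition ind_rel ::
  "('o, 'a, 'r) cat_scheme \<Rightarrow> ('p, 'b, 's) cat_scheme \<Rightarrow> ('o \<Rightarrow> 'p) \<Rightarrow> ('o \<Rightarrow> 'o \<Rightarrow> 'a \<Rightarrow> 'b)
    \<Rightarrow> 'o \<Rightarrow> 'o \<Rightarrow> ('o \<times> 'a) set \<Rightarrow> ('p \<times> 'b) set" where
  "ind_rel C D Fo Fm x y R =
     (let (r, m) = rep R; xy = prd C x y;
          nat_map = pair D (Fo xy) (Fo x) (Fo y) (Fm xy x (pr1 C x y)) (Fm xy y (pr2 C x y))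
      in subobj D (prd D (Fo x) (Fo y)) (Fo r)
           (Cmp D (Fo r) (Fo xy) (prd D (Fo x) (Fo y)) nat_map (Fm r xy m)))"

definition ind_T0_mor ::
  "('o, 'a, 'r) cat_scheme \<Rightarrow> ('p, 'b, 's) cat_scheme \<Rightarrow> ('o \<Rightarrow> 'p) \<Rightarrow> ('o \<Rightarrow> 'o \<Rightarrow> 'a \<Rightarrow> 'b)
    \<Rightarrow> 'o \<Rightarrow> 'o \<Rightarrow> (('o \<times> 'a) set \<Rightarrow>\<^sub>0 'k::field) \<Rightarrow> (('p \<times> 'b) set \<Rightarrow>\<^sub>0 'k)" where
  "ind_T0_mor C D Fo Fm x y \<phi> =
     (\<Sum>R \<in> Poly_Mapping.keys \<phi>.
        Poly_Mapping.single (ind_rel C D Fo Fm x y R) (Poly_Mapping.lookup \<phi> R))"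

definition additive_obj :: "('o \<Rightarrow> 'p) \<Rightarrow> (nat \<rightharpoonup> 'o) \<Rightarrow> (nat \<rightharpoonup> 'p)" where
  "additive_obj Go X = (\<lambda>i. map_option Go (X i))"

definition additive_mor ::
  "('o \<Rightarrow> 'o \<Rightarrow> 'v \<Rightarrow> 'w::ab_group_add)
    \<Rightarrow> (nat \<rightharpoonup> 'o) \<Rightarrow> (nat \<rightharpoonup> 'o) \<Rightarrow> (nat \<Rightarrow> nat \<Rightarrow> 'v) \<Rightarrow> (nat \<Rightarrow> nat \<Rightarrow> 'w)" where
  "additive_mor Gm X Y f = (\<lambda>i j. if i \<in> dom X \<and> j \<in> dom Y
     then Gm (the (X i)) (the (Y j)) (f i j) else 0)"

definition karoubi_obj :: "('o \<Rightarrow> 'p) \<Rightarrow> ('o \<Rightarrow> 'o \<Rightarrow> 'v \<Rightarrow> 'w) \<Rightarrow> 'o \<times> 'v \<Rightarrow> 'p \<times> 'w" where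
  "karoubi_obj Go Gm = (\<lambda>(x, e). (Go x, Gm x x e))"

definition karoubi_mor :: "('o \<Rightarrow> 'o \<Rightarrow> 'v \<Rightarrow> 'w) \<Rightarrow> 'o \<times> 'v \<Rightarrow> 'o \<times> 'v \<Rightarrow> 'v \<Rightarrow> 'w" where
  "karoubi_mor Gm = (\<lambda>(x, _) (y, _). Gm x y)"

definition ind_T_obj ::
  "('o, 'a, 'r) cat_scheme \<Rightarrow> ('p, 'b, 's) cat_scheme \<Rightarrow> ('o \<Rightarrow> 'p) \<Rightarrow> ('o \<Rightarrow> 'o \<Rightarrow> 'a \<Rightarrow> 'b)
    \<Rightarrow> (nat \<rightharpoonup> 'o) \<times> (nat \<Rightarrow> nat \<Rightarrow> ('o \<times> 'a) set \<Rightarrow>\<^sub>0 'k::field)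
    \<Rightarrow> (nat \<rightharpoonup> 'p) \<times> (nat \<Rightarrow> nat \<Rightarrow> ('p \<times> 'b) set \<Rightarrow>\<^sub>0 'k)" where
  "ind_T_obj C D Fo Fm = karoubi_obj (additive_obj Fo) (additive_mor (ind_T0_mor C D Fo Fm))"

definition ind_T_mor ::
  "('o, 'a, 'r) cat_scheme \<Rightarrow> ('p, 'b, 's) cat_scheme \<Rightarrow> ('o \<Rightarrow> 'p) \<Rightarrow> ('o \<Rightarrow> 'o \<Rightarrow> 'a \<Rightarrow> 'b)
    \<Rightarrow> (nat \<rightharpoonup> 'o) \<times> (nat \<Rightarrow> nat \<Rightarrow> ('o \<times> 'a) set \<Rightarrow>\<^sub>0 'k::field)
    \<Rightarrow> (nat \<rightharpoonup> 'o) \<times> (nat \<Rightarrow> nat \<Rightarrow> ('o \<times> 'a) set \<Rightarrow>\<^sub>0 'k)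
    \<Rightarrow> (nat \<Rightarrow> nat \<Rightarrow> ('o \<times> 'a) set \<Rightarrow>\<^sub>0 'k) \<Rightarrow> (nat \<Rightarrow> nat \<Rightarrow> ('p \<times> 'b) set \<Rightarrow>\<^sub>0 'k)" where
  "ind_T_mor C D Fo Fm = karoubi_mor (additive_mor (ind_T0_mor C D Fo Fm))"


section \<open>Slice categories and base change\<close>

definition slice :: "('o, 'a) cat \<Rightarrow> 'o \<Rightarrow> ('o \<times> 'a, 'a) cat" where
  "slice C x0 = \<lparr>
     Obj = {(x, p). x \<in> Obj C \<and> p \<in> Hom C x x0},
     Hom = (\<lambda>(x, p) (y, q). {f \<in> Hom C x y. Cmp C x y x0 q f = p}),
     Idn = (\<lambda>(x, _). Idn C x),
     Cmp = (\<lambda>(x, _) (y, _) (z, _). Cmp C x y z)\<rparr>"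

definition slice_degree :: "('o \<Rightarrow> 'o \<Rightarrow> 'a \<Rightarrow> 'k) \<Rightarrow> 'o \<times> 'a \<Rightarrow> 'o \<times> 'a \<Rightarrow> 'a \<Rightarrow> 'k" where
  "slice_degree \<delta> = (\<lambda>(x, _) (y, _). \<delta> x y)"

text \<open>
  \<open>x \<mapsto> (x \<times> x0, pr2)\<close>, a functor to the slice category provided that all the products
  \<open>x \<times> x0\<close> exist.
\<close>

definition base_obj :: "('o, 'a) cat \<Rightarrow> 'o \<Rightarrow> 'o \<Rightarrow> 'o \<times> 'a" where
  "base_obj C x0 x = (prd C x x0, pr2 C x x0)"

definition base_mor :: "('o, 'a) cat \<Rightarrow> 'o \<Rightarrow> 'o \<Rightarrow> 'o \<Rightarrow> 'a \<Rightarrow> 'a" where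
  "base_mor C x0 x y f =
     pair C (prd C x x0) y x0 (Cmp C (prd C x x0) x y f (pr1 C x x0)) (pr2 C x x0)"

end

theory Submission
  imports Defs
begin

text \<open>
  \<open>F\<close> is right adjoint to the functor \<open>U : \<A>/x\<^sub>0 \<rightarrow> \<A>\<close> that forgets the map to \<open>x\<^sub>0\<close>, and both preserve
  jointly monic pairs, epimorphisms together with their degrees, and pullbacks, so both induce
  functors between the categories of relations. The naturality squares of the unit and the counit
  are pullback squares, hence the graphs of unit and counit commute with arbitrary relations and not
  only with graphs: the adjunction survives on \<open>\<T>\<^sup>0\<close> and then on the additive and on the
  Karoubi completion. A right adjoint preserves limits.

  Equations in \<open>\<T>\<^sup>0\<close> are checked on spans \<open>x \<leftarrow> p \<rightarrow> y\<close>, each representing the degree of \<open>p\<close> over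
  its image times that image: composition becomes the pullback of spans, the tensor product becomes
  their product, and \<open>F\<close> acts on the legs. As \<open>\<A>\<close> need not have all products, the
  tensor product on \<open>\<T>\<^sup>0\<close> is only partially defined; in the additive completion the missing
  summands become zero and it is total.
\<close>

section \<open>Categories\<close>

text \<open>In \<open>T0\<close> a graph placed after a span changes one leg, while a graph placed
  before it pulls the span back. Naturality for morphisms therefore extends to relations when the
  naturality squares are pullbacks. Here they are: \<open>x \<times> x0\<close> is the pullback of
  \<open>y \<times> x0\<close> along any \<open>f : x \<rightarrow> y\<close>, and a point of
  \<open>z\<close> and a point of \<open>r \<times> x0\<close> that agree in
  \<open>z \<times> x0\<close> come from one point of \<open>r\<close>. A composite is also zero
  when a pullback is missing. Induced functors must thus reflect the existence of pullbacks, not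
  only preserve them; by completability every such question asks for one object with compatible maps
  to the given data. Spans absorb the scalars: the pullback of two spans maps onto the pullback of
  their images by an epimorphism whose degree is the product of the two degrees. Forgetting the base
  preserves neither terminal objects nor products in general, as a product over \<open>x0\<close> is
  a fibre product. Relations are therefore carried along as jointly monic pairs of legs, and
  preservation of the terminal object is asked for only where the monoidal structure needs
  it.\<close>

definition arr :: "('o, 'a, 'r) cat_scheme \<Rightarrow> 'o \<Rightarrow> 'o \<Rightarrow> 'a \<Rightarrow> bool" where
  "arr C x y f \<longleftrightarrow> x \<in> Obj C \<and> y \<in> Obj C \<and> f \<in> Hom C x y"

text \<open>A relation given by its two legs. Stated without the product of \<open>x\<close> and
  \<open>y\<close>, it can be transported by functors that do not preserve products.\<close>

definition jointly_monic :: "('o, 'a, 'r) cat_scheme \<Rightarrow> 'o \<Rightarrow> 'o \<Rightarrow> 'o \<Rightarrow> 'a \<Rightarrow> 'a \<Rightarrow> bool" where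
  "jointly_monic C x y p a b \<longleftrightarrow> arr C p x a \<and> arr C p y b \<and>
     (\<forall>w g h. arr C w p g \<longrightarrow> arr C w p h \<longrightarrow> Cmp C w p x a g = Cmp C w p x a h \<longrightarrow>
        Cmp C w p y b g = Cmp C w p y b h \<longrightarrow> g = h)"

text \<open>Adds to \<open>is_pullback\<close> that the cospan itself lies in the category, so that
  one premise supplies all typing facts.\<close>

definition pullback ::
  "('o, 'a, 'r) cat_scheme \<Rightarrow> 'o \<Rightarrow> 'o \<Rightarrow> 'o \<Rightarrow> 'a \<Rightarrow> 'a \<Rightarrow> 'o \<Rightarrow> 'a \<Rightarrow> 'a \<Rightarrow> bool" where
  "pullback C x y z f g p a b \<longleftrightarrow> arr C x z f \<and> arr C y z g \<and> is_pullback C x y z f g p a b"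

context category
begin

lemma
  assumes "arr C x y f"
  shows arr_dom: "x \<in> Obj C" and arr_cod: "y \<in> Obj C"
  using assms by (auto simp: arr_def)

lemma arr_id [simp]: "x \<in> Obj C \<Longrightarrow> arr C x x (Idn C x)"
  by (simp add: arr_def id_in_hom)

lemma arr_comp [simp]: "arr C x y f \<Longrightarrow> arr C y z g \<Longrightarrow> arr C x z (Cmp C x y z g f)"
  unfolding arr_def by (blast intro: comp_in_hom)

lemma comp_id [simp]:
  assumes "arr C x y f"
  shows "Cmp C x y y (Idn C y) f = f" "Cmp C x x y f (Idn C x) = f"
  using assms by (auto simp: arr_def comp_id_left comp_id_right)

lemma comp_asc:
  "arr C w x f \<Longrightarrow> arr C x y g \<Longrightarrow> arr C y z h \<Longrightarrow>
    Cmp C w x z (Cmp C x y z h g) f = Cmp C w y z h (Cmp C w x y g f)"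
  unfolding arr_def by (simp add: comp_assoc)

lemma comp_eq_extend:
  assumes "Cmp C w x z g f = Cmp C w y z k h" "arr C v w t" "arr C w x f" "arr C x z g" "arr C w y h" "arr C y z k"
  shows "Cmp C v x z g (Cmp C v w x f t) = Cmp C v y z k (Cmp C v w y h t)"
  using assms by (metis comp_asc)

lemma jointly_monic_arr:
  assumes "jointly_monic C x y p a b"
  shows "arr C p x a" "arr C p y b"
  using assms by (auto simp: jointly_monic_def)

lemma jointly_monicD:
  assumes "jointly_monic C x y p a b" "arr C w p g" "arr C w p h"
    "Cmp C w p x a g = Cmp C w p x a h" "Cmp C w p y b g = Cmp C w p y b h"
  shows "g = h"
  using assms unfolding jointly_monic_def by blast

lemma jointly_monic_sym: "jointly_monic C x y p a b \<Longrightarrow> jointly_monic C y x p b a"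
  unfolding jointly_monic_def by blast

lemma monic_iff:
  "x \<in> Obj C \<Longrightarrow> y \<in> Obj C \<Longrightarrow> monic C x y f \<longleftrightarrow> arr C x y f \<and>
    (\<forall>w g h. arr C w x g \<longrightarrow> arr C w x h \<longrightarrow> Cmp C w x y f g = Cmp C w x y f h \<longrightarrow> g = h)"
  unfolding monic_def arr_def by blast

lemma epic_iff:
  "x \<in> Obj C \<Longrightarrow> y \<in> Obj C \<Longrightarrow> epic C x y f \<longleftrightarrow> arr C x y f \<and>
    (\<forall>z g h. arr C y z g \<longrightarrow> arr C y z h \<longrightarrow> Cmp C x y z g f = Cmp C x y z h f \<longrightarrow> g = h)"
  unfolding epic_def arr_def by blast

lemma iso_iff:
  "x \<in> Obj C \<Longrightarrow> y \<in> Obj C \<Longrightarrow> iso C x y f \<longleftrightarrow> arr C x y f \<and>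
    (\<exists>g. arr C y x g \<and> Cmp C x y x g f = Idn C x \<and> Cmp C y x y f g = Idn C y)"
  unfolding iso_def arr_def by blast

lemma isoE:
  assumes "iso C x y f" "x \<in> Obj C" "y \<in> Obj C"
  obtains g where "arr C x y f" "arr C y x g" "Cmp C x y x g f = Idn C x" "Cmp C y x y f g = Idn C y"
    "iso C y x g"
  using assms iso_iff by blast

lemma isoI:
  assumes "arr C x y f" "arr C y x g" "Cmp C x y x g f = Idn C x" "Cmp C y x y f g = Idn C y"
  shows "iso C x y f"
  using assms unfolding iso_def arr_def by blast

lemma iso_comp:
  assumes "iso C x y f" "iso C y z g" "x \<in> Obj C" "y \<in> Obj C" "z \<in> Obj C"
  shows "iso C x z (Cmp C x y z g f)"
proof -
  obtain f' where f: "arr C x y f" "arr C y x f'" "Cmp C x y x f' f = Idn C x" "Cmp C y x y f f' = Idn C y"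
    by (rule isoE[OF assms(1,3,4)])
  obtain g' where g: "arr C y z g" "arr C z y g'" "Cmp C y z y g' g = Idn C y" "Cmp C z y z g g' = Idn C z"
    by (rule isoE[OF assms(2,4,5)])
  have 1: "Cmp C x z y g' (Cmp C x y z g f) = f"
    using comp_asc[OF f(1) g(1,2)] f g by simp

  have 3: "Cmp C z x y f (Cmp C z y x f' g') = g'"
    using comp_asc[OF g(2) f(2,1)] f g by simp
  show ?thesis
    by (rule isoI[where g = "Cmp C z y x f' g'"]) (use f g 1 3 in \<open>simp_all add: comp_asc\<close>)
qed

lemma iso_epic: assumes "iso C x y f" "x \<in> Obj C" "y \<in> Obj C" shows "epic C x y f"
proof -
  obtain f' where f: "arr C x y f" "arr C y x f'" "Cmp C x y x f' f = Idn C x" "Cmp C y x y f f' = Idn C y"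
    by (rule isoE[OF assms])
  show ?thesis unfolding epic_iff[OF assms(2,3)]
  proof (intro conjI allI impI)
    fix z g h assume *: "arr C y z g" "arr C y z h" "Cmp C x y z g f = Cmp C x y z h f"
    have 1: "Cmp C y x z (Cmp C x y z k f) f' = k" if "arr C y z k" for k
      using comp_asc[OF f(2,1) that] f(4) comp_id(2)[OF that] by simp
    show "g = h" by (metis 1 *)
  qed (rule f)
qed

lemma iso_monic: assumes "iso C x y f" "x \<in> Obj C" "y \<in> Obj C" shows "monic C x y f"
proof -
  obtain f' where f: "arr C x y f" "arr C y x f'" "Cmp C x y x f' f = Idn C x" "Cmp C y x y f f' = Idn C y"
    by (rule isoE[OF assms])
  show ?thesis unfolding monic_iff[OF assms(2,3)]
  proof (intro conjI allI impI)
    fix w g h assume *: "arr C w x g" "arr C w x h" "Cmp C w x y f g = Cmp C w x y f h"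
    have 1: "Cmp C w y x f' (Cmp C w x y f k) = k" if "arr C w x k" for k
      using comp_asc[OF that f(1,2)] f(3) comp_id(1)[OF that] by simp
    show "g = h" by (metis 1 *)
  qed (rule f)
qed

lemma iso_id: "x \<in> Obj C \<Longrightarrow> iso C x x (Idn C x)"
  by (rule isoI[where g = "Idn C x"]) simp_all

lemma epic_comp:
  assumes "epic C x y f" "epic C y z g" "x \<in> Obj C" "y \<in> Obj C" "z \<in> Obj C"
  shows "epic C x z (Cmp C x y z g f)"
proof -
  have a: "arr C x y f" "arr C y z g" using assms by (auto simp: epic_iff)
  show ?thesis unfolding epic_iff[OF assms(3,5)]
  proof (intro conjI allI impI)
    fix w h k assume *: "arr C z w h" "arr C z w k"
      "Cmp C x z w h (Cmp C x y z g f) = Cmp C x z w k (Cmp C x y z g f)"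
    then have "Cmp C x y w (Cmp C y z w h g) f = Cmp C x y w (Cmp C y z w k g) f"
      using a by (simp add: comp_asc)
    then have "Cmp C y z w h g = Cmp C y z w k g"
      using assms(1) * a unfolding epic_iff[OF assms(3,4)] by (meson arr_comp)
    then show "h = k" using assms(2) * unfolding epic_iff[OF assms(4,5)] by blast
  qed (use a in simp)
qed

section \<open>Pullback squares and the pasting law\<close>

lemma pullback_arr:
  assumes "pullback C x y z f g p a b"
  shows "arr C x z f" "arr C y z g" "arr C p x a" "arr C p y b" "Cmp C p x z f a = Cmp C p y z g b"
proof -
  have z: "arr C x z f" "arr C y z g" and "is_pullback C x y z f g p a b"
    using assms by (simp_all add: pullback_def)
  note 1 = this(3)[unfolded is_pullback_def]
  note 2 = conjunct2[OF 1] note 3 = conjunct2[OF 2] note 4 = conjunct2[OF 3]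
  note c = conjunct1[OF 1] conjunct1[OF 2] conjunct1[OF 3]
  show "Cmp C p x z f a = Cmp C p y z g b" by (rule conjunct1[OF 4])
  show "arr C x z f" "arr C y z g" "arr C p x a" "arr C p y b"
    using z c by (simp_all add: arr_def)
qed

lemma pullback_ex1:
  assumes "pullback C x y z f g p a b" "arr C w x u" "arr C w y v" "Cmp C w x z f u = Cmp C w y z g v"
  shows "\<exists>!h. h \<in> Hom C w p \<and> Cmp C w p x a h = u \<and> Cmp C w p y b h = v"
proof -
  have "is_pullback C x y z f g p a b" using assms by (simp add: pullback_def)
  then have "\<forall>w \<in> Obj C. \<forall>u \<in> Hom C w x. \<forall>v \<in> Hom C w y. Cmp C w x z f u = Cmp C w y z g v \<longrightarrow>
        (\<exists>!h. h \<in> Hom C w p \<and> Cmp C w p x a h = u \<and> Cmp C w p y b h = v)"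
    unfolding is_pullback_def by (elim conjE) assumption
  from this[rule_format, OF _ _ _ assms(4)] show ?thesis using assms(2,3) by (simp add: arr_def)
qed

lemma pullback_lift:
  assumes "pullback C x y z f g p a b" "arr C w x u" "arr C w y v" "Cmp C w x z f u = Cmp C w y z g v"
  obtains h where "arr C w p h" "Cmp C w p x a h = u" "Cmp C w p y b h = v"
proof -
  obtain h where "h \<in> Hom C w p" "Cmp C w p x a h = u" "Cmp C w p y b h = v"
    using ex1_implies_ex[OF pullback_ex1[OF assms]] by blast
  then show ?thesis using that[of h] pullback_arr(3)[OF assms(1)] assms(2) by (simp add: arr_def)
qed

text \<open>Two morphisms with equal coordinates both mediate the cone formed by these
  coordinates.\<close>

lemma pullback_jointly_monic:
  assumes "pullback C x y z f g p a b"
  shows "jointly_monic C x y p a b"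
  unfolding jointly_monic_def
proof (intro conjI allI impI)
  note A = pullback_arr[OF assms]
  fix w h k
  assume *: "arr C w p h" "arr C w p k" "Cmp C w p x a h = Cmp C w p x a k" "Cmp C w p y b h = Cmp C w p y b k"
  have "Cmp C w x z f (Cmp C w p x a h) = Cmp C w y z g (Cmp C w p y b h)"
    using comp_eq_extend[OF A(5) *(1) A(3,1,4,2)] .
  then have "\<exists>!h'. h' \<in> Hom C w p \<and> Cmp C w p x a h' = Cmp C w p x a h \<and> Cmp C w p y b h' = Cmp C w p y b h"
    by (intro pullback_ex1[OF assms] arr_comp[OF *(1)] pullback_arr[OF assms])
  then show "h = k" using * by (auto simp: arr_def)
qed (use pullback_arr[OF assms] in auto)

lemma pullback_ext:
  assumes "pullback C x y z f g p a b" "arr C w p h" "arr C w p k"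
    "Cmp C w p x a h = Cmp C w p x a k" "Cmp C w p y b h = Cmp C w p y b k"
  shows "h = k"
  using jointly_monicD[OF pullback_jointly_monic[OF assms(1)] assms(2-)] .

text \<open>Joint monicity already contains the uniqueness of the mediating morphism, so only a lift
  remains to be produced.\<close>

lemma pullbackI:
  assumes "arr C x z f" "arr C y z g" "jointly_monic C x y p a b" "Cmp C p x z f a = Cmp C p y z g b"
    and "\<And>w u v. arr C w x u \<Longrightarrow> arr C w y v \<Longrightarrow> Cmp C w x z f u = Cmp C w y z g v \<Longrightarrow>
       \<exists>h. arr C w p h \<and> Cmp C w p x a h = u \<and> Cmp C w p y b h = v"
  shows "pullback C x y z f g p a b"
  unfolding pullback_def is_pullback_def
proof (intro conjI ballI impI)
  fix w u v
  assume *: "w \<in> Obj C" "u \<in> Hom C w x" "v \<in> Hom C w y" "Cmp C w x z f u = Cmp C w y z g v"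
  then obtain h where h: "arr C w p h" "Cmp C w p x a h = u" "Cmp C w p y b h = v"
    using assms(5)[of w u v] assms(1,2) unfolding arr_def by blast
  show "\<exists>!h. h \<in> Hom C w p \<and> Cmp C w p x a h = u \<and> Cmp C w p y b h = v"
    using h assms(3) unfolding jointly_monic_def arr_def by (metis (no_types, lifting))
qed (use assms jointly_monic_arr[OF assms(3)] in \<open>auto simp: arr_def\<close>)

lemma pullback_sym: "pullback C x y z f g p a b \<Longrightarrow> pullback C y x z g f p b a"
proof (rule pullbackI)
  assume 1: "pullback C x y z f g p a b"
  show "arr C y z g" "arr C x z f" using pullback_arr[OF 1] by blast+
  show "jointly_monic C y x p b a" using pullback_jointly_monic[OF 1] by (rule jointly_monic_sym)
  show "Cmp C p y z g b = Cmp C p x z f a" using pullback_arr(5)[OF 1] by (rule sym)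
  fix w u v assume *: "arr C w y u" "arr C w x v" "Cmp C w y z g u = Cmp C w x z f v"
  from pullback_lift[OF 1 *(2,1) *(3)[symmetric]]
  show "\<exists>h. arr C w p h \<and> Cmp C w p y b h = u \<and> Cmp C w p x a h = v" by metis
qed

text \<open>In this form the pasting law computes iterated composites of spans: the apex of the
  second pullback serves the composite cospan.\<close>

lemma pullback_pasting:
  assumes 1: "pullback C x y z f g p a b" and 2: "pullback C p w y b h q c d"
  shows "pullback C x w z f (Cmp C w y z g h) q (Cmp C q p x a c) d"
proof (rule pullbackI)
  note A = pullback_arr[OF 1] and B = pullback_arr[OF 2]
  show "jointly_monic C x w q (Cmp C q p x a c) d"
    unfolding jointly_monic_def
  proof (intro conjI allI impI)
    fix v s t
    assume *: "arr C v q s" "arr C v q t" "Cmp C v q x (Cmp C q p x a c) s = Cmp C v q x (Cmp C q p x a c) t"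
      "Cmp C v q w d s = Cmp C v q w d t"
    have "Cmp C v q p c s = Cmp C v q p c t"
    proof (rule pullback_ext[OF 1])
      show "Cmp C v p y b (Cmp C v q p c s) = Cmp C v p y b (Cmp C v q p c t)"
        using *(4) comp_eq_extend[OF B(5) *(1) B(3,1,4,2)] comp_eq_extend[OF B(5) *(2) B(3,1,4,2)] by simp
    qed (use * A B in \<open>simp_all add: comp_asc\<close>)
    then show "s = t" using pullback_ext[OF 2] * by blast
  qed (use A B in auto)
  show "Cmp C q x z f (Cmp C q p x a c) = Cmp C q w z (Cmp C w y z g h) d"
    using comp_eq_extend[OF A(5) B(3) A(3,1,4,2)] comp_asc[OF B(4,2) A(2)] B(5) by simp
  fix v s t
  assume *: "arr C v x s" "arr C v w t" "Cmp C v x z f s = Cmp C v w z (Cmp C w y z g h) t"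
  obtain k where k: "arr C v p k" "Cmp C v p x a k = s" "Cmp C v p y b k = Cmp C v w y h t"
    using pullback_lift[OF 1, of v s "Cmp C v w y h t"] * A B by (auto simp: comp_asc)
  obtain l where "arr C v q l" "Cmp C v q p c l = k" "Cmp C v q w d l = t"
    using pullback_lift[OF 2 k(1) *(2) k(3)] by blast
  then show "\<exists>l. arr C v q l \<and> Cmp C v q x (Cmp C q p x a c) l = s \<and> Cmp C v q w d l = t"
    using k A B by (auto simp: comp_asc)
qed (use pullback_arr[OF 1] pullback_arr[OF 2] in auto)

text \<open>The other half of the pasting law. It recognizes a comparison map between two pullbacks
  as a base change, from which its epimorphy and its degree follow.\<close>

lemma pullback_cancel:
  assumes 1: "pullback C x y z f g p a b" and "arr C w y h" "arr C q p c" "arr C q w d"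
    and eq: "Cmp C q p y b c = Cmp C q w y h d"
    and 2: "pullback C x w z f (Cmp C w y z g h) q (Cmp C q p x a c) d"
  shows "pullback C p w y b h q c d"
proof (rule pullbackI)
  note A = pullback_arr[OF 1] assms(2,3,4)
  show "jointly_monic C p w q c d"
    unfolding jointly_monic_def
  proof (intro conjI allI impI)
    fix v s t
    assume *: "arr C v q s" "arr C v q t" "Cmp C v q p c s = Cmp C v q p c t"
      "Cmp C v q w d s = Cmp C v q w d t"
    show "s = t" by (rule pullback_ext[OF 2]) (use * A in \<open>simp_all add: comp_asc\<close>)
  qed (use A in auto)
  show "Cmp C q p y b c = Cmp C q w y h d" by (rule eq)
  fix v s t
  assume *: "arr C v p s" "arr C v w t" "Cmp C v p y b s = Cmp C v w y h t"
  have "Cmp C v x z f (Cmp C v p x a s) = Cmp C v w z (Cmp C w y z g h) t"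
    using comp_eq_extend[OF A(5) *(1) A(3,1,4,2)] comp_asc[OF *(2) A(6) A(2)] *(3) by simp
  from pullback_lift[OF 2 arr_comp[OF *(1) A(3)] *(2) this]
  obtain k where k: "arr C v q k" "Cmp C v q x (Cmp C q p x a c) k = Cmp C v p x a s" "Cmp C v q w d k = t" .
  have "Cmp C v q p c k = s"
  proof (rule pullback_ext[OF 1])
    show "Cmp C v p y b (Cmp C v q p c k) = Cmp C v p y b s"
      using comp_eq_extend[OF eq k(1) A(7,4,8,6)] k(3) *(3) by simp
  qed (use A k * in \<open>simp_all add: comp_asc\<close>)
  then show "\<exists>l. arr C v q l \<and> Cmp C v q p c l = s \<and> Cmp C v q w d l = t" using k by blast
qed (use assms(2) pullback_arr[OF 1] in auto)

text \<open>A lift is obtained by inverting \<open>b\<close>; its first coordinate is right because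
  \<open>f\<close> is monic. Isomorphisms are thereby base changes of identities, and natural
  isomorphisms have pullback squares.\<close>

lemma pullback_isos:
  assumes "iso C x z f" "iso C p y b" "arr C y z g" "arr C p x a" "x \<in> Obj C"
    "Cmp C p x z f a = Cmp C p y z g b"
  shows "pullback C x y z f g p a b"
proof -
  have o: "z \<in> Obj C" "y \<in> Obj C" "p \<in> Obj C" using assms by (auto simp: arr_def)
  obtain f' where f: "arr C x z f" "arr C z x f'" "Cmp C x z x f' f = Idn C x" "Cmp C z x z f f' = Idn C z"
    by (rule isoE[OF assms(1,5) o(1)])
  obtain b' where b: "arr C p y b" "arr C y p b'" "Cmp C p y p b' b = Idn C p" "Cmp C y p y b b' = Idn C y"
    by (rule isoE[OF assms(2) o(3,2)])
  note B = f b assms(3,4)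
  have mb: "monic C p y b" and mf: "monic C x z f" using iso_monic assms o by blast+
  show ?thesis
  proof (rule pullbackI)
    show "jointly_monic C x y p a b"
      using mb B unfolding jointly_monic_def monic_iff[OF o(3,2)] by blast
    fix w u v
    assume *: "arr C w x u" "arr C w y v" "Cmp C w x z f u = Cmp C w y z g v"
    let ?h = "Cmp C w y p b' v"
    have h: "Cmp C w p y b ?h = v" using * B comp_asc[OF *(2) b(2,1)] by simp
    have "Cmp C w x z f (Cmp C w p x a ?h) = Cmp C w x z f u"
      using comp_eq_extend[OF assms(6) _ assms(4) B(1) B(5) assms(3), of w ?h] * B(6) h by simp
    then have "Cmp C w p x a ?h = u"
      using mf * B unfolding monic_iff[OF assms(5) o(1)] by (meson arr_comp)
    then show "\<exists>h. arr C w p h \<and> Cmp C w p x a h = u \<and> Cmp C w p y b h = v" using h * B arr_comp by blast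
  qed (use B assms(6) in auto)
qed

end

section \<open>Functors that preserve finite limits\<close>

context cat_functor
begin

lemma F_arr [simp]: "arr C x y f \<Longrightarrow> arr D (Fo x) (Fo y) (Fm x y f)"
  by (simp add: arr_def F_obj F_hom)

lemma F_comp_arr:
  "arr C x y f \<Longrightarrow> arr C y z g \<Longrightarrow>
    Fm x z (Cmp C x y z g f) = Cmp D (Fo x) (Fo y) (Fo z) (Fm y z g) (Fm x y f)"
  by (simp add: arr_def F_comp)

end

text \<open>An adjunction without the triangle identity for \<open>U\<close>; this suffices for \<open>F\<close> to preserve limits.\<close>

locale semi_adjunction = F: cat_functor C D Fo Fm + U: cat_functor D C Uo Um
  for C :: "('o, 'a, 'r) cat_scheme" and D :: "('p, 'b, 's) cat_scheme"
    and Fo :: "'o \<Rightarrow> 'p" and Fm :: "'o \<Rightarrow> 'o \<Rightarrow> 'a \<Rightarrow> 'b"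
    and Uo :: "'p \<Rightarrow> 'o" and Um :: "'p \<Rightarrow> 'p \<Rightarrow> 'b \<Rightarrow> 'a" +
  fixes \<eta> :: "'p \<Rightarrow> 'b" and \<epsilon> :: "'o \<Rightarrow> 'a"
  assumes unit_arr: "z \<in> Obj D \<Longrightarrow> arr D z (Fo (Uo z)) (\<eta> z)"
    and counit_arr: "x \<in> Obj C \<Longrightarrow> arr C (Uo (Fo x)) x (\<epsilon> x)"
    and unit_natural: "arr D z w g \<Longrightarrow>
      Cmp D z (Fo (Uo z)) (Fo (Uo w)) (Fm (Uo z) (Uo w) (Um z w g)) (\<eta> z)
        = Cmp D z w (Fo (Uo w)) (\<eta> w) g"
    and counit_natural: "arr C x y f \<Longrightarrow>
      Cmp C (Uo (Fo x)) x y f (\<epsilon> x)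
        = Cmp C (Uo (Fo x)) (Uo (Fo y)) y (\<epsilon> y) (Um (Fo x) (Fo y) (Fm x y f))"
    and triangle: "x \<in> Obj C \<Longrightarrow>
      Cmp D (Fo x) (Fo (Uo (Fo x))) (Fo x) (Fm (Uo (Fo x)) x (\<epsilon> x)) (\<eta> (Fo x)) = Idn D (Fo x)"
begin

text \<open>The adjunct \<open>U z \<rightarrow> x\<close> of
  \<open>g : z \<rightarrow> F x\<close>.\<close>

definition transpose :: "'p \<Rightarrow> 'o \<Rightarrow> 'b \<Rightarrow> 'a" where
  "transpose z x g = Cmp C (Uo z) (Uo (Fo x)) x (\<epsilon> x) (Um z (Fo x) g)"

lemma transpose_arr: "arr D z (Fo x) g \<Longrightarrow> x \<in> Obj C \<Longrightarrow> arr C (Uo z) x (transpose z x g)"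
  unfolding transpose_def using U.F_arr counit_arr F.C.arr_comp by blast

lemma transpose_comp:
  assumes "arr D z (Fo x) g" "arr C x y f"
  shows "Cmp C (Uo z) x y f (transpose z x g) = transpose z y (Cmp D z (Fo x) (Fo y) (Fm x y f) g)"
proof -
  have o: "x \<in> Obj C" "y \<in> Obj C" using assms by (auto simp: arr_def)
  note a = U.F_arr[OF assms(1)] counit_arr[OF o(1)] counit_arr[OF o(2)] F.F_arr[OF assms(2)]
  have "Cmp C (Uo z) x y f (transpose z x g)
    = Cmp C (Uo z) (Uo (Fo x)) y (Cmp C (Uo (Fo x)) x y f (\<epsilon> x)) (Um z (Fo x) g)"
    unfolding transpose_def by (rule F.C.comp_asc[OF a(1,2) assms(2), symmetric])
  also have "\<dots> = Cmp C (Uo z) (Uo (Fo y)) y (\<epsilon> y)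
      (Cmp C (Uo z) (Uo (Fo x)) (Uo (Fo y)) (Um (Fo x) (Fo y) (Fm x y f)) (Um z (Fo x) g))"
    unfolding counit_natural[OF assms(2)] by (rule F.C.comp_asc[OF a(1) U.F_arr[OF a(4)] a(3)])
  finally show ?thesis unfolding transpose_def U.F_comp_arr[OF assms(1) a(4)] .
qed

text \<open>Naturality moves \<open>g\<close> past the unit, where the triangle identity applies.
  Hence a morphism into \<open>F x\<close> is recovered from its adjunct, and
  \<open>transpose\<close> is injective.\<close>

lemma transpose_inverse:
  assumes "arr D z (Fo x) g" "x \<in> Obj C"
  shows "Cmp D z (Fo (Uo z)) (Fo x) (Fm (Uo z) x (transpose z x g)) (\<eta> z) = g"
proof -
  have z: "z \<in> Obj D" "Fo x \<in> Obj D" using assms by (auto simp: arr_def)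
  note a = U.F_arr[OF assms(1)] counit_arr[OF assms(2)] unit_arr[OF z(1)] unit_arr[OF z(2)]
  have "Cmp D z (Fo (Uo z)) (Fo x) (Fm (Uo z) x (transpose z x g)) (\<eta> z)
    = Cmp D z (Fo (Uo (Fo x))) (Fo x) (Fm (Uo (Fo x)) x (\<epsilon> x))
        (Cmp D z (Fo (Uo z)) (Fo (Uo (Fo x))) (Fm (Uo z) (Uo (Fo x)) (Um z (Fo x) g)) (\<eta> z))"
    unfolding transpose_def F.F_comp_arr[OF a(1,2)]
    by (rule F.D.comp_asc[OF a(3) F.F_arr[OF a(1)] F.F_arr[OF a(2)]])
  also have "\<dots> = Cmp D z (Fo x) (Fo x) (Idn D (Fo x)) g"
    unfolding unit_natural[OF assms(1)] triangle[OF assms(2), symmetric]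
    by (rule F.D.comp_asc[OF assms(1) a(4) F.F_arr[OF a(2)], symmetric])
  finally show ?thesis using assms by simp
qed

text \<open>A cone over the image diagram is transposed to a cone over the diagram itself; the limit
  gives a mediating morphism there, and the unit carries it back.\<close>

lemma preserves_limits:
  assumes "category J" "cat_functor J C Do Dm" "is_limit J C Do Dm L l"
  shows "is_limit J D (\<lambda>j. Fo (Do j)) (\<lambda>i j u. Fm (Do i) (Do j) (Dm i j u)) (Fo L) (\<lambda>j. Fm L (Do j) (l j))"
  unfolding is_limit_def
proof (intro conjI allI impI)
  interpret Dg: cat_functor J C Do Dm by fact
  have cone: "is_cone J C Do Dm L l" using assms(3) by (simp add: is_limit_def)
  have L: "L \<in> Obj C" using cone by (simp add: is_cone_def)
  have l: "arr C L (Do j) (l j)" if "j \<in> Obj J" for j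
    using cone that Dg.F_obj[OF that] by (simp add: is_cone_def arr_def)
  have d: "arr C (Do i) (Do j) (Dm i j u)" if "i \<in> Obj J" "j \<in> Obj J" "u \<in> Hom J i j" for i j u
    using that Dg.F_obj Dg.F_hom by (simp add: arr_def)
  show "is_cone J D (\<lambda>j. Fo (Do j)) (\<lambda>i j u. Fm (Do i) (Do j) (Dm i j u)) (Fo L) (\<lambda>j. Fm L (Do j) (l j))"
    unfolding is_cone_def
  proof (intro conjI ballI)
    show "Fo L \<in> Obj D" using L by (rule F.F_obj)
    show "Fm L (Do j) (l j) \<in> Hom D (Fo L) (Fo (Do j))" if "j \<in> Obj J" for j
      using F.F_arr[OF l[OF that]] by (simp add: arr_def)
    fix i j u assume *: "i \<in> Obj J" "j \<in> Obj J" "u \<in> Hom J i j"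
    have "Cmp C L (Do i) (Do j) (Dm i j u) (l i) = l j" using cone * by (simp add: is_cone_def)
    then show "Cmp D (Fo L) (Fo (Do i)) (Fo (Do j)) (Fm (Do i) (Do j) (Dm i j u)) (Fm L (Do i) (l i))
      = Fm L (Do j) (l j)"
      using F.F_comp_arr[OF l[OF *(1)] d[OF *]] by simp
  qed
  fix Z m
  assume m: "is_cone J D (\<lambda>j. Fo (Do j)) (\<lambda>i j u. Fm (Do i) (Do j) (Dm i j u)) Z m"
  have Z: "Z \<in> Obj D" using m by (simp add: is_cone_def)
  have ma: "arr D Z (Fo (Do j)) (m j)" if "j \<in> Obj J" for j
    using m that Z F.F_obj[OF Dg.F_obj[OF that]] by (simp add: is_cone_def arr_def)
  have UZ: "Uo Z \<in> Obj C" using Z by (rule U.F_obj)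
  have "is_cone J C Do Dm (Uo Z) (\<lambda>j. transpose Z (Do j) (m j))"
    unfolding is_cone_def
  proof (intro conjI ballI UZ)
    show "transpose Z (Do j) (m j) \<in> Hom C (Uo Z) (Do j)" if "j \<in> Obj J" for j
      using transpose_arr[OF ma[OF that] Dg.F_obj[OF that]] by (simp add: arr_def)
    fix i j u assume *: "i \<in> Obj J" "j \<in> Obj J" "u \<in> Hom J i j"
    have "Cmp D Z (Fo (Do i)) (Fo (Do j)) (Fm (Do i) (Do j) (Dm i j u)) (m i) = m j"
      using m * by (simp add: is_cone_def)
    then show "Cmp C (Uo Z) (Do i) (Do j) (Dm i j u) (transpose Z (Do i) (m i)) = transpose Z (Do j) (m j)"
      using transpose_comp[OF ma[OF *(1)] d[OF *]] by simp
  qed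
  then have "\<exists>!h. h \<in> Hom C (Uo Z) L \<and>
      (\<forall>j \<in> Obj J. Cmp C (Uo Z) L (Do j) (l j) h = transpose Z (Do j) (m j))"
    using assms(3) by (simp add: is_limit_def)
  then obtain h where h: "h \<in> Hom C (Uo Z) L"
      "\<And>j. j \<in> Obj J \<Longrightarrow> Cmp C (Uo Z) L (Do j) (l j) h = transpose Z (Do j) (m j)"
    and uniq: "\<And>k. k \<in> Hom C (Uo Z) L \<Longrightarrow>
      (\<forall>j \<in> Obj J. Cmp C (Uo Z) L (Do j) (l j) k = transpose Z (Do j) (m j)) \<Longrightarrow> k = h"
    by metis
  have ha: "arr C (Uo Z) L h" using h UZ L by (simp add: arr_def)
  \<comment> \<open>The adjunct of \<open>h\<close> in the opposite direction.\<close>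
  define k where "k = Cmp D Z (Fo (Uo Z)) (Fo L) (Fm (Uo Z) L h) (\<eta> Z)"
  show "\<exists>!k. k \<in> Hom D Z (Fo L) \<and>
      (\<forall>j \<in> Obj J. Cmp D Z (Fo L) (Fo (Do j)) (Fm L (Do j) (l j)) k = m j)"
  proof (intro ex1I conjI ballI)
    show "k \<in> Hom D Z (Fo L)"
      using F.D.arr_comp[OF unit_arr[OF Z] F.F_arr[OF ha]] by (simp add: k_def arr_def)
    fix j assume j: "j \<in> Obj J"
    have "Cmp D Z (Fo L) (Fo (Do j)) (Fm L (Do j) (l j)) k
      = Cmp D Z (Fo (Uo Z)) (Fo (Do j)) (Fm (Uo Z) (Do j) (transpose Z (Do j) (m j))) (\<eta> Z)"
      unfolding k_def h(2)[OF j, symmetric] F.F_comp_arr[OF ha l[OF j]]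
      by (rule F.D.comp_asc[OF unit_arr[OF Z] F.F_arr[OF ha] F.F_arr[OF l[OF j]], symmetric])
    also have "\<dots> = m j" by (rule transpose_inverse[OF ma[OF j] Dg.F_obj[OF j]])
    finally show "Cmp D Z (Fo L) (Fo (Do j)) (Fm L (Do j) (l j)) k = m j" .
  next
    fix k' assume k': "k' \<in> Hom D Z (Fo L) \<and>
      (\<forall>j \<in> Obj J. Cmp D Z (Fo L) (Fo (Do j)) (Fm L (Do j) (l j)) k' = m j)"
    then have ka: "arr D Z (Fo L) k'" using Z F.F_obj[OF L] by (simp add: arr_def)
    \<comment> \<open>The adjunct of a competitor mediates the transposed cone, so it equals
      \<open>h\<close>; injectivity of transposition does the rest.\<close>
    have "transpose Z L k' = h"
      using transpose_arr[OF ka L] transpose_comp[OF ka l] k' by (intro uniq) (simp_all add: arr_def)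
    then show "k' = k" using transpose_inverse[OF ka L] by (simp add: k_def)
  qed
qed

lemma preserves_finite_limits: "preserves_finite_limits C D Fo Fm"
  unfolding preserves_finite_limits_def finite_category_def
  using preserves_limits F.cat_functor_axioms by blast

end

section \<open>The additive completion\<close>

locale preadditive = category C for C :: "('o, 'v::ab_group_add, 'k) lincat" +
  assumes zero_arr: "x \<in> Obj C \<Longrightarrow> y \<in> Obj C \<Longrightarrow> arr C x y 0"
    and add_arr: "arr C x y f \<Longrightarrow> arr C x y g \<Longrightarrow> arr C x y (f + g)"
    and comp_add_left: "arr C x y f \<Longrightarrow> arr C y z g \<Longrightarrow> arr C y z h \<Longrightarrow>
      Cmp C x y z (g + h) f = Cmp C x y z g f + Cmp C x y z h f"
    and comp_add_right: "arr C x y f \<Longrightarrow> arr C x y g \<Longrightarrow> arr C y z h \<Longrightarrow>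
      Cmp C x y z h (f + g) = Cmp C x y z h f + Cmp C x y z h g"

text \<open>A matrix whose row \<open>i\<close> has its only possible nonzero entry in column
  \<open>\<sigma> i\<close>. Identities, associators, braidings, unitors and the coherence maps of
  the additive completion have this shape, which collapses the sums in matrix products.\<close>

definition monomial ::
  "(nat \<rightharpoonup> 'o) \<Rightarrow> (nat \<Rightarrow> nat) \<Rightarrow> (nat \<Rightarrow> 'v) \<Rightarrow> nat \<Rightarrow> nat \<Rightarrow> 'v::zero" where
  "monomial X \<sigma> t i j = (if i \<in> dom X \<and> j = \<sigma> i then t i else 0)"

context preadditive
begin

text \<open>Bilinearity applied to \<open>0 + 0\<close> gives an element equal to its own double,
  which the ambient group cancels.\<close>

lemma comp_zero [simp]:
  assumes "x \<in> Obj C" "y \<in> Obj C" "z \<in> Obj C"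
  shows "arr C x y f \<Longrightarrow> Cmp C x y z 0 f = 0" "arr C y z g \<Longrightarrow> Cmp C x y z g 0 = 0"
  using comp_add_left[of x y f z 0 0] comp_add_right[of x y 0 0 z g] zero_arr assms by auto

lemma sum_arr:
  assumes "x \<in> Obj C" "y \<in> Obj C" "\<And>i. i \<in> I \<Longrightarrow> arr C x y (f i)"
  shows "arr C x y (\<Sum>i\<in>I. f i)"
  using assms(3) by (induction I rule: infinite_finite_induct) (simp_all add: zero_arr add_arr assms)

lemma comp_sum_left:
  assumes "z \<in> Obj C" "arr C x y f" "\<And>i. i \<in> I \<Longrightarrow> arr C y z (g i)"
  shows "Cmp C x y z (\<Sum>i\<in>I. g i) f = (\<Sum>i\<in>I. Cmp C x y z (g i) f)"
proof -
  have o: "x \<in> Obj C" "y \<in> Obj C" using assms by (auto simp: arr_def)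
  show ?thesis using assms(3)
    by (induction I rule: infinite_finite_induct)
      (simp_all add: assms(1,2) o comp_add_left[OF assms(2)] sum_arr)
qed

lemma comp_sum_right:
  assumes "x \<in> Obj C" "arr C y z g" "\<And>i. i \<in> I \<Longrightarrow> arr C x y (f i)"
  shows "Cmp C x y z g (\<Sum>i\<in>I. f i) = (\<Sum>i\<in>I. Cmp C x y z g (f i))"
proof -
  have o: "z \<in> Obj C" "y \<in> Obj C" using assms by (auto simp: arr_def)
  show ?thesis using assms(3)
    by (induction I rule: infinite_finite_induct)
      (simp_all add: assms(1,2) o comp_add_right[OF _ _ assms(2)] sum_arr)
qed

lemma additive_objD:
  assumes "X \<in> Obj (additive C)"
  shows "finite (dom X)" "i \<in> dom X \<Longrightarrow> the (X i) \<in> Obj C"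
  using assms by (auto simp: additive_def ran_def)

lemma additive_arr_iff:
  "arr (additive C) X Y f \<longleftrightarrow> X \<in> Obj (additive C) \<and> Y \<in> Obj (additive C) \<and>
    (\<forall>i\<in>dom X. \<forall>j\<in>dom Y. arr C (the (X i)) (the (Y j)) (f i j)) \<and>
    (\<forall>i j. i \<notin> dom X \<or> j \<notin> dom Y \<longrightarrow> f i j = 0)"
  using additive_objD(2)[of X] additive_objD(2)[of Y]
  unfolding arr_def by (simp add: additive_def) blast

lemma additive_arr_entry:
  "arr (additive C) X Y f \<Longrightarrow> i \<in> dom X \<Longrightarrow> j \<in> dom Y \<Longrightarrow> arr C (the (X i)) (the (Y j)) (f i j)"
  by (simp add: additive_arr_iff)

lemma additive_arr_zero:
  "arr (additive C) X Y f \<Longrightarrow> i \<notin> dom X \<or> j \<notin> dom Y \<Longrightarrow> f i j = 0"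
  by (simp add: additive_arr_iff)

lemma additive_comp:
  "Cmp (additive C) X Y Z g f i k = (if i \<in> dom X \<and> k \<in> dom Z
    then \<Sum>j \<in> dom Y. Cmp C (the (X i)) (the (Y j)) (the (Z k)) (g j k) (f i j) else 0)"
  by (simp add: additive_def)

lemma additive_id: "Idn (additive C) X = monomial X (\<lambda>i. i) (\<lambda>i. Idn C (the (X i)))"
  by (simp add: additive_def monomial_def fun_eq_iff)

lemma additive_comp_arr:
  assumes "arr (additive C) X Y f" "arr (additive C) Y Z g"
  shows "arr (additive C) X Z (Cmp (additive C) X Y Z g f)"
proof -
  have o: "X \<in> Obj (additive C)" "Z \<in> Obj (additive C)" using assms by (auto simp: additive_arr_iff)
  note e = additive_arr_entry[OF assms(1)] additive_arr_entry[OF assms(2)]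
  have "arr C (the (X i)) (the (Z k)) (\<Sum>j \<in> dom Y. Cmp C (the (X i)) (the (Y j)) (the (Z k)) (g j k) (f i j))"
    if "i \<in> dom X" "k \<in> dom Z" for i k
    by (intro sum_arr arr_comp[OF e(1) e(2)] additive_objD(2)) (use that o in auto)
  then show ?thesis unfolding additive_arr_iff[of X Z] additive_comp using o by simp
qed

lemma monomial_arr:
  assumes "X \<in> Obj (additive C)" "Y \<in> Obj (additive C)"
    "\<And>i. i \<in> dom X \<Longrightarrow> \<sigma> i \<in> dom Y \<and> arr C (the (X i)) (the (Y (\<sigma> i))) (t i)"
  shows "arr (additive C) X Y (monomial X \<sigma> t)"
  using assms unfolding additive_arr_iff monomial_def by (auto intro!: zero_arr additive_objD(2))

lemma comp_monomial_right:
  assumes "X \<in> Obj (additive C)" "arr (additive C) Y Z g"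
    "\<And>i. i \<in> dom X \<Longrightarrow> \<sigma> i \<in> dom Y \<and> arr C (the (X i)) (the (Y (\<sigma> i))) (t i)"
  shows "Cmp (additive C) X Y Z g (monomial X \<sigma> t) i k = (if i \<in> dom X \<and> k \<in> dom Z
    then Cmp C (the (X i)) (the (Y (\<sigma> i))) (the (Z k)) (g (\<sigma> i) k) (t i) else 0)"
proof (cases "i \<in> dom X \<and> k \<in> dom Z")
  case True
  have Y: "Y \<in> Obj (additive C)" "Z \<in> Obj (additive C)" using assms(2) by (auto simp: additive_arr_iff)
  have "Cmp (additive C) X Y Z g (monomial X \<sigma> t) i k
    = (\<Sum>j\<in>dom Y. if j = \<sigma> i then Cmp C (the (X i)) (the (Y j)) (the (Z k)) (g j k) (t i) else 0)"
  proof -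
    have "Cmp C (the (X i)) (the (Y j)) (the (Z k)) (g j k) (if j = \<sigma> i then t i else 0)
      = (if j = \<sigma> i then Cmp C (the (X i)) (the (Y j)) (the (Z k)) (g j k) (t i) else 0)"
      if "j \<in> dom Y" for j
      using True that comp_zero(2)[OF _ _ _ additive_arr_entry[OF assms(2)]] additive_objD(2) assms(1) Y
      by simp
    then show ?thesis using True by (simp add: additive_comp monomial_def cong: sum.cong)
  qed
  also have "\<dots> = Cmp C (the (X i)) (the (Y (\<sigma> i))) (the (Z k)) (g (\<sigma> i) k) (t i)"
    using additive_objD(1)[OF Y(1)] assms(3) True by (simp add: sum.delta')
  finally show ?thesis using True by simp
qed (auto simp: additive_comp)

text \<open>Column \<open>\<sigma> j\<close> could receive contributions from several rows of the
  monomial matrix; injectivity leaves only the one from row \<open>j\<close>.\<close>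

lemma comp_monomial_left:
  assumes "Z \<in> Obj (additive C)" "arr (additive C) X Y g" "inj_on \<sigma> (dom Y)" "j \<in> dom Y"
    "\<And>j. j \<in> dom Y \<Longrightarrow> \<sigma> j \<in> dom Z \<and> arr C (the (Y j)) (the (Z (\<sigma> j))) (t j)"
  shows "Cmp (additive C) X Y Z (monomial Y \<sigma> t) g i (\<sigma> j) = (if i \<in> dom X
    then Cmp C (the (X i)) (the (Y j)) (the (Z (\<sigma> j))) (t j) (g i j) else 0)"
proof (cases "i \<in> dom X")
  case True
  have Y: "Y \<in> Obj (additive C)" "X \<in> Obj (additive C)" using assms(2) by (auto simp: additive_arr_iff)
  have "Cmp (additive C) X Y Z (monomial Y \<sigma> t) g i (\<sigma> j)
    = (\<Sum>j'\<in>dom Y. if j' = j then Cmp C (the (X i)) (the (Y j')) (the (Z (\<sigma> j))) (t j') (g i j') else 0)"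
  proof -
    have "Cmp C (the (X i)) (the (Y j')) (the (Z (\<sigma> j))) (if \<sigma> j = \<sigma> j' then t j' else 0) (g i j')
      = (if j' = j then Cmp C (the (X i)) (the (Y j')) (the (Z (\<sigma> j))) (t j') (g i j') else 0)"
      if "j' \<in> dom Y" for j'
      using True that comp_zero(1)[OF _ _ _ additive_arr_entry[OF assms(2)]] additive_objD(2) assms(1,4,5) Y
        inj_onD[OF assms(3), of j j']
      by auto
    then show ?thesis using True assms(4,5) by (simp add: additive_comp monomial_def cong: sum.cong)
  qed
  also have "\<dots> = Cmp C (the (X i)) (the (Y j)) (the (Z (\<sigma> j))) (t j) (g i j)"
    using additive_objD(1)[OF Y(1)] assms(4) by simp
  finally show ?thesis using True by simp
qed (auto simp: additive_comp)

lemma comp_diagonal_left: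
  assumes "Z \<in> Obj (additive C)" "arr (additive C) X Y g" "dom Y = dom Z"
    "\<And>j. j \<in> dom Y \<Longrightarrow> arr C (the (Y j)) (the (Z j)) (t j)"
  shows "Cmp (additive C) X Y Z (monomial Y (\<lambda>i. i) t) g i j = (if i \<in> dom X \<and> j \<in> dom Z
    then Cmp C (the (X i)) (the (Y j)) (the (Z j)) (t j) (g i j) else 0)"
  using comp_monomial_left[OF assms(1,2), of "\<lambda>i. i" j t i] assms(3,4)
  by (cases "j \<in> dom Y") (simp_all add: additive_comp)

lemma category_additive: "category (additive C)"
proof -
  have arrI: "arr (additive C) X Y f" if "X \<in> Obj (additive C)" "Y \<in> Obj (additive C)" "f \<in> Hom (additive C) X Y" for X Y f
    using that by (simp add: arr_def)
  have ida: "arr (additive C) X X (Idn (additive C) X)" if "X \<in> Obj (additive C)" for X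
    unfolding additive_id by (rule monomial_arr) (use that in \<open>auto simp: additive_objD\<close>)
  show ?thesis
  proof
    show "Idn (additive C) X \<in> Hom (additive C) X X" if "X \<in> Obj (additive C)" for X
      using ida[OF that] by (simp add: arr_def)
    show "Cmp (additive C) X Y Z g f \<in> Hom (additive C) X Z"
      if "X \<in> Obj (additive C)" "Y \<in> Obj (additive C)" "Z \<in> Obj (additive C)"
        "f \<in> Hom (additive C) X Y" "g \<in> Hom (additive C) Y Z" for X Y Z f g
      using additive_comp_arr[OF arrI arrI] that by (simp add: arr_def)
    show "Cmp (additive C) X Y Y (Idn (additive C) Y) f = f"
      if "X \<in> Obj (additive C)" "Y \<in> Obj (additive C)" "f \<in> Hom (additive C) X Y" for X Y f
    proof (intro ext)
      fix i j
      have f: "arr (additive C) X Y f" using that by (rule arrI)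
      show "Cmp (additive C) X Y Y (Idn (additive C) Y) f i j = f i j"
      proof (cases "i \<in> dom X \<and> j \<in> dom Y")
        case True
        then show ?thesis unfolding additive_id
          using comp_monomial_left[OF that(2) f, of "\<lambda>i. i" j "\<lambda>i. Idn C (the (Y i))" i]
            additive_objD(2)[OF that(2)] additive_arr_entry[OF f, of i j] by simp
      next
        case False then show ?thesis using additive_arr_zero[OF f] by (auto simp: additive_comp)
      qed
    qed
    show "Cmp (additive C) X X Y f (Idn (additive C) X) = f"
      if "X \<in> Obj (additive C)" "Y \<in> Obj (additive C)" "f \<in> Hom (additive C) X Y" for X Y f
    proof (intro ext)
      fix i j
      have f: "arr (additive C) X Y f" using that by (rule arrI)
      show "Cmp (additive C) X X Y f (Idn (additive C) X) i j = f i j"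
        unfolding additive_id
        using comp_monomial_right[OF that(1) f, of "\<lambda>i. i" "\<lambda>i. Idn C (the (X i))" i j]
          additive_objD(2)[OF that(1)] additive_arr_entry[OF f, of i j] additive_arr_zero[OF f, of i j]
        by auto
    qed
    show "Cmp (additive C) W Y Z h (Cmp (additive C) W X Y g f) = Cmp (additive C) W X Z (Cmp (additive C) X Y Z h g) f"
      if o: "W \<in> Obj (additive C)" "X \<in> Obj (additive C)" "Y \<in> Obj (additive C)" "Z \<in> Obj (additive C)"
        and f: "f \<in> Hom (additive C) W X" and g: "g \<in> Hom (additive C) X Y" and h: "h \<in> Hom (additive C) Y Z"
      for W X Y Z f g h
    proof (intro ext)
      fix i l
      note e = additive_arr_entry[OF arrI[OF o(1,2) f]] additive_arr_entry[OF arrI[OF o(2,3) g]]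
        additive_arr_entry[OF arrI[OF o(3,4) h]]
      show "Cmp (additive C) W Y Z h (Cmp (additive C) W X Y g f) i l = Cmp (additive C) W X Z (Cmp (additive C) X Y Z h g) f i l"
      proof (cases "i \<in> dom W \<and> l \<in> dom Z")
        case True
        \<comment> \<open>The common summand: both bracketings are the double sum of
          \<open>?t\<close>, taken in opposite orders.\<close>
        let ?t = "\<lambda>j k. Cmp C (the (W i)) (the (Y k)) (the (Z l)) (h k l)
            (Cmp C (the (W i)) (the (X j)) (the (Y k)) (g j k) (f i j))"
        have 1: "Cmp C (the (W i)) (the (Y k)) (the (Z l)) (h k l)
            (\<Sum>j\<in>dom X. Cmp C (the (W i)) (the (X j)) (the (Y k)) (g j k) (f i j)) = (\<Sum>j\<in>dom X. ?t j k)"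
          if "k \<in> dom Y" for k
          using that True e by (intro comp_sum_right) (auto simp: additive_objD o)
        have 2: "Cmp C (the (W i)) (the (X j)) (the (Z l))
            (\<Sum>k\<in>dom Y. Cmp C (the (X j)) (the (Y k)) (the (Z l)) (h k l) (g j k)) (f i j) = (\<Sum>k\<in>dom Y. ?t j k)"
          if j: "j \<in> dom X" for j
        proof -
          have "Cmp C (the (W i)) (the (X j)) (the (Z l))
            (\<Sum>k\<in>dom Y. Cmp C (the (X j)) (the (Y k)) (the (Z l)) (h k l) (g j k)) (f i j)
            = (\<Sum>k\<in>dom Y. Cmp C (the (W i)) (the (X j)) (the (Z l))
                (Cmp C (the (X j)) (the (Y k)) (the (Z l)) (h k l) (g j k)) (f i j))"
            using j True e by (intro comp_sum_left arr_comp) (auto simp: additive_objD o)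
          also have "\<dots> = (\<Sum>k\<in>dom Y. ?t j k)"
            using j True e by (intro sum.cong refl comp_asc) auto
          finally show ?thesis .
        qed
        show ?thesis using True 1 2 sum.swap[of ?t "dom Y" "dom X"] by (simp add: additive_comp)
      qed (auto simp: additive_comp)
    qed
  qed
qed

end

locale preadditive_functor = cat_functor C D Fo Fm + C: preadditive C + D: preadditive D
  for C :: "('o, 'v::ab_group_add, 'k) lincat" and D :: "('p, 'w::ab_group_add, 'k) lincat"
    and Fo :: "'o \<Rightarrow> 'p" and Fm :: "'o \<Rightarrow> 'o \<Rightarrow> 'v \<Rightarrow> 'w" +
  assumes F_add: "arr C x y f \<Longrightarrow> arr C x y g \<Longrightarrow> Fm x y (f + g) = Fm x y f + Fm x y g"
begin

lemma F_zero: "x \<in> Obj C \<Longrightarrow> y \<in> Obj C \<Longrightarrow> Fm x y 0 = 0"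
  using F_add[of x y 0 0] C.zero_arr by simp

lemma F_sum:
  assumes "x \<in> Obj C" "y \<in> Obj C" "\<And>i. i \<in> I \<Longrightarrow> arr C x y (f i)"
  shows "Fm x y (\<Sum>i\<in>I. f i) = (\<Sum>i\<in>I. Fm x y (f i))"
  using assms(3)
  by (induction I rule: infinite_finite_induct) (simp_all add: F_zero F_add C.sum_arr assms)

lemma dom_additive_obj [simp]: "dom (additive_obj G X) = dom X"
  by (auto simp: additive_obj_def)

lemma the_additive_obj [simp]: "i \<in> dom X \<Longrightarrow> the (additive_obj G X i) = G (the (X i))"
  by (auto simp: additive_obj_def)

lemma additive_obj_obj: "X \<in> Obj (additive C) \<Longrightarrow> additive_obj Fo X \<in> Obj (additive D)"
  using F_obj by (force simp: additive_def additive_obj_def ran_def dom_def)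

lemma cat_functor_additive:
  "cat_functor (additive C) (additive D) (additive_obj Fo) (additive_mor Fm)"
proof -
  interpret CA: category "additive C" by (rule C.category_additive)
  interpret DA: category "additive D" by (rule D.category_additive)
  show ?thesis
  proof
    show "additive_mor Fm X Y f \<in> Hom (additive D) (additive_obj Fo X) (additive_obj Fo Y)"
      if "X \<in> Obj (additive C)" "Y \<in> Obj (additive C)" "f \<in> Hom (additive C) X Y" for X Y f
    proof -
      have "arr (additive C) X Y f" using that by (simp add: arr_def)
      then have "arr (additive D) (additive_obj Fo X) (additive_obj Fo Y) (additive_mor Fm X Y f)"
        unfolding C.additive_arr_iff D.additive_arr_iff by (auto simp: additive_obj_obj additive_mor_def)
      then show ?thesis by (simp add: arr_def)
    qed
    show "additive_mor Fm X X (Idn (additive C) X) = Idn (additive D) (additive_obj Fo X)"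
      if "X \<in> Obj (additive C)" for X
      using C.additive_objD(2)[OF that]
      by (auto simp: fun_eq_iff additive_mor_def C.additive_id D.additive_id monomial_def F_id F_zero)
    show "additive_mor Fm X Z (Cmp (additive C) X Y Z g f)
      = Cmp (additive D) (additive_obj Fo X) (additive_obj Fo Y) (additive_obj Fo Z)
          (additive_mor Fm Y Z g) (additive_mor Fm X Y f)"
      if o: "X \<in> Obj (additive C)" "Y \<in> Obj (additive C)" "Z \<in> Obj (additive C)"
        and h: "f \<in> Hom (additive C) X Y" "g \<in> Hom (additive C) Y Z" for X Y Z f g
    proof (intro ext)
      fix i k
      have a: "arr (additive C) X Y f" "arr (additive C) Y Z g" using o h by (simp_all add: arr_def)
      note e = C.additive_arr_entry[OF a(1)] C.additive_arr_entry[OF a(2)]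
      show "additive_mor Fm X Z (Cmp (additive C) X Y Z g f) i k
        = Cmp (additive D) (additive_obj Fo X) (additive_obj Fo Y) (additive_obj Fo Z)
          (additive_mor Fm Y Z g) (additive_mor Fm X Y f) i k"
      proof (cases "i \<in> dom X \<and> k \<in> dom Z")
        case True
        then have "Fm (the (X i)) (the (Z k)) (\<Sum>j\<in>dom Y. Cmp C (the (X i)) (the (Y j)) (the (Z k)) (g j k) (f i j))
          = (\<Sum>j\<in>dom Y. Fm (the (X i)) (the (Z k)) (Cmp C (the (X i)) (the (Y j)) (the (Z k)) (g j k) (f i j)))"
          by (intro F_sum C.arr_comp[OF e]) (auto simp: C.additive_objD o)
        also have "\<dots> = (\<Sum>j\<in>dom Y. Cmp D (Fo (the (X i))) (Fo (the (Y j))) (Fo (the (Z k)))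
            (Fm (the (Y j)) (the (Z k)) (g j k)) (Fm (the (X i)) (the (Y j)) (f i j)))"
          using True by (intro sum.cong refl F_comp_arr e) auto
        finally show ?thesis using True
          by (simp add: additive_mor_def C.additive_comp D.additive_comp)
      qed (auto simp: additive_mor_def D.additive_comp)
    qed
  qed (rule additive_obj_obj)
qed

end

text \<open>Since \<open>additive_obj\<close> keeps the index set, unit and counit extend as
  diagonal matrices, and every identity can be read off entry by entry.\<close>

lemma semi_adjunction_additive:
  assumes "semi_adjunction C D Fo Fm Uo Um \<eta> \<epsilon>" "preadditive_functor C D Fo Fm" "preadditive_functor D C Uo Um"
  shows "semi_adjunction (additive C) (additive D) (additive_obj Fo) (additive_mor Fm)
    (additive_obj Uo) (additive_mor Um)
    (\<lambda>Z. monomial Z (\<lambda>i. i) (\<lambda>i. \<eta> (the (Z i))))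
    (\<lambda>X. monomial (additive_obj Uo (additive_obj Fo X)) (\<lambda>i. i) (\<lambda>i. \<epsilon> (the (X i))))"
proof -
  interpret semi_adjunction C D Fo Fm Uo Um \<eta> \<epsilon> by fact
  interpret F: preadditive_functor C D Fo Fm by fact
  interpret U: preadditive_functor D C Uo Um by fact
  have F_obj: "x \<in> Obj C \<Longrightarrow> Fo x \<in> Obj D" and U_obj: "z \<in> Obj D \<Longrightarrow> Uo z \<in> Obj C" for x z
    by (rule F.F_obj, assumption) (rule U.F_obj)
  interpret FA: cat_functor "additive C" "additive D" "additive_obj Fo" "additive_mor Fm"
    by (rule F.cat_functor_additive)
  interpret UA: cat_functor "additive D" "additive C" "additive_obj Uo" "additive_mor Um"
    by (rule U.cat_functor_additive)
  note [simp] = F.dom_additive_obj F.the_additive_obj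
  let ?\<eta> = "\<lambda>Z. monomial Z (\<lambda>i. i) (\<lambda>i. \<eta> (the (Z i)))"
  let ?\<epsilon> = "\<lambda>X. monomial (additive_obj Uo (additive_obj Fo X)) (\<lambda>i. i) (\<lambda>i. \<epsilon> (the (X i)))"
  let ?F = "additive_obj Fo" and ?U = "additive_obj Uo"
  have u: "arr (additive D) Z (?F (?U Z)) (?\<eta> Z)" if "Z \<in> Obj (additive D)" for Z
    by (rule F.D.monomial_arr)
      (use that in \<open>auto simp: F.additive_obj_obj U.additive_obj_obj F.D.additive_objD unit_arr\<close>)
  have c: "arr (additive C) (?U (?F X)) X (?\<epsilon> X)" if "X \<in> Obj (additive C)" for X
    by (rule F.C.monomial_arr)
      (use that in \<open>auto simp: F.additive_obj_obj U.additive_obj_obj F.C.additive_objD counit_arr\<close>)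
  show ?thesis
  proof
    show "arr (additive D) Z (?F (?U Z)) (?\<eta> Z)" if "Z \<in> Obj (additive D)" for Z
      using that by (rule u)
    show "arr (additive C) (?U (?F X)) X (?\<epsilon> X)" if "X \<in> Obj (additive C)" for X
      using that by (rule c)
    show "Cmp (additive D) Z (?F (?U Z)) (?F (?U W))
        (additive_mor Fm (?U Z) (?U W) (additive_mor Um Z W g)) (?\<eta> Z)
      = Cmp (additive D) Z W (?F (?U W)) (?\<eta> W) g" (is "?l = ?r")
      if g: "arr (additive D) Z W g" for Z W g
    proof (intro ext)
      fix i k
      have o: "Z \<in> Obj (additive D)" "W \<in> Obj (additive D)" using g by (simp_all add: arr_def)
      have "?l i k = (if i \<in> dom Z \<and> k \<in> dom W then Cmp D (the (Z i)) (Fo (Uo (the (Z i)))) (Fo (Uo (the (W k))))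
          (Fm (Uo (the (Z i))) (Uo (the (W k))) (Um (the (Z i)) (the (W k)) (g i k))) (\<eta> (the (Z i))) else 0)"
        using o F.D.comp_monomial_right[OF o(1) FA.F_arr[OF UA.F_arr[OF g]], of "\<lambda>i. i" "\<lambda>i. \<eta> (the (Z i))" i k]
        by (auto simp: F.D.additive_objD unit_arr additive_mor_def)
      moreover have "?r i k = (if i \<in> dom Z \<and> k \<in> dom W then Cmp D (the (Z i)) (the (W k)) (Fo (Uo (the (W k))))
          (\<eta> (the (W k))) (g i k) else 0)"
        using o F.D.comp_diagonal_left[OF _ g, of "?F (?U W)" "\<lambda>i. \<eta> (the (W i))" i k]
        by (auto simp: F.D.additive_objD unit_arr F.additive_obj_obj U.additive_obj_obj)
      ultimately show "?l i k = ?r i k" using unit_natural[OF F.D.additive_arr_entry[OF g]] by auto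
    qed
    show "Cmp (additive C) (?U (?F X)) X Y f (?\<epsilon> X)
      = Cmp (additive C) (?U (?F X)) (?U (?F Y)) Y (?\<epsilon> Y) (additive_mor Um (?F X) (?F Y) (additive_mor Fm X Y f))"
      (is "?l = ?r") if f: "arr (additive C) X Y f" for X Y f
    proof (intro ext)
      fix i k
      have o: "X \<in> Obj (additive C)" "Y \<in> Obj (additive C)" using f by (simp_all add: arr_def)
      have "?l i k = (if i \<in> dom X \<and> k \<in> dom Y then Cmp C (Uo (Fo (the (X i)))) (the (X i)) (the (Y k))
          (f i k) (\<epsilon> (the (X i))) else 0)"
        using o F.C.comp_monomial_right[OF _ f, of "?U (?F X)" "\<lambda>i. i" "\<lambda>i. \<epsilon> (the (X i))" i k]
        by (auto simp: F.C.additive_objD counit_arr F.additive_obj_obj U.additive_obj_obj)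
      moreover have "?r i k = (if i \<in> dom X \<and> k \<in> dom Y then
          Cmp C (Uo (Fo (the (X i)))) (Uo (Fo (the (Y k)))) (the (Y k)) (\<epsilon> (the (Y k)))
          (Um (Fo (the (X i))) (Fo (the (Y k))) (Fm (the (X i)) (the (Y k)) (f i k))) else 0)"
        using o F.C.comp_diagonal_left[OF o(2) UA.F_arr[OF FA.F_arr[OF f]], of "\<lambda>i. \<epsilon> (the (Y i))" i k]
        by (auto simp: F.C.additive_objD counit_arr additive_mor_def)
      ultimately show "?l i k = ?r i k" using counit_natural[OF F.C.additive_arr_entry[OF f]] by auto
    qed
    show "Cmp (additive D) (?F X) (?F (?U (?F X))) (?F X) (additive_mor Fm (?U (?F X)) X (?\<epsilon> X)) (?\<eta> (?F X))
      = Idn (additive D) (?F X)" (is "?l = ?r") if o: "X \<in> Obj (additive C)" for X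
    proof (intro ext)
      fix i k
      have 1: "?l i k = (if i \<in> dom X \<and> k \<in> dom X then
          Cmp D (Fo (the (X i))) (Fo (Uo (Fo (the (X i))))) (Fo (the (X k)))
            (additive_mor Fm (?U (?F X)) X (?\<epsilon> X) i k) (\<eta> (Fo (the (X i)))) else 0)"
        using o F.D.comp_monomial_right[OF _ FA.F_arr[OF c[OF o]], of "?F X" "\<lambda>i. i" "\<lambda>i. \<eta> (the (?F X i))" i k]
        by (auto simp: F.D.additive_objD F.C.additive_objD F_obj unit_arr F.additive_obj_obj)
      \<comment> \<open>On the diagonal this is the triangle identity; elsewhere \<open>F\<close>
        sends the zero entries of the counit to zero.\<close>
      show "?l i k = ?r i k"
        unfolding 1 F.D.additive_id
        using triangle[of "the (X i)"] F.C.additive_objD(2)[OF o] unit_arr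
        by (auto simp: monomial_def additive_mor_def F.F_zero U_obj F_obj)
    qed
  qed
qed

section \<open>The Karoubi completion\<close>

definition idem :: "('o, 'a, 'r) cat_scheme \<Rightarrow> 'o \<Rightarrow> 'a \<Rightarrow> bool" where
  "idem C x e \<longleftrightarrow> arr C x x e \<and> Cmp C x x x e e = e"

lemma karoubi_obj_iff: "(x, e) \<in> Obj (karoubi C) \<longleftrightarrow> idem C x e"
  by (auto simp: karoubi_def idem_def arr_def)

lemma karoubi_comp [simp]: "Cmp (karoubi C) (x, e) (y, d) (z, c) = Cmp C x y z"
  by (simp add: karoubi_def)

lemma karoubi_id [simp]: "Idn (karoubi C) (x, e) = e"
  by (simp add: karoubi_def)

text \<open>Idempotence of \<open>e\<close> and \<open>d\<close> splits the single condition
  \<open>d f e = f\<close> into absorption on each side. Composites and identities in the completion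
  are checked with the split form.\<close>

lemma karoubi_hom_iff:
  fixes C :: "('o, 'v, 'k) lincat"
  assumes "category C" "idem C x e" "idem C y d"
  shows "f \<in> Hom (karoubi C) (x, e) (y, d) \<longleftrightarrow>
    arr C x y f \<and> Cmp C x x y f e = f \<and> Cmp C x y y d f = f" (is "?l \<longleftrightarrow> ?r")
proof
  interpret category C by fact
  have e: "arr C x x e" "Cmp C x x x e e = e" and d: "arr C y y d" "Cmp C y y y d d = d"
    using assms by (auto simp: idem_def)
  assume ?l
  then have f: "arr C x y f" and eq: "Cmp C x x y (Cmp C x y y d f) e = f"
    using e d by (simp_all add: karoubi_def arr_def)
  have "Cmp C x x y f e = f"
    using comp_asc[OF e(1,1) arr_comp[OF f d(1)]] e(2) eq by simp
  moreover have "Cmp C x y y d f = f"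
    using comp_asc[OF arr_comp[OF e(1) f] d(1,1)] d(2) eq comp_asc[OF e(1) f d(1)] by simp
  ultimately show ?r using f by simp
next
  assume ?r
  then show ?l by (simp add: karoubi_def arr_def)
qed

lemma karoubi_arr_iff:
  fixes C :: "('o, 'v, 'k) lincat"
  assumes "category C"
  shows "arr (karoubi C) (x, e) (y, d) f \<longleftrightarrow> idem C x e \<and> idem C y d \<and>
    arr C x y f \<and> Cmp C x x y f e = f \<and> Cmp C x y y d f = f"
  unfolding arr_def[of "karoubi C"] karoubi_obj_iff using karoubi_hom_iff[OF assms] by blast

lemma category_karoubi:
  fixes K :: "('o, 'a, 'k) lincat"
  assumes "category K"
  shows "category (karoubi K)"
proof -
  interpret K: category K by fact
  show ?thesis
  proof (rule category.intro; clarify; unfold karoubi_obj_iff karoubi_comp karoubi_id)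
    fix x e assume x: "idem K x e"
    then show "e \<in> Hom (karoubi K) (x, e) (x, e)"
      unfolding karoubi_hom_iff[OF K.category_axioms x x] by (simp add: idem_def)
    fix y d f assume y: "idem K y d" and f: "f \<in> Hom (karoubi K) (x, e) (y, d)"
    note F = f[unfolded karoubi_hom_iff[OF K.category_axioms x y]]
    show "Cmp K x y y d f = f" "Cmp K x x y f e = f" using F by simp_all
    fix z c g assume z: "idem K z c" and g: "g \<in> Hom (karoubi K) (y, d) (z, c)"
    note G = g[unfolded karoubi_hom_iff[OF K.category_axioms y z]]
    have i: "arr K x x e" "arr K z z c" using x z by (simp_all add: idem_def)
    show "Cmp K x y z g f \<in> Hom (karoubi K) (x, e) (z, c)"
      unfolding karoubi_hom_iff[OF K.category_axioms x z]
      using F G i K.comp_asc[of x x e y f z g] K.comp_asc[of x y f z g z c] by simp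
    fix w b h assume w: "idem K w b" and h: "h \<in> Hom (karoubi K) (z, c) (w, b)"
    note H = h[unfolded karoubi_hom_iff[OF K.category_axioms z w]]
    show "Cmp K x z w h (Cmp K x y z g f) = Cmp K x y w (Cmp K y z w h g) f"
      using F G H K.comp_asc[of x y f z g w h] by simp
  qed
qed

lemma cat_functor_karoubi:
  fixes C :: "('o, 'v, 'k) lincat" and D :: "('p, 'w, 'k) lincat"
  assumes "cat_functor C D Fo Fm"
  shows "cat_functor (karoubi C) (karoubi D) (karoubi_obj Fo Fm) (karoubi_mor Fm)"
proof -
  interpret cat_functor C D Fo Fm by fact
  have i: "idem D (Fo x) (Fm x x e)" if "idem C x e" for x e
    using that F_comp_arr[of x x e x e] by (simp add: idem_def)
  show ?thesis
  proof (intro cat_functor.intro cat_functor_axioms.intro category_karoubi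
      C.category_axioms D.category_axioms; clarify;
      unfold karoubi_obj_def karoubi_mor_def prod.case karoubi_obj_iff karoubi_comp karoubi_id)
    fix x e assume x: "idem C x e"
    show "idem D (Fo x) (Fm x x e)" using x by (rule i)
    show "Fm x x e = Fm x x e" ..
    fix y d f assume y: "idem C y d" and f: "f \<in> Hom (karoubi C) (x, e) (y, d)"
    note F = f[unfolded karoubi_hom_iff[OF C.category_axioms x y]]
    have a: "arr C x x e" "arr C y y d" using x y by (simp_all add: idem_def)
    show "Fm x y f \<in> Hom (karoubi D) (Fo x, Fm x x e) (Fo y, Fm y y d)"
      unfolding karoubi_hom_iff[OF D.category_axioms i[OF x] i[OF y]]
      using F a F_comp_arr[of x x e y f] F_comp_arr[of x y f y d] by simp
    fix z c g assume z: "idem C z c" and g: "g \<in> Hom (karoubi C) (y, d) (z, c)"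
    note G = g[unfolded karoubi_hom_iff[OF C.category_axioms y z]]
    show "Fm x z (Cmp C x y z g f) = Cmp D (Fo x) (Fo y) (Fo z) (Fm y z g) (Fm x y f)"
      using F G F_comp_arr by blast
  qed
qed

text \<open>The identity of \<open>(z, e)\<close> is \<open>e\<close>, so unit and counit must
  absorb the idempotents. One copy of \<open>e\<close> suffices, because naturality carries it to
  the other end.\<close>

lemma semi_adjunction_karoubi:
  fixes C :: "('o, 'v, 'k) lincat" and D :: "('p, 'w, 'k) lincat"
  assumes "semi_adjunction C D Fo Fm Uo Um \<eta> \<epsilon>"
  shows "semi_adjunction (karoubi C) (karoubi D) (karoubi_obj Fo Fm) (karoubi_mor Fm)
    (karoubi_obj Uo Um) (karoubi_mor Um)
    (\<lambda>(z, e). Cmp D z z (Fo (Uo z)) (\<eta> z) e) (\<lambda>(x, e). Cmp C (Uo (Fo x)) x x e (\<epsilon> x))"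
proof -
  interpret semi_adjunction C D Fo Fm Uo Um \<eta> \<epsilon> by fact
  note D_asc = F.D.comp_asc and C_asc = F.C.comp_asc
  have Fi: "idem D (Fo x) (Fm x x e)" if "idem C x e" for x e
    using that F.F_comp_arr[of x x e x e] by (simp add: idem_def)
  have Ui: "idem C (Uo x) (Um x x e)" if "idem D x e" for x e
    using that U.F_comp_arr[of x x e x e] by (simp add: idem_def)
  show ?thesis
  proof (intro semi_adjunction.intro semi_adjunction_axioms.intro cat_functor_karoubi
      F.cat_functor_axioms U.cat_functor_axioms; clarify;
      unfold karoubi_obj_def karoubi_mor_def prod.case karoubi_obj_iff karoubi_comp karoubi_id)
    fix z e assume z: "idem D z e"
    then have a: "arr D z z e" "Cmp D z z z e e = e" "z \<in> Obj D" by (simp_all add: idem_def arr_def)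
    note u = unit_arr[OF a(3)]
    have "Cmp D z (Fo (Uo z)) (Fo (Uo z)) (Fm (Uo z) (Uo z) (Um z z e)) (Cmp D z z (Fo (Uo z)) (\<eta> z) e)
      = Cmp D z z (Fo (Uo z)) (Cmp D z z (Fo (Uo z)) (\<eta> z) e) e"
      using D_asc[OF a(1) u F.F_arr[OF U.F_arr[OF a(1)]]] unit_natural[OF a(1)] by simp
    also have "\<dots> = Cmp D z z (Fo (Uo z)) (\<eta> z) e" using D_asc[OF a(1,1) u] a by simp
    finally show "arr (karoubi D) (z, e) (Fo (Uo z), Fm (Uo z) (Uo z) (Um z z e)) (Cmp D z z (Fo (Uo z)) (\<eta> z) e)"
      unfolding karoubi_arr_iff[OF F.D.category_axioms] using z Fi[OF Ui[OF z]] F.D.arr_comp[OF a(1) u] D_asc[OF a(1,1) u] a by simp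
  next
    fix x e assume x: "idem C x e"
    then have a: "arr C x x e" "Cmp C x x x e e = e" "x \<in> Obj C" by (simp_all add: idem_def arr_def)
    note u = counit_arr[OF a(3)] note b = U.F_arr[OF F.F_arr[OF a(1)]]
    have "Cmp C (Uo (Fo x)) (Uo (Fo x)) x (Cmp C (Uo (Fo x)) x x e (\<epsilon> x)) (Um (Fo x) (Fo x) (Fm x x e))
      = Cmp C (Uo (Fo x)) x x e (Cmp C (Uo (Fo x)) x x e (\<epsilon> x))"
      using C_asc[OF b u a(1)] counit_natural[OF a(1)] by simp
    also have "\<dots> = Cmp C (Uo (Fo x)) x x e (\<epsilon> x)" using C_asc[OF u a(1,1)] a by simp
    finally show "arr (karoubi C) (Uo (Fo x), Um (Fo x) (Fo x) (Fm x x e)) (x, e) (Cmp C (Uo (Fo x)) x x e (\<epsilon> x))"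
      unfolding karoubi_arr_iff[OF F.C.category_axioms] using x Ui[OF Fi[OF x]] F.C.arr_comp[OF u a(1)] C_asc[OF u a(1,1)] a by simp
    have "Cmp D (Fo x) (Fo (Uo (Fo x))) (Fo x) (Fm (Uo (Fo x)) x (Cmp C (Uo (Fo x)) x x e (\<epsilon> x)))
          (Cmp D (Fo x) (Fo x) (Fo (Uo (Fo x))) (\<eta> (Fo x)) (Fm x x e))
      = Cmp D (Fo x) (Fo x) (Fo x)
          (Cmp D (Fo x) (Fo (Uo (Fo x))) (Fo x) (Fm (Uo (Fo x)) x (Cmp C (Uo (Fo x)) x x e (\<epsilon> x))) (\<eta> (Fo x)))
          (Fm x x e)"
      by (rule D_asc[OF F.F_arr[OF a(1)] unit_arr F.F_arr[OF F.C.arr_comp[OF u a(1)]], symmetric])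
        (rule F.F_obj[OF a(3)])
    \<comment> \<open>\<open>F e\<close> passes out on the left, and the triangle identity of the
      original adjunction cancels the rest.\<close>
    also have "Cmp D (Fo x) (Fo (Uo (Fo x))) (Fo x) (Fm (Uo (Fo x)) x (Cmp C (Uo (Fo x)) x x e (\<epsilon> x))) (\<eta> (Fo x))
      = Fm x x e"
      unfolding F.F_comp_arr[OF u a(1)]
        D_asc[OF unit_arr[OF F.F_obj[OF a(3)]] F.F_arr[OF u] F.F_arr[OF a(1)]] triangle[OF a(3)]
      using F.F_arr[OF a(1)] by simp
    also have "Cmp D (Fo x) (Fo x) (Fo x) (Fm x x e) (Fm x x e) = Fm x x e"
      using Fi[OF x] by (simp add: idem_def)
    finally show "Cmp D (Fo x) (Fo (Uo (Fo x))) (Fo x) (Fm (Uo (Fo x)) x (Cmp C (Uo (Fo x)) x x e (\<epsilon> x)))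
          (Cmp D (Fo x) (Fo x) (Fo (Uo (Fo x))) (\<eta> (Fo x)) (Fm x x e)) = Fm x x e" .
  next
    fix z e w d g assume "arr (karoubi D) (z, e) (w, d) g"
    then have z: "idem D z e" and w: "idem D w d" and g: "arr D z w g" and
      ge: "Cmp D z z w g e = g" and dg: "Cmp D z w w d g = g"
      unfolding karoubi_arr_iff[OF F.D.category_axioms] by auto
    have a: "arr D z z e" "arr D w w d" "z \<in> Obj D" "w \<in> Obj D" using z w by (simp_all add: idem_def arr_def)
    note u = unit_arr[OF a(3)] unit_arr[OF a(4)]
    have "Cmp D z (Fo (Uo z)) (Fo (Uo w)) (Fm (Uo z) (Uo w) (Um z w g)) (Cmp D z z (Fo (Uo z)) (\<eta> z) e)
      = Cmp D z w (Fo (Uo w)) (\<eta> w) g"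
      using D_asc[OF a(1) u(1) F.F_arr[OF U.F_arr[OF g]]] unit_natural[OF g] D_asc[OF a(1) g u(2)] ge by simp
    also have "\<dots> = Cmp D z w (Fo (Uo w)) (Cmp D w w (Fo (Uo w)) (\<eta> w) d) g"
      using D_asc[OF g a(2) u(2)] dg by simp
    finally show "Cmp D z (Fo (Uo z)) (Fo (Uo w)) (Fm (Uo z) (Uo w) (Um z w g)) (Cmp D z z (Fo (Uo z)) (\<eta> z) e)
      = Cmp D z w (Fo (Uo w)) (Cmp D w w (Fo (Uo w)) (\<eta> w) d) g" .
  next
    fix x e y d f assume "arr (karoubi C) (x, e) (y, d) f"
    then have x: "idem C x e" and y: "idem C y d" and f: "arr C x y f" and
      fe: "Cmp C x x y f e = f" and df: "Cmp C x y y d f = f"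
      unfolding karoubi_arr_iff[OF F.C.category_axioms] by auto
    have a: "arr C x x e" "arr C y y d" "x \<in> Obj C" "y \<in> Obj C" using x y by (simp_all add: idem_def arr_def)
    note u = counit_arr[OF a(3)] counit_arr[OF a(4)] note b = U.F_arr[OF F.F_arr[OF f]]
    have "Cmp C (Uo (Fo x)) x y f (Cmp C (Uo (Fo x)) x x e (\<epsilon> x)) = Cmp C (Uo (Fo x)) x y f (\<epsilon> x)"
      using C_asc[OF u(1) a(1) f] fe by simp
    also have "\<dots> = Cmp C (Uo (Fo x)) y y d (Cmp C (Uo (Fo x)) x y f (\<epsilon> x))"
      using C_asc[OF u(1) f a(2)] df by simp
    also have "\<dots> = Cmp C (Uo (Fo x)) (Uo (Fo y)) y (Cmp C (Uo (Fo y)) y y d (\<epsilon> y)) (Um (Fo x) (Fo y) (Fm x y f))"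
      unfolding counit_natural[OF f] by (rule C_asc[OF b u(2) a(2), symmetric])
    finally show "Cmp C (Uo (Fo x)) x y f (Cmp C (Uo (Fo x)) x x e (\<epsilon> x)) =
      Cmp C (Uo (Fo x)) (Uo (Fo y)) y (Cmp C (Uo (Fo y)) y y d (\<epsilon> y)) (Um (Fo x) (Fo y) (Fm x y f))" .
  qed
qed

section \<open>Products, pullbacks and images in regular categories\<close>

definition product :: "('o, 'a, 'r) cat_scheme \<Rightarrow> 'o \<Rightarrow> 'o \<Rightarrow> 'o \<Rightarrow> 'a \<Rightarrow> 'a \<Rightarrow> bool" where
  "product C x y p a b \<longleftrightarrow> x \<in> Obj C \<and> y \<in> Obj C \<and> is_product C x y p a b"

definition hprod :: "('o, 'a, 'r) cat_scheme \<Rightarrow> 'o \<Rightarrow> 'o \<Rightarrow> bool" where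
  "hprod C x y \<longleftrightarrow> x \<in> Obj C \<and> y \<in> Obj C \<and> has_product C x y"

definition bang :: "('o, 'a, 'r) cat_scheme \<Rightarrow> 'o \<Rightarrow> 'a" where
  "bang C x = (THE f. f \<in> Hom C x (terminal_of C))"

context category
begin

lemma pullback_chosen:
  assumes "has_pullback C x y z f g" "arr C x z f" "arr C y z g" "pullback_of C x y z f g = (p, u, v)"
  shows "pullback C x y z f g p u v"
proof -
  have "case pullback_of C x y z f g of (p, a, b) \<Rightarrow> is_pullback C x y z f g p a b"
    unfolding pullback_of_def by (rule someI_ex) (use assms(1) in \<open>auto simp: has_pullback_def\<close>)
  then show ?thesis using assms by (simp add: pullback_def)
qed

lemma has_pullbackI: "pullback C x y z f g p u v \<Longrightarrow> has_pullback C x y z f g"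
  unfolding pullback_def has_pullback_def by blast

lemma has_pullback_obtain:
  assumes "has_pullback C x y z f g" "arr C x z f" "arr C y z g"
  obtains p u v where "pullback C x y z f g p u v"
  using assms unfolding pullback_def has_pullback_def by blast

lemma product_chosen:
  assumes "hprod C x y"
  shows "product C x y (prd C x y) (pr1 C x y) (pr2 C x y)"
proof -
  have "case product_of C x y of (p, a, b) \<Rightarrow> is_product C x y p a b"
    unfolding product_of_def
    by (rule someI_ex) (use assms in \<open>auto simp: has_product_def hprod_def\<close>)
  then show ?thesis using assms by (simp add: hprod_def product_def prd_def pr1_def pr2_def case_prod_unfold)
qed

lemma pullback_identity: "arr C x y f \<Longrightarrow> pullback C x y y f (Idn C y) x (Idn C x) f"
proof (rule pullback_sym, rule pullback_isos)
  assume f: "arr C x y f"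
  then have "x \<in> Obj C" "y \<in> Obj C" by (auto simp: arr_def)
  then show "iso C y y (Idn C y)" "iso C x x (Idn C x)" "arr C x y f" "y \<in> Obj C" using f by (simp_all add: iso_id)
  show "Cmp C x y y (Idn C y) f = Cmp C x x y f (Idn C x)" using f by simp
qed

end

context regular_category
begin

lemma terminal_chosen: "terminal C (terminal_of C)"
  unfolding terminal_of_def by (rule someI_ex) (rule terminal_exists)

lemma terminal_obj: "terminal_of C \<in> Obj C"
  using terminal_chosen by (simp add: terminal_def)

lemma bang_arr: "x \<in> Obj C \<Longrightarrow> arr C x (terminal_of C) (bang C x)"
  using terminal_chosen theI'[of "\<lambda>f. f \<in> Hom C x (terminal_of C)"]
  unfolding bang_def arr_def terminal_def by blast

lemma terminal_ext: "arr C x (terminal_of C) f \<Longrightarrow> arr C x (terminal_of C) g \<Longrightarrow> f = g"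
  using terminal_chosen unfolding arr_def terminal_def by blast

text \<open>Any two morphisms to \<open>x\<close> and \<open>y\<close> from one object agree in the
  terminal object. Reading products as pullbacks subjects their existence to the completability
  axiom and passes on joint monicity and lifting.\<close>

lemma product_iff_pullback:
  "product C x y p a b \<longleftrightarrow> x \<in> Obj C \<and> y \<in> Obj C \<and> 
     pullback C x y (terminal_of C) (bang C x) (bang C y) p a b"
proof -
  have eq: "Cmp C w x (terminal_of C) (bang C x) u = Cmp C w y (terminal_of C) (bang C y) v"
    if "x \<in> Obj C" "y \<in> Obj C" "w \<in> Obj C" "u \<in> Hom C w x" "v \<in> Hom C w y" for w u v
    by (rule terminal_ext[OF arr_comp[OF _ bang_arr[OF that(1)]] arr_comp[OF _ bang_arr[OF that(2)]]])
      (use that in \<open>auto simp: arr_def\<close>)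
  show ?thesis
  proof (cases "x \<in> Obj C \<and> y \<in> Obj C")
    case True
    then have o: "x \<in> Obj C" "y \<in> Obj C" by auto
    show ?thesis
      unfolding product_def pullback_def is_product_def is_pullback_def
      using o eq[OF o] bang_arr[OF o(1)] bang_arr[OF o(2)]
      by (safe; blast)
  next
    case False then show ?thesis by (auto simp: product_def)
  qed
qed

lemma product_pullback:
  "product C x y p a b \<Longrightarrow> pullback C x y (terminal_of C) (bang C x) (bang C y) p a b"
  by (simp add: product_iff_pullback)

lemma product_arr:
  assumes "product C x y p a b"
  shows "arr C p x a" "arr C p y b"
  using pullback_arr[OF product_pullback[OF assms]] by auto

lemma product_jointly_monic: "product C x y p a b \<Longrightarrow> jointly_monic C x y p a b"
  by (rule pullback_jointly_monic[OF product_pullback])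

lemma product_lift:
  assumes "product C x y p a b" "arr C w x u" "arr C w y v"
  obtains h where "arr C w p h" "Cmp C w p x a h = u" "Cmp C w p y b h = v"
proof (rule pullback_lift[OF product_pullback[OF assms(1)] assms(2,3)])
  have "x \<in> Obj C" "y \<in> Obj C" using assms by (auto simp: arr_def)
  then show "Cmp C w x (terminal_of C) (bang C x) u = Cmp C w y (terminal_of C) (bang C y) v"
    using assms bang_arr by (intro terminal_ext[of w]) (blast intro: arr_comp)+
qed

lemma productI:
  assumes "jointly_monic C x y p a b"
    and "\<And>w u v. arr C w x u \<Longrightarrow> arr C w y v \<Longrightarrow> \<exists>h. arr C w p h \<and> Cmp C w p x a h = u \<and> Cmp C w p y b h = v"
  shows "product C x y p a b"
proof -
  note a = jointly_monic_arr[OF assms(1)]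
  have o: "x \<in> Obj C" "y \<in> Obj C" using a by (auto simp: arr_def)
  have "Cmp C p x (terminal_of C) (bang C x) a = Cmp C p y (terminal_of C) (bang C y) b"
    using a bang_arr o by (intro terminal_ext[of p]) (blast intro: arr_comp)+
  then show ?thesis unfolding product_iff_pullback using o
    by (intro conjI pullbackI bang_arr assms) auto
qed

text \<open>Completability turns the existence of a pullback into the existence of some cone. Cones
  are easily transported along morphisms, so the question whether a composite of spans vanishes is
  settled in this form.\<close>

lemma has_pullback_iff:
  assumes "arr C x z f" "arr C y z g"
  shows "has_pullback C x y z f g \<longleftrightarrow>
    (\<exists>w u v. arr C w x u \<and> arr C w y v \<and> Cmp C w x z f u = Cmp C w y z g v)"
proof
  assume "has_pullback C x y z f g"
  then obtain p u v where P: "pullback C x y z f g p u v" using has_pullback_obtain assms by blast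
  show "\<exists>w u v. arr C w x u \<and> arr C w y v \<and> Cmp C w x z f u = Cmp C w y z g v"
    by (intro exI conjI) (rule pullback_arr[OF P])+
next
  assume "\<exists>w u v. arr C w x u \<and> arr C w y v \<and> Cmp C w x z f u = Cmp C w y z g v"
  then obtain w u v where "arr C w x u" "arr C w y v" "Cmp C w x z f u = Cmp C w y z g v" by blast
  then show "has_pullback C x y z f g"
    using assms pullback_of_completable unfolding arr_def by blast
qed

text \<open>The two maps from \<open>w\<close> complete the cospan over the terminal object.\<close>

lemma hprodI: "arr C w x u \<Longrightarrow> arr C w y v \<Longrightarrow> hprod C x y"
proof -
  assume a: "arr C w x u" "arr C w y v"
  then have o: "x \<in> Obj C" "y \<in> Obj C" by (auto simp: arr_def)
  have "has_pullback C x y (terminal_of C) (bang C x) (bang C y)"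
    unfolding has_pullback_iff[OF bang_arr[OF o(1)] bang_arr[OF o(2)]]
    using a terminal_ext[OF arr_comp[OF a(1) bang_arr[OF o(1)]] arr_comp[OF a(2) bang_arr[OF o(2)]]] by blast
  then obtain p u v where "pullback C x y (terminal_of C) (bang C x) (bang C y) p u v"
    using has_pullback_obtain bang_arr o by blast
  then have "product C x y p u v" using o by (simp add: product_iff_pullback)
  then show ?thesis using o by (auto simp: product_def hprod_def has_product_def)
qed

lemma product_hprod: "product C x y p a b \<Longrightarrow> hprod C x y"
  using product_arr hprodI by blast

lemma hprod_obj:
  assumes "hprod C x y"
  shows "x \<in> Obj C" "y \<in> Obj C" "prd C x y \<in> Obj C"
  using product_arr(1)[OF product_chosen[OF assms]] assms by (auto simp: hprod_def arr_def)

lemma pr_arr: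
  assumes "hprod C x y"
  shows "arr C (prd C x y) x (pr1 C x y)" "arr C (prd C x y) y (pr2 C x y)"
  using product_arr[OF product_chosen[OF assms]] by auto

lemma pair_lift:
  assumes "arr C w x f" "arr C w y g"
  shows "arr C w (prd C x y) (pair C w x y f g)"
    "Cmp C w (prd C x y) x (pr1 C x y) (pair C w x y f g) = f"
    "Cmp C w (prd C x y) y (pr2 C x y) (pair C w x y f g) = g"
proof -
  note h = hprodI[OF assms] note P = product_chosen[OF h]
  obtain k where k: "arr C w (prd C x y) k" "Cmp C w (prd C x y) x (pr1 C x y) k = f"
    "Cmp C w (prd C x y) y (pr2 C x y) k = g"
    using product_lift[OF P assms] .
  \<comment> \<open>\<open>pair\<close> is a definite description; joint monicity of the chosen
    projections supplies the uniqueness it requires.\<close>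
  have "pair C w x y f g = k"
    unfolding pair_def
  proof (rule the_equality)
    show "k' = k" if "k' \<in> Hom C w (prd C x y) \<and> Cmp C w (prd C x y) x (pr1 C x y) k' = f \<and>
      Cmp C w (prd C x y) y (pr2 C x y) k' = g" for k'
      by (rule jointly_monicD[OF product_jointly_monic[OF P]]) (use that k in \<open>auto simp: arr_def\<close>)
  qed (use k in \<open>auto simp: arr_def\<close>)
  then show "arr C w (prd C x y) (pair C w x y f g)"
    "Cmp C w (prd C x y) x (pr1 C x y) (pair C w x y f g) = f"
    "Cmp C w (prd C x y) y (pr2 C x y) (pair C w x y f g) = g" using k by auto
qed

lemma prd_ext:
  assumes "hprod C x y" "arr C w (prd C x y) h" "arr C w (prd C x y) k"
    "Cmp C w (prd C x y) x (pr1 C x y) h = Cmp C w (prd C x y) x (pr1 C x y) k"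
    "Cmp C w (prd C x y) y (pr2 C x y) h = Cmp C w (prd C x y) y (pr2 C x y) k"
  shows "h = k"
  using jointly_monicD[OF product_jointly_monic[OF product_chosen[OF assms(1)]] assms(2-)] .

lemma pair_eqI:
  assumes "arr C w x f" "arr C w y g" "arr C w (prd C x y) h"
    "Cmp C w (prd C x y) x (pr1 C x y) h = f" "Cmp C w (prd C x y) y (pr2 C x y) h = g"
  shows "pair C w x y f g = h"
  by (rule prd_ext[OF hprodI[OF assms(1,2)] pair_lift(1)[OF assms(1,2)] assms(3)])
    (simp_all add: pair_lift[OF assms(1,2)] assms(4,5))

lemma pair_pr:
  assumes "hprod C x y" "arr C w (prd C x y) h"
  shows "pair C w x y (Cmp C w (prd C x y) x (pr1 C x y) h) (Cmp C w (prd C x y) y (pr2 C x y) h) = h"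
  using pr_arr[OF assms(1)] assms(2) by (intro pair_eqI) auto

lemma pair_comp:
  assumes "arr C w x f" "arr C w y g" "arr C v w k"
  shows "Cmp C v w (prd C x y) (pair C w x y f g) k = pair C v x y (Cmp C v w x f k) (Cmp C v w y g k)"
proof (rule pair_eqI[symmetric])
  note P = pr_arr[OF hprodI[OF assms(1,2)]] and Q = pair_lift[OF assms(1,2)]
  show "Cmp C v (prd C x y) x (pr1 C x y) (Cmp C v w (prd C x y) (pair C w x y f g) k) = Cmp C v w x f k"
    using comp_asc[OF assms(3) Q(1) P(1)] Q by simp
  show "Cmp C v (prd C x y) y (pr2 C x y) (Cmp C v w (prd C x y) (pair C w x y f g) k) = Cmp C v w y g k"
    using comp_asc[OF assms(3) Q(1) P(2)] Q by simp
qed (use assms pair_lift in auto)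

text \<open>Passes between subobjects of the chosen product, in which relations are formulated, and
  pairs of legs, in which the arguments run.\<close>

lemma monic_pair_iff:
  assumes "arr C p x a" "arr C p y b"
  shows "monic C p (prd C x y) (pair C p x y a b) \<longleftrightarrow> jointly_monic C x y p a b"
proof -
  note h = hprodI[OF assms] note o = hprod_obj[OF h] note P = pair_lift[OF assms]
  have p: "p \<in> Obj C" using assms by (auto simp: arr_def)
  have "Cmp C w p (prd C x y) (pair C p x y a b) g = Cmp C w p (prd C x y) (pair C p x y a b) k \<longleftrightarrow>
     Cmp C w p x a g = Cmp C w p x a k \<and> Cmp C w p y b g = Cmp C w p y b k"
    if "arr C w p g" "arr C w p k" for w g k
    using that pair_comp[OF assms that(1)] pair_comp[OF assms that(2)]
      pair_lift[OF arr_comp[OF that(1) assms(1)] arr_comp[OF that(1) assms(2)]]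
      pair_lift[OF arr_comp[OF that(2) assms(1)] arr_comp[OF that(2) assms(2)]] by metis
  then show ?thesis unfolding monic_iff[OF p o(3)] jointly_monic_def using assms P(1) by blast
qed

lemma image_chosen:
  assumes "arr C x y f" "image_of C x y f = (q, e, m)"
  shows "q \<in> Obj C" "epic C x q e" "monic C q y m" "Cmp C x q y m e = f"
proof -
  have "\<exists>t. case t of (q, e, m) \<Rightarrow> epi_mono C x y f q e m"
    using image_exists assms(1) by (auto simp: arr_def)
  then have "case image_of C x y f of (q, e, m) \<Rightarrow> epi_mono C x y f q e m"
    unfolding image_of_def by (rule someI_ex)
  then show "q \<in> Obj C" "epic C x q e" "monic C q y m" "Cmp C x q y m e = f"
    using assms by (auto simp: epi_mono_def)
qed

text \<open>Whether two spans have a zero composite depends only on their images. A cone over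
  \<open>p0\<close> need not lift to \<open>p\<close>, but it does after its apex has been replaced
  by a base change of \<open>e\<close>.\<close>

lemma has_pullback_epic:
  assumes "epic C p p0 e" "p \<in> Obj C" "arr C p0 y f" "arr C q y g"
  shows "has_pullback C p q y (Cmp C p p0 y f e) g \<longleftrightarrow> has_pullback C p0 q y f g"
proof -
  have p0: "p0 \<in> Obj C" using assms by (auto simp: arr_def)
  have e: "arr C p p0 e" using assms p0 by (simp add: epic_iff)
  show ?thesis
  proof
    assume "has_pullback C p q y (Cmp C p p0 y f e) g"
    then obtain w u v where "arr C w p u" "arr C w q v" "Cmp C w p y (Cmp C p p0 y f e) u = Cmp C w q y g v"
      using has_pullback_iff[of p y "Cmp C p p0 y f e" q g] e assms by auto
    then show "has_pullback C p0 q y f g"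
      unfolding has_pullback_iff[OF assms(3,4)] using comp_asc[of w p u p0 e y f] e assms arr_comp by metis
  next
    assume "has_pullback C p0 q y f g"
    then obtain W u v where W: "pullback C p0 q y f g W u v" using has_pullback_obtain assms by blast
    note A = pullback_arr[OF W]
    \<comment> \<open>Base change along an epimorphism always exists; its apex maps to
      \<open>p\<close> and to \<open>W\<close>, which yields the cone sought.\<close>
    have "has_pullback C p W p0 e u"
      using pullback_of_epi[of p W p0 e u] assms(1,2) p0 A by (auto simp: arr_def)
    then obtain V s t where V: "pullback C p W p0 e u V s t" using has_pullback_obtain e A by blast
    note B = pullback_arr[OF V]
    have "Cmp C V p y (Cmp C p p0 y f e) s = Cmp C V q y g (Cmp C V W q v t)"
      using comp_asc[OF B(3) e A(1)] B(5) comp_asc[OF B(4) A(3,1)] comp_asc[OF B(4) A(4,2)] A(5) by simp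
    then show "has_pullback C p q y (Cmp C p p0 y f e) g"
      using has_pullback_iff[of p y "Cmp C p p0 y f e" q g] e assms arr_comp[OF B(4) A(4)] B(3) by auto
  qed
qed

end

section \<open>Spans and relations\<close>

abbreviation scl :: "'k::field \<Rightarrow> ('x \<Rightarrow>\<^sub>0 'k) \<Rightarrow> ('x \<Rightarrow>\<^sub>0 'k)" where
  "scl c \<equiv> Poly_Mapping.map ((*) c)"

text \<open>
  The morphism of \<open>\<T>\<^sup>0\<close> represented by a span \<open>x \<leftarrow> p \<rightarrow> y\<close>. Morphisms represented by spans are
  composed by pullback, without passing to images.
\<close>

definition span_rel ::
  "('o, 'a, 'r) cat_scheme \<Rightarrow> ('o \<Rightarrow> 'o \<Rightarrow> 'a \<Rightarrow> 'k::field) \<Rightarrow> 'o \<Rightarrow> 'o \<Rightarrow> 'o \<Rightarrow> 'a \<Rightarrow> 'a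
    \<Rightarrow> ('o \<times> 'a) set \<Rightarrow>\<^sub>0 'k" where
  "span_rel C \<delta> x y p a b = (let (q, e, i) = image_of C p (prd C x y) (pair C p x y a b)
     in Poly_Mapping.single (subobj C (prd C x y) q i) (\<delta> p q e))"

lemma lookup_scl [simp]: "Poly_Mapping.lookup (scl c \<phi>) k = c * Poly_Mapping.lookup \<phi> k"
  by (simp add: Poly_Mapping.map.rep_eq when_def)

lemma scl_simps [simp]:
  "scl c (\<phi> + \<psi>) = scl c \<phi> + scl c \<psi>" "scl c 0 = 0" "scl 0 \<phi> = 0" "scl 1 \<phi> = \<phi>"
  "scl c (scl d \<phi>) = scl (c * d) \<phi>"
  by (auto intro!: poly_mapping_eqI simp: lookup_add algebra_simps)

lemma scl_add: "scl (c + d) \<phi> = scl c \<phi> + scl d \<phi>"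
  by (auto intro!: poly_mapping_eqI simp: lookup_add algebra_simps)

lemma scl_single [simp]: "scl c (Poly_Mapping.single k d) = Poly_Mapping.single k (c * d)"
  by (auto intro!: poly_mapping_eqI simp: lookup_single when_def)

lemma scl_sum: "scl c (\<Sum>i\<in>I. f i) = (\<Sum>i\<in>I. scl c (f i))"
  by (induction I rule: infinite_finite_induct) auto

lemma keys_scl: "Poly_Mapping.keys (scl c \<phi>) \<subseteq> Poly_Mapping.keys \<phi>"
  by (auto simp: in_keys_iff)

locale degree_category = regular_category C for C :: "('o, 'a, 'r) cat_scheme" +
  fixes \<delta> :: "'o \<Rightarrow> 'o \<Rightarrow> 'a \<Rightarrow> 'k::field"
  assumes degree: "degree_function C \<delta>"
begin

lemma degree_id: "x \<in> Obj C \<Longrightarrow> \<delta> x x (Idn C x) = 1"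
  using degree by (simp add: degree_function_def)

lemma degree_comp:
  "epic C x y e \<Longrightarrow> epic C y z e' \<Longrightarrow> x \<in> Obj C \<Longrightarrow> y \<in> Obj C \<Longrightarrow> z \<in> Obj C \<Longrightarrow>
    \<delta> x z (Cmp C x y z e' e) = \<delta> y z e' * \<delta> x y e"
  using degree unfolding degree_function_def by blast

lemma epic_pullback:
  assumes "pullback C x y z e g p a e'" "epic C x z e"
  shows "epic C p y e'" "\<delta> p y e' = \<delta> x z e"
proof -
  have o: "x \<in> Obj C" "y \<in> Obj C" "z \<in> Obj C" "g \<in> Hom C y z" "is_pullback C x y z e g p a e'"
    using assms(1) by (auto simp: pullback_def arr_def)
  then show "epic C p y e'" using epi_stable[OF _ _ _ assms(2)] by blast
  note 3 = degree[unfolded degree_function_def, THEN conjunct2, THEN conjunct2]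
  show "\<delta> p y e' = \<delta> x z e"
    by (rule 3[rule_format, OF _ _ _ _ assms(2)]) fact+
qed

text \<open>Multiplicativity alone would only make the degrees of \<open>f\<close> and of its
  inverse reciprocal; but \<open>f\<close> is also a base change of an identity.\<close>

lemma degree_iso:
  assumes "iso C x y f" "x \<in> Obj C" "y \<in> Obj C"
  shows "\<delta> x y f = 1"
proof -
  have f: "arr C x y f" using assms by (simp add: iso_iff)
  have "pullback C y y y (Idn C y) (Idn C y) x f f"
    by (rule pullback_isos) (use assms f in \<open>auto simp: iso_id\<close>)
  then show ?thesis using epic_pullback(2)[OF _ iso_epic[OF iso_id]] assms by (simp add: degree_id)
qed

text \<open>By cancellation in the pasting law the comparison map of the two pullbacks is a base
  change of \<open>e\<close>, hence epic of the same degree.\<close>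

lemma pullback_epic:
  assumes "pullback C p q y (Cmp C p p0 y f e) g W u v" "epic C p p0 e" "arr C p0 y f"
    "pullback C p0 q y f g W0 u0 v0"
  obtains h where "epic C W W0 h" "\<delta> W W0 h = \<delta> p p0 e" "Cmp C W W0 p0 u0 h = Cmp C W p p0 e u"
    "Cmp C W W0 q v0 h = v"
proof -
  note A = pullback_arr[OF assms(1)] and B = pullback_arr[OF assms(4)]
  have e: "arr C p p0 e" using assms(2) epic_iff[of p p0] A B by (auto simp: arr_def)
  obtain h where h: "arr C W W0 h" "Cmp C W W0 p0 u0 h = Cmp C W p p0 e u" "Cmp C W W0 q v0 h = v"
    by (rule pullback_lift[OF assms(4) arr_comp[OF A(3) e] A(4)]) (use A(5) comp_asc[OF A(3) e B(1)] in simp)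
  have "pullback C W0 p p0 u0 e W h u"
    by (rule pullback_cancel[OF pullback_sym[OF assms(4)] e h(1) A(3)])
      (use h pullback_sym[OF assms(1)] in auto)
  from epic_pullback[OF pullback_sym[OF this] assms(2)] show ?thesis using that h by blast
qed

text \<open>The two apexes are replaced one after the other, with \<open>V\<close> as the half-way
  pullback, and the degrees multiply.\<close>

lemma pullback_epic_epic:
  assumes "pullback C p q y (Cmp C p p0 y f e) (Cmp C q q0 y g e') W u v"
    "epic C p p0 e" "epic C q q0 e'" "arr C p0 y f" "arr C q0 y g" "pullback C p0 q0 y f g W0 u0 v0"
  obtains h where "epic C W W0 h" "\<delta> W W0 h = \<delta> p p0 e * \<delta> q q0 e'"
    "Cmp C W W0 p0 u0 h = Cmp C W p p0 e u" "Cmp C W W0 q0 v0 h = Cmp C W q q0 e' v"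
proof -
  note A = pullback_arr[OF assms(1)] and B = pullback_arr[OF assms(6)]
  have e: "arr C q q0 e'" using assms(3) epic_iff[of q q0] A B by (auto simp: arr_def)
  have "has_pullback C p0 q y f (Cmp C q q0 y g e')"
    using has_pullbackI[OF assms(1)] has_pullback_epic[OF assms(2) _ assms(4) A(2)] A by (simp add: arr_def)
  then obtain V s t where V: "pullback C p0 q y f (Cmp C q q0 y g e') V s t"
    using has_pullback_obtain assms(4) A(2) by blast
  note D = pullback_arr[OF V]
  obtain h where h: "epic C W V h" "\<delta> W V h = \<delta> p p0 e" "Cmp C W V p0 s h = Cmp C W p p0 e u"
    "Cmp C W V q t h = v" using pullback_epic[OF assms(1,2,4) V] .
  obtain k where k: "epic C V W0 k" "\<delta> V W0 k = \<delta> q q0 e'" "Cmp C V W0 q0 v0 k = Cmp C V q q0 e' t"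
    "Cmp C V W0 p0 u0 k = s" using pullback_epic[OF pullback_sym[OF V] assms(3,5) pullback_sym[OF assms(6)]] .
  have o: "W \<in> Obj C" "V \<in> Obj C" "W0 \<in> Obj C" using A B D by (auto simp: arr_def)
  have ha: "arr C W V h" "arr C V W0 k" using h(1) k(1) o by (auto simp: epic_iff)
  show ?thesis
  proof (rule that[of "Cmp C W V W0 k h"])
    show "epic C W W0 (Cmp C W V W0 k h)" using h(1) k(1) o by (rule epic_comp)
    show "\<delta> W W0 (Cmp C W V W0 k h) = \<delta> p p0 e * \<delta> q q0 e'" using degree_comp[OF h(1) k(1) o] h k by simp
    show "Cmp C W W0 p0 u0 (Cmp C W V W0 k h) = Cmp C W p p0 e u"
      using comp_asc[OF ha B(3)] h k by simp
    show "Cmp C W W0 q0 v0 (Cmp C W V W0 k h) = Cmp C W q q0 e' v"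
      using comp_asc[OF ha B(4)] comp_asc[OF ha(1) D(4) e] h k by simp
  qed
qed

lemma has_pullback_epic_epic:
  assumes "epic C p p0 e" "epic C q q0 e'" "p \<in> Obj C" "q \<in> Obj C" "arr C p0 y f" "arr C q0 y g"
  shows "has_pullback C p q y (Cmp C p p0 y f e) (Cmp C q q0 y g e') \<longleftrightarrow> has_pullback C p0 q0 y f g"
proof -
  have e: "arr C q q0 e'" using assms by (simp add: epic_iff arr_dom[OF assms(6)])
  have s: "has_pullback C x z y f g \<longleftrightarrow> has_pullback C z x y g f" if "arr C x y f" "arr C z y g" for x z f g
    using that has_pullback_iff[of x y f z g] has_pullback_iff[of z y g x f] by metis
  show ?thesis
    using has_pullback_epic[OF assms(1,3,5) arr_comp[OF e assms(6)]]
      has_pullback_epic[OF assms(2,4,6,5)] s[OF assms(5,6)] s[OF assms(5) arr_comp[OF e assms(6)]] by blast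
qed

section \<open>Subobjects and the relation represented by a span\<close>

lemma subobj_eq:
  assumes "iso C r s h" "r \<in> Obj C" "s \<in> Obj C" "arr C s z n"
  shows "subobj C z r (Cmp C r s z n h) = subobj C z s n"
proof -
  obtain g where g: "arr C r s h" "arr C s r g" "Cmp C r s r g h = Idn C r" "Cmp C s r s h g = Idn C s" "iso C s r g"
    by (rule isoE[OF assms(1-3)])
  have m: "arr C r z (Cmp C r s z n h)" using g assms by simp
  have n: "n = Cmp C s r z (Cmp C r s z n h) g"
    using comp_asc[OF g(2,1) assms(4)] g assms by simp
  \<comment> \<open>Composition with \<open>h\<close> and its inverse translates the witnesses, so
    the two classes have the same members.\<close>
  have "(\<exists>l. iso C r t l \<and> Cmp C r t z k l = Cmp C r s z n h) \<longleftrightarrow> (\<exists>l. iso C s t l \<and> Cmp C s t z k l = n)"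
    if t: "t \<in> Obj C" "monic C t z k" for t k
  proof (intro iffI; elim exE conjE)
    fix l assume l: "iso C r t l" "Cmp C r t z k l = Cmp C r s z n h"
    have a: "arr C r t l" "arr C t z k" using l(1) t assms arr_cod[OF assms(4)] by (auto simp: iso_iff monic_iff)
    show "\<exists>h. iso C s t h \<and> Cmp C s t z k h = n"
      by (rule exI[of _ "Cmp C s r t l g"])
        (use iso_comp[OF g(5) l(1)] comp_asc[OF g(2) a] n l t assms in simp)
  next
    fix l assume l: "iso C s t l" "Cmp C s t z k l = n"
    have a: "arr C s t l" "arr C t z k" using l(1) t assms arr_cod[OF assms(4)] by (auto simp: iso_iff monic_iff)
    show "\<exists>h'. iso C r t h' \<and> Cmp C r t z k h' = Cmp C r s z n h"
      by (rule exI[of _ "Cmp C r s t l h"])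
        (use iso_comp[OF assms(1) l(1)] comp_asc[OF g(1) a] l t assms in simp)
  qed
  then show ?thesis unfolding subobj_def by (intro Collect_cong) (auto split: prod.splits)
qed

lemma rep_subobj:
  assumes "monic C r z m" "r \<in> Obj C" "z \<in> Obj C" "rep (subobj C z r m) = (s, n)"
  obtains h where "s \<in> Obj C" "monic C s z n" "iso C r s h" "Cmp C r s z n h = m"
    "subobj C z s n = subobj C z r m"
proof -
  have m: "arr C r z m" using assms by (simp add: monic_iff)
  have "(r, m) \<in> subobj C z r m"
    using assms m iso_id[OF assms(2)] comp_id(2)[OF m] unfolding subobj_def by blast
  then have "rep (subobj C z r m) \<in> subobj C z r m" unfolding rep_def by (rule someI)
  then obtain h where h: "s \<in> Obj C" "monic C s z n" "iso C r s h" "Cmp C r s z n h = m"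
    using assms(4) unfolding subobj_def by auto
  have "arr C s z n" using h assms by (simp add: monic_iff)
  from subobj_eq[OF h(3) assms(2) h(1) this] have "subobj C z s n = subobj C z r m" using h(4) by simp
  then show ?thesis using that h by blast
qed

abbreviation "sp \<equiv> span_rel C \<delta>"

text \<open>Any epi-mono factorization may take the place of the chosen image: two of them differ by
  an isomorphism, which changes neither the subobject nor, having degree 1, the coefficient.\<close>

lemma span_rel_eq:
  assumes "jointly_monic C x y r a b" "epic C p r e" "p \<in> Obj C"
  shows "sp x y p (Cmp C p r x a e) (Cmp C p r y b e)
    = Poly_Mapping.single (subobj C (prd C x y) r (pair C r x y a b)) (\<delta> p r e)"
proof -
  note a = jointly_monic_arr[OF assms(1)]
  have r: "r \<in> Obj C" using a by (simp add: arr_def)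
  have e: "arr C p r e" using assms r by (simp add: epic_iff)
  let ?f = "pair C p x y (Cmp C p r x a e) (Cmp C p r y b e)"
  have f: "arr C p (prd C x y) ?f" using a e by (intro pair_lift) auto
  have m: "monic C r (prd C x y) (pair C r x y a b)" using assms a by (simp add: monic_pair_iff)
  have fe: "Cmp C p r (prd C x y) (pair C r x y a b) e = ?f" using pair_comp[OF a e] .
  obtain q e0 i where q: "image_of C p (prd C x y) ?f = (q, e0, i)" by (metis prod_cases3)
  note Q = image_chosen[OF f q]
  note o = hprod_obj[OF hprodI[OF a]]
  have "epi_mono C p (prd C x y) ?f r e (pair C r x y a b)" "epi_mono C p (prd C x y) ?f q e0 i"
    using Q assms m fe r by (auto simp: epi_mono_def)
  from image_unique[OF _ _ _ this] f
  obtain h where h: "iso C r q h" "Cmp C p r q h e = e0" "Cmp C r q (prd C x y) i h = pair C r x y a b"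
    by (auto simp: arr_def)
  have "arr C q (prd C x y) i" using Q o by (simp add: monic_iff)
  from subobj_eq[OF h(1) r Q(1) this]
  have "subobj C (prd C x y) q i = subobj C (prd C x y) r (pair C r x y a b)" using h(3) by simp
  moreover have "\<delta> p q e0 = \<delta> p r e"
    using degree_comp[OF assms(2) iso_epic[OF h(1) r Q(1)] assms(3) r Q(1)] degree_iso[OF h(1) r Q(1)] h(2) by simp
  ultimately show ?thesis by (simp add: span_rel_def q)
qed

lemma span_rel_jointly_monic:
  assumes "jointly_monic C x y p a b"
  shows "sp x y p a b = Poly_Mapping.single (subobj C (prd C x y) p (pair C p x y a b)) 1"
proof -
  note a = jointly_monic_arr[OF assms]
  have p: "p \<in> Obj C" using a by (simp add: arr_def)
  show ?thesis using span_rel_eq[OF assms iso_epic[OF iso_id] p] a p by (simp add: degree_id)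
qed

text \<open>Composition, tensor product and induced functors act on the representative picked by
  \<open>rep\<close>. The isomorphism from the image to it is absorbed into \<open>e\<close> at no
  cost in degree.\<close>

lemma span_rel_rep:
  assumes "arr C p x a" "arr C p y b"
  obtains R r m e where "R \<in> Rel C x y" "rep R = (r, m)" "arr C r (prd C x y) m" "epic C p r e"
    "arr C p r e" "Cmp C p r (prd C x y) m e = pair C p x y a b"
    "sp x y p a b = Poly_Mapping.single R (\<delta> p r e)"
    "jointly_monic C x y r (Cmp C r (prd C x y) x (pr1 C x y) m) (Cmp C r (prd C x y) y (pr2 C x y) m)"
proof -
  note h = hprodI[OF assms] note o = hprod_obj[OF h] note f = pair_lift[OF assms]
  have p: "p \<in> Obj C" using assms by (simp add: arr_def)
  obtain q e0 i where q: "image_of C p (prd C x y) (pair C p x y a b) = (q, e0, i)" by (metis prod_cases3)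
  note Q = image_chosen[OF f(1) q]
  let ?R = "subobj C (prd C x y) q i"
  obtain r m where rm: "rep ?R = (r, m)" by (metis prod.exhaust)
  obtain g where g: "r \<in> Obj C" "monic C r (prd C x y) m" "iso C q r g" "Cmp C q r (prd C x y) m g = i"
    by (rule rep_subobj[OF Q(3,1) o(3) rm])
  have a: "arr C p q e0" "arr C q r g" "arr C r (prd C x y) m"
    using Q g p o by (auto simp: epic_iff iso_iff monic_iff)
  show ?thesis
  proof (rule that[of ?R r m "Cmp C p q r g e0"])
    show "?R \<in> Rel C x y" using Q h by (auto simp: Rel_def Subobj_def hprod_def)
    show "epic C p r (Cmp C p q r g e0)" by (rule epic_comp) (use Q g p iso_epic in auto)
    show "Cmp C p r (prd C x y) m (Cmp C p q r g e0) = pair C p x y a b"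
      using comp_asc[OF a] g Q by simp
    show "sp x y p a b = Poly_Mapping.single ?R (\<delta> p r (Cmp C p q r g e0))"
      using degree_comp[OF Q(2) iso_epic[OF g(3) Q(1) g(1)] p Q(1) g(1)] degree_iso[OF g(3) Q(1) g(1)]
      by (simp add: span_rel_def q)
    have "monic C r (prd C x y) (pair C r x y (Cmp C r (prd C x y) x (pr1 C x y) m) (Cmp C r (prd C x y) y (pr2 C x y) m))"
      using pair_pr[OF h a(3)] g(2) by simp
    then show "jointly_monic C x y r (Cmp C r (prd C x y) x (pr1 C x y) m) (Cmp C r (prd C x y) y (pr2 C x y) m)"
      using monic_pair_iff arr_comp[OF a(3)] pr_arr[OF h] by blast
  qed (use rm a in auto)
qed

text \<open>Composing the image projection of \<open>p\<close> with \<open>e\<close> factors the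
  larger span through the same relation, and degrees are multiplicative.\<close>

lemma span_rel_epic:
  assumes "arr C p x a" "arr C p y b" "epic C p' p e" "p' \<in> Obj C"
  shows "sp x y p' (Cmp C p' p x a e) (Cmp C p' p y b e) = scl (\<delta> p' p e) (sp x y p a b)"
proof -
  have p: "p \<in> Obj C" using assms by (simp add: arr_def)
  have e: "arr C p' p e" using assms p by (simp add: epic_iff)
  obtain R r m e0 where R: "rep R = (r, m)" "arr C r (prd C x y) m" "epic C p r e0"
    "arr C p r e0" "Cmp C p r (prd C x y) m e0 = pair C p x y a b"
    "sp x y p a b = Poly_Mapping.single R (\<delta> p r e0)"
    and jm: "jointly_monic C x y r (Cmp C r (prd C x y) x (pr1 C x y) m) (Cmp C r (prd C x y) y (pr2 C x y) m)"
    by (rule span_rel_rep[OF assms(1,2)])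
  have r: "r \<in> Obj C" using R by (simp add: arr_def)
  note P = pr_arr[OF hprodI[OF assms(1,2)]] note Q = pair_lift[OF assms(1,2)]
  let ?a = "Cmp C r (prd C x y) x (pr1 C x y) m" and ?b = "Cmp C r (prd C x y) y (pr2 C x y) m"
  have ab: "Cmp C p r x ?a e0 = a" "Cmp C p r y ?b e0 = b"
    using comp_asc[OF R(4,2) P(1)] comp_asc[OF R(4,2) P(2)] R(5) Q by auto
  note J = jointly_monic_arr[OF jm]
  have "sp x y p' (Cmp C p' p x a e) (Cmp C p' p y b e)
    = sp x y p' (Cmp C p' r x ?a (Cmp C p' p r e0 e)) (Cmp C p' r y ?b (Cmp C p' p r e0 e))"
    using comp_asc[OF e R(4) J(1)] comp_asc[OF e R(4) J(2)] ab by simp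
  also have "\<dots> = Poly_Mapping.single (subobj C (prd C x y) r (pair C r x y ?a ?b)) (\<delta> p' r (Cmp C p' p r e0 e))"
    by (rule span_rel_eq[OF jm epic_comp[OF assms(3) R(3) assms(4) p r] assms(4)])
  also have "\<dots> = scl (\<delta> p' p e) (Poly_Mapping.single (subobj C (prd C x y) r (pair C r x y ?a ?b)) (\<delta> p r e0))"
    using degree_comp[OF assms(3) R(3) assms(4) p r] by (simp add: mult.commute)
  also have "Poly_Mapping.single (subobj C (prd C x y) r (pair C r x y ?a ?b)) (\<delta> p r e0) = sp x y p a b"
    using span_rel_eq[OF jm R(3) p] ab by simp
  finally show ?thesis .
qed

end

section \<open>The category of relations\<close>

definition klinear :: "(('x \<Rightarrow>\<^sub>0 'k::field) \<Rightarrow> ('y \<Rightarrow>\<^sub>0 'k)) \<Rightarrow> bool" where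
  "klinear L \<longleftrightarrow> (\<forall>\<phi> \<psi>. L (\<phi> + \<psi>) = L \<phi> + L \<psi>) \<and> (\<forall>c \<phi>. L (scl c \<phi>) = scl c (L \<phi>))"

text \<open>Composition, tensor product and induced functor on \<open>T0\<close> are all extensions
  of this kind, which makes linearity available in each argument.\<close>

definition lin_ext :: "('x \<Rightarrow> 'y \<Rightarrow>\<^sub>0 'k::field) \<Rightarrow> ('x \<Rightarrow>\<^sub>0 'k) \<Rightarrow> ('y \<Rightarrow>\<^sub>0 'k)" where
  "lin_ext K \<phi> = (\<Sum>R \<in> Poly_Mapping.keys \<phi>. scl (Poly_Mapping.lookup \<phi> R) (K R))"

lemma klinearD:
  assumes "klinear L"
  shows "L (\<phi> + \<psi>) = L \<phi> + L \<psi>" "L (scl c \<phi>) = scl c (L \<phi>)" "L 0 = 0"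
proof -
  show "L (\<phi> + \<psi>) = L \<phi> + L \<psi>" and s: "L (scl c \<phi>) = scl c (L \<phi>)" for c \<phi>
    using assms by (auto simp: klinear_def)
  show "L 0 = 0" using s[of 0 0] by simp
qed

lemma klinear_sum: "klinear L \<Longrightarrow> L (\<Sum>i\<in>I. f i) = (\<Sum>i\<in>I. L (f i))"
  by (induction I rule: infinite_finite_induct) (simp_all add: klinearD)

lemma klinear_ident: "klinear (\<lambda>\<phi>. \<phi>)"
  by (simp add: klinear_def)

lemma klinear_comp: "klinear L \<Longrightarrow> klinear M \<Longrightarrow> klinear (\<lambda>\<phi>. L (M \<phi>))"
  by (simp add: klinear_def)

text \<open>The support of a sum can be smaller than the union of the supports. Summing over a fixed
  finite superset makes extensions comparable.\<close>

lemma lin_ext_superset: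
  assumes "finite A" "Poly_Mapping.keys \<phi> \<subseteq> A"
  shows "lin_ext K \<phi> = (\<Sum>R\<in>A. scl (Poly_Mapping.lookup \<phi> R) (K R))"
  unfolding lin_ext_def by (rule sum.mono_neutral_left) (use assms in \<open>auto simp: in_keys_iff\<close>)

lemma klinear_lin_ext:
  fixes K :: "'x \<Rightarrow> 'y \<Rightarrow>\<^sub>0 'k::field"
  shows "klinear (lin_ext K)"
  unfolding klinear_def
proof (intro conjI allI)
  fix \<phi> \<psi> :: "'x \<Rightarrow>\<^sub>0 'k"
  let ?A = "Poly_Mapping.keys \<phi> \<union> Poly_Mapping.keys \<psi>"
  have "lin_ext K (\<phi> + \<psi>) = (\<Sum>R\<in>?A. scl (Poly_Mapping.lookup (\<phi> + \<psi>) R) (K R))"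
    by (rule lin_ext_superset) (simp_all add: Poly_Mapping.keys_add)
  then show "lin_ext K (\<phi> + \<psi>) = lin_ext K \<phi> + lin_ext K \<psi>"
    by (simp add: lin_ext_superset[of ?A] lookup_add scl_add sum.distrib)
next
  fix c and \<phi> :: "'x \<Rightarrow>\<^sub>0 'k"
  have "lin_ext K (scl c \<phi>) = (\<Sum>R\<in>Poly_Mapping.keys \<phi>. scl (Poly_Mapping.lookup (scl c \<phi>) R) (K R))"
    by (rule lin_ext_superset) (auto intro: set_mp[OF keys_scl])
  then show "lin_ext K (scl c \<phi>) = scl c (lin_ext K \<phi>)" by (simp add: lin_ext_def scl_sum)
qed

lemma klinear_lin_ext_param: "(\<And>R. klinear (\<lambda>\<psi>. M R \<psi>)) \<Longrightarrow> klinear (\<lambda>\<psi>. lin_ext (\<lambda>R. M R \<psi>) \<phi>)"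
  by (simp add: klinear_def lin_ext_def sum.distrib scl_sum mult.commute)

lemma lin_ext_single [simp]: "lin_ext K (Poly_Mapping.single R c) = scl c (K R)"
  by (subst lin_ext_superset[of "{R}"]) auto

lemma lin_ext_singles: "lin_ext (\<lambda>R. Poly_Mapping.single R 1) \<phi> = \<phi>"
  by (rule poly_mapping_eqI)
    (simp add: lin_ext_def lookup_sum lookup_single when_def in_keys_iff sum.delta' flip: sum.delta_remove)

lemma klinear_eq_lin_ext:
  assumes "klinear L"
  shows "L \<phi> = lin_ext (\<lambda>R. L (Poly_Mapping.single R 1)) \<phi>"
proof -
  have "L \<phi> = L (\<Sum>R\<in>Poly_Mapping.keys \<phi>. scl (Poly_Mapping.lookup \<phi> R) (Poly_Mapping.single R 1))"
    using lin_ext_singles[of \<phi>] by (simp add: lin_ext_def)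
  also have "\<dots> = lin_ext (\<lambda>R. L (Poly_Mapping.single R 1)) \<phi>"
    unfolding klinear_sum[OF assms] klinearD(2)[OF assms] lin_ext_def ..
  finally show ?thesis .
qed

lemma T0_simps [simp]:
  "Obj (T0 C \<delta>) = Obj C" "Scl (T0 C \<delta>) c = scl c" "Idn (T0 C \<delta>) x = graph_rel C x x (Idn C x)"
  by (simp_all add: T0_def)

lemma T0_arr_iff: "arr (T0 C \<delta>) x y \<phi> \<longleftrightarrow> x \<in> Obj C \<and> y \<in> Obj C \<and> Poly_Mapping.keys \<phi> \<subseteq> Rel C x y"
  by (simp add: arr_def T0_def)

lemma T0_comp_eq:
  "Cmp (T0 C \<delta>) x y z \<psi> \<phi> = lin_ext (\<lambda>R. lin_ext (\<lambda>S. rel_comp C \<delta> x y z S R) \<psi>) \<phi>"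
  by (simp add: T0_def lin_ext_def scl_sum mult.commute)

lemma klinear_T0_comp:
  "klinear (\<lambda>\<phi>. Cmp (T0 C \<delta>) x y z \<psi> \<phi>)" "klinear (\<lambda>\<psi>. Cmp (T0 C \<delta>) x y z \<psi> \<phi>)"
  unfolding T0_comp_eq by (rule klinear_lin_ext klinear_lin_ext_param)+

lemmas T0_comp_linear = klinearD[OF klinear_T0_comp(1)] klinearD[OF klinear_T0_comp(2)]

lemma klinear_T0_compI:
  assumes "klinear L"
  shows "klinear (\<lambda>\<phi>. Cmp (T0 C \<delta>) x y z \<psi> (L \<phi>))" "klinear (\<lambda>\<phi>. Cmp (T0 C \<delta>) x y z (L \<phi>) \<psi>)"
  by (rule klinear_comp[OF klinear_T0_comp(1) assms] klinear_comp[OF klinear_T0_comp(2) assms])+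

context degree_category
begin

lemma span_rel_arr: "arr C p x a \<Longrightarrow> arr C p y b \<Longrightarrow> arr (T0 C \<delta>) x y (sp x y p a b)"
proof -
  assume a: "arr C p x a" "arr C p y b"
  obtain R d where "R \<in> Rel C x y" "sp x y p a b = Poly_Mapping.single R d"
    using span_rel_rep[OF a] by metis
  moreover have "x \<in> Obj C" "y \<in> Obj C" using a by (auto simp: arr_def)
  ultimately show ?thesis by (simp add: T0_arr_iff)
qed

lemma rel_span:
  assumes "R \<in> Rel C x y" "x \<in> Obj C" "y \<in> Obj C"
  obtains p a b where "arr C p x a" "arr C p y b" "sp x y p a b = Poly_Mapping.single R 1"
proof -
  obtain r m where m: "r \<in> Obj C" "monic C r (prd C x y) m" "R = subobj C (prd C x y) r m"
    and h: "hprod C x y" using assms by (auto simp: Rel_def Subobj_def hprod_def split: if_splits)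
  let ?a = "Cmp C r (prd C x y) x (pr1 C x y) m" and ?b = "Cmp C r (prd C x y) y (pr2 C x y) m"
  have ma: "arr C r (prd C x y) m" using m hprod_obj[OF h] by (simp add: monic_iff)
  have ab: "arr C r x ?a" "arr C r y ?b" using ma pr_arr[OF h] by auto
  have "sp x y r ?a ?b = Poly_Mapping.single R 1"
    using span_rel_jointly_monic[of x y r ?a ?b] monic_pair_iff[OF ab] pair_pr[OF h ma] m by simp
  then show ?thesis using that ab by blast
qed

text \<open>Each relation is represented by some span with coefficient 1, so spans generate the
  hom-space and identities between linear maps may be tested on them.\<close>

lemma T0_eqI:
  assumes "klinear L" "klinear L'" "arr (T0 C \<delta>) x y \<phi>"
    "\<And>p a b. arr C p x a \<Longrightarrow> arr C p y b \<Longrightarrow> L (sp x y p a b) = L' (sp x y p a b)"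
  shows "L \<phi> = L' \<phi>"
proof -
  have "L (Poly_Mapping.single R 1) = L' (Poly_Mapping.single R 1)" if "R \<in> Poly_Mapping.keys \<phi>" for R
  proof -
    have R: "R \<in> Rel C x y" "x \<in> Obj C" "y \<in> Obj C" using assms(3) that by (auto simp: T0_arr_iff)
    obtain p a b where "arr C p x a" "arr C p y b" "sp x y p a b = Poly_Mapping.single R 1"
      by (rule rel_span[OF R])
    then show ?thesis using assms(4)[of p a b] by simp
  qed
  then show ?thesis
    unfolding klinear_eq_lin_ext[OF assms(1), of \<phi>] klinear_eq_lin_ext[OF assms(2), of \<phi>] lin_ext_def by simp
qed

text \<open>The same generation argument for typing. The target may lie in another category of
  relations, so that induced functors are covered as well.\<close>

lemma T0_arrI:
  assumes "klinear L" "arr (T0 C \<delta>) x y \<phi>" "x' \<in> Obj D" "y' \<in> Obj D"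
    "\<And>p a b. arr C p x a \<Longrightarrow> arr C p y b \<Longrightarrow> arr (T0 D \<delta>') x' y' (L (sp x y p a b))"
  shows "arr (T0 D \<delta>') x' y' (L \<phi>)"
proof -
  have "arr (T0 D \<delta>') x' y' (L (Poly_Mapping.single R 1))" if "R \<in> Poly_Mapping.keys \<phi>" for R
  proof -
    have R: "R \<in> Rel C x y" "x \<in> Obj C" "y \<in> Obj C" using assms(2) that by (auto simp: T0_arr_iff)
    obtain p a b where "arr C p x a" "arr C p y b" "sp x y p a b = Poly_Mapping.single R 1"
      by (rule rel_span[OF R])
    then show ?thesis using assms(5)[of p a b] by simp
  qed
  moreover have "Poly_Mapping.keys (lin_ext (\<lambda>R. L (Poly_Mapping.single R 1)) \<phi>)
    \<subseteq> (\<Union>R\<in>Poly_Mapping.keys \<phi>. Poly_Mapping.keys (L (Poly_Mapping.single R 1)))"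
    unfolding lin_ext_def by (rule subset_trans[OF Poly_Mapping.keys_sum]) (rule UN_mono[OF subset_refl keys_scl])
  ultimately show ?thesis
    unfolding klinear_eq_lin_ext[OF assms(1), of \<phi>] T0_arr_iff using assms(3,4)
    by (intro conjI) (assumption | rule subset_trans, assumption, blast)+
qed

section \<open>Composition of relations by pullback of spans\<close>

lemma rel_comp_rep:
  fixes x y z
  assumes "rep R = (r, m)" "rep S = (s, n)"
  defines "r1 \<equiv> Cmp C r (prd C x y) x (pr1 C x y) m" and "r2 \<equiv> Cmp C r (prd C x y) y (pr2 C x y) m"
    and "s1 \<equiv> Cmp C s (prd C y z) y (pr1 C y z) n" and "s2 \<equiv> Cmp C s (prd C y z) z (pr2 C y z) n"
  shows "rel_comp C \<delta> x y z S R = (if has_pullback C r s y r2 s1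
    then (case pullback_of C r s y r2 s1 of (p, u, v) \<Rightarrow> sp x z p (Cmp C p r x r1 u) (Cmp C p s z s2 v)) else 0)"
  by (simp add: rel_comp_def Let_def assms span_rel_def case_prod_unfold)

text \<open>On the left the two factors contribute their degrees over their images. On the right the
  comparison of the pullback of spans with the pullback of images is epic with exactly the product
  of these degrees, so \<open>span_rel_epic\<close> produces the same scalar.\<close>

lemma
  assumes a: "arr C p x a" "arr C p y b" "arr C q y c" "arr C q z d"
  shows T0_comp_span: "pullback C p q y b c w u v \<Longrightarrow>
      Cmp (T0 C \<delta>) x y z (sp y z q c d) (sp x y p a b) = sp x z w (Cmp C w p x a u) (Cmp C w q z d v)"
    and T0_comp_span_zero: "\<not> has_pullback C p q y b c \<Longrightarrow>
      Cmp (T0 C \<delta>) x y z (sp y z q c d) (sp x y p a b) = 0"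
proof -
  obtain R r m e where R: "rep R = (r, m)" "arr C r (prd C x y) m" "epic C p r e"
    "arr C p r e" "Cmp C p r (prd C x y) m e = pair C p x y a b"
    "sp x y p a b = Poly_Mapping.single R (\<delta> p r e)"
    by (rule span_rel_rep[OF a(1,2)])
  obtain S s n e' where S: "rep S = (s, n)" "arr C s (prd C y z) n" "epic C q s e'"
    "arr C q s e'" "Cmp C q s (prd C y z) n e' = pair C q y z c d"
    "sp y z q c d = Poly_Mapping.single S (\<delta> q s e')"
    by (rule span_rel_rep[OF a(3,4)])
  note P = pr_arr[OF hprodI[OF a(1,2)]] pr_arr[OF hprodI[OF a(3,4)]]
  note Q = pair_lift[OF a(1,2)] pair_lift[OF a(3,4)]
  define r1 where "r1 = Cmp C r (prd C x y) x (pr1 C x y) m"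
  define r2 where "r2 = Cmp C r (prd C x y) y (pr2 C x y) m"
  define s1 where "s1 = Cmp C s (prd C y z) y (pr1 C y z) n"
  define s2 where "s2 = Cmp C s (prd C y z) z (pr2 C y z) n"
  have l: "arr C r x r1" "arr C r y r2" "arr C s y s1" "arr C s z s2"
    using R S P unfolding r1_def r2_def s1_def s2_def by (auto intro: arr_comp)
  have e: "Cmp C p r x r1 e = a" "Cmp C p r y r2 e = b" "Cmp C q s y s1 e' = c" "Cmp C q s z s2 e' = d"
    unfolding r1_def r2_def s1_def s2_def
    using comp_asc[OF R(4,2) P(1)] comp_asc[OF R(4,2) P(2)] comp_asc[OF S(4,2) P(3)] comp_asc[OF S(4,2) P(4)]
      R(5) S(5) Q by auto
  have o: "p \<in> Obj C" "q \<in> Obj C" using a by (auto simp: arr_def)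
  have hp: "has_pullback C p q y b c \<longleftrightarrow> has_pullback C r s y r2 s1"
    using has_pullback_epic_epic[OF R(3) S(3) o l(2,3)] e by simp
  have comp: "Cmp (T0 C \<delta>) x y z (sp y z q c d) (sp x y p a b)
    = scl (\<delta> p r e * \<delta> q s e') (rel_comp C \<delta> x y z S R)"
    by (simp add: T0_comp_eq R(6) S(6))
  note rc = rel_comp_rep[OF R(1) S(1), of x y z, folded r1_def r2_def s1_def s2_def]
  show "Cmp (T0 C \<delta>) x y z (sp y z q c d) (sp x y p a b) = 0" if "\<not> has_pullback C p q y b c"
    using that by (simp add: comp hp rc)
  show "Cmp (T0 C \<delta>) x y z (sp y z q c d) (sp x y p a b) = sp x z w (Cmp C w p x a u) (Cmp C w q z d v)"
    if W: "pullback C p q y b c w u v"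
  proof -
    note A = pullback_arr[OF W]
    have h: "has_pullback C r s y r2 s1" using has_pullbackI[OF W] hp by simp
    obtain W0 u0 v0 where W0: "pullback_of C r s y r2 s1 = (W0, u0, v0)" by (metis prod_cases3)
    note W0p = pullback_chosen[OF h l(2,3) W0] note B = pullback_arr[OF W0p]
    obtain k where k: "epic C w W0 k" "\<delta> w W0 k = \<delta> p r e * \<delta> q s e'"
      "Cmp C w W0 r u0 k = Cmp C w p r e u" "Cmp C w W0 s v0 k = Cmp C w q s e' v"
      by (rule pullback_epic_epic[OF _ R(3) S(3) l(2,3) W0p, of w u v]) (use W e in auto)
    have w: "w \<in> Obj C" "W0 \<in> Obj C" using A B by (auto simp: arr_def)
    have ka: "arr C w W0 k" using k w by (simp add: epic_iff)
    have "sp x z w (Cmp C w W0 x (Cmp C W0 r x r1 u0) k) (Cmp C w W0 z (Cmp C W0 s z s2 v0) k)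
      = scl (\<delta> w W0 k) (sp x z W0 (Cmp C W0 r x r1 u0) (Cmp C W0 s z s2 v0))"
      by (rule span_rel_epic[OF _ _ k(1) w(1)]) (use B l in auto)
    moreover have "Cmp C w W0 x (Cmp C W0 r x r1 u0) k = Cmp C w p x a u"
      using comp_asc[OF ka B(3) l(1)] comp_asc[OF A(3) R(4) l(1)] k e by simp
    moreover have "Cmp C w W0 z (Cmp C W0 s z s2 v0) k = Cmp C w q z d v"
      using comp_asc[OF ka B(4) l(4)] comp_asc[OF A(4) S(4) l(4)] k e by simp
    ultimately show ?thesis by (simp add: comp rc h W0 k(2))
  qed
qed

text \<open>A graph is jointly monic through its identity leg, hence equal to its own image.\<close>

lemma graph_rel_span: "arr C x y f \<Longrightarrow> graph_rel C x y f = sp x y x (Idn C x) f"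
proof -
  assume f: "arr C x y f"
  then have x: "x \<in> Obj C" by (simp add: arr_def)
  have "jointly_monic C x y x (Idn C x) f"
    unfolding jointly_monic_def using f x comp_id(1) by auto
  then show ?thesis by (simp add: span_rel_jointly_monic graph_rel_def)
qed

lemma graph_rel_arr: "arr C x y f \<Longrightarrow> arr (T0 C \<delta>) x y (graph_rel C x y f)"
  using graph_rel_span span_rel_arr arr_id[OF arr_dom] by metis

lemma T0_comp_graph_span:
  assumes "arr C p x a" "arr C p y b" "arr C y z g"
  shows "Cmp (T0 C \<delta>) x y z (graph_rel C y z g) (sp x y p a b) = sp x z p a (Cmp C p y z g b)"
proof -
  have "y \<in> Obj C" using assms by (simp add: arr_def)
  then show ?thesis unfolding graph_rel_span[OF assms(3)]
    using T0_comp_span[OF assms(1,2) arr_id assms(3) pullback_identity[OF assms(2)]] assms by simp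
qed

lemma T0_comp_span_graph:
  assumes "arr C x y f" "arr C q y c" "arr C q z d" "pullback C x q y f c w u v"
  shows "Cmp (T0 C \<delta>) x y z (sp y z q c d) (graph_rel C x y f) = sp x z w u (Cmp C w q z d v)"
proof -
  have "x \<in> Obj C" using assms by (simp add: arr_def)
  then show ?thesis unfolding graph_rel_span[OF assms(1)]
    using T0_comp_span[OF arr_id assms(1,2,3,4)] pullback_arr[OF assms(4)] by simp
qed

lemma T0_comp_graph:
  assumes "arr C x y f" "arr C y z g"
  shows "Cmp (T0 C \<delta>) x y z (graph_rel C y z g) (graph_rel C x y f) = graph_rel C x z (Cmp C x y z g f)"
  using T0_comp_graph_span[OF arr_id assms] assms arr_dom[OF assms(1)]
  by (simp add: graph_rel_span)

text \<open>The left side replaces the leg \<open>b\<close> by \<open>g b\<close>; the right side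
  has as apex the pullback of \<open>a'\<close> along \<open>f\<close>. The pullback hypothesis
  makes \<open>p\<close> that apex, so both sides are the same span.\<close>

lemma T0_natural:
  assumes "arr C x x' f" "arr C y y' g" "arr C p y b" "arr C p' y' b'"
    and "pullback C x p' x' f a' p a h" "Cmp C p y y' g b = Cmp C p p' y' b' h"
  shows "Cmp (T0 C \<delta>) x y y' (graph_rel C y y' g) (sp x y p a b)
    = Cmp (T0 C \<delta>) x x' y' (sp x' y' p' a' b') (graph_rel C x x' f)"
  using T0_comp_graph_span[OF pullback_arr(3)[OF assms(5)] assms(3,2)]
    T0_comp_span_graph[OF assms(1) pullback_arr(2)[OF assms(5)] assms(4,5)] assms(6) by simp

text \<open>With \<open>f\<close> and \<open>h\<close> invertible the pullback condition is
  automatic, so commuting squares suffice.\<close>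

lemma T0_natural_iso:
  assumes "iso C x x' f" "iso C p p' h" "x \<in> Obj C" "arr C y y' g" "arr C p x a" "arr C p y b"
    "arr C p' x' a'" "arr C p' y' b'"
    and "Cmp C p x x' f a = Cmp C p p' x' a' h" "Cmp C p y y' g b = Cmp C p p' y' b' h"
  shows "Cmp (T0 C \<delta>) x y y' (graph_rel C y y' g) (sp x y p a b)
    = Cmp (T0 C \<delta>) x x' y' (sp x' y' p' a' b') (graph_rel C x x' f)"
proof (rule T0_natural[OF _ assms(4,6,8)])
  have "x' \<in> Obj C" using assms by (simp add: arr_def)
  then show "arr C x x' f" using assms by (simp add: iso_iff)
  show "pullback C x p' x' f a' p a h" by (rule pullback_isos) (use assms in auto)
qed (rule assms)

lemma T0_iso:
  assumes "iso C x y f" "x \<in> Obj C" "y \<in> Obj C"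
  shows "iso (T0 C \<delta>) x y (graph_rel C x y f)"
proof -
  obtain g where g: "arr C x y f" "arr C y x g" "Cmp C x y x g f = Idn C x" "Cmp C y x y f g = Idn C y"
    by (rule isoE[OF assms])
  show ?thesis unfolding iso_def
  proof (intro conjI bexI)
    show "graph_rel C x y f \<in> Hom (T0 C \<delta>) x y" "graph_rel C y x g \<in> Hom (T0 C \<delta>) y x"
      using graph_rel_arr g by (auto simp: arr_def)
  qed (use g in \<open>simp_all add: T0_comp_graph\<close>)
qed

lemma T0_comp_arr:
  assumes f: "arr (T0 C \<delta>) x y \<phi>" and g: "arr (T0 C \<delta>) y z \<psi>"
  shows "arr (T0 C \<delta>) x z (Cmp (T0 C \<delta>) x y z \<psi> \<phi>)"
proof (rule T0_arrI[OF klinear_T0_comp(2) g])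
  show o: "x \<in> Obj C" "z \<in> Obj C" using f g by (auto simp: T0_arr_iff)
  fix q c d assume c: "arr C q y c" "arr C q z d"
  show "arr (T0 C \<delta>) x z (Cmp (T0 C \<delta>) x y z (sp y z q c d) \<phi>)"
  proof (rule T0_arrI[OF klinear_T0_comp(1) f o])
    fix p a b assume a: "arr C p x a" "arr C p y b"
    show "arr (T0 C \<delta>) x z (Cmp (T0 C \<delta>) x y z (sp y z q c d) (sp x y p a b))"
    proof (cases "has_pullback C p q y b c")
      case True
      then obtain w u v where W: "pullback C p q y b c w u v" using has_pullback_obtain a c by metis
      show ?thesis unfolding T0_comp_span[OF a c W]
        by (intro span_rel_arr arr_comp[OF pullback_arr(3)[OF W] a(1)] arr_comp[OF pullback_arr(4)[OF W] c(2)])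
    qed (simp add: T0_comp_span_zero[OF a c] T0_arr_iff o)
  qed
qed

text \<open>Both bracketings amount to one limit of the zigzag through \<open>y\<close> and
  \<open>z\<close>. The case distinction asks whether this zigzag has any cone at all; if not, both
  sides are zero, though the missing pullback may occur at different stages.\<close>

lemma T0_assoc_span:
  assumes a: "arr C p1 x a1" "arr C p1 y b1" "arr C p2 y a2" "arr C p2 z b2" "arr C p3 z a3" "arr C p3 w b3"
  shows "Cmp (T0 C \<delta>) x z w (sp z w p3 a3 b3) (Cmp (T0 C \<delta>) x y z (sp y z p2 a2 b2) (sp x y p1 a1 b1))
    = Cmp (T0 C \<delta>) x y w (Cmp (T0 C \<delta>) y z w (sp z w p3 a3 b3) (sp y z p2 a2 b2)) (sp x y p1 a1 b1)"
    (is "?l = ?r")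
proof (cases "\<exists>t u1 u2 u3. arr C t p1 u1 \<and> arr C t p2 u2 \<and> arr C t p3 u3 \<and>
    Cmp C t p1 y b1 u1 = Cmp C t p2 y a2 u2 \<and> Cmp C t p2 z b2 u2 = Cmp C t p3 z a3 u3")
  case True
  then obtain t u1 u2 u3 where t: "arr C t p1 u1" "arr C t p2 u2" "arr C t p3 u3"
    "Cmp C t p1 y b1 u1 = Cmp C t p2 y a2 u2" "Cmp C t p2 z b2 u2 = Cmp C t p3 z a3 u3" by blast
  have "has_pullback C p1 p2 y b1 a2" "has_pullback C p2 p3 z b2 a3"
    using has_pullback_iff[OF a(2,3)] has_pullback_iff[OF a(4,5)] t by blast+
  then obtain V s1 s2 W t2 t3 where V: "pullback C p1 p2 y b1 a2 V s1 s2" and W: "pullback C p2 p3 z b2 a3 W t2 t3"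
    using has_pullback_obtain a by metis
  note A = pullback_arr[OF V] and B = pullback_arr[OF W]
  obtain h where h: "arr C t V h" "Cmp C t V p2 s2 h = u2" using pullback_lift[OF V t(1,2,4)] by metis
  obtain k where k: "arr C t W k" "Cmp C t W p2 t2 k = u2" using pullback_lift[OF W t(2,3,5)] by metis
  have "has_pullback C V W p2 s2 t2" using has_pullback_iff[OF A(4) B(3)] h k by metis
  then obtain U l m where U: "pullback C V W p2 s2 t2 U l m" using has_pullback_obtain A B by metis
  note D = pullback_arr[OF U]
  \<comment> \<open>Pasting \<open>U\<close> with either neighbour shows that the same apex computes
    both bracketings.\<close>
  have 1: "pullback C p3 V z a3 (Cmp C V p2 z b2 s2) U (Cmp C U W p3 t3 m) l"
    by (rule pullback_pasting[OF pullback_sym[OF W] pullback_sym[OF U]])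
  have 2: "pullback C p1 W y b1 (Cmp C W p2 y a2 t2) U (Cmp C U V p1 s1 l) m"
    by (rule pullback_pasting[OF V U])
  have "?l = sp x w U (Cmp C U V x (Cmp C V p1 x a1 s1) l) (Cmp C U p3 w b3 (Cmp C U W p3 t3 m))"
    unfolding T0_comp_span[OF a(1,2,3,4) V]
    by (rule T0_comp_span[OF _ _ a(5,6) pullback_sym[OF 1]]) (use A a in auto)
  moreover have "?r = sp x w U (Cmp C U p1 x a1 (Cmp C U V p1 s1 l)) (Cmp C U W w (Cmp C W p3 w b3 t3) m)"
    unfolding T0_comp_span[OF a(3,4,5,6) W]
    by (rule T0_comp_span[OF a(1,2) _ _ 2]) (use B a in auto)
  ultimately show ?thesis using comp_asc[OF D(3) A(3) a(1)] comp_asc[OF D(4) B(4) a(6)] by simp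
next
  case False
  have "?l = 0"
  proof (cases "has_pullback C p1 p2 y b1 a2")
    case True
    then obtain V s1 s2 where V: "pullback C p1 p2 y b1 a2 V s1 s2" using has_pullback_obtain a by metis
    note A = pullback_arr[OF V]
    \<comment> \<open>A second pullback would supply the cone that was excluded.\<close>
    have "\<not> has_pullback C V p3 z (Cmp C V p2 z b2 s2) a3"
    proof
      assume "has_pullback C V p3 z (Cmp C V p2 z b2 s2) a3"
      then obtain U l m where U: "pullback C V p3 z (Cmp C V p2 z b2 s2) a3 U l m"
        using has_pullback_obtain arr_comp[OF A(4) a(4)] a(5) by metis
      note D = pullback_arr[OF U]
      have "Cmp C U p1 y b1 (Cmp C U V p1 s1 l) = Cmp C U p2 y a2 (Cmp C U V p2 s2 l)"
        by (rule comp_eq_extend[OF A(5) D(3) A(3,1,4,2)])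
      moreover have "Cmp C U p2 z b2 (Cmp C U V p2 s2 l) = Cmp C U p3 z a3 m"
        using D(5) comp_asc[OF D(3) A(4) a(4)] by simp
      ultimately show False using False arr_comp[OF D(3) A(3)] arr_comp[OF D(3) A(4)] D(4) by blast
    qed
    then show ?thesis unfolding T0_comp_span[OF a(1,2,3,4) V]
      by (intro T0_comp_span_zero[OF _ _ a(5,6)]) (use A a in auto)
  qed (simp add: T0_comp_span_zero[OF a(1,2,3,4)] T0_comp_linear)
  moreover have "?r = 0"
  proof (cases "has_pullback C p2 p3 z b2 a3")
    case True
    then obtain W t2 t3 where W: "pullback C p2 p3 z b2 a3 W t2 t3" using has_pullback_obtain a by metis
    note B = pullback_arr[OF W]
    have "\<not> has_pullback C p1 W y b1 (Cmp C W p2 y a2 t2)"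
    proof
      assume "has_pullback C p1 W y b1 (Cmp C W p2 y a2 t2)"
      then obtain U l m where U: "pullback C p1 W y b1 (Cmp C W p2 y a2 t2) U l m"
        using has_pullback_obtain arr_comp[OF B(3) a(3)] a(2) by metis
      note D = pullback_arr[OF U]
      have "Cmp C U p2 z b2 (Cmp C U W p2 t2 m) = Cmp C U p3 z a3 (Cmp C U W p3 t3 m)"
        by (rule comp_eq_extend[OF B(5) D(4) B(3,1,4,2)])
      moreover have "Cmp C U p1 y b1 l = Cmp C U p2 y a2 (Cmp C U W p2 t2 m)"
        using D(5) comp_asc[OF D(4) B(3) a(3)] by simp
      ultimately show False using False arr_comp[OF D(4) B(3)] arr_comp[OF D(4) B(4)] D(3) by blast
    qed
    then show ?thesis unfolding T0_comp_span[OF a(3,4,5,6) W]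
      by (intro T0_comp_span_zero[OF a(1,2)]) (use B a in auto)
  qed (simp add: T0_comp_span_zero[OF a(3,4,5,6)] T0_comp_linear)
  ultimately show ?thesis by simp
qed

text \<open>Trilinearity reduces the claim to spans, one argument at a time.\<close>

lemma T0_assoc:
  assumes f: "arr (T0 C \<delta>) x y f" and g: "arr (T0 C \<delta>) y z g" and h: "arr (T0 C \<delta>) z w h"
  shows "Cmp (T0 C \<delta>) x z w h (Cmp (T0 C \<delta>) x y z g f) = Cmp (T0 C \<delta>) x y w (Cmp (T0 C \<delta>) y z w h g) f"
proof (rule T0_eqI[OF _ _ h])
  fix p3 a3 b3 assume 3: "arr C p3 z a3" "arr C p3 w b3"
  show "Cmp (T0 C \<delta>) x z w (sp z w p3 a3 b3) (Cmp (T0 C \<delta>) x y z g f) = Cmp (T0 C \<delta>) x y w (Cmp (T0 C \<delta>) y z w (sp z w p3 a3 b3) g) f"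
  proof (rule T0_eqI[OF _ _ g])
    fix p2 a2 b2 assume 2: "arr C p2 y a2" "arr C p2 z b2"
    show "Cmp (T0 C \<delta>) x z w (sp z w p3 a3 b3) (Cmp (T0 C \<delta>) x y z (sp y z p2 a2 b2) f)
      = Cmp (T0 C \<delta>) x y w (Cmp (T0 C \<delta>) y z w (sp z w p3 a3 b3) (sp y z p2 a2 b2)) f"
      by (rule T0_eqI[OF _ _ f]) (intro klinear_T0_compI klinear_ident T0_assoc_span 2 3; assumption)+
  qed (intro klinear_T0_compI klinear_ident)+
qed (intro klinear_T0_compI klinear_ident)+

lemma category_T0: "category (T0 C \<delta>)"
proof
  note arrI = arr_def[of "T0 C \<delta>", THEN iffD2, OF conjI, OF _ conjI]
  show "Idn (T0 C \<delta>) x \<in> Hom (T0 C \<delta>) x x" if "x \<in> Obj (T0 C \<delta>)" for x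
    using graph_rel_arr[OF arr_id] that by (simp add: arr_def)
  show "Cmp (T0 C \<delta>) x y z g f \<in> Hom (T0 C \<delta>) x z"
    if "x \<in> Obj (T0 C \<delta>)" "y \<in> Obj (T0 C \<delta>)" "z \<in> Obj (T0 C \<delta>)" "f \<in> Hom (T0 C \<delta>) x y" "g \<in> Hom (T0 C \<delta>) y z"
    for x y z f g
    using T0_comp_arr[OF arrI arrI] that by (simp add: arr_def)
  show "Cmp (T0 C \<delta>) x y y (Idn (T0 C \<delta>) y) f = f"
    if "x \<in> Obj (T0 C \<delta>)" "y \<in> Obj (T0 C \<delta>)" "f \<in> Hom (T0 C \<delta>) x y" for x y f
  proof -
    have "y \<in> Obj C" using that by simp
    show ?thesis unfolding T0_simps
      by (rule T0_eqI[OF klinear_T0_comp(1) klinear_ident arrI[OF that]])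
        (use T0_comp_graph_span[OF _ _ arr_id[OF \<open>y \<in> Obj C\<close>]] in simp)
  qed
  show "Cmp (T0 C \<delta>) x x y f (Idn (T0 C \<delta>) x) = f"
    if "x \<in> Obj (T0 C \<delta>)" "y \<in> Obj (T0 C \<delta>)" "f \<in> Hom (T0 C \<delta>) x y" for x y f
  proof -
    have x: "x \<in> Obj C" using that by simp
    show ?thesis unfolding T0_simps
    proof (rule T0_eqI[OF klinear_T0_comp(2) klinear_ident arrI[OF that]])
      fix p a b assume a: "arr C p x a" "arr C p y b"
      show "Cmp (T0 C \<delta>) x x y (sp x y p a b) (graph_rel C x x (Idn C x)) = sp x y p a b"
        using T0_comp_span_graph[OF arr_id[OF x] a pullback_sym[OF pullback_identity[OF a(1)]]] a by simp
    qed
  qed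
  show "Cmp (T0 C \<delta>) w y z h (Cmp (T0 C \<delta>) w x y g f) = Cmp (T0 C \<delta>) w x z (Cmp (T0 C \<delta>) x y z h g) f"
    if "w \<in> Obj (T0 C \<delta>)" "x \<in> Obj (T0 C \<delta>)" "y \<in> Obj (T0 C \<delta>)" "z \<in> Obj (T0 C \<delta>)"
      "f \<in> Hom (T0 C \<delta>) w x" "g \<in> Hom (T0 C \<delta>) x y" "h \<in> Hom (T0 C \<delta>) y z" for w x y z f g h
    using that by (intro T0_assoc arrI) auto
qed

lemma preadditive_T0: "preadditive (T0 C \<delta>)"
proof (intro preadditive.intro category_T0 preadditive_axioms.intro)
  show "arr (T0 C \<delta>) x y (f + g)" if "arr (T0 C \<delta>) x y f" "arr (T0 C \<delta>) x y g" for x y f g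
    using that Poly_Mapping.keys_add[of f g] by (auto simp: T0_arr_iff)
qed (simp_all add: T0_arr_iff T0_comp_linear)

end

section \<open>Functors induced on categories of relations\<close>

text \<open>Joint monicity makes the image of a relation a relation although the natural map from
  \<open>F(x \<times> y)\<close> to \<open>F x \<times> F y\<close> need not be invertible.
  Reflection of pullbacks is required because a composite that is zero must stay zero.\<close>

locale degree_functor = cat_functor C D Fo Fm + C: degree_category C \<delta> + D: degree_category D \<delta>'
  for C :: "('o, 'a, 'r) cat_scheme" and D :: "('p, 'b, 's) cat_scheme"
    and Fo :: "'o \<Rightarrow> 'p" and Fm :: "'o \<Rightarrow> 'o \<Rightarrow> 'a \<Rightarrow> 'b"
    and \<delta> :: "'o \<Rightarrow> 'o \<Rightarrow> 'a \<Rightarrow> 'k::field" and \<delta>' :: "'p \<Rightarrow> 'p \<Rightarrow> 'b \<Rightarrow> 'k" +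
  assumes F_jointly_monic: "jointly_monic C x y p a b \<Longrightarrow>
      jointly_monic D (Fo x) (Fo y) (Fo p) (Fm p x a) (Fm p y b)"
    and F_epic: "x \<in> Obj C \<Longrightarrow> y \<in> Obj C \<Longrightarrow> epic C x y e \<Longrightarrow> epic D (Fo x) (Fo y) (Fm x y e)"
    and F_degree: "x \<in> Obj C \<Longrightarrow> y \<in> Obj C \<Longrightarrow> epic C x y e \<Longrightarrow> \<delta>' (Fo x) (Fo y) (Fm x y e) = \<delta> x y e"
    and F_pullback: "pullback C x y z f g p a b \<Longrightarrow>
      pullback D (Fo x) (Fo y) (Fo z) (Fm x z f) (Fm y z g) (Fo p) (Fm p x a) (Fm p y b)"
    and F_reflects: "arr C x z f \<Longrightarrow> arr C y z g \<Longrightarrow>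
      has_pullback D (Fo x) (Fo y) (Fo z) (Fm x z f) (Fm y z g) \<Longrightarrow> has_pullback C x y z f g"
begin

abbreviation T0F :: "'o \<Rightarrow> 'o \<Rightarrow> (('o \<times> 'a) set \<Rightarrow>\<^sub>0 'k) \<Rightarrow> ('p \<times> 'b) set \<Rightarrow>\<^sub>0 'k" where
  "T0F \<equiv> ind_T0_mor C D Fo Fm"

lemma ind_eq: "T0F x y \<phi> = lin_ext (\<lambda>R. Poly_Mapping.single (ind_rel C D Fo Fm x y R) 1) \<phi>"
  by (simp add: ind_T0_mor_def lin_ext_def)

lemma klinear_ind: "klinear (T0F x y)"
  unfolding ind_eq by (rule klinear_lin_ext)

text \<open>Preserved joint monicity shows that \<open>ind_rel\<close> is the relation with legs
  \<open>F r1\<close> and \<open>F r2\<close>; preserved epimorphisms and degrees then match the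
  coefficients.\<close>

lemma ind_span:
  assumes "arr C p x a" "arr C p y b"
  shows "T0F x y (C.sp x y p a b) = D.sp (Fo x) (Fo y) (Fo p) (Fm p x a) (Fm p y b)"
proof -
  obtain R r m e where R: "rep R = (r, m)" "arr C r (prd C x y) m" "epic C p r e"
    "arr C p r e" "Cmp C p r (prd C x y) m e = pair C p x y a b"
    "C.sp x y p a b = Poly_Mapping.single R (\<delta> p r e)"
    and jm: "jointly_monic C x y r (Cmp C r (prd C x y) x (pr1 C x y) m) (Cmp C r (prd C x y) y (pr2 C x y) m)"
    by (rule C.span_rel_rep[OF assms])
  note P = C.pr_arr[OF C.hprodI[OF assms]] and Q = C.pair_lift[OF assms]
  define r1 where "r1 = Cmp C r (prd C x y) x (pr1 C x y) m"
  define r2 where "r2 = Cmp C r (prd C x y) y (pr2 C x y) m"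
  note jm = jm[folded r1_def r2_def] note l = C.jointly_monic_arr[OF jm]
  have ab: "Cmp C p r x r1 e = a" "Cmp C p r y r2 e = b"
    using C.comp_asc[OF R(4,2) P(1)] C.comp_asc[OF R(4,2) P(2)] R(5) Q by (auto simp: r1_def r2_def)
  have o: "p \<in> Obj C" "r \<in> Obj C" using R by (auto simp: arr_def)
  have "Cmp D (Fo r) (Fo (prd C x y)) (prd D (Fo x) (Fo y))
      (pair D (Fo (prd C x y)) (Fo x) (Fo y) (Fm (prd C x y) x (pr1 C x y)) (Fm (prd C x y) y (pr2 C x y)))
      (Fm r (prd C x y) m) = pair D (Fo r) (Fo x) (Fo y) (Fm r x r1) (Fm r y r2)"
    unfolding r1_def r2_def F_comp_arr[OF R(2) P(1)] F_comp_arr[OF R(2) P(2)]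
    by (rule D.pair_comp) (use P R in auto)
  then have "Poly_Mapping.single (ind_rel C D Fo Fm x y R) 1 = D.sp (Fo x) (Fo y) (Fo r) (Fm r x r1) (Fm r y r2)"
    by (simp add: ind_rel_def R(1) Let_def D.span_rel_jointly_monic[OF F_jointly_monic[OF jm]])
  moreover have "D.sp (Fo x) (Fo y) (Fo p) (Fm p x a) (Fm p y b)
    = scl (\<delta> p r e) (D.sp (Fo x) (Fo y) (Fo r) (Fm r x r1) (Fm r y r2))"
    unfolding ab[symmetric] F_comp_arr[OF R(4) l(1)] F_comp_arr[OF R(4) l(2)] F_degree[OF o R(3), symmetric]
    by (rule D.span_rel_epic) (use l F_epic[OF o R(3)] F_obj o in auto)
  ultimately show ?thesis by (simp add: R(6) ind_eq)
qed

lemma ind_graph: "arr C x y f \<Longrightarrow> T0F x y (graph_rel C x y f) = graph_rel D (Fo x) (Fo y) (Fm x y f)"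
  using ind_span[of x x "Idn C x" y f] C.arr_dom[of x y f]
  by (simp add: C.graph_rel_span D.graph_rel_span F_id)

lemma ind_arr:
  assumes "arr (T0 C \<delta>) x y \<phi>"
  shows "arr (T0 D \<delta>') (Fo x) (Fo y) (T0F x y \<phi>)"
proof (rule C.T0_arrI[OF klinear_ind assms])
  show "Fo x \<in> Obj D" "Fo y \<in> Obj D" using assms F_obj by (auto simp: T0_arr_iff)
qed (simp add: ind_span D.span_rel_arr)

lemma ind_comp:
  assumes f: "arr (T0 C \<delta>) x y f" and g: "arr (T0 C \<delta>) y z g"
  shows "T0F x z (Cmp (T0 C \<delta>) x y z g f) = Cmp (T0 D \<delta>') (Fo x) (Fo y) (Fo z) (T0F y z g) (T0F x y f)"
proof (rule C.T0_eqI[OF _ _ g])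
  fix q c d assume c: "arr C q y c" "arr C q z d"
  show "T0F x z (Cmp (T0 C \<delta>) x y z (C.sp y z q c d) f)
    = Cmp (T0 D \<delta>') (Fo x) (Fo y) (Fo z) (T0F y z (C.sp y z q c d)) (T0F x y f)"
  proof (rule C.T0_eqI[OF _ _ f])
    fix p a b assume a: "arr C p x a" "arr C p y b"
    show "T0F x z (Cmp (T0 C \<delta>) x y z (C.sp y z q c d) (C.sp x y p a b))
      = Cmp (T0 D \<delta>') (Fo x) (Fo y) (Fo z) (T0F y z (C.sp y z q c d)) (T0F x y (C.sp x y p a b))"
    proof (cases "has_pullback C p q y b c")
      case True
      then obtain w u v where W: "pullback C p q y b c w u v" using C.has_pullback_obtain a c by metis
      note A = C.pullback_arr[OF W]
      show ?thesis
        unfolding C.T0_comp_span[OF a c W] ind_span[OF a] ind_span[OF c]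
          ind_span[OF C.arr_comp[OF A(3) a(1)] C.arr_comp[OF A(4) c(2)]]
          D.T0_comp_span[OF F_arr[OF a(1)] F_arr[OF a(2)] F_arr[OF c(1)] F_arr[OF c(2)] F_pullback[OF W]]
          F_comp_arr[OF A(3) a(1)] F_comp_arr[OF A(4) c(2)] ..
    next
      case False
      \<comment> \<open>A pullback of the images would reflect to one of the given legs, so a zero
        composite has zero image.\<close>
      then have "\<not> has_pullback D (Fo p) (Fo q) (Fo y) (Fm p y b) (Fm q y c)" using F_reflects[OF a(2) c(1)] by blast
      then show ?thesis
        using C.T0_comp_span_zero[OF a c False] a c
        by (simp add: ind_span D.T0_comp_span_zero klinearD[OF klinear_ind])
    qed
  qed (intro klinear_T0_compI klinear_comp[OF klinear_ind] klinear_ind klinear_ident)+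
qed (intro klinear_T0_compI klinear_comp[OF klinear_ind] klinear_ind klinear_ident)+

lemma preadditive_functor_ind: "preadditive_functor (T0 C \<delta>) (T0 D \<delta>') Fo T0F"
proof (intro preadditive_functor.intro cat_functor.intro C.category_T0 D.category_T0 C.preadditive_T0 D.preadditive_T0
    cat_functor_axioms.intro preadditive_functor_axioms.intro)
  show "T0F x y f \<in> Hom (T0 D \<delta>') (Fo x) (Fo y)"
    if "x \<in> Obj (T0 C \<delta>)" "y \<in> Obj (T0 C \<delta>)" "f \<in> Hom (T0 C \<delta>) x y" for x y f
    using ind_arr[of x y f] that by (simp add: arr_def)
  show "T0F x z (Cmp (T0 C \<delta>) x y z g f) = Cmp (T0 D \<delta>') (Fo x) (Fo y) (Fo z) (T0F y z g) (T0F x y f)"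
    if "x \<in> Obj (T0 C \<delta>)" "y \<in> Obj (T0 C \<delta>)" "z \<in> Obj (T0 C \<delta>)" "f \<in> Hom (T0 C \<delta>) x y" "g \<in> Hom (T0 C \<delta>) y z"
    for x y z f g
    using that by (intro ind_comp) (simp_all add: arr_def)
qed (simp_all add: F_obj ind_graph F_id klinearD[OF klinear_ind])

lemma linear_functor_ind: "linear_functor (T C \<delta>) (T D \<delta>') (ind_T_obj C D Fo Fm) (ind_T_mor C D Fo Fm)"
proof -
  interpret T0F: preadditive_functor "T0 C \<delta>" "T0 D \<delta>'" Fo T0F by (rule preadditive_functor_ind)
  have "cat_functor (T C \<delta>) (T D \<delta>') (ind_T_obj C D Fo Fm) (ind_T_mor C D Fo Fm)"
    unfolding T_def ind_T_obj_def ind_T_mor_def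
    by (rule cat_functor_karoubi[OF T0F.cat_functor_additive])
  then show ?thesis unfolding linear_functor_def
    by (auto simp: T_def karoubi_def additive_def ind_T_mor_def karoubi_mor_def additive_mor_def fun_eq_iff
        klinearD[OF klinear_ind] split: prod.splits)
qed

end

text \<open>The adjunction is lifted through both completions, and preservation of limits is
  concluded only there.\<close>

lemma karoubi_additive_semi_adjunction:
  assumes "semi_adjunction C D Fo Fm Uo Um \<eta> \<epsilon>" "preadditive_functor C D Fo Fm" "preadditive_functor D C Uo Um"
  shows "preserves_finite_limits (karoubi (additive C)) (karoubi (additive D))
    (karoubi_obj (additive_obj Fo) (additive_mor Fm)) (karoubi_mor (additive_mor Fm))"
  by (rule semi_adjunction.preserves_finite_limits[OF semi_adjunction_karoubi[OF semi_adjunction_additive[OF assms]]])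

section \<open>Slice categories\<close>

lemma slice_arr_iff: "arr (slice C x0) (x, p) (y, q) f \<longleftrightarrow>
    x \<in> Obj C \<and> y \<in> Obj C \<and> p \<in> Hom C x x0 \<and> q \<in> Hom C y x0 \<and> f \<in> Hom C x y \<and> Cmp C x y x0 q f = p"
  by (auto simp: arr_def slice_def)

lemma slice_obj_iff: "(x, p) \<in> Obj (slice C x0) \<longleftrightarrow> x \<in> Obj C \<and> p \<in> Hom C x x0"
  by (simp add: slice_def)

lemma slice_simps [simp]:
  "Idn (slice C x0) (x, p) = Idn C x"
  "Cmp (slice C x0) (x, p) (y, q) (z, r) = Cmp C x y z"
  by (simp_all add: slice_def)

locale slice_category = degree_category C \<delta>
  for C :: "('o, 'a) cat" and \<delta> :: "'o \<Rightarrow> 'o \<Rightarrow> 'a \<Rightarrow> 'k::field" +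
  fixes x0 :: 'o
  assumes base: "x0 \<in> Obj C" and products: "\<forall>x \<in> Obj C. has_product C x x0"
begin

abbreviation "B \<equiv> slice C x0"
abbreviation "P x \<equiv> prd C x x0"
abbreviation "\<pi> x \<equiv> pr1 C x x0"
abbreviation "\<rho> x \<equiv> pr2 C x x0"

lemma sarr_iff: "arr B (x, p) (y, q) f \<longleftrightarrow>
    arr C x x0 p \<and> arr C y x0 q \<and> arr C x y f \<and> Cmp C x y x0 q f = p"
  unfolding slice_arr_iff using base by (auto simp: arr_def)

lemma sobj_iff: "(x, p) \<in> Obj B \<longleftrightarrow> arr C x x0 p"
  using base by (auto simp: arr_def slice_obj_iff)

lemma category_slice: "category B"
  by (unfold_locales; clarify; unfold slice_simps slice_obj_iff)
    (auto simp: slice_def id_in_hom comp_id_left comp_id_right base intro: comp_in_hom comp_assoc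
      comp_assoc[symmetric, THEN trans])

sublocale S: category B by (rule category_slice)

lemma arr_over:
  assumes "arr B (x, p) (y, q) f" "arr C w x g"
  shows "Cmp C w x x0 p g = Cmp C w y x0 q (Cmp C w x y f g)"
  using assms comp_asc[of w x g y f x0 q] by (simp add: sarr_iff)

lemma slice_monic: "arr C x x0 p \<Longrightarrow> arr C y x0 q \<Longrightarrow>
  monic B (x, p) (y, q) f \<longleftrightarrow> arr B (x, p) (y, q) f \<and> monic C x y f"
proof -
  assume p: "arr C x x0 p" "arr C y x0 q"
  then have o: "x \<in> Obj C" "y \<in> Obj C" by (auto simp: arr_def)
  note iff = S.monic_iff[OF sobj_iff[THEN iffD2, OF p(1)] sobj_iff[THEN iffD2, OF p(2)]]
  show ?thesis
  proof (intro iffI conjI; (elim conjE)?)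
    assume m: "monic B (x, p) (y, q) f"
    then show a: "arr B (x, p) (y, q) f" by (simp add: iff)
    show "monic C x y f" unfolding monic_iff[OF o]
    proof (intro conjI allI impI)
      show "arr C x y f" using a by (simp add: sarr_iff)
      fix w g h assume g: "arr C w x g" "arr C w x h" "Cmp C w x y f g = Cmp C w x y f h"
      \<comment> \<open>Since \<open>p\<close> is \<open>q f\<close>, the morphisms \<open>g\<close>
        and \<open>h\<close> have the same composite to the base, and both become morphisms over
        it.\<close>
      have "arr B (w, Cmp C w x x0 p g) (x, p) g" "arr B (w, Cmp C w x x0 p g) (x, p) h"
        using g p arr_over[OF a g(1)] arr_over[OF a g(2)] arr_comp[OF g(1) p(1)] by (simp_all add: sarr_iff)
      then show "g = h" using m g(3) unfolding iff by fastforce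
    qed
  next
    assume "arr B (x, p) (y, q) f" "monic C x y f"
    then show "monic B (x, p) (y, q) f" unfolding iff monic_iff[OF o] by (auto simp: sarr_iff)
  qed
qed

lemma hprod_base: "x \<in> Obj C \<Longrightarrow> hprod C x x0"
  using base products by (simp add: hprod_def)

lemmas base_obj_arr = pr_arr[OF hprod_base] hprod_obj[OF hprod_base]

text \<open>An epimorphism of the slice must be tested in \<open>C\<close> against objects
  \<open>z\<close> without a map to the base. Pairing with \<open>q\<close> replaces
  \<open>z\<close> by \<open>z \<times> x0\<close>, which lies over the base; the products with
  \<open>x0\<close> enter here.\<close>

lemma slice_epic: "arr C x x0 p \<Longrightarrow> arr C y x0 q \<Longrightarrow>
  epic B (x, p) (y, q) f \<longleftrightarrow> arr B (x, p) (y, q) f \<and> epic C x y f"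
proof -
  assume p: "arr C x x0 p" "arr C y x0 q"
  then have o: "x \<in> Obj C" "y \<in> Obj C" by (auto simp: arr_def)
  note iff = S.epic_iff[OF sobj_iff[THEN iffD2, OF p(1)] sobj_iff[THEN iffD2, OF p(2)]]
  show ?thesis
  proof (intro iffI conjI; (elim conjE)?)
    assume m: "epic B (x, p) (y, q) f"
    then show a: "arr B (x, p) (y, q) f" by (simp add: iff)
    then have f: "arr C x y f" "Cmp C x y x0 q f = p" by (auto simp: sarr_iff)
    show "epic C x y f" unfolding epic_iff[OF o]
    proof (intro conjI allI impI)
      show "arr C x y f" by fact
      fix z g h assume g: "arr C y z g" "arr C y z h" "Cmp C x y z g f = Cmp C x y z h f"
      note P = pair_lift[OF g(1) p(2)] pair_lift[OF g(2) p(2)]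
      have z: "z \<in> Obj C" using g by (simp add: arr_def)
      have "arr B (y, q) (P z, \<rho> z) (pair C y z x0 g q)" "arr B (y, q) (P z, \<rho> z) (pair C y z x0 h q)"
        using P p base_obj_arr[OF z] by (auto simp: sarr_iff)
      moreover have "Cmp C x y (P z) (pair C y z x0 g q) f = Cmp C x y (P z) (pair C y z x0 h q) f"
        using pair_comp[OF g(1) p(2) f(1)] pair_comp[OF g(2) p(2) f(1)] g(3) by simp
      ultimately have "pair C y z x0 g q = pair C y z x0 h q" using m unfolding iff by fastforce
      then show "g = h" using P by metis
    qed
  next
    assume "arr B (x, p) (y, q) f" "epic C x y f"
    then show "epic B (x, p) (y, q) f" unfolding iff epic_iff[OF o] by (auto simp: sarr_iff)
  qed
qed

lemma slice_iso: "arr B (x, p) (y, q) f \<Longrightarrow> iso B (x, p) (y, q) f \<longleftrightarrow> iso C x y f"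
proof -
  assume f: "arr B (x, p) (y, q) f"
  then have a: "arr C x x0 p" "arr C y x0 q" "arr C x y f" by (auto simp: sarr_iff)
  then have o: "x \<in> Obj C" "y \<in> Obj C" by (auto simp: arr_def)
  note iff = S.iso_iff[OF sobj_iff[THEN iffD2, OF a(1)] sobj_iff[THEN iffD2, OF a(2)]] iso_iff[OF o]
  have "arr B (y, q) (x, p) g" if "arr C y x g" "Cmp C y x y f g = Idn C y" for g
    using arr_over[OF f that(1)] that a by (simp add: sarr_iff)
  moreover have "arr C y x g" if "arr B (y, q) (x, p) g" for g using that by (simp add: sarr_iff)
  ultimately show ?thesis unfolding iff slice_simps using f a by blast
qed

lemma slice_jointly_monic:
  assumes "arr B (r, s) (x, p) a" "arr B (r, s) (y, q) b"
  shows "jointly_monic B (x, p) (y, q) (r, s) a b \<longleftrightarrow> jointly_monic C x y r a b"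
proof
  have ab: "arr C r x a" "arr C r y b" "arr C x x0 p" "arr C r x0 s" using assms by (auto simp: sarr_iff)
  show "jointly_monic C x y r a b" if m: "jointly_monic B (x, p) (y, q) (r, s) a b"
    unfolding jointly_monic_def
  proof (intro conjI allI impI)
    fix w g h
    assume g: "arr C w r g" "arr C w r h" "Cmp C w r x a g = Cmp C w r x a h" "Cmp C w r y b g = Cmp C w r y b h"
    have "arr B (w, Cmp C w r x0 s g) (r, s) g" "arr B (w, Cmp C w r x0 s g) (r, s) h"
      using g ab arr_over[OF assms(1) g(1)] arr_over[OF assms(1) g(2)] by (auto simp: sarr_iff)
    from S.jointly_monicD[OF m this] show "g = h" using g by simp
  qed (use ab in auto)
  show "jointly_monic B (x, p) (y, q) (r, s) a b" if m: "jointly_monic C x y r a b"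
    unfolding jointly_monic_def
  proof (intro conjI allI impI)
    fix w g h assume "arr B w (r, s) g" "arr B w (r, s) h"
      "Cmp B w (r, s) (x, p) a g = Cmp B w (r, s) (x, p) a h" "Cmp B w (r, s) (y, q) b g = Cmp B w (r, s) (y, q) b h"
    then show "g = h" by (cases w) (auto simp: sarr_iff intro: jointly_monicD[OF m])
  qed (use assms in auto)
qed

text \<open>A cone in \<open>C\<close> over a cospan of the slice gets its map to the base through
  either foot, with the same result, so cones in \<open>C\<close> and in the slice
  correspond.\<close>

lemma slice_pullback:
  assumes "arr B (x, p) (z, r) f" "arr B (y, q) (z, r) g" "arr B (w, s) (x, p) a" "arr B (w, s) (y, q) b"
  shows "pullback B (x, p) (y, q) (z, r) f g (w, s) a b \<longleftrightarrow> pullback C x y z f g w a b"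
proof
  have ab: "arr C x z f" "arr C y z g" "arr C w x a" "arr C w y b" "arr C x x0 p" "arr C y x0 q"
    "arr C w x0 s" "arr C z x0 r" "Cmp C w x x0 p a = s"
    using assms by (auto simp: sarr_iff)
  show "pullback C x y z f g w a b" if P: "pullback B (x, p) (y, q) (z, r) f g (w, s) a b"
  proof (rule pullbackI)
    show "jointly_monic C x y w a b"
      using S.pullback_jointly_monic[OF P] slice_jointly_monic[OF assms(3,4)] by simp
    show "Cmp C w x z f a = Cmp C w y z g b" using S.pullback_arr(5)[OF P] by simp
    fix t u v assume t: "arr C t x u" "arr C t y v" "Cmp C t x z f u = Cmp C t y z g v"
    have "arr B (t, Cmp C t x x0 p u) (x, p) u" "arr B (t, Cmp C t x x0 p u) (y, q) v"
      using t ab arr_over[OF assms(1) t(1)] arr_over[OF assms(2) t(2)] by (auto simp: sarr_iff)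
    from S.pullback_lift[OF P this] t(3)
    obtain h where "arr B (t, Cmp C t x x0 p u) (w, s) h" "Cmp C t w x a h = u" "Cmp C t w y b h = v" by auto
    then show "\<exists>h. arr C t w h \<and> Cmp C t w x a h = u \<and> Cmp C t w y b h = v" by (auto simp: sarr_iff)
  qed (use ab in auto)
  show "pullback B (x, p) (y, q) (z, r) f g (w, s) a b" if P: "pullback C x y z f g w a b"
  proof (rule S.pullbackI)
    show "jointly_monic B (x, p) (y, q) (w, s) a b"
      using pullback_jointly_monic[OF P] slice_jointly_monic[OF assms(3,4)] by simp
    show "Cmp B (w, s) (x, p) (z, r) f a = Cmp B (w, s) (y, q) (z, r) g b" using pullback_arr(5)[OF P] by simp
    fix t u v assume t: "arr B t (x, p) u" "arr B t (y, q) v" "Cmp B t (x, p) (z, r) f u = Cmp B t (y, q) (z, r) g v"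
    obtain t' k where tk: "t = (t', k)" by (cases t)
    from t have t': "arr C t' x u" "arr C t' y v" "Cmp C t' x z f u = Cmp C t' y z g v" "Cmp C t' x x0 p u = k" "arr C t' x0 k"
      unfolding tk by (auto simp: sarr_iff)
    obtain h where h: "arr C t' w h" "Cmp C t' w x a h = u" "Cmp C t' w y b h = v"
      by (rule pullback_lift[OF P t'(1,2,3)])
    have "arr B t (w, s) h" unfolding tk using h t' ab arr_over[OF assms(3) h(1)] by (simp add: sarr_iff)
    then show "\<exists>h. arr B t (w, s) h \<and> Cmp B t (w, s) (x, p) a h = u \<and> Cmp B t (w, s) (y, q) b h = v"
      using h by (auto simp: tk)
  qed (use assms in auto)
qed

lemma slice_pullbackI:
  assumes "arr B (x, p) (z, r) f" "arr B (y, q) (z, r) g" "pullback C x y z f g w a b"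
  shows "pullback B (x, p) (y, q) (z, r) f g (w, Cmp C w x x0 p a) a b"
proof -
  note A = pullback_arr[OF assms(3)]
  have "arr B (w, Cmp C w x x0 p a) (x, p) a" "arr B (w, Cmp C w x x0 p a) (y, q) b"
    using assms A arr_over[OF assms(1) A(3)] arr_over[OF assms(2) A(4)] by (auto simp: sarr_iff)
  then show ?thesis using slice_pullback[OF assms(1,2)] assms(3) by simp
qed

lemma slice_pullbackD:
  assumes "pullback B (x, p) (y, q) (z, r) f g (w, s) a b"
  shows "pullback C x y z f g w a b"
  using slice_pullback S.pullback_arr[OF assms] assms by blast

lemma slice_has_pullback:
  assumes "arr B (x, p) (z, r) f" "arr B (y, q) (z, r) g"
  shows "has_pullback B (x, p) (y, q) (z, r) f g \<longleftrightarrow> has_pullback C x y z f g"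
proof
  assume "has_pullback B (x, p) (y, q) (z, r) f g"
  then obtain w a b where "pullback B (x, p) (y, q) (z, r) f g w a b" using S.has_pullback_obtain assms by metis
  then show "has_pullback C x y z f g" using slice_pullbackD has_pullbackI by (cases w) blast
next
  assume "has_pullback C x y z f g"
  moreover have "arr C x z f" "arr C y z g" using assms by (auto simp: sarr_iff)
  ultimately obtain w a b where "pullback C x y z f g w a b" using has_pullback_obtain by metis
  from S.has_pullbackI[OF slice_pullbackI[OF assms this]] show "has_pullback B (x, p) (y, q) (z, r) f g" .
qed

text \<open>The structure map of the intermediate object is forced by that of \<open>y\<close>, so
  factorizations in the slice are those of \<open>C\<close>.\<close>

lemma slice_epi_mono:
  assumes "arr B (x, p) (y, q) f"
  shows "epi_mono B (x, p) (y, q) f (i, s) e m \<longleftrightarrow> epi_mono C x y f i e m \<and> arr C i y m \<and> s = Cmp C i y x0 q m"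
    (is "?l \<longleftrightarrow> ?r")
proof
  have a: "arr C x x0 p" "arr C y x0 q" "arr C x y f" "Cmp C x y x0 q f = p" using assms by (auto simp: sarr_iff)
  assume l: ?l
  then have s: "arr C i x0 s" "Cmp C x i y m e = f" by (auto simp: epi_mono_def sobj_iff)
  show ?r using l a(1,2) s slice_monic[OF s(1) a(2)] slice_epic[OF a(1) s(1)]
    by (auto simp: epi_mono_def sarr_iff arr_dom)
next
  have a: "arr C x x0 p" "arr C y x0 q" "arr C x y f" "Cmp C x y x0 q f = p" using assms by (auto simp: sarr_iff)
  assume r: ?r
  have o: "x \<in> Obj C" "y \<in> Obj C" "i \<in> Obj C" using a r by (auto simp: arr_def)
  have m: "arr C i y m" "arr C x i e" "Cmp C x i y m e = f" using r o by (auto simp: epi_mono_def epic_iff)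
  have s: "arr C i x0 s" using r m a by auto
  have "arr B (i, s) (y, q) m" "arr B (x, p) (i, s) e"
    using m s a r comp_asc[OF m(2,1) a(2)] by (auto simp: sarr_iff)
  then show ?l using r s m slice_monic[OF s a(2)] slice_epic[OF a(1) s] by (auto simp: epi_mono_def sobj_iff)
qed

text \<open>The axioms concern epimorphisms, pullbacks and factorizations, which the preceding
  lemmas identify with those of \<open>C\<close>; the terminal object is the identity of the
  base.\<close>

lemma regular_slice: "regular_category B"
proof (intro regular_category.intro category_slice regular_category_axioms.intro)
  have "terminal B (x0, Idn C x0)"
    unfolding terminal_def
  proof (intro conjI ballI)
    show "(x0, Idn C x0) \<in> Obj B" using base by (simp add: sobj_iff)
    fix t assume "t \<in> Obj B"
    then obtain x p where t: "t = (x, p)" "arr C x x0 p" by (cases t) (auto simp: sobj_iff)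
    show "\<exists>!f. f \<in> Hom B t (x0, Idn C x0)"
      using t(2) comp_id(1)[of x x0] by (auto simp: t(1) slice_def arr_def intro!: ex1I[of _ p])
  qed
  then show "\<exists>t. terminal B t" ..
next
  fix X Y f assume "X \<in> Obj B" "Y \<in> Obj B" "f \<in> Hom B X Y"
  moreover obtain x p y q where XY: "X = (x, p)" "Y = (y, q)" by (metis prod.exhaust)
  ultimately have f: "arr B (x, p) (y, q) f" by (simp add: arr_def)
  then have fC: "x \<in> Obj C" "y \<in> Obj C" "f \<in> Hom C x y" unfolding sarr_iff unfolding arr_def by blast+
  obtain i e m where i: "epi_mono C x y f i e m" using image_exists[OF fC] by blast
  then have "arr C i y m" using fC monic_iff[of i y m] by (auto simp: epi_mono_def)
  with i show "\<exists>q e m. epi_mono B X Y f q e m" using slice_epi_mono[OF f] XY by blast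
  fix Q e m Q' e' m' assume "epi_mono B X Y f Q e m" "epi_mono B X Y f Q' e' m'"
  moreover obtain i s i' s' where Q: "Q = (i, s)" "Q' = (i', s')" by (metis prod.exhaust)
  ultimately have 1: "epi_mono C x y f i e m" "arr C i y m" "s = Cmp C i y x0 q m"
    and 2: "epi_mono C x y f i' e' m'" "arr C i' y m'" "s' = Cmp C i' y x0 q m'"
    using slice_epi_mono[OF f] XY by auto
  from image_unique[OF fC 1(1) 2(1)]
  obtain h where h: "iso C i i' h" "Cmp C x i i' h e = e'" "Cmp C i i' y m' h = m" by blast
  have ha: "arr C i i' h" using h(1) 1(2) 2(2) by (auto simp: iso_iff arr_dom)
  have q: "arr C y x0 q" using f by (simp add: sarr_iff)
  have "arr B (i, s) (i', s') h"
    using comp_asc[OF ha 2(2) q] h(3) 1 2 ha q by (simp add: sarr_iff)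
  then have "iso B Q Q' h" using slice_iso h(1) Q by blast
  then show "\<exists>h. iso B Q Q' h \<and> Cmp B X Q Q' h e = e' \<and> Cmp B Q Q' Y m' h = m"
    using h Q XY by auto
next
  fix X Y Z f g W u v
  assume "X \<in> Obj B" "Y \<in> Obj B" "Z \<in> Obj B" "f \<in> Hom B X Z" "g \<in> Hom B Y Z"
    "W \<in> Obj B" "u \<in> Hom B W X" "v \<in> Hom B W Y" "Cmp B W X Z f u = Cmp B W Y Z g v"
  moreover obtain x p y q z r w s where *: "X = (x, p)" "Y = (y, q)" "Z = (z, r)" "W = (w, s)" by (metis prod.exhaust)
  ultimately have a: "arr B (x, p) (z, r) f" "arr B (y, q) (z, r) g" "arr B (w, s) (x, p) u" "arr B (w, s) (y, q) v"
    and eq: "Cmp C w x z f u = Cmp C w y z g v" by (auto simp: arr_def)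
  then have "has_pullback C x y z f g" using has_pullback_iff[of x z f y g] by (auto simp: sarr_iff)
  then show "has_pullback B X Y Z f g" using slice_has_pullback[OF a(1,2)] * by simp
next
  fix X Y Z f g
  assume "X \<in> Obj B" "Y \<in> Obj B" "Z \<in> Obj B" "epic B X Z f" "g \<in> Hom B Y Z"
  moreover obtain x p y q z r where *: "X = (x, p)" "Y = (y, q)" "Z = (z, r)" by (metis prod.exhaust)
  ultimately have a: "arr B (x, p) (z, r) f" "arr B (y, q) (z, r) g" and e: "epic C x z f"
    using slice_epic[of x p z r f] by (auto simp: sobj_iff arr_def[of B])
  then have "arr C x z f" "arr C y z g" by (auto simp: sarr_iff)
  then have "has_pullback C x y z f g" using pullback_of_epi[OF _ _ _ e] by (simp add: arr_def)
  then show "has_pullback B X Y Z f g" using slice_has_pullback[OF a(1,2)] * by simp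
  fix W k l assume "is_pullback B X Y Z f g W k l"
  moreover obtain w s where W: "W = (w, s)" by (metis prod.exhaust)
  ultimately have P: "pullback B (x, p) (y, q) (z, r) f g (w, s) k l" using a * by (simp add: pullback_def)
  have "epic C w y l" using epic_pullback(1)[OF slice_pullbackD[OF P] e] .
  then show "epic B W Y l" using S.pullback_arr(4)[OF P] slice_epic[of w s y q l] * W by (auto simp: sarr_iff)
qed

lemma degree_slice: "degree_function B (slice_degree \<delta>)"
  unfolding degree_function_def
proof (intro conjI ballI allI impI)
  show "slice_degree \<delta> X X (Idn B X) = 1" if "X \<in> Obj B" for X
    using that degree_id by (cases X) (simp add: slice_degree_def slice_obj_iff)
  fix X Y Z assume o: "X \<in> Obj B" "Y \<in> Obj B" "Z \<in> Obj B"
  obtain x p y q z r where *: "X = (x, p)" "Y = (y, q)" "Z = (z, r)" by (metis prod.exhaust)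
  have a: "arr C x x0 p" "arr C y x0 q" "arr C z x0 r" using o * by (auto simp: sobj_iff)
  have oC: "x \<in> Obj C" "y \<in> Obj C" "z \<in> Obj C" using a by (auto simp: arr_def)
  show "slice_degree \<delta> X Z (Cmp B X Y Z e' e) = slice_degree \<delta> Y Z e' * slice_degree \<delta> X Y e"
    if "epic B X Y e" "epic B Y Z e'" for e e'
    using that degree_comp[of x y e z e'] oC * slice_epic[OF a(1,2)] slice_epic[OF a(2,3)]
    by (auto simp: slice_degree_def)
  fix e g W k l assume g: "g \<in> Hom B Y Z" and e: "epic B X Z e" and P: "is_pullback B X Y Z e g W k l"
  obtain w s where W: "W = (w, s)" by (metis prod.exhaust)
  have e': "epic C x z e" "arr B (x, p) (z, r) e" using e slice_epic[OF a(1,3)] * by auto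
  have "pullback B (x, p) (y, q) (z, r) e g (w, s) k l" using P e' g o * W by (simp add: pullback_def arr_def[of B])
  from epic_pullback(2)[OF slice_pullbackD[OF this] e'(1)]
  show "slice_degree \<delta> W Y l = slice_degree \<delta> X Z e" using * W by (simp add: slice_degree_def)
qed

sublocale S: degree_category B "slice_degree \<delta>"
  by (intro degree_category.intro regular_slice degree_category_axioms.intro degree_slice)

end

section \<open>Base change and its adjunction with the forgetful functor\<close>

context slice_category
begin

abbreviation "\<delta>B \<equiv> slice_degree \<delta>"
abbreviation "Fo \<equiv> base_obj C x0"
abbreviation "Fm \<equiv> base_mor C x0"

lemma base_mor_arr:
  assumes "arr C x y f"
  shows "arr C (P x) (P y) (Fm x y f)"
    "Cmp C (P x) (P y) y (\<pi> y) (Fm x y f) = Cmp C (P x) x y f (\<pi> x)"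
    "Cmp C (P x) (P y) x0 (\<rho> y) (Fm x y f) = \<rho> x"
proof -
  have x: "x \<in> Obj C" using assms by (simp add: arr_def)
  note p = pair_lift[OF arr_comp[OF base_obj_arr(1)[OF x] assms] base_obj_arr(2)[OF x]]
  show "arr C (P x) (P y) (Fm x y f)"
    "Cmp C (P x) (P y) y (\<pi> y) (Fm x y f) = Cmp C (P x) x y f (\<pi> x)"
    "Cmp C (P x) (P y) x0 (\<rho> y) (Fm x y f) = \<rho> x"
    using p unfolding base_mor_def by auto
qed

lemma base_mor_comp:
  assumes "arr C x y f" "arr C t (P x) u"
  shows "Cmp C t (P y) y (\<pi> y) (Cmp C t (P x) (P y) (Fm x y f) u) = Cmp C t x y f (Cmp C t (P x) x (\<pi> x) u)"
    "Cmp C t (P y) x0 (\<rho> y) (Cmp C t (P x) (P y) (Fm x y f) u) = Cmp C t (P x) x0 (\<rho> x) u"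
proof -
  have o: "x \<in> Obj C" "y \<in> Obj C" using assms by (auto simp: arr_def)
  note F = base_mor_arr[OF assms(1)] note P = base_obj_arr[OF o(1)] base_obj_arr[OF o(2)]
  show "Cmp C t (P y) y (\<pi> y) (Cmp C t (P x) (P y) (Fm x y f) u) = Cmp C t x y f (Cmp C t (P x) x (\<pi> x) u)"
    by (rule comp_eq_extend[OF F(2) assms(2) F(1) P(6) P(1) assms(1)])
  show "Cmp C t (P y) x0 (\<rho> y) (Cmp C t (P x) (P y) (Fm x y f) u) = Cmp C t (P x) x0 (\<rho> x) u"
    using comp_asc[OF assms(2) F(1) P(7)] F(3) by simp
qed

lemma base_mor_slice: "arr C x y f \<Longrightarrow> arr B (Fo x) (Fo y) (Fm x y f)"
  using base_mor_arr[of x y f] base_obj_arr[of x] base_obj_arr[of y] by (auto simp: base_obj_def sarr_iff arr_dom arr_cod)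

lemma base_ext:
  assumes "x \<in> Obj C" "arr C t (P x) u" "arr C t (P x) v"
    "Cmp C t (P x) x (\<pi> x) u = Cmp C t (P x) x (\<pi> x) v" "Cmp C t (P x) x0 (\<rho> x) u = Cmp C t (P x) x0 (\<rho> x) v"
  shows "u = v"
  using prd_ext[OF hprod_base] assms by blast

text \<open>This exhibits \<open>F f\<close> as a base change of \<open>f\<close>, which gives
  preservation of epimorphisms with their degrees and, by pasting, of pullbacks. It is also the
  naturality square of the counit. The lift has \<open>u\<close> and the \<open>x0\<close>
  coordinate of \<open>v\<close> as coordinates.\<close>

lemma base_square:
  assumes f: "arr C x y f"
  shows "pullback C x (P y) y f (\<pi> y) (P x) (\<pi> x) (Fm x y f)"
proof (rule pullbackI)
  have o: "x \<in> Obj C" "y \<in> Obj C" using f by (auto simp: arr_def)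
  note F = base_mor_arr[OF f] note P = base_obj_arr[OF o(1)] base_obj_arr[OF o(2)]
  show "arr C x y f" "arr C (P y) y (\<pi> y)" using f P by auto
  show "Cmp C (P x) x y f (\<pi> x) = Cmp C (P x) (P y) y (\<pi> y) (Fm x y f)" using F by simp
  show "jointly_monic C x (P y) (P x) (\<pi> x) (Fm x y f)"
    unfolding jointly_monic_def
  proof (intro conjI allI impI)
    fix w g h
    assume g: "arr C w (P x) g" "arr C w (P x) h" "Cmp C w (P x) x (\<pi> x) g = Cmp C w (P x) x (\<pi> x) h"
      "Cmp C w (P x) (P y) (Fm x y f) g = Cmp C w (P x) (P y) (Fm x y f) h"
    show "g = h" by (rule base_ext[OF o(1) g(1,2,3)]) (metis base_mor_comp(2)[OF f g(1)] base_mor_comp(2)[OF f g(2)] g(4))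
  qed (use P F in auto)
  fix w u v assume u: "arr C w x u" "arr C w (P y) v" "Cmp C w x y f u = Cmp C w (P y) y (\<pi> y) v"
  have vr: "arr C w x0 (Cmp C w (P y) x0 (\<rho> y) v)" using u P by auto
  let ?h = "pair C w x x0 u (Cmp C w (P y) x0 (\<rho> y) v)"
  note h = pair_lift[OF u(1) vr]
  have "Cmp C w (P x) (P y) (Fm x y f) ?h = v"
    by (rule base_ext[OF o(2)]) (use h u F base_mor_comp[OF f h(1)] in auto)
  then show "\<exists>h. arr C w (P x) h \<and> Cmp C w (P x) x (\<pi> x) h = u \<and> Cmp C w (P x) (P y) (Fm x y f) h = v"
    using h by blast
qed

lemma base_functor: "cat_functor C B Fo Fm"
proof (intro cat_functor.intro category_axioms category_slice cat_functor_axioms.intro)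
  show "Fo x \<in> Obj B" if "x \<in> Obj C" for x
    using base_obj_arr[OF that] by (simp add: base_obj_def sobj_iff)
  show "Fm x y f \<in> Hom B (Fo x) (Fo y)" if "x \<in> Obj C" "y \<in> Obj C" "f \<in> Hom C x y" for x y f
    using base_mor_slice[of x y f] that by (simp add: arr_def)
  show "Fm x x (Idn C x) = Idn B (Fo x)" if x: "x \<in> Obj C" for x
  proof -
    note F = base_mor_arr[OF arr_id[OF x]] and P = base_obj_arr[OF x]
    have "Fm x x (Idn C x) = Idn C (P x)"
      by (rule base_ext[OF x F(1) arr_id[OF P(5)]]) (simp_all only: F comp_id[OF P(1)] comp_id[OF P(2)])
    then show ?thesis by (simp add: base_obj_def)
  qed
  show "Fm x z (Cmp C x y z g f) = Cmp B (Fo x) (Fo y) (Fo z) (Fm y z g) (Fm x y f)"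
    if o: "x \<in> Obj C" "y \<in> Obj C" "z \<in> Obj C" and fg: "f \<in> Hom C x y" "g \<in> Hom C y z" for x y z f g
  proof -
    have a: "arr C x y f" "arr C y z g" using o fg by (simp_all add: arr_def)
    note F = base_mor_arr[OF a(1)] base_mor_arr[OF a(2)] base_mor_arr[OF arr_comp[OF a]]
    have "Fm x z (Cmp C x y z g f) = Cmp C (P x) (P y) (P z) (Fm y z g) (Fm x y f)"
      by (rule base_ext[OF o(3) F(7) arr_comp[OF F(1,4)]])
        (simp_all only: F base_mor_comp[OF a(2) F(1)] comp_asc[OF base_obj_arr(1)[OF o(1)] a])
    then show ?thesis by (simp add: base_obj_def)
  qed
qed

lemma forgetful_functor: "cat_functor B C fst (\<lambda>_ _ f. f)"
proof (intro cat_functor.intro category_axioms category_slice cat_functor_axioms.intro; clarify)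
  show "fst (x, p) \<in> Obj C" if "(x, p) \<in> Obj B" for x p using that by (simp add: slice_obj_iff)
  show "f \<in> Hom C (fst (x, p)) (fst (y, q))" if "(x, p) \<in> Obj B" "(y, q) \<in> Obj B" "f \<in> Hom B (x, p) (y, q)" for x p y q f
    using that by (simp add: slice_def)
qed simp_all

text \<open>In the slice the relevant notions agree with those of \<open>C\<close>, so forgetting
  the base preserves them and reflects pullbacks.\<close>

sublocale U: degree_functor B C fst "\<lambda>_ _ f. f" \<delta>B \<delta>
proof (intro degree_functor.intro forgetful_functor S.degree_category_axioms degree_category_axioms
    degree_functor_axioms.intro; clarify; unfold fst_conv)
  fix x p y q r s a b assume "jointly_monic B (x, p) (y, q) (r, s) a b"
  then show "jointly_monic C x y r a b" using slice_jointly_monic S.jointly_monic_arr by blast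
next
  fix x p y q e assume "(x, p) \<in> Obj B" "(y, q) \<in> Obj B" "epic B (x, p) (y, q) e"
  then show "epic C x y e" using slice_epic by (simp add: sobj_iff)
  show "\<delta> x y e = \<delta>B (x, p) (y, q) e" by (simp add: slice_degree_def)
next
  fix x p y q z r f g w s a b
  show "pullback C x y z f g w a b" if "pullback B (x, p) (y, q) (z, r) f g (w, s) a b"
    using that by (rule slice_pullbackD)
  show "has_pullback B (x, p) (y, q) (z, r) f g" if "arr B (x, p) (z, r) f" "arr B (y, q) (z, r) g" "has_pullback C x y z f g"
    using that slice_has_pullback by blast
qed

sublocale F: degree_functor C B Fo Fm \<delta> \<delta>B
proof (intro degree_functor.intro base_functor S.degree_category_axioms degree_category_axioms
    degree_functor_axioms.intro)
  interpret F: cat_functor C B Fo Fm by (rule base_functor)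
  show "jointly_monic B (Fo x) (Fo y) (Fo p) (Fm p x a) (Fm p y b)" if jm: "jointly_monic C x y p a b" for x y p a b
  proof -
    note a = jointly_monic_arr[OF jm]
    have o: "p \<in> Obj C" "x \<in> Obj C" "y \<in> Obj C" using a by (auto simp: arr_def)
    note P = base_obj_arr[OF o(1)]
    have "jointly_monic C (P x) (P y) (P p) (Fm p x a) (Fm p y b)"
      unfolding jointly_monic_def
    proof (intro conjI allI impI)
      fix w g h
      assume g: "arr C w (P p) g" "arr C w (P p) h" 
        "Cmp C w (P p) (P x) (Fm p x a) g = Cmp C w (P p) (P x) (Fm p x a) h"
        "Cmp C w (P p) (P y) (Fm p y b) g = Cmp C w (P p) (P y) (Fm p y b) h"
      \<comment> \<open>The coordinate in \<open>p\<close> is determined by the original jointly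
        monic pair; the coordinate in \<open>x0\<close> is left unchanged by
        \<open>F a\<close>.\<close>
      show "g = h"
      proof (rule base_ext[OF o(1) g(1,2)])
        show "Cmp C w (P p) p (\<pi> p) g = Cmp C w (P p) p (\<pi> p) h"
          by (rule jointly_monicD[OF jm arr_comp[OF g(1) P(1)] arr_comp[OF g(2) P(1)]])
            (metis base_mor_comp(1)[OF a(1) g(1)] base_mor_comp(1)[OF a(1) g(2)] g(3),
             metis base_mor_comp(1)[OF a(2) g(1)] base_mor_comp(1)[OF a(2) g(2)] g(4))
        show "Cmp C w (P p) x0 (\<rho> p) g = Cmp C w (P p) x0 (\<rho> p) h"
          by (metis base_mor_comp(2)[OF a(1) g(1)] base_mor_comp(2)[OF a(1) g(2)] g(3))
      qed
    qed (use base_mor_arr a in auto)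
    then show ?thesis
      using base_mor_slice[OF a(1)] base_mor_slice[OF a(2)] slice_jointly_monic by (simp add: base_obj_def)
  qed
  fix x y e assume o: "x \<in> Obj C" "y \<in> Obj C" and e: "epic C x y e"
  have a: "arr C x y e" using e o by (simp add: epic_iff)
  note E = epic_pullback[OF base_square[OF a] e]
  show "epic B (Fo x) (Fo y) (Fm x y e)"
    using E(1) slice_epic[OF base_obj_arr(2)[OF o(1)] base_obj_arr(2)[OF o(2)]] base_mor_slice[OF a]
    by (simp add: base_obj_def)
  show "\<delta>B (Fo x) (Fo y) (Fm x y e) = \<delta> x y e" using E(2) by (simp add: slice_degree_def base_obj_def)
next
  fix x y z f g p a b assume R: "pullback C x y z f g p a b"
  note A = pullback_arr[OF R]
  have o: "p \<in> Obj C" "x \<in> Obj C" "y \<in> Obj C" "z \<in> Obj C" using A by (auto simp: arr_def)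
  note Q = base_obj_arr
  \<comment> \<open>The rectangle obtained by pasting \<open>R\<close> with the base square of
    \<open>b\<close> is also a rectangle built on \<open>fP\<close>; cancelling \<open>fP\<close>
    leaves the required square.\<close>
  have fP: "pullback C x (P z) z f (\<pi> z) (P x) (\<pi> x) (Fm x z f)" by (rule base_square[OF A(1)])
  have "pullback C x (P y) z f (Cmp C (P y) y z g (\<pi> y)) (P p) (Cmp C (P p) p x a (\<pi> p)) (Fm p y b)"
    by (rule pullback_pasting[OF R base_square[OF A(4)]])
  then have "pullback C (P x) (P y) (P z) (Fm x z f) (Fm y z g) (P p) (Fm p x a) (Fm p y b)"
  proof (intro pullback_cancel[OF fP])
    show "Cmp C (P p) (P x) (P z) (Fm x z f) (Fm p x a) = Cmp C (P p) (P y) (P z) (Fm y z g) (Fm p y b)"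
    proof (rule base_ext[OF o(4)])
      show "arr C (P p) (P z) (Cmp C (P p) (P x) (P z) (Fm x z f) (Fm p x a))"
        by (rule arr_comp[OF base_mor_arr(1)[OF A(3)] base_mor_arr(1)[OF A(1)]])
      show "arr C (P p) (P z) (Cmp C (P p) (P y) (P z) (Fm y z g) (Fm p y b))"
        by (rule arr_comp[OF base_mor_arr(1)[OF A(4)] base_mor_arr(1)[OF A(2)]])
    qed (simp_all only: base_mor_comp[OF A(1) base_mor_arr(1)[OF A(3)]] base_mor_comp[OF A(2) base_mor_arr(1)[OF A(4)]]
          base_mor_arr(2,3)[OF A(3)] base_mor_arr(2,3)[OF A(4)] comp_eq_extend[OF A(5) Q(1)[OF o(1)] A(3,1,4,2)])
  qed (use base_mor_arr[OF A(2)] base_mor_arr[OF A(3)] base_mor_arr[OF A(4)] in simp_all)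
  then show "pullback B (Fo x) (Fo y) (Fo z) (Fm x z f) (Fm y z g) (Fo p) (Fm p x a) (Fm p y b)"
    using slice_pullback base_mor_slice[OF A(1)] base_mor_slice[OF A(2)] base_mor_slice[OF A(3)] base_mor_slice[OF A(4)]
    by (simp add: base_obj_def)
next
  fix x y z f g
  assume f: "arr C x z f" and g: "arr C y z g" and "has_pullback B (Fo x) (Fo y) (Fo z) (Fm x z f) (Fm y z g)"
  then have "has_pullback C (P x) (P y) (P z) (Fm x z f) (Fm y z g)"
    using slice_has_pullback base_mor_slice[OF f] base_mor_slice[OF g] by (simp add: base_obj_def)
  then obtain w u v where w: "arr C w (P x) u" "arr C w (P y) v"
    "Cmp C w (P x) (P z) (Fm x z f) u = Cmp C w (P y) (P z) (Fm y z g) v"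
    using has_pullback_iff[OF base_mor_arr(1)[OF f] base_mor_arr(1)[OF g]] by blast
  \<comment> \<open>Forgetting the \<open>x0\<close> coordinate turns a cone over the images into a
    cone over the given cospan.\<close>
  have "arr C w x (Cmp C w (P x) x (\<pi> x) u)" "arr C w y (Cmp C w (P y) y (\<pi> y) v)"
    using w base_obj_arr f g by (auto simp: arr_dom)
  then show "has_pullback C x y z f g"
    unfolding has_pullback_iff[OF f g] using base_mor_comp(1)[OF f w(1)] base_mor_comp(1)[OF g w(2)] w(3) by metis
qed

text \<open>The graph of the structure map \<open>p\<close>, a section of the projection to
  \<open>z\<close>.\<close>

definition \<eta> :: "'o \<times> 'a \<Rightarrow> 'a" where
  "\<eta> = (\<lambda>(z, p). pair C z z x0 (Idn C z) p)"

lemma unit_base: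
  assumes "arr C z x0 p"
  shows "arr C z (P z) (\<eta> (z, p))" "Cmp C z (P z) z (\<pi> z) (\<eta> (z, p)) = Idn C z"
    "Cmp C z (P z) x0 (\<rho> z) (\<eta> (z, p)) = p" "arr B (z, p) (Fo z) (\<eta> (z, p))"
proof -
  have z: "z \<in> Obj C" using assms by (simp add: arr_def)
  note h = pair_lift[OF arr_id[OF z] assms]
  show "arr C z (P z) (\<eta> (z, p))" "Cmp C z (P z) z (\<pi> z) (\<eta> (z, p)) = Idn C z"
    "Cmp C z (P z) x0 (\<rho> z) (\<eta> (z, p)) = p" using h by (simp_all add: \<eta>_def)
  then show "arr B (z, p) (Fo z) (\<eta> (z, p))" using assms base_obj_arr[OF z] by (simp add: base_obj_def sarr_iff)
qed

lemma unit_comp: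
  assumes "arr C z x0 p" "arr C t z u"
  shows "Cmp C t (P z) z (\<pi> z) (Cmp C t z (P z) (\<eta> (z, p)) u) = u"
    "Cmp C t (P z) x0 (\<rho> z) (Cmp C t z (P z) (\<eta> (z, p)) u) = Cmp C t z x0 p u"
proof -
  have z: "z \<in> Obj C" using assms by (simp add: arr_def)
  note h = unit_base[OF assms(1)] base_obj_arr[OF z]
  show "Cmp C t (P z) z (\<pi> z) (Cmp C t z (P z) (\<eta> (z, p)) u) = u"
    using comp_asc[OF assms(2) h(1) h(5)] h(2) assms by simp
  show "Cmp C t (P z) x0 (\<rho> z) (Cmp C t z (P z) (\<eta> (z, p)) u) = Cmp C t z x0 p u"
    using comp_asc[OF assms(2) h(1) h(6)] h(3) by simp
qed

text \<open>If \<open>u\<close> and \<open>v\<close> agree in \<open>z \<times> x0\<close>, then the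
  \<open>x0\<close> coordinate of \<open>v\<close> is forced by \<open>u\<close>. So
  \<open>v\<close> is determined by its coordinate in \<open>r\<close>, and this coordinate is the
  lift.\<close>

lemma unit_square:
  assumes "arr B (r, s) (z, p) a"
  shows "Cmp C r z (P z) (\<eta> (z, p)) a = Cmp C r (P r) (P z) (Fm r z a) (\<eta> (r, s))"
    "pullback C z (P r) (P z) (\<eta> (z, p)) (Fm r z a) r a (\<eta> (r, s))"
proof -
  have a: "arr C r z a" "arr C z x0 p" "arr C r x0 s" "Cmp C r z x0 p a = s" using assms by (auto simp: sarr_iff)
  have o: "z \<in> Obj C" "r \<in> Obj C" using a by (auto simp: arr_def)
  note e = unit_base[OF a(2)] unit_base[OF a(3)]
  show eq: "Cmp C r z (P z) (\<eta> (z, p)) a = Cmp C r (P r) (P z) (Fm r z a) (\<eta> (r, s))"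
    by (rule base_ext[OF o(1) arr_comp[OF a(1) e(1)] arr_comp[OF e(5) base_mor_arr(1)[OF a(1)]]])
      (simp_all only: unit_comp[OF a(2,1)] base_mor_comp[OF a(1) e(5)] e(6,7) comp_id[OF a(1)] a(4))
  show "pullback C z (P r) (P z) (\<eta> (z, p)) (Fm r z a) r a (\<eta> (r, s))"
  proof (rule pullbackI[OF e(1) base_mor_arr(1)[OF a(1)] _ eq])
    show "jointly_monic C z (P r) r a (\<eta> (r, s))"
      unfolding jointly_monic_def
    proof (intro conjI allI impI)
      fix w g h assume "arr C w r g" "arr C w r h" "Cmp C w r (P r) (\<eta> (r, s)) g = Cmp C w r (P r) (\<eta> (r, s)) h"
      then show "g = h" using unit_comp(1)[OF a(3)] by metis
    qed (use a e in auto)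
    fix w u v assume u: "arr C w z u" "arr C w (P r) v"
      "Cmp C w z (P z) (\<eta> (z, p)) u = Cmp C w (P r) (P z) (Fm r z a) v"
    note rp = base_obj_arr[OF o(2)]
    let ?h = "Cmp C w (P r) r (\<pi> r) v"
    have h: "arr C w r ?h" using u rp by auto
    have ah: "Cmp C w r z a ?h = u" using unit_comp(1)[OF a(2) u(1)] base_mor_comp(1)[OF a(1) u(2)] u(3) by simp
    moreover have "Cmp C w r (P r) (\<eta> (r, s)) ?h = v"
    proof (rule base_ext[OF o(2) _ u(2)])
      show "Cmp C w (P r) x0 (\<rho> r) (Cmp C w r (P r) (\<eta> (r, s)) ?h) = Cmp C w (P r) x0 (\<rho> r) v"
        using unit_comp(2)[OF a(3) h] unit_comp(2)[OF a(2) u(1)] base_mor_comp(2)[OF a(1) u(2)] u(3)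
          comp_asc[OF h a(1,2)] a(4) ah by simp
    qed (use unit_comp(1)[OF a(3) h] h e in auto)
    ultimately show "\<exists>h. arr C w r h \<and> Cmp C w r z a h = u \<and> Cmp C w r (P r) (\<eta> (r, s)) h = v" using h by blast
  qed
qed

lemma semi_adjunction_base:
  "semi_adjunction C B Fo Fm fst (\<lambda>_ _ f. f) \<eta> \<pi>"
proof (intro semi_adjunction.intro semi_adjunction_axioms.intro base_functor forgetful_functor)
  show "arr B z (Fo (fst z)) (\<eta> z)" if "z \<in> Obj B" for z using that unit_base(4) by (cases z) (simp add: sobj_iff)
  show "arr C (fst (Fo x)) x (\<pi> x)" if "x \<in> Obj C" for x using base_obj_arr[OF that] by (simp add: base_obj_def)
  show "Cmp B z (Fo (fst z)) (Fo (fst w)) (Fm (fst z) (fst w) g) (\<eta> z) = Cmp B z w (Fo (fst w)) (\<eta> w) g"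
    if "arr B z w g" for z w g
    using unit_square(1)[of "fst z" "snd z" "fst w" "snd w" g] that
    by (cases z; cases w) (simp add: base_obj_def)
  show "Cmp C (fst (Fo x)) x y f (\<pi> x) = Cmp C (fst (Fo x)) (fst (Fo y)) y (\<pi> y) (Fm x y f)"
    if "arr C x y f" for x y f using base_mor_arr(2)[OF that] by (simp add: base_obj_def)
  show "Cmp B (Fo x) (Fo (fst (Fo x))) (Fo x) (Fm (fst (Fo x)) x (\<pi> x)) (\<eta> (Fo x)) = Idn B (Fo x)"
    if x: "x \<in> Obj C" for x
  proof -
    note P = base_obj_arr[OF x] note e = unit_base[OF P(2)]
    have "Cmp C (P x) (P (P x)) (P x) (Fm (P x) x (\<pi> x)) (\<eta> (P x, \<rho> x)) = Idn C (P x)"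
      by (rule base_ext[OF x arr_comp[OF e(1) base_mor_arr(1)[OF P(1)]] arr_id[OF P(5)]])
        (simp_all only: base_mor_comp[OF P(1) e(1)] e(2,3) comp_id[OF P(1)] comp_id[OF P(2)])
    then show ?thesis by (simp add: base_obj_def)
  qed
qed

text \<open>Unit and counit enter as graphs. Their naturality squares are the pullbacks
  \<open>unit_square\<close> and \<open>base_square\<close>, as \<open>T0_natural\<close> demands;
  the triangle identity is one between graphs.\<close>

lemma semi_adjunction_T0:
  "semi_adjunction (T0 C \<delta>) (T0 B \<delta>B) Fo F.T0F fst U.T0F
     (\<lambda>z. graph_rel B z (Fo (fst z)) (\<eta> z)) (\<lambda>x. graph_rel C (P x) x (\<pi> x))"
proof -
  interpret adj: semi_adjunction C B Fo Fm fst "\<lambda>_ _ f. f" \<eta> \<pi> by (rule semi_adjunction_base)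
  interpret FT: preadditive_functor "T0 C \<delta>" "T0 B \<delta>B" Fo F.T0F by (rule F.preadditive_functor_ind)
  interpret UT: preadditive_functor "T0 B \<delta>B" "T0 C \<delta>" fst U.T0F by (rule U.preadditive_functor_ind)
  have fst_Fo [simp]: "fst (Fo x) = P x" for x by (simp add: base_obj_def)
  show ?thesis
  proof (intro semi_adjunction.intro FT.cat_functor_axioms UT.cat_functor_axioms semi_adjunction_axioms.intro)
    show "arr (T0 B \<delta>B) z (Fo (fst z)) (graph_rel B z (Fo (fst z)) (\<eta> z))" if "z \<in> Obj (T0 B \<delta>B)" for z
      using adj.unit_arr that by (intro S.graph_rel_arr) simp
    show "arr (T0 C \<delta>) (fst (Fo x)) x (graph_rel C (P x) x (\<pi> x))" if "x \<in> Obj (T0 C \<delta>)" for x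
      using base_obj_arr(1)[of x] that by (simp add: graph_rel_arr)
    show "Cmp (T0 B \<delta>B) z (Fo (fst z)) (Fo (fst w)) (F.T0F (fst z) (fst w) (U.T0F z w \<phi>)) (graph_rel B z (Fo (fst z)) (\<eta> z))
      = Cmp (T0 B \<delta>B) z w (Fo (fst w)) (graph_rel B w (Fo (fst w)) (\<eta> w)) \<phi>"
      if "arr (T0 B \<delta>B) z w \<phi>" for z w \<phi>
    proof (rule S.T0_eqI[OF _ _ that])
      fix p a b assume a: "arr B p z a" "arr B p w b"
      have o: "p \<in> Obj B" "z \<in> Obj B" "w \<in> Obj B" using a by (auto simp: arr_def)
      \<comment> \<open>The square is known to be a pullback in \<open>C\<close>; it is needed in
        the slice.\<close>
      have "pullback B z (Fo (fst p)) (Fo (fst z)) (\<eta> z) (Fm (fst p) (fst z) a) p a (\<eta> p)"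
        using unit_square(2)[of "fst p" "snd p" "fst z" "snd z" a] a(1) adj.unit_arr[OF o(1)] adj.unit_arr[OF o(2)]
          F.F_arr[OF U.F_arr[OF a(1)]]
        by (cases p; cases z) (simp add: slice_pullback base_obj_def)
      from S.T0_natural[OF adj.unit_arr[OF o(2)] adj.unit_arr[OF o(3)] a(2) F.F_arr[OF U.F_arr[OF a(2)]] this]
      show "Cmp (T0 B \<delta>B) z (Fo (fst z)) (Fo (fst w)) (F.T0F (fst z) (fst w) (U.T0F z w (S.sp z w p a b)))
          (graph_rel B z (Fo (fst z)) (\<eta> z))
        = Cmp (T0 B \<delta>B) z w (Fo (fst w)) (graph_rel B w (Fo (fst w)) (\<eta> w)) (S.sp z w p a b)"
        unfolding U.ind_span[OF a] F.ind_span[OF U.F_arr[OF a(1)] U.F_arr[OF a(2)]]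
        using adj.unit_natural[OF a(2)] by simp
    qed (intro klinear_T0_compI klinear_comp[OF F.klinear_ind U.klinear_ind] klinear_ident)+
    show "Cmp (T0 C \<delta>) (fst (Fo x)) x y \<phi> (graph_rel C (P x) x (\<pi> x))
      = Cmp (T0 C \<delta>) (fst (Fo x)) (fst (Fo y)) y (graph_rel C (P y) y (\<pi> y)) (U.T0F (Fo x) (Fo y) (F.T0F x y \<phi>))"
      if "arr (T0 C \<delta>) x y \<phi>" for x y \<phi>
    proof (rule T0_eqI[OF _ _ that])
      fix p a b assume a: "arr C p x a" "arr C p y b"
      have o: "p \<in> Obj C" "x \<in> Obj C" "y \<in> Obj C" using a by (auto simp: arr_def)
      show "Cmp (T0 C \<delta>) (fst (Fo x)) x y (sp x y p a b) (graph_rel C (P x) x (\<pi> x))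
        = Cmp (T0 C \<delta>) (fst (Fo x)) (fst (Fo y)) y (graph_rel C (P y) y (\<pi> y)) (U.T0F (Fo x) (Fo y) (F.T0F x y (sp x y p a b)))"
        unfolding F.ind_span[OF a] U.ind_span[OF F.F_arr[OF a(1)] F.F_arr[OF a(2)]] fst_Fo
        by (rule T0_natural[OF base_obj_arr(1)[OF o(2)] base_obj_arr(1)[OF o(3)] base_mor_arr(1)[OF a(2)] a(2)
              pullback_sym[OF base_square[OF a(1)]] base_mor_arr(2)[OF a(2)], symmetric])
    qed (intro klinear_T0_compI klinear_comp[OF U.klinear_ind F.klinear_ind] klinear_ident)+
    show "Cmp (T0 B \<delta>B) (Fo x) (Fo (fst (Fo x))) (Fo x) (F.T0F (fst (Fo x)) x (graph_rel C (P x) x (\<pi> x)))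
        (graph_rel B (Fo x) (Fo (fst (Fo x))) (\<eta> (Fo x))) = Idn (T0 B \<delta>B) (Fo x)"
      if "x \<in> Obj (T0 C \<delta>)" for x
    proof -
      have x: "x \<in> Obj C" using that by simp
      note p = base_obj_arr(1)[OF x]
      show ?thesis
        using S.T0_comp_graph[OF adj.unit_arr[OF F.F_obj[OF x]], of "Fo x" "Fm (P x) x (\<pi> x)"]
          base_mor_slice[OF p] adj.triangle[OF x] by (simp add: F.ind_graph[OF p])
    qed
  qed
qed

lemma base_preserves_finite_limits:
  "preserves_finite_limits C B Fo Fm"
  "preserves_finite_limits (T C \<delta>) (T B \<delta>B) (ind_T_obj C B Fo Fm) (ind_T_mor C B Fo Fm)"
  unfolding T_def ind_T_obj_def ind_T_mor_def
  by (rule semi_adjunction.preserves_finite_limits[OF semi_adjunction_base])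
    (rule karoubi_additive_semi_adjunction[OF semi_adjunction_T0 F.preadditive_functor_ind U.preadditive_functor_ind])

end

section \<open>Tensor products of relations\<close>

text \<open>
  A tensor product \<open>x \<otimes> y\<close> that is defined only if \<open>ex x y\<close> holds. The tensor product of composites
  vanishes if the intermediate tensor product is not defined.
\<close>

locale partial_tensor = category C
  for C :: "('o, 'v::ab_group_add, 'k) lincat" and ex :: "'o \<Rightarrow> 'o \<Rightarrow> bool" and S :: "('o, 'v) tensor" +
  assumes unit_obj: "tunit S \<in> Obj C"
    and tobj_obj: "x \<in> Obj C \<Longrightarrow> y \<in> Obj C \<Longrightarrow> ex x y \<Longrightarrow> tobj S x y \<in> Obj C"
    and ex_assoc: "x \<in> Obj C \<Longrightarrow> y \<in> Obj C \<Longrightarrow> z \<in> Obj C \<Longrightarrow>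
      ex x y \<and> ex (tobj S x y) z \<longleftrightarrow> ex y z \<and> ex x (tobj S y z)"
    and ex_unit: "x \<in> Obj C \<Longrightarrow> ex (tunit S) x" "x \<in> Obj C \<Longrightarrow> ex x (tunit S)"
    and ex_sym: "x \<in> Obj C \<Longrightarrow> y \<in> Obj C \<Longrightarrow> ex x y \<Longrightarrow> ex y x"
    and tmor_arr: "arr C x x' f \<Longrightarrow> arr C y y' g \<Longrightarrow> ex x y \<Longrightarrow> ex x' y' \<Longrightarrow>
      arr C (tobj S x y) (tobj S x' y') (tmor S x x' y y' f g)"
    and tmor_id: "x \<in> Obj C \<Longrightarrow> y \<in> Obj C \<Longrightarrow> ex x y \<Longrightarrow>
      tmor S x x y y (Idn C x) (Idn C y) = Idn C (tobj S x y)"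
    and tmor_comp: "arr C x x' f \<Longrightarrow> arr C x' x'' f' \<Longrightarrow> arr C y y' g \<Longrightarrow> arr C y' y'' g' \<Longrightarrow> ex x y \<Longrightarrow> ex x'' y'' \<Longrightarrow>
      tmor S x x'' y y'' (Cmp C x x' x'' f' f) (Cmp C y y' y'' g' g)
        = (if ex x' y' then Cmp C (tobj S x y) (tobj S x' y') (tobj S x'' y'')
             (tmor S x' x'' y' y'' f' g') (tmor S x x' y y' f g) else 0)"
    and assoc_arr: "x \<in> Obj C \<Longrightarrow> y \<in> Obj C \<Longrightarrow> z \<in> Obj C \<Longrightarrow> ex x y \<Longrightarrow> ex (tobj S x y) z \<Longrightarrow>
      arr C (tobj S (tobj S x y) z) (tobj S x (tobj S y z)) (tassoc S x y z)"
    and lunit_arr: "x \<in> Obj C \<Longrightarrow> arr C (tobj S (tunit S) x) x (tlunit S x)"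
    and runit_arr: "x \<in> Obj C \<Longrightarrow> arr C (tobj S x (tunit S)) x (trunit S x)"
    and braid_arr: "x \<in> Obj C \<Longrightarrow> y \<in> Obj C \<Longrightarrow> ex x y \<Longrightarrow> arr C (tobj S x y) (tobj S y x) (tbraid S x y)"
    and assoc_natural: "arr C x x' f \<Longrightarrow> arr C y y' g \<Longrightarrow> arr C z z' h \<Longrightarrow> ex x y \<Longrightarrow> ex (tobj S x y) z \<Longrightarrow>
      ex x' y' \<Longrightarrow> ex (tobj S x' y') z' \<Longrightarrow>
      Cmp C (tobj S (tobj S x y) z) (tobj S (tobj S x' y') z') (tobj S x' (tobj S y' z')) (tassoc S x' y' z')
        (tmor S (tobj S x y) (tobj S x' y') z z' (tmor S x x' y y' f g) h)
      = Cmp C (tobj S (tobj S x y) z) (tobj S x (tobj S y z)) (tobj S x' (tobj S y' z'))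
        (tmor S x x' (tobj S y z) (tobj S y' z') f (tmor S y y' z z' g h)) (tassoc S x y z)"
    and braid_natural: "arr C x x' f \<Longrightarrow> arr C y y' g \<Longrightarrow> ex x y \<Longrightarrow> ex x' y' \<Longrightarrow>
      Cmp C (tobj S x y) (tobj S x' y') (tobj S y' x') (tbraid S x' y') (tmor S x x' y y' f g)
      = Cmp C (tobj S x y) (tobj S y x) (tobj S y' x') (tmor S y y' x x' g f) (tbraid S x y)"

locale additive_partial_tensor = partial_tensor C ex S + preadditive C
  for C :: "('o, 'v::ab_group_add, 'k) lincat" and ex :: "'o \<Rightarrow> 'o \<Rightarrow> bool" and S :: "('o, 'v) tensor" +
  assumes tmor_add_left: "arr C x x' f \<Longrightarrow> arr C x x' f' \<Longrightarrow> arr C y y' g \<Longrightarrow> ex x y \<Longrightarrow> ex x' y' \<Longrightarrow>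
      tmor S x x' y y' (f + f') g = tmor S x x' y y' f g + tmor S x x' y y' f' g"
    and tmor_add_right: "arr C x x' f \<Longrightarrow> arr C y y' g \<Longrightarrow> arr C y y' g' \<Longrightarrow> ex x y \<Longrightarrow> ex x' y' \<Longrightarrow>
      tmor S x x' y y' f (g + g') = tmor S x x' y y' f g + tmor S x x' y y' f g'"

definition prod_map :: "('o, 'a, 'r) cat_scheme \<Rightarrow> 'o \<Rightarrow> 'o \<Rightarrow> 'o \<Rightarrow> 'o \<Rightarrow> 'a \<Rightarrow> 'a \<Rightarrow> 'a" where
  "prod_map C p x q y f g = pair C (prd C p q) x y
     (Cmp C (prd C p q) p x f (pr1 C p q)) (Cmp C (prd C p q) q y g (pr2 C p q))"

section \<open>Products of morphisms\<close>

context regular_category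
begin

text \<open>A single object over both factors decides existence, so products propagate along
  morphisms out of the factors, and questions about iterated products become symmetric.\<close>

lemma hprod_iff: "hprod C x y \<longleftrightarrow> (\<exists>w u v. arr C w x u \<and> arr C w y v)"
  using hprodI pr_arr by metis

lemma hprod_iff_has_product: "x \<in> Obj C \<Longrightarrow> y \<in> Obj C \<Longrightarrow> hprod C x y \<longleftrightarrow> has_product C x y"
  by (simp add: hprod_def)

lemma hprod_iff_has_pullback:
  assumes "x \<in> Obj C" "y \<in> Obj C"
  shows "hprod C x y \<longleftrightarrow> has_pullback C x y (terminal_of C) (bang C x) (bang C y)"
proof
  show "has_pullback C x y (terminal_of C) (bang C x) (bang C y)" if "hprod C x y"
    using has_pullbackI[OF product_pullback[OF product_chosen[OF that]]] .
  assume "has_pullback C x y (terminal_of C) (bang C x) (bang C y)"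
  then obtain w u v where "pullback C x y (terminal_of C) (bang C x) (bang C y) w u v"
    using has_pullback_obtain bang_arr assms by metis
  then show "hprod C x y" using hprodI pullback_arr(3,4) by metis
qed

lemma hprod_map: "hprod C p q \<Longrightarrow> arr C p x f \<Longrightarrow> arr C q y g \<Longrightarrow> hprod C x y"
  unfolding hprod_iff using arr_comp by blast

lemma hprod_sym: "hprod C x y \<Longrightarrow> hprod C y x"
  unfolding hprod_iff by blast

lemma prod_map_arr:
  assumes "hprod C p q" "arr C p x f" "arr C q y g"
  shows "arr C (prd C p q) (prd C x y) (prod_map C p x q y f g)"
    "Cmp C (prd C p q) (prd C x y) x (pr1 C x y) (prod_map C p x q y f g) = Cmp C (prd C p q) p x f (pr1 C p q)"
    "Cmp C (prd C p q) (prd C x y) y (pr2 C x y) (prod_map C p x q y f g) = Cmp C (prd C p q) q y g (pr2 C p q)"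
  unfolding prod_map_def
  by (rule pair_lift[OF arr_comp[OF pr_arr(1)[OF assms(1)] assms(2)] arr_comp[OF pr_arr(2)[OF assms(1)] assms(3)]])+

lemma prod_map_comp:
  assumes "hprod C p q" "arr C p x f" "arr C q y g" "arr C w (prd C p q) u"
  shows "Cmp C w (prd C x y) x (pr1 C x y) (Cmp C w (prd C p q) (prd C x y) (prod_map C p x q y f g) u)
      = Cmp C w p x f (Cmp C w (prd C p q) p (pr1 C p q) u)"
    "Cmp C w (prd C x y) y (pr2 C x y) (Cmp C w (prd C p q) (prd C x y) (prod_map C p x q y f g) u)
      = Cmp C w q y g (Cmp C w (prd C p q) q (pr2 C p q) u)"
proof -
  note M = prod_map_arr[OF assms(1-3)] and P = pr_arr[OF assms(1)] and Q = pr_arr[OF hprod_map[OF assms(1-3)]]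
  show "Cmp C w (prd C x y) x (pr1 C x y) (Cmp C w (prd C p q) (prd C x y) (prod_map C p x q y f g) u)
      = Cmp C w p x f (Cmp C w (prd C p q) p (pr1 C p q) u)"
    by (rule comp_eq_extend[OF M(2) assms(4) M(1) Q(1) P(1) assms(2)])
  show "Cmp C w (prd C x y) y (pr2 C x y) (Cmp C w (prd C p q) (prd C x y) (prod_map C p x q y f g) u)
      = Cmp C w q y g (Cmp C w (prd C p q) q (pr2 C p q) u)"
    by (rule comp_eq_extend[OF M(3) assms(4) M(1) Q(2) P(2) assms(3)])
qed

lemma prod_map_id: "hprod C x y \<Longrightarrow> prod_map C x x y y (Idn C x) (Idn C y) = Idn C (prd C x y)"
proof -
  assume h: "hprod C x y"
  note P = pr_arr[OF h] and o = hprod_obj[OF h] note M = prod_map_arr[OF h arr_id[OF o(1)] arr_id[OF o(2)]]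
  show ?thesis
    by (rule prd_ext[OF h M(1) arr_id[OF o(3)]]) (simp_all only: M(2,3) comp_id[OF P(1)] comp_id[OF P(2)])
qed

lemma prod_map_prod_map:
  assumes h: "hprod C p q" and f: "arr C p x f" "arr C q y g" and k: "arr C x x' f'" "arr C y y' g'"
  shows "Cmp C (prd C p q) (prd C x y) (prd C x' y') (prod_map C x x' y y' f' g') (prod_map C p x q y f g)
    = prod_map C p x' q y' (Cmp C p x x' f' f) (Cmp C q y y' g' g)"
proof -
  note h' = hprod_map[OF h f] note h'' = hprod_map[OF h' k]
  note M = prod_map_arr[OF h f] and M' = prod_map_arr[OF h' k] and N = prod_map_arr[OF h arr_comp[OF f(1) k(1)] arr_comp[OF f(2) k(2)]]
  show ?thesis
    by (rule prd_ext[OF h'' arr_comp[OF M(1) M'(1)] N(1)])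
      (simp_all only: prod_map_comp[OF h' k M(1)] M N comp_asc[OF pr_arr(1)[OF h] f(1) k(1)] comp_asc[OF pr_arr(2)[OF h] f(2) k(2)])
qed

lemma product_iso:
  assumes "product C x y p a b" "product C x y q c d" "arr C q p h"
    "Cmp C q p x a h = c" "Cmp C q p y b h = d"
  shows "iso C q p h"
proof -
  note A = product_arr[OF assms(1)] product_arr[OF assms(2)]
  obtain k where k: "arr C p q k" "Cmp C p q x c k = a" "Cmp C p q y d k = b"
    by (rule product_lift[OF assms(2) A(1,2)])
  have o: "p \<in> Obj C" "q \<in> Obj C" using A by (auto simp: arr_def)
  show ?thesis
  proof (rule isoI[OF assms(3) k(1)])
    show "Cmp C q p q k h = Idn C q"
      by (rule jointly_monicD[OF product_jointly_monic[OF assms(2)] arr_comp[OF assms(3) k(1)] arr_id[OF o(2)]])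
        (simp_all only: comp_asc[OF assms(3) k(1) A(3), symmetric] comp_asc[OF assms(3) k(1) A(4), symmetric] k(2,3) assms(4,5)
          comp_id[OF A(3)] comp_id[OF A(4)])
    show "Cmp C p q p h k = Idn C p"
      by (rule jointly_monicD[OF product_jointly_monic[OF assms(1)] arr_comp[OF k(1) assms(3)] arr_id[OF o(1)]])
        (simp_all only: comp_asc[OF k(1) assms(3) A(1), symmetric] comp_asc[OF k(1) assms(3) A(2), symmetric] k(2,3) assms(4,5)
          comp_id[OF A(1)] comp_id[OF A(2)])
  qed
qed

text \<open>Limits commute with limits: a cone over the product cospan is a pair of cones. This is
  the compatibility of tensor product and composition at the level of spans.\<close>

lemma prod_map_pullback:
  assumes 1: "pullback C p1 p2 x b1 a2 W u1 u2" and 2: "pullback C q1 q2 y d1 c2 W' v1 v2" and h: "hprod C W W'"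
  shows "pullback C (prd C p1 q1) (prd C p2 q2) (prd C x y) (prod_map C p1 x q1 y b1 d1) (prod_map C p2 x q2 y a2 c2)
    (prd C W W') (prod_map C W p1 W' q1 u1 v1) (prod_map C W p2 W' q2 u2 v2)"
proof (rule pullbackI)
  note A = pullback_arr[OF 1] and B = pullback_arr[OF 2]
  note h1 = hprod_map[OF h A(3) B(3)] and h2 = hprod_map[OF h A(4) B(4)]
  note h0 = hprod_map[OF h1 A(1) B(1)]
  note M1 = prod_map_arr[OF h1 A(1) B(1)] and M2 = prod_map_arr[OF h2 A(2) B(2)]
    and N1 = prod_map_arr[OF h A(3) B(3)] and N2 = prod_map_arr[OF h A(4) B(4)]
  show "arr C (prd C p1 q1) (prd C x y) (prod_map C p1 x q1 y b1 d1)" "arr C (prd C p2 q2) (prd C x y) (prod_map C p2 x q2 y a2 c2)"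
    using M1 M2 by blast+
  show "Cmp C (prd C W W') (prd C p1 q1) (prd C x y) (prod_map C p1 x q1 y b1 d1) (prod_map C W p1 W' q1 u1 v1)
    = Cmp C (prd C W W') (prd C p2 q2) (prd C x y) (prod_map C p2 x q2 y a2 c2) (prod_map C W p2 W' q2 u2 v2)"
    by (simp only: prod_map_prod_map[OF h A(3) B(3) A(1) B(1)] prod_map_prod_map[OF h A(4) B(4) A(2) B(2)] A(5) B(5))
  show "jointly_monic C (prd C p1 q1) (prd C p2 q2) (prd C W W') (prod_map C W p1 W' q1 u1 v1) (prod_map C W p2 W' q2 u2 v2)"
    unfolding jointly_monic_def
  proof (intro conjI allI impI N1 N2)
    fix t g k
    assume g: "arr C t (prd C W W') g" and k: "arr C t (prd C W W') k"
      and e1: "Cmp C t (prd C W W') (prd C p1 q1) (prod_map C W p1 W' q1 u1 v1) g = Cmp C t (prd C W W') (prd C p1 q1) (prod_map C W p1 W' q1 u1 v1) k"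
      and e2: "Cmp C t (prd C W W') (prd C p2 q2) (prod_map C W p2 W' q2 u2 v2) g = Cmp C t (prd C W W') (prd C p2 q2) (prod_map C W p2 W' q2 u2 v2) k"
    note P = pr_arr[OF h]
    note c = prod_map_comp[OF h A(3) B(3) g] prod_map_comp[OF h A(4) B(4) g]
      prod_map_comp[OF h A(3) B(3) k] prod_map_comp[OF h A(4) B(4) k]
    show "g = k"
    proof (rule prd_ext[OF h g k])
      show "Cmp C t (prd C W W') W (pr1 C W W') g = Cmp C t (prd C W W') W (pr1 C W W') k"
        by (rule pullback_ext[OF 1 arr_comp[OF g P(1)] arr_comp[OF k P(1)]])
          (simp_all only: c(1,3,5,7)[symmetric] e1 e2)
      show "Cmp C t (prd C W W') W' (pr2 C W W') g = Cmp C t (prd C W W') W' (pr2 C W W') k"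
        by (rule pullback_ext[OF 2 arr_comp[OF g P(2)] arr_comp[OF k P(2)]])
          (simp_all only: c(2,4,6,8)[symmetric] e1 e2)
    qed
  qed
  fix t s s' assume s: "arr C t (prd C p1 q1) s" "arr C t (prd C p2 q2) s'"
    and eq: "Cmp C t (prd C p1 q1) (prd C x y) (prod_map C p1 x q1 y b1 d1) s = Cmp C t (prd C p2 q2) (prd C x y) (prod_map C p2 x q2 y a2 c2) s'"
  note P1 = pr_arr[OF h1] and P2 = pr_arr[OF h2] and P = pr_arr[OF h]
  note c = prod_map_comp[OF h1 A(1) B(1) s(1)] prod_map_comp[OF h2 A(2) B(2) s(2)]
  obtain k where k: "arr C t W k" "Cmp C t W p1 u1 k = Cmp C t (prd C p1 q1) p1 (pr1 C p1 q1) s"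
    "Cmp C t W p2 u2 k = Cmp C t (prd C p2 q2) p2 (pr1 C p2 q2) s'"
    by (rule pullback_lift[OF 1 arr_comp[OF s(1) P1(1)] arr_comp[OF s(2) P2(1)]]) (simp only: c(1,3)[symmetric] eq)
  obtain l where l: "arr C t W' l" "Cmp C t W' q1 v1 l = Cmp C t (prd C p1 q1) q1 (pr2 C p1 q1) s"
    "Cmp C t W' q2 v2 l = Cmp C t (prd C p2 q2) q2 (pr2 C p2 q2) s'"
    by (rule pullback_lift[OF 2 arr_comp[OF s(1) P1(2)] arr_comp[OF s(2) P2(2)]]) (simp only: c(2,4)[symmetric] eq)
  note H = pair_lift[OF k(1) l(1)]
  have "Cmp C t (prd C W W') (prd C p1 q1) (prod_map C W p1 W' q1 u1 v1) (pair C t W W' k l) = s"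
    by (rule prd_ext[OF h1 arr_comp[OF H(1) N1(1)] s(1)]) (simp_all only: prod_map_comp[OF h A(3) B(3) H(1)] H(2,3) k l)
  moreover have "Cmp C t (prd C W W') (prd C p2 q2) (prod_map C W p2 W' q2 u2 v2) (pair C t W W' k l) = s'"
    by (rule prd_ext[OF h2 arr_comp[OF H(1) N2(1)] s(2)]) (simp_all only: prod_map_comp[OF h A(4) B(4) H(1)] H(2,3) k l)
  ultimately show "\<exists>r. arr C t (prd C W W') r \<and> Cmp C t (prd C W W') (prd C p1 q1) (prod_map C W p1 W' q1 u1 v1) r = s \<and>
      Cmp C t (prd C W W') (prd C p2 q2) (prod_map C W p2 W' q2 u2 v2) r = s'"
    using H(1) by blast
qed

subsection \<open>Associativity and symmetry of products\<close>

text \<open>Either side says that some object has maps to \<open>x\<close>, \<open>y\<close> and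
  \<open>z\<close>.\<close>

lemma hprod_assoc:
  "hprod C x y \<and> hprod C (prd C x y) z \<longleftrightarrow> hprod C y z \<and> hprod C x (prd C y z)"
proof
  assume h: "hprod C x y \<and> hprod C (prd C x y) z"
  then obtain w u v where w: "arr C w (prd C x y) u" "arr C w z v" unfolding hprod_iff[of "prd C x y"] by blast
  note P = pr_arr[OF conjunct1[OF h]]
  show "hprod C y z \<and> hprod C x (prd C y z)"
    using hprodI[OF arr_comp[OF w(1) P(2)] w(2)]
      hprodI[OF arr_comp[OF w(1) P(1)] pair_lift(1)[OF arr_comp[OF w(1) P(2)] w(2)]] by blast
next
  assume h: "hprod C y z \<and> hprod C x (prd C y z)"
  then obtain w u v where w: "arr C w (prd C y z) u" "arr C w x v" unfolding hprod_iff[of x "prd C y z"] by blast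
  note P = pr_arr[OF conjunct1[OF h]]
  show "hprod C x y \<and> hprod C (prd C x y) z"
    using hprodI[OF w(2) arr_comp[OF w(1) P(1)]]
      hprodI[OF pair_lift(1)[OF w(2) arr_comp[OF w(1) P(1)]] arr_comp[OF w(1) P(2)]] by blast
qed

lemma prd_assoc_arr:
  assumes h: "hprod C x y" and k: "hprod C (prd C x y) z"
  shows "arr C (prd C (prd C x y) z) (prd C x (prd C y z)) (prd_assoc C x y z)"
    "Cmp C (prd C (prd C x y) z) (prd C x (prd C y z)) x (pr1 C x (prd C y z)) (prd_assoc C x y z)
      = Cmp C (prd C (prd C x y) z) (prd C x y) x (pr1 C x y) (pr1 C (prd C x y) z)"
    "Cmp C (prd C (prd C x y) z) (prd C y z) y (pr1 C y z)
      (Cmp C (prd C (prd C x y) z) (prd C x (prd C y z)) (prd C y z) (pr2 C x (prd C y z)) (prd_assoc C x y z))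
      = Cmp C (prd C (prd C x y) z) (prd C x y) y (pr2 C x y) (pr1 C (prd C x y) z)"
    "Cmp C (prd C (prd C x y) z) (prd C y z) z (pr2 C y z)
      (Cmp C (prd C (prd C x y) z) (prd C x (prd C y z)) (prd C y z) (pr2 C x (prd C y z)) (prd_assoc C x y z))
      = pr2 C (prd C x y) z"
proof -
  note P = pr_arr[OF h] and Q = pr_arr[OF k]
  note 1 = pair_lift[OF arr_comp[OF Q(1) P(2)] Q(2)]
  note 2 = pair_lift[OF arr_comp[OF Q(1) P(1)] 1(1)]
  have eq: "prd_assoc C x y z = pair C (prd C (prd C x y) z) x (prd C y z)
      (Cmp C (prd C (prd C x y) z) (prd C x y) x (pr1 C x y) (pr1 C (prd C x y) z))
      (pair C (prd C (prd C x y) z) y z (Cmp C (prd C (prd C x y) z) (prd C x y) y (pr2 C x y) (pr1 C (prd C x y) z)) (pr2 C (prd C x y) z))"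
    by (simp add: prd_assoc_def Let_def)
  show "arr C (prd C (prd C x y) z) (prd C x (prd C y z)) (prd_assoc C x y z)"
    "Cmp C (prd C (prd C x y) z) (prd C x (prd C y z)) x (pr1 C x (prd C y z)) (prd_assoc C x y z)
      = Cmp C (prd C (prd C x y) z) (prd C x y) x (pr1 C x y) (pr1 C (prd C x y) z)"
    "Cmp C (prd C (prd C x y) z) (prd C y z) y (pr1 C y z)
      (Cmp C (prd C (prd C x y) z) (prd C x (prd C y z)) (prd C y z) (pr2 C x (prd C y z)) (prd_assoc C x y z))
      = Cmp C (prd C (prd C x y) z) (prd C x y) y (pr2 C x y) (pr1 C (prd C x y) z)"
    "Cmp C (prd C (prd C x y) z) (prd C y z) z (pr2 C y z)
      (Cmp C (prd C (prd C x y) z) (prd C x (prd C y z)) (prd C y z) (pr2 C x (prd C y z)) (prd_assoc C x y z))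
      = pr2 C (prd C x y) z"
    unfolding eq using 2 by (simp_all only: 1 2)
qed

lemma triple_ext:
  assumes "hprod C y z" "hprod C x (prd C y z)" "arr C t (prd C x (prd C y z)) f" "arr C t (prd C x (prd C y z)) g"
    "Cmp C t (prd C x (prd C y z)) x (pr1 C x (prd C y z)) f = Cmp C t (prd C x (prd C y z)) x (pr1 C x (prd C y z)) g"
    "Cmp C t (prd C y z) y (pr1 C y z) (Cmp C t (prd C x (prd C y z)) (prd C y z) (pr2 C x (prd C y z)) f)
      = Cmp C t (prd C y z) y (pr1 C y z) (Cmp C t (prd C x (prd C y z)) (prd C y z) (pr2 C x (prd C y z)) g)"
    "Cmp C t (prd C y z) z (pr2 C y z) (Cmp C t (prd C x (prd C y z)) (prd C y z) (pr2 C x (prd C y z)) f)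
      = Cmp C t (prd C y z) z (pr2 C y z) (Cmp C t (prd C x (prd C y z)) (prd C y z) (pr2 C x (prd C y z)) g)"
  shows "f = g"
  by (rule prd_ext[OF assms(2,3,4,5)], rule prd_ext[OF assms(1) arr_comp[OF assms(3)] arr_comp[OF assms(4)] assms(6,7)])
    (rule pr_arr[OF assms(2)])+

lemma prd_assoc_comp:
  assumes h: "hprod C x y" "hprod C (prd C x y) z" and u: "arr C t (prd C (prd C x y) z) u"
  shows "Cmp C t (prd C x (prd C y z)) x (pr1 C x (prd C y z)) (Cmp C t (prd C (prd C x y) z) (prd C x (prd C y z)) (prd_assoc C x y z) u)
      = Cmp C t (prd C x y) x (pr1 C x y) (Cmp C t (prd C (prd C x y) z) (prd C x y) (pr1 C (prd C x y) z) u)"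
    "Cmp C t (prd C y z) y (pr1 C y z) (Cmp C t (prd C x (prd C y z)) (prd C y z) (pr2 C x (prd C y z))
        (Cmp C t (prd C (prd C x y) z) (prd C x (prd C y z)) (prd_assoc C x y z) u))
      = Cmp C t (prd C x y) y (pr2 C x y) (Cmp C t (prd C (prd C x y) z) (prd C x y) (pr1 C (prd C x y) z) u)"
    "Cmp C t (prd C y z) z (pr2 C y z) (Cmp C t (prd C x (prd C y z)) (prd C y z) (pr2 C x (prd C y z))
        (Cmp C t (prd C (prd C x y) z) (prd C x (prd C y z)) (prd_assoc C x y z) u))
      = Cmp C t (prd C (prd C x y) z) z (pr2 C (prd C x y) z) u"
proof -
  have h': "hprod C y z" "hprod C x (prd C y z)" using hprod_assoc h by blast+
  note P = pr_arr[OF h(1)] pr_arr[OF h(2)] pr_arr[OF h'(1)] pr_arr[OF h'(2)] and a = prd_assoc_arr[OF h]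
  show "Cmp C t (prd C x (prd C y z)) x (pr1 C x (prd C y z)) (Cmp C t (prd C (prd C x y) z) (prd C x (prd C y z)) (prd_assoc C x y z) u)
      = Cmp C t (prd C x y) x (pr1 C x y) (Cmp C t (prd C (prd C x y) z) (prd C x y) (pr1 C (prd C x y) z) u)"
    by (rule comp_eq_extend[OF a(2) u a(1) P(7) P(3,1)])
  have 2: "Cmp C t (prd C x (prd C y z)) (prd C y z) (pr2 C x (prd C y z))
        (Cmp C t (prd C (prd C x y) z) (prd C x (prd C y z)) (prd_assoc C x y z) u)
      = Cmp C t (prd C (prd C x y) z) (prd C y z)
        (Cmp C (prd C (prd C x y) z) (prd C x (prd C y z)) (prd C y z) (pr2 C x (prd C y z)) (prd_assoc C x y z)) u"
    by (rule comp_asc[OF u a(1) P(8), symmetric])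
  show "Cmp C t (prd C y z) y (pr1 C y z) (Cmp C t (prd C x (prd C y z)) (prd C y z) (pr2 C x (prd C y z))
        (Cmp C t (prd C (prd C x y) z) (prd C x (prd C y z)) (prd_assoc C x y z) u))
      = Cmp C t (prd C x y) y (pr2 C x y) (Cmp C t (prd C (prd C x y) z) (prd C x y) (pr1 C (prd C x y) z) u)"
    unfolding 2 by (rule comp_eq_extend[OF a(3) u arr_comp[OF a(1) P(8)] P(5) P(3,2)])
  show "Cmp C t (prd C y z) z (pr2 C y z) (Cmp C t (prd C x (prd C y z)) (prd C y z) (pr2 C x (prd C y z))
        (Cmp C t (prd C (prd C x y) z) (prd C x (prd C y z)) (prd_assoc C x y z) u))
      = Cmp C t (prd C (prd C x y) z) z (pr2 C (prd C x y) z) u"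
    unfolding 2 using comp_asc[OF u arr_comp[OF a(1) P(8)] P(6)] a(4) by simp
qed

lemma prd_assoc_iso:
  assumes h: "hprod C x y" "hprod C (prd C x y) z"
  shows "iso C (prd C (prd C x y) z) (prd C x (prd C y z)) (prd_assoc C x y z)"
proof -
  have h': "hprod C y z" "hprod C x (prd C y z)" using hprod_assoc h by blast+
  note P = pr_arr[OF h(1)] pr_arr[OF h(2)] pr_arr[OF h'(1)] pr_arr[OF h'(2)] and a = prd_assoc_arr[OF h]
  note ac = prd_assoc_comp[OF h]
  let ?q = "prd C x (prd C y z)" and ?p = "prd C (prd C x y) z"
  have o: "?q \<in> Obj C" "?p \<in> Obj C" using a(1) by (auto simp: arr_def)
  note q2 = arr_comp[OF P(8) P(5)] arr_comp[OF P(8) P(6)]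
  note 1 = pair_lift[OF P(7) q2(1)] note 2 = pair_lift[OF 1(1) q2(2)]
  let ?b = "pair C ?q (prd C x y) z (pair C ?q x y (pr1 C x (prd C y z)) (Cmp C ?q (prd C y z) y (pr1 C y z) (pr2 C x (prd C y z))))
      (Cmp C ?q (prd C y z) z (pr2 C y z) (pr2 C x (prd C y z)))"
  have ab: "Cmp C ?q ?p ?q (prd_assoc C x y z) ?b = Idn C ?q"
    by (rule triple_ext[OF h' arr_comp[OF 2(1) a(1)] arr_id[OF o(1)]])
      (simp_all only: ac[OF 2(1)] 1 2 comp_id[OF P(7)] comp_id[OF P(8)])
  have "Cmp C ?p ?q ?q (Cmp C ?q ?p ?q (prd_assoc C x y z) ?b) (prd_assoc C x y z) = prd_assoc C x y z"
    unfolding ab using a(1) by simp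
  then have aba: "Cmp C ?p ?p ?q (prd_assoc C x y z) (Cmp C ?p ?q ?p ?b (prd_assoc C x y z)) = prd_assoc C x y z"
    using comp_asc[OF a(1) 2(1) a(1)] by simp
  \<comment> \<open>The coordinates of a morphism into the left-hand product can be read off after
    \<open>prd_assoc\<close>, so it is enough that the two sides have the same composite with
    it.\<close>
  have ba: "Cmp C ?p ?q ?p ?b (prd_assoc C x y z) = Idn C ?p"
  proof -
    note k = arr_comp[OF a(1) 2(1)] arr_id[OF o(2)]
    have 3: "Cmp C ?p ?p (prd C x y) (pr1 C (prd C x y) z) (Cmp C ?p ?q ?p ?b (prd_assoc C x y z)) = Cmp C ?p ?p (prd C x y) (pr1 C (prd C x y) z) (Idn C ?p)"
      by (rule prd_ext[OF h(1) arr_comp[OF k(1) P(3)] arr_comp[OF k(2) P(3)]])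
        (simp_all only: ac[OF k(1), symmetric] aba ac[OF k(2), symmetric] comp_id[OF a(1)])
    show ?thesis
      by (rule prd_ext[OF h(2) k 3]) (simp only: ac(3)[OF k(1), symmetric] aba ac(3)[OF k(2), symmetric] comp_id[OF a(1)])
  qed
  show ?thesis by (rule isoI[OF a(1) 2(1) ba ab])
qed

lemma prd_assoc_natural:
  assumes h: "hprod C p q" "hprod C (prd C p q) r" and f: "arr C p x a" "arr C q y b" "arr C r z c"
  shows "Cmp C (prd C (prd C p q) r) (prd C (prd C x y) z) (prd C x (prd C y z)) (prd_assoc C x y z)
      (prod_map C (prd C p q) (prd C x y) r z (prod_map C p x q y a b) c)
    = Cmp C (prd C (prd C p q) r) (prd C p (prd C q r)) (prd C x (prd C y z))
      (prod_map C p x (prd C q r) (prd C y z) a (prod_map C q y r z b c)) (prd_assoc C p q r)"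
proof -
  have h': "hprod C q r" "hprod C p (prd C q r)" using hprod_assoc h by blast+
  note m = prod_map_arr[OF h(1) f(1,2)] note M = prod_map_arr[OF h(2) m(1) f(3)]
  note n = prod_map_arr[OF h'(1) f(2,3)] note N = prod_map_arr[OF h'(2) f(1) n(1)]
  note k = hprod_map[OF h(1) f(1,2)] hprod_map[OF h(2) m(1) f(3)] 
  have k': "hprod C y z" "hprod C x (prd C y z)" using hprod_assoc k by blast+
  note A = prd_assoc_arr[OF h] and B = prd_assoc_arr[OF k]
  note P = pr_arr[OF h(2)] pr_arr[OF h'(2)]
  show ?thesis
    by (rule triple_ext[OF k' arr_comp[OF M(1) B(1)] arr_comp[OF A(1) N(1)]])
      (simp_all only: prd_assoc_comp[OF k M(1)] M prod_map_comp[OF h(1) f(1,2) P(1)]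
        prod_map_comp[OF h'(2) f(1) n(1) A(1)] prod_map_comp[OF h'(1) f(2,3) arr_comp[OF A(1) P(4)]] A)
qed

abbreviation "swap x y \<equiv> pair C (prd C x y) y x (pr2 C x y) (pr1 C x y)"

text \<open>The object \<open>x \<times> y\<close> with its projections exchanged is a product of
  \<open>y\<close> and \<open>x\<close>.\<close>

lemma swap_iso: "hprod C x y \<Longrightarrow> iso C (prd C x y) (prd C y x) (swap x y)"
proof -
  assume h: "hprod C x y"
  note P = pr_arr[OF h] note s = pair_lift[OF P(2,1)]
  have "product C y x (prd C x y) (pr2 C x y) (pr1 C x y)"
    using product_chosen[OF h] pullback_sym unfolding product_iff_pullback by blast
  from product_iso[OF product_chosen[OF hprod_sym[OF h]] this s] show ?thesis .
qed

lemma swap_natural: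
  assumes h: "hprod C p q" and f: "arr C p x a" "arr C q y b"
  shows "Cmp C (prd C p q) (prd C x y) (prd C y x) (swap x y) (prod_map C p x q y a b)
    = Cmp C (prd C p q) (prd C q p) (prd C y x) (prod_map C q y p x b a) (swap p q)"
proof -
  note k = hprod_map[OF h f] note P = pr_arr[OF h] pr_arr[OF k]
  note s = pair_lift[OF P(2,1)] pair_lift[OF P(4,3)] and m = prod_map_arr[OF h f]
    and n = prod_map_arr[OF hprod_sym[OF h] f(2,1)]
  show ?thesis
    by (rule prd_ext[OF hprod_sym[OF k] arr_comp[OF m(1) s(4)] arr_comp[OF s(1) n(1)]])
      (simp_all only: prod_map_comp[OF hprod_sym[OF h] f(2,1) s(1)] s(2,3) pair_comp[OF P(4,3) m(1)]
        m(2,3) pair_lift[OF arr_comp[OF P(2) f(2)] arr_comp[OF P(1) f(1)]])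
qed

end

lemma T0_tensor_simps [simp]:
  "tobj (T0_tensor C) = prd C" "tunit (T0_tensor C) = terminal_of C"
  "tassoc (T0_tensor C) x y z = graph_rel C (prd C (prd C x y) z) (prd C x (prd C y z)) (prd_assoc C x y z)"
  "tlunit (T0_tensor C) x = graph_rel C (prd C (terminal_of C) x) x (pr2 C (terminal_of C) x)"
  "trunit (T0_tensor C) x = graph_rel C (prd C x (terminal_of C)) x (pr1 C x (terminal_of C))"
  "tbraid (T0_tensor C) x y = graph_rel C (prd C x y) (prd C y x) (pair C (prd C x y) y x (pr2 C x y) (pr1 C x y))"
  by (simp_all add: T0_tensor_def)

lemma T0_tmor_eq:
  "tmor (T0_tensor C) x x' y y' \<phi> \<psi> = lin_ext (\<lambda>R. lin_ext (\<lambda>S. rel_tensor C x x' y y' R S) \<psi>) \<phi>"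
  by (simp add: T0_tensor_def lin_ext_def scl_sum)

lemma klinear_T0_tmor:
  "klinear (\<lambda>\<phi>. tmor (T0_tensor C) x x' y y' \<phi> \<psi>)" "klinear (\<lambda>\<psi>. tmor (T0_tensor C) x x' y y' \<phi> \<psi>)"
  unfolding T0_tmor_eq by (rule klinear_lin_ext klinear_lin_ext_param)+

lemma klinear_T0_tmorI:
  assumes "klinear L"
  shows "klinear (\<lambda>\<phi>. tmor (T0_tensor C) x x' y y' (L \<phi>) \<psi>)" "klinear (\<lambda>\<phi>. tmor (T0_tensor C) x x' y y' \<psi> (L \<phi>))"
  by (rule klinear_comp[OF klinear_T0_tmor(1) assms] klinear_comp[OF klinear_T0_tmor(2) assms])+

section \<open>Tensor products of spans and their laws\<close>

context degree_category
begin

abbreviation Ten :: "('o, ('o \<times> 'a) set \<Rightarrow>\<^sub>0 'k) tensor" where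
  "Ten \<equiv> T0_tensor C"

text \<open>Writes the map from \<open>p\<close> to the terminal object through \<open>e\<close>,
  the shape in which the comparison lemmas for pullbacks apply to products.\<close>

lemma bang_comp: "arr C p r e \<Longrightarrow> Cmp C p r (terminal_of C) (bang C r) e = bang C p"
  using terminal_ext[OF arr_comp[OF _ bang_arr] bang_arr] by (meson arr_dom arr_cod)

text \<open>The product of two jointly monic pairs of legs is jointly monic, coordinate by
  coordinate, so it is a relation already and has coefficient 1.\<close>

lemma rel_tensor_rep:
  assumes "rep R = (r, m)" "rep S = (s, n)" "arr C r (prd C x x') m" "arr C s (prd C y y') n" "hprod C x x'" "hprod C y y'"
    and jR: "jointly_monic C x x' r (Cmp C r (prd C x x') x (pr1 C x x') m) (Cmp C r (prd C x x') x' (pr2 C x x') m)"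
    and jS: "jointly_monic C y y' s (Cmp C s (prd C y y') y (pr1 C y y') n) (Cmp C s (prd C y y') y' (pr2 C y y') n)"
  shows "rel_tensor C x x' y y' R S = (if hprod C r s then
    sp (prd C x y) (prd C x' y') (prd C r s)
      (prod_map C r x s y (Cmp C r (prd C x x') x (pr1 C x x') m) (Cmp C s (prd C y y') y (pr1 C y y') n))
      (prod_map C r x' s y' (Cmp C r (prd C x x') x' (pr2 C x x') m) (Cmp C s (prd C y y') y' (pr2 C y y') n)) else 0)"
proof (cases "hprod C r s")
  case True
  note P = pr_arr[OF True] note X = pr_arr[OF assms(5)] pr_arr[OF assms(6)]
  define r1 where "r1 = Cmp C r (prd C x x') x (pr1 C x x') m"
  define r2 where "r2 = Cmp C r (prd C x x') x' (pr2 C x x') m"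
  define s1 where "s1 = Cmp C s (prd C y y') y (pr1 C y y') n"
  define s2 where "s2 = Cmp C s (prd C y y') y' (pr2 C y y') n"
  note jR = jR[folded r1_def r2_def] and jS = jS[folded s1_def s2_def]
  note A = jointly_monic_arr[OF jR] jointly_monic_arr[OF jS]
  note M = prod_map_arr[OF True A(1,3)] and N = prod_map_arr[OF True A(2,4)]
  have jm: "jointly_monic C (prd C x y) (prd C x' y') (prd C r s) (prod_map C r x s y r1 s1) (prod_map C r x' s y' r2 s2)"
    unfolding jointly_monic_def
  proof (intro conjI allI impI M N)
    fix t g k
    assume g: "arr C t (prd C r s) g" "arr C t (prd C r s) k"
      and e: "Cmp C t (prd C r s) (prd C x y) (prod_map C r x s y r1 s1) g = Cmp C t (prd C r s) (prd C x y) (prod_map C r x s y r1 s1) k"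
      "Cmp C t (prd C r s) (prd C x' y') (prod_map C r x' s y' r2 s2) g = Cmp C t (prd C r s) (prd C x' y') (prod_map C r x' s y' r2 s2) k"
    note c = prod_map_comp[OF True A(1,3) g(1)] prod_map_comp[OF True A(1,3) g(2)]
      prod_map_comp[OF True A(2,4) g(1)] prod_map_comp[OF True A(2,4) g(2)]
    show "g = k"
    proof (rule prd_ext[OF True g])
      show "Cmp C t (prd C r s) r (pr1 C r s) g = Cmp C t (prd C r s) r (pr1 C r s) k"
        by (rule jointly_monicD[OF jR arr_comp[OF g(1) P(1)] arr_comp[OF g(2) P(1)]]) (simp_all only: c[symmetric] e)
      show "Cmp C t (prd C r s) s (pr2 C r s) g = Cmp C t (prd C r s) s (pr2 C r s) k"
        by (rule jointly_monicD[OF jS arr_comp[OF g(1) P(2)] arr_comp[OF g(2) P(2)]]) (simp_all only: c[symmetric] e)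
    qed
  qed
  have "has_product C r s" using True by (simp add: hprod_def)
  then show ?thesis
    using True span_rel_jointly_monic[OF jm] comp_asc[OF P(1) assms(3) X(1)] comp_asc[OF P(1) assms(3) X(2)]
      comp_asc[OF P(2) assms(4) X(3)] comp_asc[OF P(2) assms(4) X(4)]
    by (simp add: rel_tensor_def assms(1,2) Let_def r1_def r2_def s1_def s2_def prod_map_def)
next
  case False
  then have "\<not> has_product C r s" using assms(3,4) by (simp add: hprod_def arr_dom[OF assms(3)] arr_dom[OF assms(4)])
  then show ?thesis using False by (simp add: rel_tensor_def assms(1,2) Let_def)
qed

text \<open>The product of the apexes is their pullback over the terminal object. Comparing it with
  the product of the images is thus an instance of the comparison used for composition and
  contributes the product of the degrees.\<close>

lemma
  assumes a: "arr C p x a" "arr C p x' b" "arr C q y c" "arr C q y' d"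
  shows T0_tensor_span: "hprod C p q \<Longrightarrow> tmor Ten x x' y y' (sp x x' p a b) (sp y y' q c d)
      = sp (prd C x y) (prd C x' y') (prd C p q) (prod_map C p x q y a c) (prod_map C p x' q y' b d)"
    and T0_tensor_span_zero: "\<not> hprod C p q \<Longrightarrow> tmor Ten x x' y y' (sp x x' p a b) (sp y y' q c d) = 0"
proof -
  note hx = hprodI[OF a(1,2)] and hy = hprodI[OF a(3,4)]
  obtain R r m e where R: "rep R = (r, m)" "arr C r (prd C x x') m" "epic C p r e"
    "arr C p r e" "Cmp C p r (prd C x x') m e = pair C p x x' a b"
    "sp x x' p a b = Poly_Mapping.single R (\<delta> p r e)"
    and jR: "jointly_monic C x x' r (Cmp C r (prd C x x') x (pr1 C x x') m) (Cmp C r (prd C x x') x' (pr2 C x x') m)"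
    by (rule span_rel_rep[OF a(1,2)])
  obtain S s n e' where S: "rep S = (s, n)" "arr C s (prd C y y') n" "epic C q s e'"
    "arr C q s e'" "Cmp C q s (prd C y y') n e' = pair C q y y' c d"
    "sp y y' q c d = Poly_Mapping.single S (\<delta> q s e')"
    and jS: "jointly_monic C y y' s (Cmp C s (prd C y y') y (pr1 C y y') n) (Cmp C s (prd C y y') y' (pr2 C y y') n)"
    by (rule span_rel_rep[OF a(3,4)])
  define r1 where "r1 = Cmp C r (prd C x x') x (pr1 C x x') m"
  define r2 where "r2 = Cmp C r (prd C x x') x' (pr2 C x x') m"
  define s1 where "s1 = Cmp C s (prd C y y') y (pr1 C y y') n"
  define s2 where "s2 = Cmp C s (prd C y y') y' (pr2 C y y') n"
  note P = pr_arr[OF hx] pr_arr[OF hy] note Q = pair_lift[OF a(1,2)] pair_lift[OF a(3,4)]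
  note l = jointly_monic_arr[OF jR[folded r1_def r2_def]] jointly_monic_arr[OF jS[folded s1_def s2_def]]
  have e: "Cmp C p r x r1 e = a" "Cmp C p r x' r2 e = b" "Cmp C q s y s1 e' = c" "Cmp C q s y' s2 e' = d"
    unfolding r1_def r2_def s1_def s2_def
    using comp_asc[OF R(4,2) P(1)] comp_asc[OF R(4,2) P(2)] comp_asc[OF S(4,2) P(3)] comp_asc[OF S(4,2) P(4)]
      R(5) S(5) Q by auto
  have o: "p \<in> Obj C" "q \<in> Obj C" "r \<in> Obj C" "s \<in> Obj C" using a l by (auto simp: arr_def)
  have hp: "hprod C p q \<longleftrightarrow> hprod C r s"
    using has_pullback_epic_epic[OF R(3) S(3) o(1,2) bang_arr[OF o(3)] bang_arr[OF o(4)]]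
    by (simp add: bang_comp[OF R(4)] bang_comp[OF S(4)] hprod_iff_has_pullback o)
  have tens: "tmor Ten x x' y y' (sp x x' p a b) (sp y y' q c d)
    = scl (\<delta> p r e * \<delta> q s e') (rel_tensor C x x' y y' R S)"
    by (simp add: T0_tmor_eq R(6) S(6))
  note rt = rel_tensor_rep[OF R(1) S(1) R(2) S(2) hx hy jR jS, folded r1_def r2_def s1_def s2_def]
  show "tmor Ten x x' y y' (sp x x' p a b) (sp y y' q c d) = 0" if "\<not> hprod C p q"
    using that by (simp add: tens hp rt)
  show "tmor Ten x x' y y' (sp x x' p a b) (sp y y' q c d)
      = sp (prd C x y) (prd C x' y') (prd C p q) (prod_map C p x q y a c) (prod_map C p x' q y' b d)"
    if h: "hprod C p q"
  proof -
    have h': "hprod C r s" using h hp by simp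
    note W0 = product_pullback[OF product_chosen[OF h']]
    have W: "pullback C p q (terminal_of C) (Cmp C p r (terminal_of C) (bang C r) e) (Cmp C q s (terminal_of C) (bang C s) e')
      (prd C p q) (pr1 C p q) (pr2 C p q)"
      unfolding bang_comp[OF R(4)] bang_comp[OF S(4)] by (rule product_pullback[OF product_chosen[OF h]])
    obtain k where k: "epic C (prd C p q) (prd C r s) k" "\<delta> (prd C p q) (prd C r s) k = \<delta> p r e * \<delta> q s e'"
      "Cmp C (prd C p q) (prd C r s) r (pr1 C r s) k = Cmp C (prd C p q) p r e (pr1 C p q)"
      "Cmp C (prd C p q) (prd C r s) s (pr2 C r s) k = Cmp C (prd C p q) q s e' (pr2 C p q)"
      by (rule pullback_epic_epic[OF W R(3) S(3) bang_arr[OF o(3)] bang_arr[OF o(4)] W0])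
    note PP = pr_arr[OF h] and PQ = pr_arr[OF h']
    have w: "prd C p q \<in> Obj C" "prd C r s \<in> Obj C" using hprod_obj[OF h] hprod_obj[OF h'] by blast+
    have ka: "arr C (prd C p q) (prd C r s) k" using k w by (simp add: epic_iff)
    \<comment> \<open>In coordinates \<open>k\<close> is \<open>e \<times> e'\<close>, so it
      composes with products of morphisms factor by factor.\<close>
    have km: "Cmp C (prd C p q) (prd C r s) (prd C u v) (prod_map C r u s v f g) k = prod_map C p u q v (Cmp C p r u f e) (Cmp C q s v g e')"
      if "arr C r u f" "arr C s v g" for u v f g
    proof -
      note M = prod_map_arr[OF h' that] and N = prod_map_arr[OF h arr_comp[OF R(4) that(1)] arr_comp[OF S(4) that(2)]]
      show ?thesis
        by (rule prd_ext[OF hprod_map[OF h' that] arr_comp[OF ka M(1)] N(1)])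
          (simp_all only: prod_map_comp[OF h' that ka] k N comp_asc[OF PP(1) R(4) that(1)] comp_asc[OF PP(2) S(4) that(2)])
    qed
    have "sp (prd C x y) (prd C x' y') (prd C p q)
        (Cmp C (prd C p q) (prd C r s) (prd C x y) (prod_map C r x s y r1 s1) k)
        (Cmp C (prd C p q) (prd C r s) (prd C x' y') (prod_map C r x' s y' r2 s2) k)
      = scl (\<delta> p r e * \<delta> q s e') (sp (prd C x y) (prd C x' y') (prd C r s) (prod_map C r x s y r1 s1) (prod_map C r x' s y' r2 s2))"
      unfolding k(2)[symmetric]
      by (rule span_rel_epic[OF prod_map_arr(1)[OF h' l(1,3)] prod_map_arr(1)[OF h' l(2,4)] k(1) w(1)])
    then show ?thesis by (simp add: tens rt h' km[OF l(1,3)] km[OF l(2,4)] e)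
  qed
qed

lemma T0_tensor_graph:
  assumes "arr C x x' f" "arr C y y' g" "hprod C x y"
  shows "tmor Ten x x' y y' (graph_rel C x x' f) (graph_rel C y y' g)
    = graph_rel C (prd C x y) (prd C x' y') (prod_map C x x' y y' f g)"
proof -
  note o = hprod_obj[OF assms(3)]
  show ?thesis
    unfolding graph_rel_span[OF assms(1)] graph_rel_span[OF assms(2)] graph_rel_span[OF prod_map_arr(1)[OF assms(3,1,2)]]
    using T0_tensor_span[OF arr_id[OF o(1)] assms(1) arr_id[OF o(2)] assms(2,3)] by (simp add: prod_map_id[OF assms(3)])
qed

lemma T0_tensor_arr:
  assumes f: "arr (T0 C \<delta>) x x' f" and g: "arr (T0 C \<delta>) y y' g" and h: "hprod C x y" "hprod C x' y'"
  shows "arr (T0 C \<delta>) (prd C x y) (prd C x' y') (tmor Ten x x' y y' f g)"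
proof (rule T0_arrI[OF klinear_T0_tmor(1) f])
  show o: "prd C x y \<in> Obj C" "prd C x' y' \<in> Obj C" using hprod_obj h by blast+
  fix p a b assume a: "arr C p x a" "arr C p x' b"
  show "arr (T0 C \<delta>) (prd C x y) (prd C x' y') (tmor Ten x x' y y' (sp x x' p a b) g)"
  proof (rule T0_arrI[OF klinear_T0_tmor(2) g o])
    fix q c d assume c: "arr C q y c" "arr C q y' d"
    show "arr (T0 C \<delta>) (prd C x y) (prd C x' y') (tmor Ten x x' y y' (sp x x' p a b) (sp y y' q c d))"
    proof (cases "hprod C p q")
      case True
      show ?thesis unfolding T0_tensor_span[OF a c True]
        by (intro span_rel_arr prod_map_arr True a c)
    qed (simp add: T0_tensor_span_zero[OF a c] T0_arr_iff o)
  qed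
qed

text \<open>Both sides are governed by one question: is there an object mapping compatibly to all
  four apexes? If so, the product of the two pullbacks is the pullback of the products. If not, both
  sides vanish, at whichever stage existence fails.\<close>

lemma T0_tensor_comp_span:
  assumes a: "arr C p1 x a1" "arr C p1 x' b1" "arr C p2 x' a2" "arr C p2 x'' b2"
    and c: "arr C q1 y c1" "arr C q1 y' d1" "arr C q2 y' c2" "arr C q2 y'' d2"
  shows "tmor Ten x x'' y y'' (Cmp (T0 C \<delta>) x x' x'' (sp x' x'' p2 a2 b2) (sp x x' p1 a1 b1))
      (Cmp (T0 C \<delta>) y y' y'' (sp y' y'' q2 c2 d2) (sp y y' q1 c1 d1))
    = (if hprod C x' y' then Cmp (T0 C \<delta>) (prd C x y) (prd C x' y') (prd C x'' y'')
        (tmor Ten x' x'' y' y'' (sp x' x'' p2 a2 b2) (sp y' y'' q2 c2 d2))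
        (tmor Ten x x' y y' (sp x x' p1 a1 b1) (sp y y' q1 c1 d1)) else 0)" (is "?l = ?r")
proof (cases "\<exists>t u1 u2 v1 v2. arr C t p1 u1 \<and> arr C t p2 u2 \<and> arr C t q1 v1 \<and> arr C t q2 v2 \<and>
    Cmp C t p1 x' b1 u1 = Cmp C t p2 x' a2 u2 \<and> Cmp C t q1 y' d1 v1 = Cmp C t q2 y' c2 v2")
  case True
  then obtain t u1 u2 v1 v2 where t: "arr C t p1 u1" "arr C t p2 u2" "arr C t q1 v1" "arr C t q2 v2"
    "Cmp C t p1 x' b1 u1 = Cmp C t p2 x' a2 u2" "Cmp C t q1 y' d1 v1 = Cmp C t q2 y' c2 v2" by blast
  have "has_pullback C p1 p2 x' b1 a2" "has_pullback C q1 q2 y' d1 c2"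
    using has_pullback_iff[OF a(2,3)] has_pullback_iff[OF c(2,3)] t by blast+
  then obtain W s1 s2 W' t1 t2 where W: "pullback C p1 p2 x' b1 a2 W s1 s2" and W': "pullback C q1 q2 y' d1 c2 W' t1 t2"
    using has_pullback_obtain a c by metis
  note A = pullback_arr[OF W] and B = pullback_arr[OF W']
  obtain k where k: "arr C t W k" using pullback_lift[OF W t(1,2,5)] by metis
  obtain l where l: "arr C t W' l" using pullback_lift[OF W' t(3,4,6)] by metis
  note h = hprodI[OF k l] note h1 = hprodI[OF t(1,3)] and h2 = hprodI[OF t(2,4)]
  \<comment> \<open>Such an object also maps to \<open>x'\<close> and \<open>y'\<close>, so the
    intermediate product exists.\<close>
  note h' = hprod_map[OF h1 a(2) c(2)]
  have "?r = sp (prd C x y) (prd C x'' y'') (prd C W W')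
      (Cmp C (prd C W W') (prd C p1 q1) (prd C x y) (prod_map C p1 x q1 y a1 c1) (prod_map C W p1 W' q1 s1 t1))
      (Cmp C (prd C W W') (prd C p2 q2) (prd C x'' y'') (prod_map C p2 x'' q2 y'' b2 d2) (prod_map C W p2 W' q2 s2 t2))"
    using h' T0_comp_span[OF prod_map_arr(1)[OF h1 a(1) c(1)] prod_map_arr(1)[OF h1 a(2) c(2)]
        prod_map_arr(1)[OF h2 a(3) c(3)] prod_map_arr(1)[OF h2 a(4) c(4)] prod_map_pullback[OF W W' h]]
    by (simp only: T0_tensor_span[OF a(1,2) c(1,2) h1] T0_tensor_span[OF a(3,4) c(3,4) h2] if_True)
  also have "\<dots> = ?l"
    unfolding T0_comp_span[OF a W] T0_comp_span[OF c W']
      T0_tensor_span[OF arr_comp[OF A(3) a(1)] arr_comp[OF A(4) a(4)] arr_comp[OF B(3) c(1)] arr_comp[OF B(4) c(4)] h]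
      prod_map_prod_map[OF h A(3) B(3) a(1) c(1)] prod_map_prod_map[OF h A(4) B(4) a(4) c(4)] ..
  finally show ?thesis ..
next
  case False
  have "?l = 0"
  proof (cases "has_pullback C p1 p2 x' b1 a2 \<and> has_pullback C q1 q2 y' d1 c2")
    case True
    then obtain W s1 s2 W' t1 t2 where W: "pullback C p1 p2 x' b1 a2 W s1 s2" and W': "pullback C q1 q2 y' d1 c2 W' t1 t2"
      using has_pullback_obtain a c by metis
    note A = pullback_arr[OF W] and B = pullback_arr[OF W']
    have "\<not> hprod C W W'"
    proof
      assume "hprod C W W'"
      then obtain t k l where k: "arr C t W k" "arr C t W' l" unfolding hprod_iff by blast
      show False
        using False arr_comp[OF k(1) A(3)] arr_comp[OF k(1) A(4)] arr_comp[OF k(2) B(3)] arr_comp[OF k(2) B(4)]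
          comp_eq_extend[OF A(5) k(1) A(3,1,4,2)] comp_eq_extend[OF B(5) k(2) B(3,1,4,2)] by blast
    qed
    then show ?thesis
      unfolding T0_comp_span[OF a W] T0_comp_span[OF c W']
      by (rule T0_tensor_span_zero[OF arr_comp[OF A(3) a(1)] arr_comp[OF A(4) a(4)] arr_comp[OF B(3) c(1)] arr_comp[OF B(4) c(4)]])
  next
    case False
    then show ?thesis using T0_comp_span_zero[OF a] T0_comp_span_zero[OF c]
      by (auto simp: klinearD[OF klinear_T0_tmor(1)] klinearD[OF klinear_T0_tmor(2)])
  qed
  moreover have "?r = 0"
  proof (cases "hprod C p1 q1 \<and> hprod C p2 q2")
    case True
    then have h: "hprod C p1 q1" "hprod C p2 q2" by auto
    note M = prod_map_arr[OF h(1) a(1) c(1)] prod_map_arr[OF h(1) a(2) c(2)]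
      prod_map_arr[OF h(2) a(3) c(3)] prod_map_arr[OF h(2) a(4) c(4)] note P = pr_arr[OF h(1)] pr_arr[OF h(2)]
    note P' = pr_arr[OF hprod_map[OF h(1) a(2) c(2)]]
    have "\<not> has_pullback C (prd C p1 q1) (prd C p2 q2) (prd C x' y') (prod_map C p1 x' q1 y' b1 d1) (prod_map C p2 x' q2 y' a2 c2)"
    proof
      assume "has_pullback C (prd C p1 q1) (prd C p2 q2) (prd C x' y') (prod_map C p1 x' q1 y' b1 d1) (prod_map C p2 x' q2 y' a2 c2)"
      then obtain t u v where u: "arr C t (prd C p1 q1) u" "arr C t (prd C p2 q2) v"
        "Cmp C t (prd C p1 q1) (prd C x' y') (prod_map C p1 x' q1 y' b1 d1) u = Cmp C t (prd C p2 q2) (prd C x' y') (prod_map C p2 x' q2 y' a2 c2) v"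
        using has_pullback_iff[OF M(4) M(7)] by blast
      note e = prod_map_comp[OF h(1) a(2) c(2) u(1), unfolded u(3) prod_map_comp[OF h(2) a(3) c(3) u(2)]]
      show False
        using False arr_comp[OF u(1) P(1)] arr_comp[OF u(2) P(3)] arr_comp[OF u(1) P(2)] arr_comp[OF u(2) P(4)]
          e(1)[symmetric] e(2)[symmetric] by blast
    qed
    then show ?thesis
      using T0_comp_span_zero[OF M(1) M(4) M(7) M(10)]
      by (simp only: T0_tensor_span[OF a(1,2) c(1,2) h(1)] T0_tensor_span[OF a(3,4) c(3,4) h(2)] if_cancel not_False_eq_True)
  next
    case False
    then show ?thesis using T0_tensor_span_zero[OF a(1,2) c(1,2)] T0_tensor_span_zero[OF a(3,4) c(3,4)]
      by (auto simp: T0_comp_linear)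
  qed
  ultimately show ?thesis by (simp only:)
qed

lemma klinear_if: "klinear L \<Longrightarrow> klinear (\<lambda>\<phi>. if b then L \<phi> else 0)"
  by (simp add: klinear_def)

lemma T0_tensor_comp:
  assumes f: "arr (T0 C \<delta>) x x' f" and f': "arr (T0 C \<delta>) x' x'' f'" and g: "arr (T0 C \<delta>) y y' g" and g': "arr (T0 C \<delta>) y' y'' g'"
  shows "tmor Ten x x'' y y'' (Cmp (T0 C \<delta>) x x' x'' f' f) (Cmp (T0 C \<delta>) y y' y'' g' g)
    = (if hprod C x' y' then Cmp (T0 C \<delta>) (prd C x y) (prd C x' y') (prd C x'' y'')
        (tmor Ten x' x'' y' y'' f' g') (tmor Ten x x' y y' f g) else 0)"
proof (rule T0_eqI[OF _ _ f])
  fix p1 a1 b1 assume 1: "arr C p1 x a1" "arr C p1 x' b1"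
  show "tmor Ten x x'' y y'' (Cmp (T0 C \<delta>) x x' x'' f' (sp x x' p1 a1 b1)) (Cmp (T0 C \<delta>) y y' y'' g' g)
    = (if hprod C x' y' then Cmp (T0 C \<delta>) (prd C x y) (prd C x' y') (prd C x'' y'')
        (tmor Ten x' x'' y' y'' f' g') (tmor Ten x x' y y' (sp x x' p1 a1 b1) g) else 0)"
  proof (rule T0_eqI[OF _ _ f'])
    fix p2 a2 b2 assume 2: "arr C p2 x' a2" "arr C p2 x'' b2"
    show "tmor Ten x x'' y y'' (Cmp (T0 C \<delta>) x x' x'' (sp x' x'' p2 a2 b2) (sp x x' p1 a1 b1)) (Cmp (T0 C \<delta>) y y' y'' g' g)
      = (if hprod C x' y' then Cmp (T0 C \<delta>) (prd C x y) (prd C x' y') (prd C x'' y'')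
        (tmor Ten x' x'' y' y'' (sp x' x'' p2 a2 b2) g') (tmor Ten x x' y y' (sp x x' p1 a1 b1) g) else 0)"
    proof (rule T0_eqI[OF _ _ g])
      fix q1 c1 d1 assume 3: "arr C q1 y c1" "arr C q1 y' d1"
      show "tmor Ten x x'' y y'' (Cmp (T0 C \<delta>) x x' x'' (sp x' x'' p2 a2 b2) (sp x x' p1 a1 b1)) (Cmp (T0 C \<delta>) y y' y'' g' (sp y y' q1 c1 d1))
        = (if hprod C x' y' then Cmp (T0 C \<delta>) (prd C x y) (prd C x' y') (prd C x'' y'')
          (tmor Ten x' x'' y' y'' (sp x' x'' p2 a2 b2) g') (tmor Ten x x' y y' (sp x x' p1 a1 b1) (sp y y' q1 c1 d1)) else 0)"
        by (rule T0_eqI[OF _ _ g'])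
          (intro klinear_if klinear_T0_tmorI klinear_T0_compI klinear_ident T0_tensor_comp_span[OF 1 2 3]; assumption)+
    qed (intro klinear_if klinear_T0_tmorI klinear_T0_compI klinear_ident)+
  qed (intro klinear_if klinear_T0_tmorI klinear_T0_compI klinear_ident)+
qed (intro klinear_if klinear_T0_tmorI klinear_T0_compI klinear_ident)+

text \<open>The associators of the feet and of the apexes are isomorphisms commuting with the legs,
  which \<open>T0_natural_iso\<close> turns into the claim. If the triple product of the apexes is
  missing, it is missing for either bracketing and both sides vanish.\<close>

lemma T0_assoc_natural:
  assumes f: "arr (T0 C \<delta>) x x' f" and g: "arr (T0 C \<delta>) y y' g" and h: "arr (T0 C \<delta>) z z' h"
    and e: "hprod C x y" "hprod C (prd C x y) z" "hprod C x' y'" "hprod C (prd C x' y') z'"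
  shows "Cmp (T0 C \<delta>) (prd C (prd C x y) z) (prd C (prd C x' y') z') (prd C x' (prd C y' z')) (tassoc Ten x' y' z')
      (tmor Ten (prd C x y) (prd C x' y') z z' (tmor Ten x x' y y' f g) h)
    = Cmp (T0 C \<delta>) (prd C (prd C x y) z) (prd C x (prd C y z)) (prd C x' (prd C y' z'))
      (tmor Ten x x' (prd C y z) (prd C y' z') f (tmor Ten y y' z z' g h)) (tassoc Ten x y z)" (is "?L f g h = ?R f g h")
proof (rule T0_eqI[OF _ _ f])
  fix p a b assume 1: "arr C p x a" "arr C p x' b"
  show "?L (sp x x' p a b) g h = ?R (sp x x' p a b) g h"
  proof (rule T0_eqI[OF _ _ g])
    fix q c d assume 2: "arr C q y c" "arr C q y' d"
    show "?L (sp x x' p a b) (sp y y' q c d) h = ?R (sp x x' p a b) (sp y y' q c d) h"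
    proof (rule T0_eqI[OF _ _ h])
      fix r i j assume 3: "arr C r z i" "arr C r z' j"
      show "?L (sp x x' p a b) (sp y y' q c d) (sp z z' r i j) = ?R (sp x x' p a b) (sp y y' q c d) (sp z z' r i j)"
      proof (cases "hprod C p q \<and> hprod C (prd C p q) r")
        case True
        then have k: "hprod C p q" "hprod C (prd C p q) r" "hprod C q r" "hprod C p (prd C q r)"
          using hprod_assoc[of p q r] by blast+
        note m = prod_map_arr(1)[OF k(1) 1(1) 2(1)] prod_map_arr(1)[OF k(1) 1(2) 2(2)]
          prod_map_arr(1)[OF k(3) 2(1) 3(1)] prod_map_arr(1)[OF k(3) 2(2) 3(2)]
        note M = prod_map_arr(1)[OF k(2) m(1) 3(1)] prod_map_arr(1)[OF k(2) m(2) 3(2)]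
          prod_map_arr(1)[OF k(4) 1(1) m(3)] prod_map_arr(1)[OF k(4) 1(2) m(4)]
        have L: "tmor Ten (prd C x y) (prd C x' y') z z' (tmor Ten x x' y y' (sp x x' p a b) (sp y y' q c d)) (sp z z' r i j)
          = sp (prd C (prd C x y) z) (prd C (prd C x' y') z') (prd C (prd C p q) r)
            (prod_map C (prd C p q) (prd C x y) r z (prod_map C p x q y a c) i)
            (prod_map C (prd C p q) (prd C x' y') r z' (prod_map C p x' q y' b d) j)"
          unfolding T0_tensor_span[OF 1 2 k(1)] by (rule T0_tensor_span[OF m(1,2) 3 k(2)])
        have R: "tmor Ten x x' (prd C y z) (prd C y' z') (sp x x' p a b) (tmor Ten y y' z z' (sp y y' q c d) (sp z z' r i j))
          = sp (prd C x (prd C y z)) (prd C x' (prd C y' z')) (prd C p (prd C q r))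
            (prod_map C p x (prd C q r) (prd C y z) a (prod_map C q y r z c i))
            (prod_map C p x' (prd C q r) (prd C y' z') b (prod_map C q y' r z' d j))"
          unfolding T0_tensor_span[OF 2 3 k(3)] by (rule T0_tensor_span[OF 1 m(3,4) k(4)])
        show ?thesis unfolding L R T0_tensor_simps
          by (rule T0_natural_iso[OF prd_assoc_iso[OF e(1,2)] prd_assoc_iso[OF k(1,2)] hprod_obj(3)[OF e(2)]
                prd_assoc_arr(1)[OF e(3,4)] M prd_assoc_natural[OF k(1,2) 1(1) 2(1) 3(1)] prd_assoc_natural[OF k(1,2) 1(2) 2(2) 3(2)]])
      next
        case False
        have "tmor Ten (prd C x y) (prd C x' y') z z' (tmor Ten x x' y y' (sp x x' p a b) (sp y y' q c d)) (sp z z' r i j) = 0"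
        proof (cases "hprod C p q")
          case True
          show ?thesis unfolding T0_tensor_span[OF 1 2 True]
            by (rule T0_tensor_span_zero[OF prod_map_arr(1)[OF True 1(1) 2(1)] prod_map_arr(1)[OF True 1(2) 2(2)] 3]) (use False True in blast)
        qed (simp only: T0_tensor_span_zero[OF 1 2] klinearD(3)[OF klinear_T0_tmor(1)] not_False_eq_True)
        moreover have "tmor Ten x x' (prd C y z) (prd C y' z') (sp x x' p a b) (tmor Ten y y' z z' (sp y y' q c d) (sp z z' r i j)) = 0"
        proof (cases "hprod C q r")
          case True
          show ?thesis unfolding T0_tensor_span[OF 2 3 True]
            by (rule T0_tensor_span_zero[OF 1 prod_map_arr(1)[OF True 2(1) 3(1)] prod_map_arr(1)[OF True 2(2) 3(2)]])
              (use False True hprod_assoc[of p q r] in blast)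
        qed (simp only: T0_tensor_span_zero[OF 2 3] klinearD(3)[OF klinear_T0_tmor(2)] not_False_eq_True)
        ultimately show ?thesis by (simp only: T0_comp_linear)
      qed
    qed (intro klinear_T0_tmorI klinear_T0_compI klinear_ident)+
  qed (intro klinear_T0_tmorI klinear_T0_compI klinear_ident)+
qed (intro klinear_T0_tmorI klinear_T0_compI klinear_ident)+

lemma T0_braid_natural:
  assumes f: "arr (T0 C \<delta>) x x' f" and g: "arr (T0 C \<delta>) y y' g" and e: "hprod C x y" "hprod C x' y'"
  shows "Cmp (T0 C \<delta>) (prd C x y) (prd C x' y') (prd C y' x') (tbraid Ten x' y') (tmor Ten x x' y y' f g)
    = Cmp (T0 C \<delta>) (prd C x y) (prd C y x) (prd C y' x') (tmor Ten y y' x x' g f) (tbraid Ten x y)" (is "?L f g = ?R f g")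
proof (rule T0_eqI[OF _ _ f])
  fix p a b assume 1: "arr C p x a" "arr C p x' b"
  show "?L (sp x x' p a b) g = ?R (sp x x' p a b) g"
  proof (rule T0_eqI[OF _ _ g])
    fix q c d assume 2: "arr C q y c" "arr C q y' d"
    show "?L (sp x x' p a b) (sp y y' q c d) = ?R (sp x x' p a b) (sp y y' q c d)"
    proof (cases "hprod C p q")
      case True
      note k = True hprod_sym[OF True]
      show ?thesis unfolding T0_tensor_span[OF 1 2 k(1)] T0_tensor_span[OF 2 1 k(2)] T0_tensor_simps
        by (rule T0_natural_iso[OF swap_iso[OF e(1)] swap_iso[OF True] hprod_obj(3)[OF e(1)]
              pair_lift(1)[OF pr_arr(2,1)[OF e(2)]] prod_map_arr(1)[OF k(1) 1(1) 2(1)] prod_map_arr(1)[OF k(1) 1(2) 2(2)]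
              prod_map_arr(1)[OF k(2) 2(1) 1(1)] prod_map_arr(1)[OF k(2) 2(2) 1(2)]
              swap_natural[OF True 1(1) 2(1)] swap_natural[OF True 1(2) 2(2)]])
    next
      case False
      then have "\<not> hprod C q p" using hprod_sym by blast
      with False show ?thesis by (simp only: T0_tensor_span_zero[OF 1 2] T0_tensor_span_zero[OF 2 1] T0_comp_linear not_False_eq_True)
    qed
  qed (intro klinear_T0_tmorI klinear_T0_compI klinear_ident)+
qed (intro klinear_T0_tmorI klinear_T0_compI klinear_ident)+

lemma hprod_terminal: "x \<in> Obj C \<Longrightarrow> hprod C (terminal_of C) x" "x \<in> Obj C \<Longrightarrow> hprod C x (terminal_of C)"
  unfolding hprod_iff using bang_arr arr_id by blast+

lemma additive_partial_tensor_T0: "additive_partial_tensor (T0 C \<delta>) (has_product C) Ten"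
proof -
  note [simp] = hprod_iff_has_product
  have h: "hprod C x y \<longleftrightarrow> has_product C x y" if "arr (T0 C \<delta>) x x' f" "arr (T0 C \<delta>) y y' g" for x x' y y' f g
    using that by (simp add: T0_arr_iff)
  have h': "hprod C x' y' \<longleftrightarrow> has_product C x' y'" if "arr (T0 C \<delta>) x x' f" "arr (T0 C \<delta>) y y' g" for x x' y y' f g
    using that by (simp add: T0_arr_iff)
  \<comment> \<open>\<open>hprod\<close> contains the requirement that its arguments are objects;
    for an iterated product this holds once the inner product exists.\<close>
  have as: "has_product C x y \<and> has_product C (prd C x y) z \<longleftrightarrow> hprod C x y \<and> hprod C (prd C x y) z" if "x \<in> Obj C" "y \<in> Obj C" "z \<in> Obj C" for x y z
    using that hprod_obj(3)[of x y] hprod_iff_has_product by blast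
  have as': "has_product C y z \<and> has_product C x (prd C y z) \<longleftrightarrow> hprod C y z \<and> hprod C x (prd C y z)" if "x \<in> Obj C" "y \<in> Obj C" "z \<in> Obj C" for x y z
    using that hprod_obj(3)[of y z] hprod_iff_has_product by blast
  show ?thesis
  proof (intro additive_partial_tensor.intro partial_tensor.intro category_T0 preadditive_T0
      partial_tensor_axioms.intro additive_partial_tensor_axioms.intro; (unfold T0_simps T0_tensor_simps(1,2))?)
    show "terminal_of C \<in> Obj C" by (rule terminal_obj)
    show "prd C x y \<in> Obj C" if "x \<in> Obj C" "y \<in> Obj C" "has_product C x y" for x y
      using that by (intro hprod_obj) simp
    show "has_product C x y \<and> has_product C (prd C x y) z \<longleftrightarrow> has_product C y z \<and> has_product C x (prd C y z)"
      if "x \<in> Obj C" "y \<in> Obj C" "z \<in> Obj C" for x y z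
      using as[OF that] as'[OF that] hprod_assoc[of x y z] by blast
    show "has_product C (terminal_of C) x" "has_product C x (terminal_of C)" if "x \<in> Obj C" for x
      using hprod_terminal[OF that] by (simp_all add: hprod_def)
    show "has_product C y x" if "x \<in> Obj C" "y \<in> Obj C" "has_product C x y" for x y
      using that hprod_sym[of x y] by simp
    show "arr (T0 C \<delta>) (prd C x y) (prd C x' y') (tmor Ten x x' y y' f g)"
      if "arr (T0 C \<delta>) x x' f" "arr (T0 C \<delta>) y y' g" "has_product C x y" "has_product C x' y'" for x x' y y' f g
      using T0_tensor_arr[OF that(1,2)] that h[OF that(1,2)] h'[OF that(1,2)] by blast
    show "tmor Ten x x y y (graph_rel C x x (Idn C x)) (graph_rel C y y (Idn C y)) = graph_rel C (prd C x y) (prd C x y) (Idn C (prd C x y))"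
      if "x \<in> Obj C" "y \<in> Obj C" "has_product C x y" for x y
      using T0_tensor_graph[OF arr_id[OF that(1)] arr_id[OF that(2)]] prod_map_id[of x y] that by simp
    show "tmor Ten x x'' y y'' (Cmp (T0 C \<delta>) x x' x'' f' f) (Cmp (T0 C \<delta>) y y' y'' g' g)
      = (if has_product C x' y' then Cmp (T0 C \<delta>) (prd C x y) (prd C x' y') (prd C x'' y'')
        (tmor Ten x' x'' y' y'' f' g') (tmor Ten x x' y y' f g) else 0)"
      if "arr (T0 C \<delta>) x x' f" "arr (T0 C \<delta>) x' x'' f'" "arr (T0 C \<delta>) y y' g" "arr (T0 C \<delta>) y' y'' g'" for x x' x'' y y' y'' f f' g g'
      using T0_tensor_comp[OF that] h'[OF that(1,3)] by simp
    show "arr (T0 C \<delta>) (prd C (prd C x y) z) (prd C x (prd C y z)) (tassoc Ten x y z)"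
      if "x \<in> Obj C" "y \<in> Obj C" "z \<in> Obj C" "has_product C x y" "has_product C (prd C x y) z" for x y z
      using graph_rel_arr[OF prd_assoc_arr(1)] as[OF that(1-3)] that(4,5) by simp
    show "arr (T0 C \<delta>) (prd C (terminal_of C) x) x (tlunit Ten x)" "arr (T0 C \<delta>) (prd C x (terminal_of C)) x (trunit Ten x)"
      if "x \<in> Obj C" for x
      using graph_rel_arr[OF pr_arr(2)[OF hprod_terminal(1)[OF that]]] graph_rel_arr[OF pr_arr(1)[OF hprod_terminal(2)[OF that]]] by simp_all
    show "arr (T0 C \<delta>) (prd C x y) (prd C y x) (tbraid Ten x y)" if "x \<in> Obj C" "y \<in> Obj C" "has_product C x y" for x y
    proof -
      have "hprod C x y" using that by simp
      from graph_rel_arr[OF pair_lift(1)[OF pr_arr(2,1)[OF this]]] show ?thesis by simp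
    qed
    show "Cmp (T0 C \<delta>) (prd C (prd C x y) z) (prd C (prd C x' y') z') (prd C x' (prd C y' z')) (tassoc Ten x' y' z')
        (tmor Ten (prd C x y) (prd C x' y') z z' (tmor Ten x x' y y' f g) h)
      = Cmp (T0 C \<delta>) (prd C (prd C x y) z) (prd C x (prd C y z)) (prd C x' (prd C y' z'))
        (tmor Ten x x' (prd C y z) (prd C y' z') f (tmor Ten y y' z z' g h)) (tassoc Ten x y z)"
      if "arr (T0 C \<delta>) x x' f" "arr (T0 C \<delta>) y y' g" "arr (T0 C \<delta>) z z' h" "has_product C x y" "has_product C (prd C x y) z"
        "has_product C x' y'" "has_product C (prd C x' y') z'" for x x' f y y' g z z' h
      using that(4-7) as[of x y z] as[of x' y' z'] that(1-3) by (intro T0_assoc_natural[OF that(1-3)]) (auto simp: T0_arr_iff simp del: hprod_iff_has_product)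
    show "Cmp (T0 C \<delta>) (prd C x y) (prd C x' y') (prd C y' x') (tbraid Ten x' y') (tmor Ten x x' y y' f g)
      = Cmp (T0 C \<delta>) (prd C x y) (prd C y x) (prd C y' x') (tmor Ten y y' x x' g f) (tbraid Ten x y)"
      if "arr (T0 C \<delta>) x x' f" "arr (T0 C \<delta>) y y' g" "has_product C x y" "has_product C x' y'" for x x' f y y' g
      using T0_braid_natural[OF that(1,2)] that(3,4) h[OF that(1,2)] h'[OF that(1,2)] by blast
  qed (simp_all add: klinearD[OF klinear_T0_tmor(1)] klinearD[OF klinear_T0_tmor(2)])
qed

end

section \<open>Monoidal functors\<close>

text \<open>\<open>ex_iff_left\<close> is not an instance of \<open>ex_iff\<close>, since the tensor
  product of \<open>F x\<close> and \<open>F y\<close> is only isomorphic to an object in the image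
  of \<open>F\<close>. Both are used to match the index families of the two sides in the additive
  completion.\<close>

locale partial_tensor_functor = cat_functor C D Fo Fm + S: partial_tensor C ex S + S': partial_tensor D ex' S'
  for C :: "('o, 'v::ab_group_add, 'k) lincat" and ex :: "'o \<Rightarrow> 'o \<Rightarrow> bool" and S :: "('o, 'v) tensor"
    and D :: "('p, 'w::ab_group_add, 'k) lincat" and ex' :: "'p \<Rightarrow> 'p \<Rightarrow> bool" and S' :: "('p, 'w) tensor"
    and Fo :: "'o \<Rightarrow> 'p" and Fm :: "'o \<Rightarrow> 'o \<Rightarrow> 'v \<Rightarrow> 'w" +
  fixes \<nu> :: "'o \<Rightarrow> 'o \<Rightarrow> 'w" and \<epsilon> :: 'w
  assumes ex_iff: "x \<in> Obj C \<Longrightarrow> y \<in> Obj C \<Longrightarrow> ex' (Fo x) (Fo y) \<longleftrightarrow> ex x y"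
    and ex_iff_left: "x \<in> Obj C \<Longrightarrow> y \<in> Obj C \<Longrightarrow> z \<in> Obj C \<Longrightarrow> ex x y \<Longrightarrow>
      ex' (tobj S' (Fo x) (Fo y)) (Fo z) \<longleftrightarrow> ex (tobj S x y) z"
    and unit_iso: "iso D (tunit S') (Fo (tunit S)) \<epsilon>"
    and mult_iso: "x \<in> Obj C \<Longrightarrow> y \<in> Obj C \<Longrightarrow> ex x y \<Longrightarrow>
      iso D (tobj S' (Fo x) (Fo y)) (Fo (tobj S x y)) (\<nu> x y)"
    and mult_natural: "arr C x x' f \<Longrightarrow> arr C y y' g \<Longrightarrow> ex x y \<Longrightarrow> ex x' y' \<Longrightarrow>
      Cmp D (tobj S' (Fo x) (Fo y)) (tobj S' (Fo x') (Fo y')) (Fo (tobj S x' y'))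
        (\<nu> x' y') (tmor S' (Fo x) (Fo x') (Fo y) (Fo y') (Fm x x' f) (Fm y y' g))
      = Cmp D (tobj S' (Fo x) (Fo y)) (Fo (tobj S x y)) (Fo (tobj S x' y'))
        (Fm (tobj S x y) (tobj S x' y') (tmor S x x' y y' f g)) (\<nu> x y)"
    and mult_assoc: "x \<in> Obj C \<Longrightarrow> y \<in> Obj C \<Longrightarrow> z \<in> Obj C \<Longrightarrow> ex x y \<Longrightarrow> ex (tobj S x y) z \<Longrightarrow>
      Cmp D (tobj S' (tobj S' (Fo x) (Fo y)) (Fo z)) (Fo (tobj S (tobj S x y) z)) (Fo (tobj S x (tobj S y z)))
        (Fm (tobj S (tobj S x y) z) (tobj S x (tobj S y z)) (tassoc S x y z))
        (Cmp D (tobj S' (tobj S' (Fo x) (Fo y)) (Fo z)) (tobj S' (Fo (tobj S x y)) (Fo z)) (Fo (tobj S (tobj S x y) z))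
          (\<nu> (tobj S x y) z)
          (tmor S' (tobj S' (Fo x) (Fo y)) (Fo (tobj S x y)) (Fo z) (Fo z) (\<nu> x y) (Idn D (Fo z))))
      = Cmp D (tobj S' (tobj S' (Fo x) (Fo y)) (Fo z)) (tobj S' (Fo x) (Fo (tobj S y z))) (Fo (tobj S x (tobj S y z)))
        (\<nu> x (tobj S y z))
        (Cmp D (tobj S' (tobj S' (Fo x) (Fo y)) (Fo z)) (tobj S' (Fo x) (tobj S' (Fo y) (Fo z))) (tobj S' (Fo x) (Fo (tobj S y z)))
          (tmor S' (Fo x) (Fo x) (tobj S' (Fo y) (Fo z)) (Fo (tobj S y z)) (Idn D (Fo x)) (\<nu> y z))
          (tassoc S' (Fo x) (Fo y) (Fo z)))"
    and mult_lunit: "x \<in> Obj C \<Longrightarrow>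
      Cmp D (tobj S' (tunit S') (Fo x)) (Fo (tobj S (tunit S) x)) (Fo x) (Fm (tobj S (tunit S) x) x (tlunit S x))
        (Cmp D (tobj S' (tunit S') (Fo x)) (tobj S' (Fo (tunit S)) (Fo x)) (Fo (tobj S (tunit S) x))
          (\<nu> (tunit S) x) (tmor S' (tunit S') (Fo (tunit S)) (Fo x) (Fo x) \<epsilon> (Idn D (Fo x))))
      = tlunit S' (Fo x)"
    and mult_runit: "x \<in> Obj C \<Longrightarrow>
      Cmp D (tobj S' (Fo x) (tunit S')) (Fo (tobj S x (tunit S))) (Fo x) (Fm (tobj S x (tunit S)) x (trunit S x))
        (Cmp D (tobj S' (Fo x) (tunit S')) (tobj S' (Fo x) (Fo (tunit S))) (Fo (tobj S x (tunit S)))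
          (\<nu> x (tunit S)) (tmor S' (Fo x) (Fo x) (tunit S') (Fo (tunit S)) (Idn D (Fo x)) \<epsilon>))
      = trunit S' (Fo x)"
    and mult_braid: "x \<in> Obj C \<Longrightarrow> y \<in> Obj C \<Longrightarrow> ex x y \<Longrightarrow>
      Cmp D (tobj S' (Fo x) (Fo y)) (Fo (tobj S x y)) (Fo (tobj S y x))
        (Fm (tobj S x y) (tobj S y x) (tbraid S x y)) (\<nu> x y)
      = Cmp D (tobj S' (Fo x) (Fo y)) (tobj S' (Fo y) (Fo x)) (Fo (tobj S y x)) (\<nu> y x) (tbraid S' (Fo x) (Fo y))"

text \<open>A preserved terminal object together with preserved pullbacks yields preserved products,
  the source of the coherence isomorphisms.\<close>

locale terminal_degree_functor = degree_functor C D Fo Fm \<delta> \<delta>'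
  for C :: "('o, 'a, 'r) cat_scheme" and D :: "('p, 'b, 's) cat_scheme"
    and Fo :: "'o \<Rightarrow> 'p" and Fm :: "'o \<Rightarrow> 'o \<Rightarrow> 'a \<Rightarrow> 'b"
    and \<delta> :: "'o \<Rightarrow> 'o \<Rightarrow> 'a \<Rightarrow> 'k::field" and \<delta>' :: "'p \<Rightarrow> 'p \<Rightarrow> 'b \<Rightarrow> 'k" +
  assumes F_terminal: "terminal D (Fo (terminal_of C))"
begin

lemma F_terminal_ext: "arr D w (Fo (terminal_of C)) f \<Longrightarrow> arr D w (Fo (terminal_of C)) g \<Longrightarrow> f = g"
  using F_terminal unfolding arr_def terminal_def by blast

lemma F_product:
  assumes "product C x y p a b"
  shows "product D (Fo x) (Fo y) (Fo p) (Fm p x a) (Fm p y b)"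
proof (rule D.productI[OF F_jointly_monic[OF C.product_jointly_monic[OF assms]]])
  fix w u v assume u: "arr D w (Fo x) u" "arr D w (Fo y) v"
  note P = C.product_pullback[OF assms] note A = C.pullback_arr[OF P]
  obtain h where "arr D w (Fo p) h" "Cmp D w (Fo p) (Fo x) (Fm p x a) h = u" "Cmp D w (Fo p) (Fo y) (Fm p y b) h = v"
    by (rule D.pullback_lift[OF F_pullback[OF P] u
          F_terminal_ext[OF D.arr_comp[OF u(1) F_arr[OF A(1)]] D.arr_comp[OF u(2) F_arr[OF A(2)]]]])
  then show "\<exists>h. arr D w (Fo p) h \<and> Cmp D w (Fo p) (Fo x) (Fm p x a) h = u \<and> Cmp D w (Fo p) (Fo y) (Fm p y b) h = v"
    by blast
qed

text \<open>Since the image of the terminal object is terminal, morphisms to \<open>F x\<close> and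
  \<open>F y\<close> form a cone over the image of the cospan from \<open>x\<close> and
  \<open>y\<close> to the terminal object; reflection of pullbacks brings it back.\<close>

lemma F_hprod:
  assumes "x \<in> Obj C" "y \<in> Obj C"
  shows "hprod D (Fo x) (Fo y) \<longleftrightarrow> hprod C x y"
proof
  show "hprod D (Fo x) (Fo y)" if "hprod C x y"
    using D.product_hprod[OF F_product[OF C.product_chosen[OF that]]] .
  assume "hprod D (Fo x) (Fo y)"
  then obtain w u v where u: "arr D w (Fo x) u" "arr D w (Fo y) v" unfolding D.hprod_iff by blast
  note b = C.bang_arr[OF assms(1)] C.bang_arr[OF assms(2)]
  have "has_pullback D (Fo x) (Fo y) (Fo (terminal_of C)) (Fm x (terminal_of C) (bang C x)) (Fm y (terminal_of C) (bang C y))"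
    unfolding D.has_pullback_iff[OF F_arr[OF b(1)] F_arr[OF b(2)]]
    using u F_terminal_ext[OF D.arr_comp[OF u(1) F_arr[OF b(1)]] D.arr_comp[OF u(2) F_arr[OF b(2)]]] by blast
  from F_reflects[OF b this] show "hprod C x y" using C.hprod_iff_has_pullback[OF assms] by simp
qed

text \<open>The inverse of the natural map from \<open>F(x \<times> y)\<close> to
  \<open>F x \<times> F y\<close>, singled out by its coordinates.\<close>

definition nu :: "'o \<Rightarrow> 'o \<Rightarrow> 'b" where
  "nu x y = (SOME h. arr D (prd D (Fo x) (Fo y)) (Fo (prd C x y)) h \<and>
     Cmp D (prd D (Fo x) (Fo y)) (Fo (prd C x y)) (Fo x) (Fm (prd C x y) x (pr1 C x y)) h = pr1 D (Fo x) (Fo y) \<and>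
     Cmp D (prd D (Fo x) (Fo y)) (Fo (prd C x y)) (Fo y) (Fm (prd C x y) y (pr2 C x y)) h = pr2 D (Fo x) (Fo y))"

lemma nu:
  assumes "hprod C x y"
  shows "arr D (prd D (Fo x) (Fo y)) (Fo (prd C x y)) (nu x y)"
    "Cmp D (prd D (Fo x) (Fo y)) (Fo (prd C x y)) (Fo x) (Fm (prd C x y) x (pr1 C x y)) (nu x y) = pr1 D (Fo x) (Fo y)"
    "Cmp D (prd D (Fo x) (Fo y)) (Fo (prd C x y)) (Fo y) (Fm (prd C x y) y (pr2 C x y)) (nu x y) = pr2 D (Fo x) (Fo y)"
    "iso D (prd D (Fo x) (Fo y)) (Fo (prd C x y)) (nu x y)"
proof -
  note P = F_product[OF C.product_chosen[OF assms]] note h = D.product_hprod[OF P]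
  obtain k where "arr D (prd D (Fo x) (Fo y)) (Fo (prd C x y)) k \<and>
     Cmp D (prd D (Fo x) (Fo y)) (Fo (prd C x y)) (Fo x) (Fm (prd C x y) x (pr1 C x y)) k = pr1 D (Fo x) (Fo y) \<and>
     Cmp D (prd D (Fo x) (Fo y)) (Fo (prd C x y)) (Fo y) (Fm (prd C x y) y (pr2 C x y)) k = pr2 D (Fo x) (Fo y)"
    using D.product_lift[OF P D.pr_arr[OF h]] by metis
  from someI[of "\<lambda>k. arr D (prd D (Fo x) (Fo y)) (Fo (prd C x y)) k \<and>
     Cmp D (prd D (Fo x) (Fo y)) (Fo (prd C x y)) (Fo x) (Fm (prd C x y) x (pr1 C x y)) k = pr1 D (Fo x) (Fo y) \<and>
     Cmp D (prd D (Fo x) (Fo y)) (Fo (prd C x y)) (Fo y) (Fm (prd C x y) y (pr2 C x y)) k = pr2 D (Fo x) (Fo y)", OF this]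
  have n: "arr D (prd D (Fo x) (Fo y)) (Fo (prd C x y)) (nu x y)"
    "Cmp D (prd D (Fo x) (Fo y)) (Fo (prd C x y)) (Fo x) (Fm (prd C x y) x (pr1 C x y)) (nu x y) = pr1 D (Fo x) (Fo y)"
    "Cmp D (prd D (Fo x) (Fo y)) (Fo (prd C x y)) (Fo y) (Fm (prd C x y) y (pr2 C x y)) (nu x y) = pr2 D (Fo x) (Fo y)"
    unfolding nu_def by blast+
  then show "arr D (prd D (Fo x) (Fo y)) (Fo (prd C x y)) (nu x y)"
    "Cmp D (prd D (Fo x) (Fo y)) (Fo (prd C x y)) (Fo x) (Fm (prd C x y) x (pr1 C x y)) (nu x y) = pr1 D (Fo x) (Fo y)"
    "Cmp D (prd D (Fo x) (Fo y)) (Fo (prd C x y)) (Fo y) (Fm (prd C x y) y (pr2 C x y)) (nu x y) = pr2 D (Fo x) (Fo y)"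
    by this
  show "iso D (prd D (Fo x) (Fo y)) (Fo (prd C x y)) (nu x y)"
    by (rule D.product_iso[OF P D.product_chosen[OF h] n])
qed

lemma nu_comp:
  assumes "hprod C x y" "arr D w (prd D (Fo x) (Fo y)) u"
  shows "Cmp D w (Fo (prd C x y)) (Fo x) (Fm (prd C x y) x (pr1 C x y)) (Cmp D w (prd D (Fo x) (Fo y)) (Fo (prd C x y)) (nu x y) u)
      = Cmp D w (prd D (Fo x) (Fo y)) (Fo x) (pr1 D (Fo x) (Fo y)) u"
    "Cmp D w (Fo (prd C x y)) (Fo y) (Fm (prd C x y) y (pr2 C x y)) (Cmp D w (prd D (Fo x) (Fo y)) (Fo (prd C x y)) (nu x y) u)
      = Cmp D w (prd D (Fo x) (Fo y)) (Fo y) (pr2 D (Fo x) (Fo y)) u"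
  by (simp_all only: D.comp_asc[OF assms(2) nu(1)[OF assms(1)] F_arr[OF C.pr_arr(1)[OF assms(1)]], symmetric]
      D.comp_asc[OF assms(2) nu(1)[OF assms(1)] F_arr[OF C.pr_arr(2)[OF assms(1)]], symmetric] nu[OF assms(1)])

lemma F_prd_ext:
  assumes "hprod C x y" "arr D w (Fo (prd C x y)) f" "arr D w (Fo (prd C x y)) g"
    "Cmp D w (Fo (prd C x y)) (Fo x) (Fm (prd C x y) x (pr1 C x y)) f = Cmp D w (Fo (prd C x y)) (Fo x) (Fm (prd C x y) x (pr1 C x y)) g"
    "Cmp D w (Fo (prd C x y)) (Fo y) (Fm (prd C x y) y (pr2 C x y)) f = Cmp D w (Fo (prd C x y)) (Fo y) (Fm (prd C x y) y (pr2 C x y)) g"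
  shows "f = g"
  by (rule D.jointly_monicD[OF D.product_jointly_monic[OF F_product[OF C.product_chosen[OF assms(1)]]] assms(2-)])

lemma F_eq_extend:
  assumes "Cmp C p x z f a = Cmp C p y z g b" "arr C p x a" "arr C x z f" "arr C p y b" "arr C y z g" "arr D w (Fo p) u"
  shows "Cmp D w (Fo x) (Fo z) (Fm x z f) (Cmp D w (Fo p) (Fo x) (Fm p x a) u)
    = Cmp D w (Fo y) (Fo z) (Fm y z g) (Cmp D w (Fo p) (Fo y) (Fm p y b) u)"
proof (rule D.comp_eq_extend)
  show "Cmp D (Fo p) (Fo x) (Fo z) (Fm x z f) (Fm p x a) = Cmp D (Fo p) (Fo y) (Fo z) (Fm y z g) (Fm p y b)"
    unfolding F_comp_arr[OF assms(2,3), symmetric] F_comp_arr[OF assms(4,5), symmetric] assms(1) ..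
qed (use assms in \<open>simp_all add: F_arr\<close>)

lemma nu_natural:
  assumes h: "hprod C p q" and f: "arr C p x a" "arr C q y c"
  shows "Cmp D (prd D (Fo p) (Fo q)) (prd D (Fo x) (Fo y)) (Fo (prd C x y)) (nu x y)
      (prod_map D (Fo p) (Fo x) (Fo q) (Fo y) (Fm p x a) (Fm q y c))
    = Cmp D (prd D (Fo p) (Fo q)) (Fo (prd C p q)) (Fo (prd C x y)) (Fm (prd C p q) (prd C x y) (prod_map C p x q y a c)) (nu p q)"
proof -
  note k = C.hprod_map[OF h f] note o = C.hprod_obj[OF h]
  have h': "hprod D (Fo p) (Fo q)" using F_hprod o h by blast
  note m = C.prod_map_arr[OF h f] and M = D.prod_map_arr[OF h' F_arr[OF f(1)] F_arr[OF f(2)]]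
  note n = nu[OF h] nu[OF k] note P = C.pr_arr[OF h] C.pr_arr[OF k]
  show ?thesis
    by (rule F_prd_ext[OF k D.arr_comp[OF M(1) n(5)] D.arr_comp[OF n(1) F_arr[OF m(1)]]])
      (simp_all only: nu_comp[OF k M(1)] M F_eq_extend[OF m(2) m(1) P(3) P(1) f(1) n(1)]
        F_eq_extend[OF m(3) m(1) P(4) P(2) f(2) n(1)] n(2,3))
qed

text \<open>Both composites are determined by their coordinates in \<open>F x\<close>,
  \<open>F y\<close> and \<open>F z\<close>, and these are the three projections of the iterated
  product.\<close>

lemma nu_assoc:
  assumes h: "hprod C x y" "hprod C (prd C x y) z"
  shows "Cmp D (prd D (prd D (Fo x) (Fo y)) (Fo z)) (Fo (prd C (prd C x y) z)) (Fo (prd C x (prd C y z)))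
        (Fm (prd C (prd C x y) z) (prd C x (prd C y z)) (prd_assoc C x y z))
        (Cmp D (prd D (prd D (Fo x) (Fo y)) (Fo z)) (prd D (Fo (prd C x y)) (Fo z)) (Fo (prd C (prd C x y) z))
          (nu (prd C x y) z)
          (prod_map D (prd D (Fo x) (Fo y)) (Fo (prd C x y)) (Fo z) (Fo z) (nu x y) (Idn D (Fo z))))
      = Cmp D (prd D (prd D (Fo x) (Fo y)) (Fo z)) (prd D (Fo x) (Fo (prd C y z))) (Fo (prd C x (prd C y z)))
        (nu x (prd C y z))
        (Cmp D (prd D (prd D (Fo x) (Fo y)) (Fo z)) (prd D (Fo x) (prd D (Fo y) (Fo z))) (prd D (Fo x) (Fo (prd C y z)))
          (prod_map D (Fo x) (Fo x) (prd D (Fo y) (Fo z)) (Fo (prd C y z)) (Idn D (Fo x)) (nu y z))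
          (prd_assoc D (Fo x) (Fo y) (Fo z)))"
    "hprod D (Fo x) (Fo y)" "hprod D (prd D (Fo x) (Fo y)) (Fo z)"
proof -
  have h2: "hprod C y z" "hprod C x (prd C y z)" using C.hprod_assoc h by blast+
  note o = C.hprod_obj[OF h(1)] C.hprod_obj[OF h(2)] C.hprod_obj[OF h2(1)] C.hprod_obj[OF h2(2)]
  note n = nu[OF h(1)] nu[OF h(2)] nu[OF h2(1)] nu[OF h2(2)]
  show k: "hprod D (Fo x) (Fo y)" using F_hprod o(1,2) h(1) by blast
  have "hprod D (Fo (prd C x y)) (Fo z)" using F_hprod o h(2) by blast
  then obtain w u v where w: "arr D w (Fo (prd C x y)) u" "arr D w (Fo z) v" unfolding D.hprod_iff by blast
  have "arr D w (Fo x) (Cmp D w (Fo (prd C x y)) (Fo x) (Fm (prd C x y) x (pr1 C x y)) u)"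
    "arr D w (Fo y) (Cmp D w (Fo (prd C x y)) (Fo y) (Fm (prd C x y) y (pr2 C x y)) u)"
    using D.arr_comp[OF w(1) F_arr[OF C.pr_arr(1)[OF h(1)]]] D.arr_comp[OF w(1) F_arr[OF C.pr_arr(2)[OF h(1)]]] by blast+
  from D.hprodI[OF D.pair_lift(1)[OF this] w(2)] show k2: "hprod D (prd D (Fo x) (Fo y)) (Fo z)" .
  have k3: "hprod D (Fo y) (Fo z)" "hprod D (Fo x) (prd D (Fo y) (Fo z))" using D.hprod_assoc k k2 by blast+
  have id: "arr D (Fo x) (Fo x) (Idn D (Fo x))" "arr D (Fo z) (Fo z) (Idn D (Fo z))" using o F_obj by auto
  note m = D.prod_map_arr[OF k2 n(1) id(2)] note l = D.prod_map_arr[OF k3(2) id(1) n(9)]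
  note a = D.prd_assoc_arr[OF k k2] and b = C.prd_assoc_arr[OF h]
  note lc = D.prod_map_comp[OF k3(2) id(1) n(9) a(1)]
  note P = C.pr_arr[OF h(1)] C.pr_arr[OF h(2)] C.pr_arr[OF h2(1)] C.pr_arr[OF h2(2)]
  note Q = D.pr_arr[OF k] D.pr_arr[OF k2] D.pr_arr[OF k3(1)] D.pr_arr[OF k3(2)]
  let ?T = "prd D (prd D (Fo x) (Fo y)) (Fo z)"
  let ?M = "Cmp D ?T (prd D (Fo (prd C x y)) (Fo z)) (Fo (prd C (prd C x y) z))
          (nu (prd C x y) z) (prod_map D (prd D (Fo x) (Fo y)) (Fo (prd C x y)) (Fo z) (Fo z) (nu x y) (Idn D (Fo z)))"
  let ?L = "Cmp D ?T (Fo (prd C (prd C x y) z)) (Fo (prd C x (prd C y z))) (Fm (prd C (prd C x y) z) (prd C x (prd C y z)) (prd_assoc C x y z)) ?M"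
  let ?N = "Cmp D ?T (prd D (Fo x) (prd D (Fo y) (Fo z))) (prd D (Fo x) (Fo (prd C y z)))
          (prod_map D (Fo x) (Fo x) (prd D (Fo y) (Fo z)) (Fo (prd C y z)) (Idn D (Fo x)) (nu y z)) (prd_assoc D (Fo x) (Fo y) (Fo z))"
  let ?R = "Cmp D ?T (prd D (Fo x) (Fo (prd C y z))) (Fo (prd C x (prd C y z))) (nu x (prd C y z)) ?N"
  note M = D.arr_comp[OF m(1) n(5)] note N = D.arr_comp[OF a(1) l(1)]
  note L = D.arr_comp[OF M F_arr[OF b(1)]] note R = D.arr_comp[OF N n(13)]
  have M1: "Cmp D ?T (Fo (prd C (prd C x y) z)) (Fo (prd C x y)) (Fm (prd C (prd C x y) z) (prd C x y) (pr1 C (prd C x y) z)) ?M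
    = Cmp D ?T (prd D (Fo x) (Fo y)) (Fo (prd C x y)) (nu x y) (pr1 D (prd D (Fo x) (Fo y)) (Fo z))"
    by (simp only: nu_comp[OF h(2) m(1)] m(2))
  have M2: "Cmp D ?T (Fo (prd C (prd C x y) z)) (Fo z) (Fm (prd C (prd C x y) z) z (pr2 C (prd C x y) z)) ?M
    = pr2 D (prd D (Fo x) (Fo y)) (Fo z)"
    by (simp only: nu_comp[OF h(2) m(1)] m(3) D.comp_id[OF Q(4)])
  have R2: "Cmp D ?T (Fo (prd C x (prd C y z))) (Fo (prd C y z)) (Fm (prd C x (prd C y z)) (prd C y z) (pr2 C x (prd C y z))) ?R
    = Cmp D ?T (prd D (Fo y) (Fo z)) (Fo (prd C y z)) (nu y z)
      (Cmp D ?T (prd D (Fo x) (prd D (Fo y) (Fo z))) (prd D (Fo y) (Fo z)) (pr2 D (Fo x) (prd D (Fo y) (Fo z))) (prd_assoc D (Fo x) (Fo y) (Fo z)))"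
    by (simp only: nu_comp[OF h2(2) N] lc)
  note q = D.arr_comp[OF a(1) Q(8)]
  have L2: "Cmp D ?T (Fo (prd C x (prd C y z))) (Fo (prd C y z)) (Fm (prd C x (prd C y z)) (prd C y z) (pr2 C x (prd C y z))) ?L
    = Cmp D ?T (Fo (prd C (prd C x y) z)) (Fo (prd C y z)) (Fm (prd C (prd C x y) z) (prd C y z)
      (Cmp C (prd C (prd C x y) z) (prd C x (prd C y z)) (prd C y z) (pr2 C x (prd C y z)) (prd_assoc C x y z))) ?M"
    by (simp only: F_comp_arr[OF b(1) P(8)] D.comp_asc[OF M F_arr[OF b(1)] F_arr[OF P(8)]])
  note bb = C.arr_comp[OF b(1) P(8)]
  show "?L = ?R"
  proof (rule F_prd_ext[OF h2(2) L R])
    show "Cmp D ?T (Fo (prd C x (prd C y z))) (Fo x) (Fm (prd C x (prd C y z)) x (pr1 C x (prd C y z))) ?L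
      = Cmp D ?T (Fo (prd C x (prd C y z))) (Fo x) (Fm (prd C x (prd C y z)) x (pr1 C x (prd C y z))) ?R"
      by (simp only: F_eq_extend[OF b(2) b(1) P(7) P(3,1) M] M1 nu_comp[OF h(1) Q(3)] nu_comp[OF h2(2) N] lc a(2)
          D.comp_id[OF D.arr_comp[OF Q(3,1)]])
    show "Cmp D ?T (Fo (prd C x (prd C y z))) (Fo (prd C y z)) (Fm (prd C x (prd C y z)) (prd C y z) (pr2 C x (prd C y z))) ?L
      = Cmp D ?T (Fo (prd C x (prd C y z))) (Fo (prd C y z)) (Fm (prd C x (prd C y z)) (prd C y z) (pr2 C x (prd C y z))) ?R"
    proof (rule F_prd_ext[OF h2(1) D.arr_comp[OF L F_arr[OF P(8)]] D.arr_comp[OF R F_arr[OF P(8)]]])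
      show "Cmp D ?T (Fo (prd C y z)) (Fo y) (Fm (prd C y z) y (pr1 C y z)) (Cmp D ?T (Fo (prd C x (prd C y z))) (Fo (prd C y z)) (Fm (prd C x (prd C y z)) (prd C y z) (pr2 C x (prd C y z))) ?L)
        = Cmp D ?T (Fo (prd C y z)) (Fo y) (Fm (prd C y z) y (pr1 C y z)) (Cmp D ?T (Fo (prd C x (prd C y z))) (Fo (prd C y z)) (Fm (prd C x (prd C y z)) (prd C y z) (pr2 C x (prd C y z))) ?R)"
        by (simp only: R2 L2 F_eq_extend[OF b(3) bb P(5) P(3,2) M] M1 nu_comp[OF h(1) Q(3)] nu_comp[OF h2(1) q] a(3))
      have "Cmp D ?T (Fo (prd C y z)) (Fo z) (Fm (prd C y z) z (pr2 C y z)) (Cmp D ?T (Fo (prd C (prd C x y) z)) (Fo (prd C y z)) (Fm (prd C (prd C x y) z) (prd C y z)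
      (Cmp C (prd C (prd C x y) z) (prd C x (prd C y z)) (prd C y z) (pr2 C x (prd C y z)) (prd_assoc C x y z))) ?M)
        = pr2 D (prd D (Fo x) (Fo y)) (Fo z)"
        by (simp only: D.comp_asc[OF M F_arr[OF bb] F_arr[OF P(6)], symmetric] F_comp_arr[OF bb P(6), symmetric] b(4) M2)
      then show "Cmp D ?T (Fo (prd C y z)) (Fo z) (Fm (prd C y z) z (pr2 C y z)) (Cmp D ?T (Fo (prd C x (prd C y z))) (Fo (prd C y z)) (Fm (prd C x (prd C y z)) (prd C y z) (pr2 C x (prd C y z))) ?L)
        = Cmp D ?T (Fo (prd C y z)) (Fo z) (Fm (prd C y z) z (pr2 C y z)) (Cmp D ?T (Fo (prd C x (prd C y z))) (Fo (prd C y z)) (Fm (prd C x (prd C y z)) (prd C y z) (pr2 C x (prd C y z))) ?R)"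
        by (simp only: R2 L2 nu_comp[OF h2(1) q] a(4))
    qed
  qed
qed

lemma nu_swap:
  assumes h: "hprod C x y"
  shows "Cmp D (prd D (Fo x) (Fo y)) (Fo (prd C x y)) (Fo (prd C y x)) (Fm (prd C x y) (prd C y x) (C.swap x y)) (nu x y)
    = Cmp D (prd D (Fo x) (Fo y)) (prd D (Fo y) (Fo x)) (Fo (prd C y x)) (nu y x) (D.swap (Fo x) (Fo y))"
proof -
  note k = C.hprod_sym[OF h] note n = nu[OF h] nu[OF k] note P = C.pr_arr[OF h] C.pr_arr[OF k]
  have h': "hprod D (Fo x) (Fo y)" using F_hprod C.hprod_obj[OF h] h by blast
  note s = C.pair_lift[OF P(2,1)] and t = D.pair_lift[OF D.pr_arr(2,1)[OF h']]
  show ?thesis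
  proof (rule F_prd_ext[OF k D.arr_comp[OF n(1) F_arr[OF s(1)]] D.arr_comp[OF t(1) n(5)]])
    show "Cmp D (prd D (Fo x) (Fo y)) (Fo (prd C y x)) (Fo y) (Fm (prd C y x) y (pr1 C y x)) (Cmp D (prd D (Fo x) (Fo y)) (Fo (prd C x y)) (Fo (prd C y x)) (Fm (prd C x y) (prd C y x) (C.swap x y)) (nu x y))
      = Cmp D (prd D (Fo x) (Fo y)) (Fo (prd C y x)) (Fo y) (Fm (prd C y x) y (pr1 C y x)) (Cmp D (prd D (Fo x) (Fo y)) (prd D (Fo y) (Fo x)) (Fo (prd C y x)) (nu y x) (D.swap (Fo x) (Fo y)))"
      by (simp only: nu_comp[OF k t(1)] t D.comp_asc[OF n(1) F_arr[OF s(1)] F_arr[OF P(3)], symmetric]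
          F_comp_arr[OF s(1) P(3), symmetric] s n)
    show "Cmp D (prd D (Fo x) (Fo y)) (Fo (prd C y x)) (Fo x) (Fm (prd C y x) x (pr2 C y x)) (Cmp D (prd D (Fo x) (Fo y)) (Fo (prd C x y)) (Fo (prd C y x)) (Fm (prd C x y) (prd C y x) (C.swap x y)) (nu x y))
      = Cmp D (prd D (Fo x) (Fo y)) (Fo (prd C y x)) (Fo x) (Fm (prd C y x) x (pr2 C y x)) (Cmp D (prd D (Fo x) (Fo y)) (prd D (Fo y) (Fo x)) (Fo (prd C y x)) (nu y x) (D.swap (Fo x) (Fo y)))"
      by (simp only: nu_comp[OF k t(1)] t D.comp_asc[OF n(1) F_arr[OF s(1)] F_arr[OF P(4)], symmetric]
          F_comp_arr[OF s(1) P(4), symmetric] s n)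
  qed
qed

definition eps :: 'b where
  "eps = (THE f. f \<in> Hom D (terminal_of D) (Fo (terminal_of C)))"

lemma eps: "iso D (terminal_of D) (Fo (terminal_of C)) eps" "arr D (terminal_of D) (Fo (terminal_of C)) eps"
proof -
  have o: "terminal_of D \<in> Obj D" "Fo (terminal_of C) \<in> Obj D" using D.terminal_obj F_obj[OF C.terminal_obj] by auto
  have "\<exists>!f. f \<in> Hom D (terminal_of D) (Fo (terminal_of C))" using F_terminal o by (simp add: terminal_def)
  from theI'[OF this] show a: "arr D (terminal_of D) (Fo (terminal_of C)) eps" using o by (simp add: arr_def eps_def)
  note b = D.bang_arr[OF o(2)]
  show "iso D (terminal_of D) (Fo (terminal_of C)) eps"
    by (rule D.isoI[OF a b D.terminal_ext[OF D.arr_comp[OF a b] D.arr_id[OF o(1)]] F_terminal_ext[OF D.arr_comp[OF b a] D.arr_id[OF o(2)]]])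
qed

text \<open>All coherence maps are graphs, so the coherence laws reduce to identities between
  morphisms. Only naturality involves general relations, and there \<open>nu\<close> is an
  isomorphism on feet and apexes alike.\<close>

lemma partial_tensor_functor_T0:
  "partial_tensor_functor (T0 C \<delta>) (has_product C) (T0_tensor C) (T0 D \<delta>') (has_product D) (T0_tensor D) Fo T0F
     (\<lambda>x y. graph_rel D (prd D (Fo x) (Fo y)) (Fo (prd C x y)) (nu x y))
     (graph_rel D (terminal_of D) (Fo (terminal_of C)) eps)"
proof -
  interpret TF: preadditive_functor "T0 C \<delta>" "T0 D \<delta>'" Fo T0F by (rule preadditive_functor_ind)
  interpret TC: additive_partial_tensor "T0 C \<delta>" "has_product C" C.Ten by (rule C.additive_partial_tensor_T0)
  interpret TD: additive_partial_tensor "T0 D \<delta>'" "has_product D" D.Ten by (rule D.additive_partial_tensor_T0)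
  have hC: "hprod C x y" if "x \<in> Obj C" "y \<in> Obj C" "has_product C x y" for x y using that by (simp add: hprod_def)
  show ?thesis
  proof (intro partial_tensor_functor.intro TF.cat_functor_axioms TC.partial_tensor_axioms TD.partial_tensor_axioms
      partial_tensor_functor_axioms.intro; (unfold T0_simps T0_tensor_simps)?)
    show "has_product D (Fo x) (Fo y) \<longleftrightarrow> has_product C x y" if "x \<in> Obj C" "y \<in> Obj C" for x y
      using F_hprod[OF that] that F_obj by (simp add: hprod_def)
    show "has_product D (prd D (Fo x) (Fo y)) (Fo z) \<longleftrightarrow> has_product C (prd C x y) z"
      if o: "x \<in> Obj C" "y \<in> Obj C" "z \<in> Obj C" and e: "has_product C x y" for x y z
    proof -
      note h = hC[OF o(1,2) e] note n = nu[OF h]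
      have p: "prd C x y \<in> Obj C" by (rule C.hprod_obj(3)[OF h])
      have q: "prd D (Fo x) (Fo y) \<in> Obj D" using n(1) by (simp add: arr_def)
      have "hprod D (prd D (Fo x) (Fo y)) (Fo z) \<longleftrightarrow> hprod C (prd C x y) z"
      proof
        assume "hprod D (prd D (Fo x) (Fo y)) (Fo z)"
        \<comment> \<open>Existence is transported along \<open>nu\<close>, which leads from the
          product of the images to an object in the image of \<open>F\<close>.\<close>
        from D.hprod_map[OF this n(1) D.arr_id[OF F_obj[OF o(3)]]] show "hprod C (prd C x y) z"
          using F_hprod[OF p o(3)] by simp
      qed (rule nu_assoc(3)[OF h])
      then show ?thesis using p q o(3) F_obj by (simp add: hprod_def)
    qed
    show "iso (T0 D \<delta>') (terminal_of D) (Fo (terminal_of C)) (graph_rel D (terminal_of D) (Fo (terminal_of C)) eps)"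
      by (rule D.T0_iso[OF eps(1) D.terminal_obj F_obj[OF C.terminal_obj]])
    show "iso (T0 D \<delta>') (prd D (Fo x) (Fo y)) (Fo (prd C x y)) (graph_rel D (prd D (Fo x) (Fo y)) (Fo (prd C x y)) (nu x y))"
      if "x \<in> Obj C" "y \<in> Obj C" "has_product C x y" for x y
      using nu(1,4)[OF hC[OF that]] by (intro D.T0_iso) (auto simp: arr_def)
    show "Cmp (T0 D \<delta>') (prd D (Fo x) (Fo y)) (prd D (Fo x') (Fo y')) (Fo (prd C x' y'))
        (graph_rel D (prd D (Fo x') (Fo y')) (Fo (prd C x' y')) (nu x' y'))
        (tmor (T0_tensor D) (Fo x) (Fo x') (Fo y) (Fo y') (T0F x x' f) (T0F y y' g))
      = Cmp (T0 D \<delta>') (prd D (Fo x) (Fo y)) (Fo (prd C x y)) (Fo (prd C x' y'))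
        (T0F (prd C x y) (prd C x' y') (tmor (T0_tensor C) x x' y y' f g))
        (graph_rel D (prd D (Fo x) (Fo y)) (Fo (prd C x y)) (nu x y))" (is "?L f g = ?R f g")
      if f: "arr (T0 C \<delta>) x x' f" and g: "arr (T0 C \<delta>) y y' g" and e: "has_product C x y" "has_product C x' y'" for x x' f y y' g
    proof (rule C.T0_eqI[OF _ _ f])
      have h: "hprod C x y" "hprod C x' y'" using f g e by (auto simp: hprod_def T0_arr_iff)
      note n = nu[OF h(1)] nu[OF h(2)]
      fix p a b assume 1: "arr C p x a" "arr C p x' b"
      show "?L (C.sp x x' p a b) g = ?R (C.sp x x' p a b) g"
      proof (rule C.T0_eqI[OF _ _ g])
        fix q c d assume 2: "arr C q y c" "arr C q y' d"
        show "?L (C.sp x x' p a b) (C.sp y y' q c d) = ?R (C.sp x x' p a b) (C.sp y y' q c d)"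
        proof (cases "hprod C p q")
          case True
          have o: "p \<in> Obj C" "q \<in> Obj C" using 1 2 by (auto simp: arr_def)
          have k: "hprod D (Fo p) (Fo q)" using F_hprod[OF o] True by simp
          note m = C.prod_map_arr(1)[OF True 1(1) 2(1)] C.prod_map_arr(1)[OF True 1(2) 2(2)]
          note M = D.prod_map_arr(1)[OF k F_arr[OF 1(1)] F_arr[OF 2(1)]] D.prod_map_arr(1)[OF k F_arr[OF 1(2)] F_arr[OF 2(2)]]
          show ?thesis
            unfolding ind_span[OF 1] ind_span[OF 2] C.T0_tensor_span[OF 1 2 True] ind_span[OF m]
              D.T0_tensor_span[OF F_arr[OF 1(1)] F_arr[OF 1(2)] F_arr[OF 2(1)] F_arr[OF 2(2)] k]
            by (rule D.T0_natural_iso[OF n(4) nu(4)[OF True] D.arr_dom[OF n(1)] n(5) M F_arr[OF m(1)] F_arr[OF m(2)]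
                nu_natural[OF True 1(1) 2(1)] nu_natural[OF True 1(2) 2(2)]])
        next
          case False
          have o: "p \<in> Obj C" "q \<in> Obj C" using 1 2 by (auto simp: arr_def)
          have k: "\<not> hprod D (Fo p) (Fo q)" using F_hprod[OF o] False by simp
          show ?thesis
            unfolding ind_span[OF 1] ind_span[OF 2] C.T0_tensor_span_zero[OF 1 2 False]
              D.T0_tensor_span_zero[OF F_arr[OF 1(1)] F_arr[OF 1(2)] F_arr[OF 2(1)] F_arr[OF 2(2)] k]
            by (simp only: T0_comp_linear klinearD[OF klinear_ind])
        qed
      qed (intro klinear_T0_compI klinear_T0_tmorI klinear_comp[OF klinear_ind] klinear_ind klinear_ident)+
    qed (intro klinear_T0_compI klinear_T0_tmorI klinear_comp[OF klinear_ind] klinear_ind klinear_ident)+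
    show "Cmp (T0 D \<delta>') (prd D (prd D (Fo x) (Fo y)) (Fo z)) (Fo (prd C (prd C x y) z)) (Fo (prd C x (prd C y z)))
        (T0F (prd C (prd C x y) z) (prd C x (prd C y z)) (graph_rel C (prd C (prd C x y) z) (prd C x (prd C y z)) (prd_assoc C x y z)))
        (Cmp (T0 D \<delta>') (prd D (prd D (Fo x) (Fo y)) (Fo z)) (prd D (Fo (prd C x y)) (Fo z)) (Fo (prd C (prd C x y) z))
          (graph_rel D (prd D (Fo (prd C x y)) (Fo z)) (Fo (prd C (prd C x y) z)) (nu (prd C x y) z))
          (tmor (T0_tensor D) (prd D (Fo x) (Fo y)) (Fo (prd C x y)) (Fo z) (Fo z)
            (graph_rel D (prd D (Fo x) (Fo y)) (Fo (prd C x y)) (nu x y)) (graph_rel D (Fo z) (Fo z) (Idn D (Fo z)))))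
      = Cmp (T0 D \<delta>') (prd D (prd D (Fo x) (Fo y)) (Fo z)) (prd D (Fo x) (Fo (prd C y z))) (Fo (prd C x (prd C y z)))
        (graph_rel D (prd D (Fo x) (Fo (prd C y z))) (Fo (prd C x (prd C y z))) (nu x (prd C y z)))
        (Cmp (T0 D \<delta>') (prd D (prd D (Fo x) (Fo y)) (Fo z)) (prd D (Fo x) (prd D (Fo y) (Fo z))) (prd D (Fo x) (Fo (prd C y z)))
          (tmor (T0_tensor D) (Fo x) (Fo x) (prd D (Fo y) (Fo z)) (Fo (prd C y z)) (graph_rel D (Fo x) (Fo x) (Idn D (Fo x)))
            (graph_rel D (prd D (Fo y) (Fo z)) (Fo (prd C y z)) (nu y z)))
          (graph_rel D (prd D (prd D (Fo x) (Fo y)) (Fo z)) (prd D (Fo x) (prd D (Fo y) (Fo z))) (prd_assoc D (Fo x) (Fo y) (Fo z))))"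
      if o: "x \<in> Obj C" "y \<in> Obj C" "z \<in> Obj C" and e: "has_product C x y" "has_product C (prd C x y) z" for x y z
    proof -
      note h = hC[OF o(1,2) e(1)] note h' = hC[OF C.hprod_obj(3)[OF h] o(3) e(2)]
      have h2: "hprod C y z" "hprod C x (prd C y z)" using C.hprod_assoc h h' by blast+
      note n = nu[OF h] nu[OF h'] nu[OF h2(1)] nu[OF h2(2)] note N = nu_assoc[OF h h']
      have k: "hprod D (Fo y) (Fo z)" "hprod D (Fo x) (prd D (Fo y) (Fo z))" using D.hprod_assoc N(2,3) by blast+
      have id: "arr D (Fo x) (Fo x) (Idn D (Fo x))" "arr D (Fo z) (Fo z) (Idn D (Fo z))" using o F_obj by auto
      note m = D.prod_map_arr(1)[OF N(3) n(1) id(2)] D.prod_map_arr(1)[OF k(2) id(1) n(9)]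
      note a = D.prd_assoc_arr(1)[OF N(2,3)] C.prd_assoc_arr(1)[OF h h']
      show ?thesis
        by (simp only: D.T0_tensor_graph[OF n(1) id(2) N(3)] D.T0_tensor_graph[OF id(1) n(9) k(2)] ind_graph[OF a(2)]
            D.T0_comp_graph[OF m(1) n(5)] D.T0_comp_graph[OF D.arr_comp[OF m(1) n(5)] F_arr[OF a(2)]]
            D.T0_comp_graph[OF a(1) m(2)] D.T0_comp_graph[OF D.arr_comp[OF a(1) m(2)] n(13)] N(1))
    qed
    show "Cmp (T0 D \<delta>') (prd D (terminal_of D) (Fo x)) (Fo (prd C (terminal_of C) x)) (Fo x)
        (T0F (prd C (terminal_of C) x) x (graph_rel C (prd C (terminal_of C) x) x (pr2 C (terminal_of C) x)))
        (Cmp (T0 D \<delta>') (prd D (terminal_of D) (Fo x)) (prd D (Fo (terminal_of C)) (Fo x)) (Fo (prd C (terminal_of C) x))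
          (graph_rel D (prd D (Fo (terminal_of C)) (Fo x)) (Fo (prd C (terminal_of C) x)) (nu (terminal_of C) x))
          (tmor (T0_tensor D) (terminal_of D) (Fo (terminal_of C)) (Fo x) (Fo x)
            (graph_rel D (terminal_of D) (Fo (terminal_of C)) eps) (graph_rel D (Fo x) (Fo x) (Idn D (Fo x)))))
      = graph_rel D (prd D (terminal_of D) (Fo x)) (Fo x) (pr2 D (terminal_of D) (Fo x))" if x: "x \<in> Obj C" for x
    proof -
      note h = C.hprod_terminal(1)[OF x] D.hprod_terminal(1)[OF F_obj[OF x]] note id = D.arr_id[OF F_obj[OF x]]
      note m = D.prod_map_arr[OF h(2) eps(2) id] note n = nu[OF h(1)] note p = C.pr_arr(2)[OF h(1)]
      show ?thesis
        by (simp only: D.T0_tensor_graph[OF eps(2) id h(2)] D.T0_comp_graph[OF m(1) n(1)] ind_graph[OF p]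
            D.T0_comp_graph[OF D.arr_comp[OF m(1) n(1)] F_arr[OF p]] nu_comp(2)[OF h(1) m(1)] m(3) D.comp_id[OF D.pr_arr(2)[OF h(2)]])
    qed
    show "Cmp (T0 D \<delta>') (prd D (Fo x) (terminal_of D)) (Fo (prd C x (terminal_of C))) (Fo x)
        (T0F (prd C x (terminal_of C)) x (graph_rel C (prd C x (terminal_of C)) x (pr1 C x (terminal_of C))))
        (Cmp (T0 D \<delta>') (prd D (Fo x) (terminal_of D)) (prd D (Fo x) (Fo (terminal_of C))) (Fo (prd C x (terminal_of C)))
          (graph_rel D (prd D (Fo x) (Fo (terminal_of C))) (Fo (prd C x (terminal_of C))) (nu x (terminal_of C)))
          (tmor (T0_tensor D) (Fo x) (Fo x) (terminal_of D) (Fo (terminal_of C))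
            (graph_rel D (Fo x) (Fo x) (Idn D (Fo x))) (graph_rel D (terminal_of D) (Fo (terminal_of C)) eps)))
      = graph_rel D (prd D (Fo x) (terminal_of D)) (Fo x) (pr1 D (Fo x) (terminal_of D))" if x: "x \<in> Obj C" for x
    proof -
      note h = C.hprod_terminal(2)[OF x] D.hprod_terminal(2)[OF F_obj[OF x]] note id = D.arr_id[OF F_obj[OF x]]
      note m = D.prod_map_arr[OF h(2) id eps(2)] note n = nu[OF h(1)] note p = C.pr_arr(1)[OF h(1)]
      show ?thesis
        by (simp only: D.T0_tensor_graph[OF id eps(2) h(2)] D.T0_comp_graph[OF m(1) n(1)] ind_graph[OF p]
            D.T0_comp_graph[OF D.arr_comp[OF m(1) n(1)] F_arr[OF p]] nu_comp(1)[OF h(1) m(1)] m(2) D.comp_id[OF D.pr_arr(1)[OF h(2)]])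
    qed
    show "Cmp (T0 D \<delta>') (prd D (Fo x) (Fo y)) (Fo (prd C x y)) (Fo (prd C y x))
        (T0F (prd C x y) (prd C y x) (graph_rel C (prd C x y) (prd C y x) (C.swap x y)))
        (graph_rel D (prd D (Fo x) (Fo y)) (Fo (prd C x y)) (nu x y))
      = Cmp (T0 D \<delta>') (prd D (Fo x) (Fo y)) (prd D (Fo y) (Fo x)) (Fo (prd C y x))
        (graph_rel D (prd D (Fo y) (Fo x)) (Fo (prd C y x)) (nu y x))
        (graph_rel D (prd D (Fo x) (Fo y)) (prd D (Fo y) (Fo x)) (D.swap (Fo x) (Fo y)))"
      if "x \<in> Obj C" "y \<in> Obj C" "has_product C x y" for x y
    proof -
      note h = hC[OF that] note k = C.hprod_sym[OF h] note n = nu[OF h] nu[OF k]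
      have h': "hprod D (Fo x) (Fo y)" using F_hprod that(1,2) h by blast
      note s = C.pair_lift(1)[OF C.pr_arr(2,1)[OF h]] D.pair_lift(1)[OF D.pr_arr(2,1)[OF h']]
      show ?thesis
        by (simp only: ind_graph[OF s(1)] D.T0_comp_graph[OF n(1) F_arr[OF s(1)]] D.T0_comp_graph[OF s(2) n(5)] nu_swap[OF h])
    qed
  qed
qed

end

subsection \<open>Lifting to the additive completion\<close>

abbreviation "pd1 k \<equiv> fst (prod_decode k)"
abbreviation "pd2 k \<equiv> snd (prod_decode k)"

lemma pd_encode: "prod_encode (pd1 k, pd2 k) = k"
  by simp

lemma eq_prod_encode: "l = prod_encode (i, j) \<longleftrightarrow> pd1 l = i \<and> pd2 l = j"
  using pd_encode[of l] by force

lemma fam_tensor_dom: "k \<in> dom (fam_tensor ex t X Y) \<longleftrightarrow>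
    pd1 k \<in> dom X \<and> pd2 k \<in> dom Y \<and> ex (the (X (pd1 k))) (the (Y (pd2 k)))"
  by (simp add: fam_tensor_def domIff case_prod_unfold Let_def)

lemma fam_tensor_the: "k \<in> dom (fam_tensor ex t X Y) \<Longrightarrow>
    the (fam_tensor ex t X Y k) = t (the (X (pd1 k))) (the (Y (pd2 k)))"
  unfolding fam_tensor_dom by (simp add: fam_tensor_def case_prod_unfold Let_def)

text \<open>Displays the index set as an injective image of a set of pairs, from which finiteness
  and the reindexing of sums follow.\<close>

lemma dom_fam_tensor_eq: "dom (fam_tensor ex t X Y)
    = prod_encode ` {p \<in> dom X \<times> dom Y. ex (the (X (fst p))) (the (Y (snd p)))}"
  (is "?l = ?r")
proof (intro equalityI subsetI)
  fix k assume "k \<in> ?l"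
  then have "prod_decode k \<in> {p \<in> dom X \<times> dom Y. ex (the (X (fst p))) (the (Y (snd p)))}"
    unfolding fam_tensor_dom by (simp add: mem_Times_iff)
  then have "prod_encode (prod_decode k) \<in> ?r" by (rule imageI)
  then show "k \<in> ?r" by simp
next
  fix k assume "k \<in> ?r" then show "k \<in> ?l" unfolding fam_tensor_dom by fastforce
qed

lemma finite_dom_fam_tensor: "finite (dom X) \<Longrightarrow> finite (dom Y) \<Longrightarrow> finite (dom (fam_tensor ex t X Y))"
  unfolding dom_fam_tensor_eq by simp

text \<open>Absent pairs are written as zero terms, the form in which they arise from the vanishing
  clause of \<open>tmor_comp\<close>.\<close>

lemma sum_fam_tensor:
  assumes "finite (dom X)" "finite (dom Y)"
  shows "(\<Sum>k\<in>dom (fam_tensor ex t X Y). h k)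
    = (\<Sum>i\<in>dom X. \<Sum>j\<in>dom Y. if ex (the (X i)) (the (Y j)) then h (prod_encode (i, j)) else 0)"
proof -
  have "(\<Sum>k\<in>dom (fam_tensor ex t X Y). h k)
    = (\<Sum>p\<in>{p \<in> dom X \<times> dom Y. ex (the (X (fst p))) (the (Y (snd p)))}. h (prod_encode p))"
    unfolding dom_fam_tensor_eq by (subst sum.reindex) (auto simp: inj_prod_encode)
  also have "\<dots> = (\<Sum>p\<in>dom X \<times> dom Y. if ex (the (X (fst p))) (the (Y (snd p))) then h (prod_encode p) else 0)"
    by (rule sum.inter_filter) (use assms in simp)
  also have "\<dots> = (\<Sum>i\<in>dom X. \<Sum>j\<in>dom Y. if ex (the (X i)) (the (Y j)) then h (prod_encode (i, j)) else 0)"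
    by (simp add: sum.cartesian_product case_prod_unfold cong: if_cong)
  finally show ?thesis .
qed

text \<open>Reindexes \<open>((i, j), m)\<close> as \<open>(i, (j, m))\<close>, the effect of the
  associator on summands.\<close>

definition assoc_index :: "nat \<Rightarrow> nat" where
  "assoc_index k = prod_encode (pd1 (pd1 k), prod_encode (pd2 (pd1 k), pd2 k))"

definition braid_index :: "nat \<Rightarrow> nat" where
  "braid_index k = prod_encode (pd2 k, pd1 k)"

lemma index_simps [simp]:
  "pd1 (assoc_index k) = pd1 (pd1 k)" "pd1 (pd2 (assoc_index k)) = pd2 (pd1 k)" "pd2 (pd2 (assoc_index k)) = pd2 k"
  "pd1 (braid_index k) = pd2 k" "pd2 (braid_index k) = pd1 k"
  by (simp_all add: assoc_index_def braid_index_def)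

lemma inj_assoc_index: "inj assoc_index"
proof (rule injI)
  fix k l assume "assoc_index k = assoc_index l"
  then have "pd1 k = pd1 l" "pd2 k = pd2 l"
    using pd_encode[of "pd1 k"] pd_encode[of "pd1 l"] index_simps(1-3)[of k] index_simps(1-3)[of l] by metis+
  then show "k = l" using pd_encode by metis
qed

lemma inj_braid_index: "inj braid_index"
proof (rule injI)
  fix k l assume "braid_index k = braid_index l"
  then have "pd1 k = pd1 l" "pd2 k = pd2 l" using index_simps(4,5)[of k] index_simps(4,5)[of l] by metis+
  then show "k = l" using pd_encode by metis
qed

lemma monomial_cong:
  assumes "dom X = dom X'" "\<And>i. i \<in> dom X \<Longrightarrow> \<sigma> i = \<sigma>' i" "\<And>i. i \<in> dom X \<Longrightarrow> t i = t' i"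
  shows "monomial X \<sigma> t = monomial X' \<sigma>' t'"
  using assms by (auto simp: monomial_def fun_eq_iff)

context preadditive
begin

text \<open>Each row of the first factor meets a single row of the second, so index maps compose and
  diagrams of coherence maps can be compared entry by entry.\<close>

lemma monomial_comp:
  assumes "X \<in> Obj (additive C)" "Y \<in> Obj (additive C)" "Z \<in> Obj (additive C)"
    and t: "\<And>i. i \<in> dom X \<Longrightarrow> \<sigma> i \<in> dom Y \<and> arr C (the (X i)) (the (Y (\<sigma> i))) (t i)"
    and s: "\<And>j. j \<in> dom Y \<Longrightarrow> \<tau> j \<in> dom Z \<and> arr C (the (Y j)) (the (Z (\<tau> j))) (s j)"
  shows "Cmp (additive C) X Y Z (monomial Y \<tau> s) (monomial X \<sigma> t) = monomial X (\<lambda>i. \<tau> (\<sigma> i))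
    (\<lambda>i. Cmp C (the (X i)) (the (Y (\<sigma> i))) (the (Z (\<tau> (\<sigma> i)))) (s (\<sigma> i)) (t i))"
proof (intro ext)
  fix i k
  have "arr (additive C) Y Z (monomial Y \<tau> s)" by (rule monomial_arr[OF assms(2,3)]) (rule s)
  then have 1: "Cmp (additive C) X Y Z (monomial Y \<tau> s) (monomial X \<sigma> t) i k = (if i \<in> dom X \<and> k \<in> dom Z
    then Cmp C (the (X i)) (the (Y (\<sigma> i))) (the (Z k)) (monomial Y \<tau> s (\<sigma> i) k) (t i) else 0)"
    by (rule comp_monomial_right[OF assms(1)]) (rule t)
  show "Cmp (additive C) X Y Z (monomial Y \<tau> s) (monomial X \<sigma> t) i k = monomial X (\<lambda>i. \<tau> (\<sigma> i))
    (\<lambda>i. Cmp C (the (X i)) (the (Y (\<sigma> i))) (the (Z (\<tau> (\<sigma> i)))) (s (\<sigma> i)) (t i)) i k"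
  proof (cases "i \<in> dom X")
    case True
    have a: "\<sigma> i \<in> dom Y" "arr C (the (X i)) (the (Y (\<sigma> i))) (t i)" "\<tau> (\<sigma> i) \<in> dom Z" using t[OF True] s by auto
    show ?thesis
      using True a comp_zero(1)[OF arr_dom[OF a(2)] arr_cod[OF a(2)] _ a(2), of "the (Z k)"] additive_objD(2)[OF assms(3), of k]
      unfolding 1 by (simp add: monomial_def)
  qed (simp add: 1 monomial_def)
qed

lemma diagonal_iso:
  assumes "X \<in> Obj (additive C)" "Y \<in> Obj (additive C)" "dom X = dom Y"
    and iso: "\<And>i. i \<in> dom X \<Longrightarrow> iso C (the (X i)) (the (Y i)) (t i)"
  shows "iso (additive C) X Y (monomial X (\<lambda>i. i) t)"
proof -
  have "\<exists>g. arr C (the (X i)) (the (Y i)) (t i) \<and> arr C (the (Y i)) (the (X i)) g \<and>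
      Cmp C (the (X i)) (the (Y i)) (the (X i)) g (t i) = Idn C (the (X i)) \<and>
      Cmp C (the (Y i)) (the (X i)) (the (Y i)) (t i) g = Idn C (the (Y i))" if "i \<in> dom X" for i
    using isoE[OF iso[OF that] additive_objD(2)[OF assms(1) that]] additive_objD(2)[OF assms(2), of i] that assms(3) by metis
  then obtain g where g: "\<And>i. i \<in> dom X \<Longrightarrow> arr C (the (X i)) (the (Y i)) (t i) \<and> arr C (the (Y i)) (the (X i)) (g i) \<and>
      Cmp C (the (X i)) (the (Y i)) (the (X i)) (g i) (t i) = Idn C (the (X i)) \<and>
      Cmp C (the (Y i)) (the (X i)) (the (Y i)) (t i) (g i) = Idn C (the (Y i))" by metis
  have t: "i \<in> dom Y \<and> arr C (the (X i)) (the (Y i)) (t i)" if "i \<in> dom X" for i using g that assms(3) by simp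
  have s: "i \<in> dom X \<and> arr C (the (Y i)) (the (X i)) (g i)" if "i \<in> dom Y" for i using g that assms(3) by simp
  show ?thesis
    unfolding iso_def
  proof (intro conjI bexI[of _ "monomial Y (\<lambda>i. i) g"])
    show "monomial X (\<lambda>i. i) t \<in> Hom (additive C) X Y" using monomial_arr[OF assms(1,2) t] by (simp add: arr_def)
    show "monomial Y (\<lambda>i. i) g \<in> Hom (additive C) Y X" using monomial_arr[OF assms(2,1) s] by (simp add: arr_def)
    show "Cmp (additive C) X Y X (monomial Y (\<lambda>i. i) g) (monomial X (\<lambda>i. i) t) = Idn (additive C) X"
    proof -
      have "Cmp (additive C) X Y X (monomial Y (\<lambda>i. i) g) (monomial X (\<lambda>i. i) t)
        = monomial X (\<lambda>i. i) (\<lambda>i. Cmp C (the (X i)) (the (Y i)) (the (X i)) (g i) (t i))"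
        by (rule monomial_comp[OF assms(1,2,1)]; (rule t s)?)
      also have "\<dots> = Idn (additive C) X" unfolding additive_id by (rule monomial_cong) (use g in auto)
      finally show ?thesis .
    qed
    show "Cmp (additive C) Y X Y (monomial X (\<lambda>i. i) t) (monomial Y (\<lambda>i. i) g) = Idn (additive C) Y"
    proof -
      have "Cmp (additive C) Y X Y (monomial X (\<lambda>i. i) t) (monomial Y (\<lambda>i. i) g)
        = monomial Y (\<lambda>i. i) (\<lambda>i. Cmp C (the (Y i)) (the (X i)) (the (Y i)) (t i) (g i))"
        by (rule monomial_comp[OF assms(2,1,2)]; (rule t s)?)
      also have "\<dots> = Idn (additive C) Y" unfolding additive_id by (rule monomial_cong) (use g assms(3) in auto)
      finally show ?thesis .
    qed
  qed
qed

end

section \<open>Tensor products of families and matrices\<close>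

context additive_partial_tensor
begin

abbreviation "ten \<equiv> fam_tensor ex (tobj S)"
abbreviation "AT \<equiv> additive_tensor ex S"

lemma additive_tensor_simps:
  "tobj AT = ten" "tunit AT = [0 \<mapsto> tunit S]"
  by (simp_all add: additive_tensor_def Let_def)

lemma additive_tmor:
  "tmor AT X X' Y Y' f g k l = (if k \<in> dom (ten X Y) \<and> l \<in> dom (ten X' Y')
    then tmor S (the (X (pd1 k))) (the (X' (pd1 l))) (the (Y (pd2 k))) (the (Y' (pd2 l)))
      (f (pd1 k) (pd1 l)) (g (pd2 k) (pd2 l)) else 0)"
  by (simp add: additive_tensor_def Let_def case_prod_unfold)

lemma additive_assoc: "tassoc AT X Y Z = monomial (ten (ten X Y) Z) assoc_index
    (\<lambda>k. tassoc S (the (X (pd1 (pd1 k)))) (the (Y (pd2 (pd1 k)))) (the (Z (pd2 k))))"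
  by (simp add: additive_tensor_def Let_def case_prod_unfold monomial_def fun_eq_iff assoc_index_def)

lemma additive_braid: "tbraid AT X Y = monomial (ten X Y) braid_index (\<lambda>k. tbraid S (the (X (pd1 k))) (the (Y (pd2 k))))"
  by (simp add: additive_tensor_def Let_def case_prod_unfold monomial_def fun_eq_iff braid_index_def)

text \<open>The unit family has the single index \<open>0\<close>, and by \<open>ex_unit\<close> no
  summand is lost.\<close>

lemma ten_unit_dom:
  assumes "X \<in> Obj (additive C)"
  shows "k \<in> dom (ten [0 \<mapsto> tunit S] X) \<longleftrightarrow> pd1 k = 0 \<and> pd2 k \<in> dom X"
    "k \<in> dom (ten X [0 \<mapsto> tunit S]) \<longleftrightarrow> pd2 k = 0 \<and> pd1 k \<in> dom X"
  using ex_unit additive_objD(2)[OF assms] by (auto simp: fam_tensor_dom simp del: domIff split: if_splits)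

lemma additive_unitors:
  assumes "X \<in> Obj (additive C)"
  shows "tlunit AT X = monomial (ten [0 \<mapsto> tunit S] X) (\<lambda>k. pd2 k) (\<lambda>k. tlunit S (the (X (pd2 k))))"
    "trunit AT X = monomial (ten X [0 \<mapsto> tunit S]) (\<lambda>k. pd1 k) (\<lambda>k. trunit S (the (X (pd1 k))))"
  unfolding monomial_def ten_unit_dom[OF assms]
  by (auto simp: additive_tensor_def Let_def fun_eq_iff eq_prod_encode simp del: domIff)

lemma ten_obj:
  assumes "X \<in> Obj (additive C)" "Y \<in> Obj (additive C)"
  shows "ten X Y \<in> Obj (additive C)"
proof -
  have "the (ten X Y k) \<in> Obj C" if "k \<in> dom (ten X Y)" for k
    unfolding fam_tensor_the[OF that]
    using that[unfolded fam_tensor_dom] additive_objD(2)[OF assms(1)] additive_objD(2)[OF assms(2)] tobj_obj by blast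
  moreover have "finite (dom (ten X Y))"
    using finite_dom_fam_tensor additive_objD(1)[OF assms(1)] additive_objD(1)[OF assms(2)] by blast
  ultimately show ?thesis by (force simp: additive_def ran_def)
qed

lemma unit_family: "[0 \<mapsto> tunit S] \<in> Obj (additive C)"
  using unit_obj by (simp add: additive_def)

text \<open>By \<open>ex_assoc\<close> a triple of summands is present in one bracketing exactly if
  it is present in the other. Otherwise the associator could not be a bijection between
  summands.\<close>

lemma ten_assoc_dom:
  assumes "X \<in> Obj (additive C)" "Y \<in> Obj (additive C)" "Z \<in> Obj (additive C)"
  shows "assoc_index k \<in> dom (ten X (ten Y Z)) \<longleftrightarrow> k \<in> dom (ten (ten X Y) Z)"
proof -
  have 1: "k \<in> dom (ten (ten X Y) Z) \<longleftrightarrow> pd1 (pd1 k) \<in> dom X \<and> pd2 (pd1 k) \<in> dom Y \<and> pd2 k \<in> dom Z \<and>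
      ex (the (X (pd1 (pd1 k)))) (the (Y (pd2 (pd1 k)))) \<and>
      ex (tobj S (the (X (pd1 (pd1 k)))) (the (Y (pd2 (pd1 k))))) (the (Z (pd2 k)))"
  proof (cases "pd1 k \<in> dom (ten X Y)")
    case True
    then show ?thesis using True[unfolded fam_tensor_dom] by (simp add: fam_tensor_dom[of k] fam_tensor_the)
  next
    case False
    then show ?thesis using False[unfolded fam_tensor_dom] unfolding fam_tensor_dom[of k] by blast
  qed
  have 2: "assoc_index k \<in> dom (ten X (ten Y Z)) \<longleftrightarrow> pd1 (pd1 k) \<in> dom X \<and> pd2 (pd1 k) \<in> dom Y \<and> pd2 k \<in> dom Z \<and>
      ex (the (Y (pd2 (pd1 k)))) (the (Z (pd2 k))) \<and>
      ex (the (X (pd1 (pd1 k)))) (tobj S (the (Y (pd2 (pd1 k)))) (the (Z (pd2 k))))"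
  proof (cases "pd2 (assoc_index k) \<in> dom (ten Y Z)")
    case True
    then show ?thesis using True[unfolded fam_tensor_dom] by (simp add: fam_tensor_dom[of "assoc_index k"] fam_tensor_the)
  next
    case False
    then show ?thesis using False[unfolded fam_tensor_dom index_simps]
      unfolding fam_tensor_dom[of "assoc_index k"] index_simps by blast
  qed
  show ?thesis unfolding 1 2
    using ex_assoc[OF additive_objD(2)[OF assms(1)] additive_objD(2)[OF assms(2)] additive_objD(2)[OF assms(3)]] by blast
qed

lemma tmor_zero:
  assumes "x \<in> Obj C" "x' \<in> Obj C" "y \<in> Obj C" "y' \<in> Obj C" "ex x y" "ex x' y'"
  shows "arr C y y' g \<Longrightarrow> tmor S x x' y y' 0 g = 0" "arr C x x' f \<Longrightarrow> tmor S x x' y y' f 0 = 0"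
  using tmor_add_left[of x x' 0 0 y y' g] tmor_add_right[of x x' f y y' 0 0] assms zero_arr by auto

lemma tmor_sum_left:
  assumes "x \<in> Obj C" "x' \<in> Obj C" "arr C y y' g" "ex x y" "ex x' y'" "\<And>i. i \<in> I \<Longrightarrow> arr C x x' (f i)"
  shows "tmor S x x' y y' (\<Sum>i\<in>I. f i) g = (\<Sum>i\<in>I. tmor S x x' y y' (f i) g)"
proof -
  have o: "y \<in> Obj C" "y' \<in> Obj C" using assms by (auto simp: arr_def)
  show ?thesis using assms(6)
    by (induction I rule: infinite_finite_induct) (simp_all add: assms(1-5) o tmor_zero tmor_add_left sum_arr)
qed

lemma tmor_sum_right:
  assumes "y \<in> Obj C" "y' \<in> Obj C" "arr C x x' f" "ex x y" "ex x' y'" "\<And>i. i \<in> I \<Longrightarrow> arr C y y' (g i)"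
  shows "tmor S x x' y y' f (\<Sum>i\<in>I. g i) = (\<Sum>i\<in>I. tmor S x x' y y' f (g i))"
proof -
  have o: "x \<in> Obj C" "x' \<in> Obj C" using assms by (auto simp: arr_def)
  show ?thesis using assms(6)
    by (induction I rule: infinite_finite_induct) (simp_all add: assms(1-5) o tmor_zero tmor_add_right sum_arr)
qed

lemma additive_tmor_arr:
  assumes f: "arr (additive C) X X' f" and g: "arr (additive C) Y Y' g"
  shows "arr (additive C) (ten X Y) (ten X' Y') (tmor AT X X' Y Y' f g)"
proof -
  have o: "X \<in> Obj (additive C)" "X' \<in> Obj (additive C)" "Y \<in> Obj (additive C)" "Y' \<in> Obj (additive C)"
    using f g by (auto simp: arr_def)
  have "arr C (the (ten X Y k)) (the (ten X' Y' l)) (tmor AT X X' Y Y' f g k l)"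
    if k: "k \<in> dom (ten X Y)" and l: "l \<in> dom (ten X' Y')" for k l
    unfolding fam_tensor_the[OF k] fam_tensor_the[OF l] additive_tmor
    using k l k[unfolded fam_tensor_dom] l[unfolded fam_tensor_dom]
      tmor_arr[OF additive_arr_entry[OF f] additive_arr_entry[OF g]] by simp
  then show ?thesis unfolding additive_arr_iff[of "ten X Y"] using ten_obj o by (simp add: additive_tmor)
qed

text \<open>The hypothesis on \<open>ex\<close> keeps nonzero entries from landing on an absent
  summand, where the tensor product would delete them.\<close>

lemma additive_tmor_monomial:
  assumes o: "X \<in> Obj (additive C)" "X' \<in> Obj (additive C)" "Y \<in> Obj (additive C)" "Y' \<in> Obj (additive C)"
    and t: "\<And>i. i \<in> dom X \<Longrightarrow> \<sigma> i \<in> dom X' \<and> arr C (the (X i)) (the (X' (\<sigma> i))) (t i)"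
    and s: "\<And>j. j \<in> dom Y \<Longrightarrow> \<tau> j \<in> dom Y' \<and> arr C (the (Y j)) (the (Y' (\<tau> j))) (s j)"
    and e: "\<And>k. k \<in> dom (ten X Y) \<Longrightarrow> ex (the (X' (\<sigma> (pd1 k)))) (the (Y' (\<tau> (pd2 k))))"
  shows "tmor AT X X' Y Y' (monomial X \<sigma> t) (monomial Y \<tau> s)
    = monomial (ten X Y) (\<lambda>k. prod_encode (\<sigma> (pd1 k), \<tau> (pd2 k)))
      (\<lambda>k. tmor S (the (X (pd1 k))) (the (X' (\<sigma> (pd1 k)))) (the (Y (pd2 k))) (the (Y' (\<tau> (pd2 k)))) (t (pd1 k)) (s (pd2 k)))"
proof (intro ext)
  fix k l
  show "tmor AT X X' Y Y' (monomial X \<sigma> t) (monomial Y \<tau> s) k l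
    = monomial (ten X Y) (\<lambda>k. prod_encode (\<sigma> (pd1 k), \<tau> (pd2 k)))
      (\<lambda>k. tmor S (the (X (pd1 k))) (the (X' (\<sigma> (pd1 k)))) (the (Y (pd2 k))) (the (Y' (\<tau> (pd2 k)))) (t (pd1 k)) (s (pd2 k))) k l"
  proof (cases "k \<in> dom (ten X Y)")
    case True
    note k = True[unfolded fam_tensor_dom]
    have k1: "pd1 k \<in> dom X" "pd2 k \<in> dom Y" "ex (the (X (pd1 k))) (the (Y (pd2 k)))" using k by auto
    show ?thesis
    proof (cases "l = prod_encode (\<sigma> (pd1 k), \<tau> (pd2 k))")
      case l: True
      have "l \<in> dom (ten X' Y')" unfolding fam_tensor_dom using t[OF k1(1)] s[OF k1(2)] e[OF True] l by simp
      then show ?thesis using True k1 l by (simp add: additive_tmor monomial_def)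
    next
      case l: False
      then have l': "pd1 l \<noteq> \<sigma> (pd1 k) \<or> pd2 l \<noteq> \<tau> (pd2 k)" unfolding eq_prod_encode by simp
      have "tmor AT X X' Y Y' (monomial X \<sigma> t) (monomial Y \<tau> s) k l = 0"
      proof (cases "l \<in> dom (ten X' Y')")
        case L: True
        have l1: "pd1 l \<in> dom X'" "pd2 l \<in> dom Y'" "ex (the (X' (pd1 l))) (the (Y' (pd2 l)))"
          using L[unfolded fam_tensor_dom] by auto
        note O = additive_objD(2)[OF o(1) k1(1)] additive_objD(2)[OF o(2) l1(1)] additive_objD(2)[OF o(3) k1(2)] additive_objD(2)[OF o(4) l1(2)]
        have mt: "arr (additive C) X X' (monomial X \<sigma> t)" by (rule monomial_arr[OF o(1,2)]) (rule t)
        have ms: "arr (additive C) Y Y' (monomial Y \<tau> s)" by (rule monomial_arr[OF o(3,4)]) (rule s)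
        note a = additive_arr_entry[OF mt k1(1) l1(1)] additive_arr_entry[OF ms k1(2) l1(2)]
        show ?thesis
        proof (cases "pd1 l = \<sigma> (pd1 k)")
          case True
          then have "monomial Y \<tau> s (pd2 k) (pd2 l) = 0" using l' by (simp add: monomial_def)
          then show ?thesis using tmor_zero(2)[OF O k1(3) l1(3) a(1)] by (simp add: additive_tmor)
        next
          case False
          then have "monomial X \<sigma> t (pd1 k) (pd1 l) = 0" by (simp add: monomial_def)
          then show ?thesis using tmor_zero(1)[OF O k1(3) l1(3) a(2)] by (simp add: additive_tmor)
        qed
      qed (simp add: additive_tmor)
      then show ?thesis using l by (simp add: monomial_def)
    qed
  qed (simp add: additive_tmor monomial_def)
qed

lemma additive_tmor_id:
  assumes o: "X \<in> Obj (additive C)" "Y \<in> Obj (additive C)"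
  shows "tmor AT X X Y Y (Idn (additive C) X) (Idn (additive C) Y) = Idn (additive C) (ten X Y)"
proof -
  have t: "i \<in> dom X \<and> arr C (the (X i)) (the (X i)) (Idn C (the (X i)))" if "i \<in> dom X" for i using that additive_objD(2)[OF o(1)] by simp
  have s: "j \<in> dom Y \<and> arr C (the (Y j)) (the (Y j)) (Idn C (the (Y j)))" if "j \<in> dom Y" for j using that additive_objD(2)[OF o(2)] by simp
  have e: "ex (the (X (pd1 k))) (the (Y (pd2 k)))" if "k \<in> dom (ten X Y)" for k using that by (simp add: fam_tensor_dom)
  have "tmor AT X X Y Y (Idn (additive C) X) (Idn (additive C) Y) = monomial (ten X Y) (\<lambda>k. prod_encode (pd1 k, pd2 k))
    (\<lambda>k. tmor S (the (X (pd1 k))) (the (X (pd1 k))) (the (Y (pd2 k))) (the (Y (pd2 k))) (Idn C (the (X (pd1 k)))) (Idn C (the (Y (pd2 k)))))"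
    unfolding additive_id by (rule additive_tmor_monomial[OF o(1,1) o(2,2)]; (rule t s e)?; assumption?)
  also have "\<dots> = Idn (additive C) (ten X Y)" unfolding additive_id
  proof (rule monomial_cong)
    fix k assume k: "k \<in> dom (ten X Y)"
    show "prod_encode (pd1 k, pd2 k) = k" by simp
    show "tmor S (the (X (pd1 k))) (the (X (pd1 k))) (the (Y (pd2 k))) (the (Y (pd2 k))) (Idn C (the (X (pd1 k)))) (Idn C (the (Y (pd2 k))))
      = Idn C (the (ten X Y k))"
      unfolding fam_tensor_the[OF k]
      using k[unfolded fam_tensor_dom] tmor_id additive_objD(2)[OF o(1)] additive_objD(2)[OF o(2)] by blast
  qed simp
  finally show ?thesis .
qed

text \<open>Bilinearity expands both matrix products into a double sum over intermediate pairs.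
  Pairs without a tensor product do not occur in the middle object, and the vanishing clause of
  \<open>tmor_comp\<close> removes exactly their terms.\<close>

lemma additive_tmor_comp:
  assumes f: "arr (additive C) X X' f" and f': "arr (additive C) X' X'' f'" and g: "arr (additive C) Y Y' g" and g': "arr (additive C) Y' Y'' g'"
  shows "tmor AT X X'' Y Y'' (Cmp (additive C) X X' X'' f' f) (Cmp (additive C) Y Y' Y'' g' g)
    = Cmp (additive C) (ten X Y) (ten X' Y') (ten X'' Y'') (tmor AT X' X'' Y' Y'' f' g') (tmor AT X X' Y Y' f g)"
proof (intro ext)
  fix k l
  have o: "X \<in> Obj (additive C)" "X' \<in> Obj (additive C)" "X'' \<in> Obj (additive C)"
    "Y \<in> Obj (additive C)" "Y' \<in> Obj (additive C)" "Y'' \<in> Obj (additive C)" using f f' g g' by (auto simp: arr_def)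
  show "tmor AT X X'' Y Y'' (Cmp (additive C) X X' X'' f' f) (Cmp (additive C) Y Y' Y'' g' g) k l
    = Cmp (additive C) (ten X Y) (ten X' Y') (ten X'' Y'') (tmor AT X' X'' Y' Y'' f' g') (tmor AT X X' Y Y' f g) k l"
  proof (cases "k \<in> dom (ten X Y) \<and> l \<in> dom (ten X'' Y'')")
    case True
    then have K: "k \<in> dom (ten X Y)" and L: "l \<in> dom (ten X'' Y'')" by auto
    have k: "pd1 k \<in> dom X" "pd2 k \<in> dom Y" "ex (the (X (pd1 k))) (the (Y (pd2 k)))" using K by (simp_all add: fam_tensor_dom)
    have l: "pd1 l \<in> dom X''" "pd2 l \<in> dom Y''" "ex (the (X'' (pd1 l))) (the (Y'' (pd2 l)))" using L by (simp_all add: fam_tensor_dom)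
    note ob = additive_objD(2)[OF o(1) k(1)] additive_objD(2)[OF o(3) l(1)] additive_objD(2)[OF o(4) k(2)] additive_objD(2)[OF o(6) l(2)]
    define F where "F i = Cmp C (the (X (pd1 k))) (the (X' i)) (the (X'' (pd1 l))) (f' i (pd1 l)) (f (pd1 k) i)" for i
    define G where "G j = Cmp C (the (Y (pd2 k))) (the (Y' j)) (the (Y'' (pd2 l))) (g' j (pd2 l)) (g (pd2 k) j)" for j
    have Fa: "arr C (the (X (pd1 k))) (the (X'' (pd1 l))) (F i)" if "i \<in> dom X'" for i
      unfolding F_def by (rule arr_comp[OF additive_arr_entry[OF f k(1) that] additive_arr_entry[OF f' that l(1)]])
    have Ga: "arr C (the (Y (pd2 k))) (the (Y'' (pd2 l))) (G j)" if "j \<in> dom Y'" for j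
      unfolding G_def by (rule arr_comp[OF additive_arr_entry[OF g k(2) that] additive_arr_entry[OF g' that l(2)]])
    let ?t = "tmor S (the (X (pd1 k))) (the (X'' (pd1 l))) (the (Y (pd2 k))) (the (Y'' (pd2 l)))"
    have "tmor AT X X'' Y Y'' (Cmp (additive C) X X' X'' f' f) (Cmp (additive C) Y Y' Y'' g' g) k l
      = ?t (\<Sum>i\<in>dom X'. F i) (\<Sum>j\<in>dom Y'. G j)"
      using K L k l by (simp add: additive_tmor additive_comp F_def G_def)
    also have "\<dots> = (\<Sum>i\<in>dom X'. ?t (F i) (\<Sum>j\<in>dom Y'. G j))"
      by (rule tmor_sum_left[OF ob(1,2) sum_arr[OF ob(3,4)] k(3) l(3)]) (rule Ga Fa, assumption)+
    also have "\<dots> = (\<Sum>i\<in>dom X'. \<Sum>j\<in>dom Y'. ?t (F i) (G j))"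
      by (rule sum.cong[OF refl], rule tmor_sum_right[OF ob(3,4) Fa k(3) l(3) Ga])
    also have "\<dots> = (\<Sum>i\<in>dom X'. \<Sum>j\<in>dom Y'. if ex (the (X' i)) (the (Y' j))
        then Cmp C (the (ten X Y k)) (the (ten X' Y' (prod_encode (i, j)))) (the (ten X'' Y'' l))
          (tmor AT X' X'' Y' Y'' f' g' (prod_encode (i, j)) l) (tmor AT X X' Y Y' f g k (prod_encode (i, j))) else 0)"
    proof (intro sum.cong refl)
      fix i j assume ij: "i \<in> dom X'" "j \<in> dom Y'"
      note tc = tmor_comp[OF additive_arr_entry[OF f k(1) ij(1)] additive_arr_entry[OF f' ij(1) l(1)]
          additive_arr_entry[OF g k(2) ij(2)] additive_arr_entry[OF g' ij(2) l(2)] k(3) l(3), folded F_def G_def]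
      show "?t (F i) (G j) = (if ex (the (X' i)) (the (Y' j))
        then Cmp C (the (ten X Y k)) (the (ten X' Y' (prod_encode (i, j)))) (the (ten X'' Y'' l))
          (tmor AT X' X'' Y' Y'' f' g' (prod_encode (i, j)) l) (tmor AT X X' Y Y' f g k (prod_encode (i, j))) else 0)"
      proof (cases "ex (the (X' i)) (the (Y' j))")
        case True
        then have ijd: "prod_encode (i, j) \<in> dom (ten X' Y')" using ij by (simp add: fam_tensor_dom)
        show ?thesis using True by (simp add: tc additive_tmor K L ijd fam_tensor_the[OF K] fam_tensor_the[OF L] fam_tensor_the[OF ijd])
      qed (simp add: tc)
    qed
    also have "\<dots> = Cmp (additive C) (ten X Y) (ten X' Y') (ten X'' Y'') (tmor AT X' X'' Y' Y'' f' g') (tmor AT X X' Y Y' f g) k l"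
      using K L by (simp add: additive_comp sum_fam_tensor[OF additive_objD(1)[OF o(2)] additive_objD(1)[OF o(5)]])
    finally show ?thesis .
  qed (auto simp: additive_tmor additive_comp simp del: domIff)
qed

lemma assoc_entry:
  assumes o: "X \<in> Obj (additive C)" "Y \<in> Obj (additive C)" "Z \<in> Obj (additive C)" and k: "k \<in> dom (ten (ten X Y) Z)"
  shows "pd1 (pd1 k) \<in> dom X" "pd2 (pd1 k) \<in> dom Y" "pd2 k \<in> dom Z" "pd1 k \<in> dom (ten X Y)"
    "ex (the (X (pd1 (pd1 k)))) (the (Y (pd2 (pd1 k))))"
    "ex (tobj S (the (X (pd1 (pd1 k)))) (the (Y (pd2 (pd1 k))))) (the (Z (pd2 k)))"
    "the (ten (ten X Y) Z k) = tobj S (tobj S (the (X (pd1 (pd1 k)))) (the (Y (pd2 (pd1 k))))) (the (Z (pd2 k)))"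
    "assoc_index k \<in> dom (ten X (ten Y Z))" "pd2 (assoc_index k) \<in> dom (ten Y Z)"
    "the (ten X (ten Y Z) (assoc_index k)) = tobj S (the (X (pd1 (pd1 k)))) (tobj S (the (Y (pd2 (pd1 k)))) (the (Z (pd2 k))))"
    "arr C (the (ten (ten X Y) Z k)) (the (ten X (ten Y Z) (assoc_index k)))
      (tassoc S (the (X (pd1 (pd1 k)))) (the (Y (pd2 (pd1 k)))) (the (Z (pd2 k))))"
proof -
  show 1: "pd1 k \<in> dom (ten X Y)" "pd2 k \<in> dom Z" using k by (simp_all add: fam_tensor_dom[of k])
  show 2: "pd1 (pd1 k) \<in> dom X" "pd2 (pd1 k) \<in> dom Y" "ex (the (X (pd1 (pd1 k)))) (the (Y (pd2 (pd1 k))))"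
    using 1(1) by (simp_all add: fam_tensor_dom)
  show 3: "ex (tobj S (the (X (pd1 (pd1 k)))) (the (Y (pd2 (pd1 k))))) (the (Z (pd2 k)))"
    using k fam_tensor_the[OF 1(1)] by (simp add: fam_tensor_dom[of k])
  show 4: "the (ten (ten X Y) Z k) = tobj S (tobj S (the (X (pd1 (pd1 k)))) (the (Y (pd2 (pd1 k))))) (the (Z (pd2 k)))"
    by (simp add: fam_tensor_the[OF k] fam_tensor_the[OF 1(1)])
  show a: "assoc_index k \<in> dom (ten X (ten Y Z))" using ten_assoc_dom[OF o] k by simp
  then show b: "pd2 (assoc_index k) \<in> dom (ten Y Z)" by (simp only: fam_tensor_dom[of "assoc_index k"])
  show 5: "the (ten X (ten Y Z) (assoc_index k)) = tobj S (the (X (pd1 (pd1 k)))) (tobj S (the (Y (pd2 (pd1 k)))) (the (Z (pd2 k))))"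
    by (simp add: fam_tensor_the[OF a] fam_tensor_the[OF b])
  show "arr C (the (ten (ten X Y) Z k)) (the (ten X (ten Y Z) (assoc_index k)))
      (tassoc S (the (X (pd1 (pd1 k)))) (the (Y (pd2 (pd1 k)))) (the (Z (pd2 k))))"
    unfolding 4 5
    by (rule assoc_arr[OF additive_objD(2)[OF o(1) 2(1)] additive_objD(2)[OF o(2) 2(2)] additive_objD(2)[OF o(3) 1(2)] 2(3) 3])
qed

lemma additive_assoc_natural:
  assumes f: "arr (additive C) X X' f" and g: "arr (additive C) Y Y' g" and h: "arr (additive C) Z Z' h"
  shows "Cmp (additive C) (ten (ten X Y) Z) (ten (ten X' Y') Z') (ten X' (ten Y' Z')) (tassoc AT X' Y' Z')
      (tmor AT (ten X Y) (ten X' Y') Z Z' (tmor AT X X' Y Y' f g) h)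
    = Cmp (additive C) (ten (ten X Y) Z) (ten X (ten Y Z)) (ten X' (ten Y' Z'))
      (tmor AT X X' (ten Y Z) (ten Y' Z') f (tmor AT Y Y' Z Z' g h)) (tassoc AT X Y Z)" (is "?l = ?r")
proof (intro ext)
  fix k l
  have o: "X \<in> Obj (additive C)" "Y \<in> Obj (additive C)" "Z \<in> Obj (additive C)"
    and o': "X' \<in> Obj (additive C)" "Y' \<in> Obj (additive C)" "Z' \<in> Obj (additive C)" using f g h by (auto simp: arr_def)
  note T = ten_obj[OF ten_obj[OF o(1,2)] o(3)] ten_obj[OF o'(1) ten_obj[OF o'(2,3)]]
  note m = additive_tmor_arr[OF f g] additive_tmor_arr[OF g h]
  note A = additive_tmor_arr[OF m(1) h] additive_tmor_arr[OF f m(2)]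
  show "?l k l = ?r k l"
  proof (cases "k \<in> dom (ten (ten X Y) Z) \<and> l \<in> dom (ten X' (ten Y' Z'))")
    case True
    then have k: "k \<in> dom (ten (ten X Y) Z)" and l: "l \<in> dom (ten X' (ten Y' Z'))" by auto
    \<comment> \<open>The row that \<open>assoc_index\<close> sends to column \<open>l\<close>,
      found by bracketing the other way.\<close>
    define j where "j = prod_encode (prod_encode (pd1 l, pd1 (pd2 l)), pd2 (pd2 l))"
    have jl: "assoc_index j = l" by (simp add: assoc_index_def j_def)
    have j: "j \<in> dom (ten (ten X' Y') Z')" using l ten_assoc_dom[OF o', of j] by (simp add: jl)
    note K = assoc_entry[OF o k] and J = assoc_entry[OF o' j]
    note e = additive_arr_entry[OF f K(1) J(1)] additive_arr_entry[OF g K(2) J(2)] additive_arr_entry[OF h K(3) J(3)]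
    have L: "?l k l = Cmp C (the (ten (ten X Y) Z k)) (the (ten (ten X' Y') Z' j)) (the (ten X' (ten Y' Z') l))
      (tassoc S (the (X' (pd1 (pd1 j)))) (the (Y' (pd2 (pd1 j)))) (the (Z' (pd2 j))))
      (tmor AT (ten X Y) (ten X' Y') Z Z' (tmor AT X X' Y Y' f g) h k j)"
      unfolding additive_assoc jl[symmetric]
      using comp_monomial_left[OF T(2) A(1) inj_on_subset[OF inj_assoc_index] j, of
          "\<lambda>k. tassoc S (the (X' (pd1 (pd1 k)))) (the (Y' (pd2 (pd1 k)))) (the (Z' (pd2 k)))" k]
        assoc_entry(8,11)[OF o'] k by simp
    have R: "?r k l = Cmp C (the (ten (ten X Y) Z k)) (the (ten X (ten Y Z) (assoc_index k))) (the (ten X' (ten Y' Z') l))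
      (tmor AT X X' (ten Y Z) (ten Y' Z') f (tmor AT Y Y' Z Z' g h) (assoc_index k) l)
      (tassoc S (the (X (pd1 (pd1 k)))) (the (Y (pd2 (pd1 k)))) (the (Z (pd2 k))))"
      unfolding additive_assoc
      using comp_monomial_right[OF T(1) A(2), of assoc_index
          "\<lambda>k. tassoc S (the (X (pd1 (pd1 k)))) (the (Y (pd2 (pd1 k)))) (the (Z (pd2 k)))" k l]
        assoc_entry(8,11)[OF o] k l by simp
    have t1: "tmor AT (ten X Y) (ten X' Y') Z Z' (tmor AT X X' Y Y' f g) h k j
      = tmor S (tobj S (the (X (pd1 (pd1 k)))) (the (Y (pd2 (pd1 k))))) (tobj S (the (X' (pd1 (pd1 j)))) (the (Y' (pd2 (pd1 j)))))
        (the (Z (pd2 k))) (the (Z' (pd2 j)))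
        (tmor S (the (X (pd1 (pd1 k)))) (the (X' (pd1 (pd1 j)))) (the (Y (pd2 (pd1 k)))) (the (Y' (pd2 (pd1 j))))
          (f (pd1 (pd1 k)) (pd1 (pd1 j))) (g (pd2 (pd1 k)) (pd2 (pd1 j)))) (h (pd2 k) (pd2 j))"
      using k j K(4) J(4) by (simp add: additive_tmor fam_tensor_the[OF K(4)] fam_tensor_the[OF J(4)])
    have t2: "tmor AT X X' (ten Y Z) (ten Y' Z') f (tmor AT Y Y' Z Z' g h) (assoc_index k) l
      = tmor S (the (X (pd1 (pd1 k)))) (the (X' (pd1 (pd1 j)))) (tobj S (the (Y (pd2 (pd1 k)))) (the (Z (pd2 k))))
        (tobj S (the (Y' (pd2 (pd1 j)))) (the (Z' (pd2 j)))) (f (pd1 (pd1 k)) (pd1 (pd1 j)))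
        (tmor S (the (Y (pd2 (pd1 k)))) (the (Y' (pd2 (pd1 j)))) (the (Z (pd2 k))) (the (Z' (pd2 j)))
          (g (pd2 (pd1 k)) (pd2 (pd1 j))) (h (pd2 k) (pd2 j)))"
      unfolding jl[symmetric]
      using K(8,9) J(8,9) by (simp add: additive_tmor fam_tensor_the[OF K(9)] fam_tensor_the[OF J(9)])
    show ?thesis unfolding L R t1 t2 K(7,10) J(7) J(10)[unfolded jl]
      by (rule assoc_natural[OF e K(5,6) J(5,6)])
  qed (auto simp: additive_comp simp del: domIff)
qed

lemma braid_entry:
  assumes o: "X \<in> Obj (additive C)" "Y \<in> Obj (additive C)" and k: "k \<in> dom (ten X Y)"
  shows "pd1 k \<in> dom X" "pd2 k \<in> dom Y" "ex (the (X (pd1 k))) (the (Y (pd2 k)))"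
    "braid_index k \<in> dom (ten Y X)" "the (ten Y X (braid_index k)) = tobj S (the (Y (pd2 k))) (the (X (pd1 k)))"
    "arr C (the (ten X Y k)) (the (ten Y X (braid_index k))) (tbraid S (the (X (pd1 k))) (the (Y (pd2 k))))"
proof -
  show 1: "pd1 k \<in> dom X" "pd2 k \<in> dom Y" "ex (the (X (pd1 k))) (the (Y (pd2 k)))" using k by (simp_all add: fam_tensor_dom)
  note O = additive_objD(2)[OF o(1) 1(1)] additive_objD(2)[OF o(2) 1(2)]
  show b: "braid_index k \<in> dom (ten Y X)" using 1 ex_sym[OF O 1(3)] by (simp add: fam_tensor_dom)
  show 2: "the (ten Y X (braid_index k)) = tobj S (the (Y (pd2 k))) (the (X (pd1 k)))" by (simp add: fam_tensor_the[OF b])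
  show "arr C (the (ten X Y k)) (the (ten Y X (braid_index k))) (tbraid S (the (X (pd1 k))) (the (Y (pd2 k))))"
    unfolding 2 fam_tensor_the[OF k] by (rule braid_arr[OF O 1(3)])
qed

lemma additive_braid_natural:
  assumes f: "arr (additive C) X X' f" and g: "arr (additive C) Y Y' g"
  shows "Cmp (additive C) (ten X Y) (ten X' Y') (ten Y' X') (tbraid AT X' Y') (tmor AT X X' Y Y' f g)
    = Cmp (additive C) (ten X Y) (ten Y X) (ten Y' X') (tmor AT Y Y' X X' g f) (tbraid AT X Y)" (is "?l = ?r")
proof (intro ext)
  fix k l
  have o: "X \<in> Obj (additive C)" "Y \<in> Obj (additive C)" and o': "X' \<in> Obj (additive C)" "Y' \<in> Obj (additive C)"
    using f g by (auto simp: arr_def)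
  note A = additive_tmor_arr[OF f g] additive_tmor_arr[OF g f]
  show "?l k l = ?r k l"
  proof (cases "k \<in> dom (ten X Y) \<and> l \<in> dom (ten Y' X')")
    case True
    then have k: "k \<in> dom (ten X Y)" and l: "l \<in> dom (ten Y' X')" by auto
    \<comment> \<open>\<open>braid_index\<close> is its own inverse, so this is the row that it
      sends to column \<open>l\<close>.\<close>
    define j where "j = braid_index l"
    have jl: "braid_index j = l" by (simp add: braid_index_def j_def)
    have j: "j \<in> dom (ten X' Y')" unfolding j_def by (rule braid_entry(4)[OF o'(2,1) l])
    note K = braid_entry[OF o k] and J = braid_entry[OF o' j]
    have L: "?l k l = Cmp C (the (ten X Y k)) (the (ten X' Y' j)) (the (ten Y' X' l))
      (tbraid S (the (X' (pd1 j))) (the (Y' (pd2 j)))) (tmor AT X X' Y Y' f g k j)"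
      unfolding additive_braid jl[symmetric]
      using comp_monomial_left[OF ten_obj[OF o'(2,1)] A(1) inj_on_subset[OF inj_braid_index] j, of
          "\<lambda>k. tbraid S (the (X' (pd1 k))) (the (Y' (pd2 k)))" k] braid_entry(4,6)[OF o'] k by simp
    have R: "?r k l = Cmp C (the (ten X Y k)) (the (ten Y X (braid_index k))) (the (ten Y' X' l))
      (tmor AT Y Y' X X' g f (braid_index k) l) (tbraid S (the (X (pd1 k))) (the (Y (pd2 k))))"
      unfolding additive_braid
      using comp_monomial_right[OF ten_obj[OF o] A(2), of braid_index "\<lambda>k. tbraid S (the (X (pd1 k))) (the (Y (pd2 k)))" k l]
        braid_entry(4,6)[OF o] k l by simp
    have t1: "tmor AT X X' Y Y' f g k j = tmor S (the (X (pd1 k))) (the (X' (pd1 j))) (the (Y (pd2 k))) (the (Y' (pd2 j)))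
        (f (pd1 k) (pd1 j)) (g (pd2 k) (pd2 j))" using k j by (simp add: additive_tmor)
    have t2: "tmor AT Y Y' X X' g f (braid_index k) l = tmor S (the (Y (pd2 k))) (the (Y' (pd2 j))) (the (X (pd1 k))) (the (X' (pd1 j)))
        (g (pd2 k) (pd2 j)) (f (pd1 k) (pd1 j))" unfolding jl[symmetric] using K(4) J(4) by (simp add: additive_tmor)
    show ?thesis unfolding L R t1 t2 K(5) fam_tensor_the[OF k] fam_tensor_the[OF j] J(5)[unfolded jl]
      by (rule braid_natural[OF additive_arr_entry[OF f K(1) J(1)] additive_arr_entry[OF g K(2) J(2)] K(3) J(3)])
  qed (auto simp: additive_comp simp del: domIff)
qed

lemma unitor_entry:
  assumes o: "X \<in> Obj (additive C)"
  shows "k \<in> dom (ten [0 \<mapsto> tunit S] X) \<Longrightarrow> pd2 k \<in> dom X \<and>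
      arr C (the (ten [0 \<mapsto> tunit S] X k)) (the (X (pd2 k))) (tlunit S (the (X (pd2 k))))"
    "k \<in> dom (ten X [0 \<mapsto> tunit S]) \<Longrightarrow> pd1 k \<in> dom X \<and>
      arr C (the (ten X [0 \<mapsto> tunit S] k)) (the (X (pd1 k))) (trunit S (the (X (pd1 k))))"
proof -
  show "pd2 k \<in> dom X \<and> arr C (the (ten [0 \<mapsto> tunit S] X k)) (the (X (pd2 k))) (tlunit S (the (X (pd2 k))))"
    if k: "k \<in> dom (ten [0 \<mapsto> tunit S] X)"
    unfolding fam_tensor_the[OF k] using k[unfolded ten_unit_dom[OF o]] lunit_arr additive_objD(2)[OF o] by simp
  show "pd1 k \<in> dom X \<and> arr C (the (ten X [0 \<mapsto> tunit S] k)) (the (X (pd1 k))) (trunit S (the (X (pd1 k))))"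
    if k: "k \<in> dom (ten X [0 \<mapsto> tunit S])"
    unfolding fam_tensor_the[OF k] using k[unfolded ten_unit_dom[OF o]] runit_arr additive_objD(2)[OF o] by simp
qed

lemma partial_tensor_additive: "partial_tensor (additive C) (\<lambda>_ _. True) AT"
proof (intro partial_tensor.intro category_additive partial_tensor_axioms.intro; (unfold additive_tensor_simps)?)
  show "[0 \<mapsto> tunit S] \<in> Obj (additive C)" by (rule unit_family)
  show "tmor AT X X'' Y Y'' (Cmp (additive C) X X' X'' f' f) (Cmp (additive C) Y Y' Y'' g' g)
    = (if True then Cmp (additive C) (ten X Y) (ten X' Y') (ten X'' Y'') (tmor AT X' X'' Y' Y'' f' g') (tmor AT X X' Y Y' f g) else 0)"
    if "arr (additive C) X X' f" "arr (additive C) X' X'' f'" "arr (additive C) Y Y' g" "arr (additive C) Y' Y'' g'" for X X' f X'' f' Y Y' g Y'' g'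
    using additive_tmor_comp[OF that] by simp
  show "arr (additive C) (ten (ten X Y) Z) (ten X (ten Y Z)) (tassoc AT X Y Z)"
    if o: "X \<in> Obj (additive C)" "Y \<in> Obj (additive C)" "Z \<in> Obj (additive C)" for X Y Z
    unfolding additive_assoc by (rule monomial_arr) (use ten_obj o assoc_entry(8,11)[OF o] in auto)
  show "arr (additive C) (ten [0 \<mapsto> tunit S] X) X (tlunit AT X)" "arr (additive C) (ten X [0 \<mapsto> tunit S]) X (trunit AT X)"
    if o: "X \<in> Obj (additive C)" for X
    unfolding additive_unitors[OF o] by (rule monomial_arr[OF ten_obj]; (rule unit_family o unitor_entry[OF o])?; assumption?)+
  show "arr (additive C) (ten X Y) (ten Y X) (tbraid AT X Y)" if o: "X \<in> Obj (additive C)" "Y \<in> Obj (additive C)" for X Y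
    unfolding additive_braid by (rule monomial_arr) (use ten_obj o braid_entry(4,6)[OF o] in auto)
qed (simp_all add: ten_obj additive_tmor_arr additive_tmor_id additive_assoc_natural additive_braid_natural)

end

context preadditive
begin

text \<open>Reads the type of the entries off the type of the matrix; the entries of tensored
  coherence maps are typed this way.\<close>

lemma monomial_entry_arr:
  assumes "arr (additive C) X Y (monomial X \<sigma> t)" "i \<in> dom X" "\<sigma> i \<in> dom Y"
  shows "arr C (the (X i)) (the (Y (\<sigma> i))) (t i)"
  using additive_arr_entry[OF assms] assms(2) by (simp add: monomial_def)

end

lemma (in preadditive_functor) additive_mor_monomial:
  assumes "X \<in> Obj (additive C)" "Y \<in> Obj (additive C)"
    "\<And>i. i \<in> dom X \<Longrightarrow> \<sigma> i \<in> dom Y \<and> arr C (the (X i)) (the (Y (\<sigma> i))) (t i)"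
  shows "additive_mor Fm X Y (monomial X \<sigma> t)
    = monomial (additive_obj Fo X) \<sigma> (\<lambda>i. Fm (the (X i)) (the (Y (\<sigma> i))) (t i))"
proof (intro ext)
  fix i j
  show "additive_mor Fm X Y (monomial X \<sigma> t) i j
    = monomial (additive_obj Fo X) \<sigma> (\<lambda>i. Fm (the (X i)) (the (Y (\<sigma> i))) (t i)) i j"
    using assms(3)[of i] F_zero[of "the (X i)" "the (Y j)"] C.additive_objD(2)[OF assms(1), of i] C.additive_objD(2)[OF assms(2), of j]
    by (simp add: additive_mor_def monomial_def)
qed

section \<open>The coherence maps of the additive extension\<close>

locale additive_partial_tensor_functor = S: additive_partial_tensor C ex S + S': additive_partial_tensor D ex' S'
  + F: preadditive_functor C D Fo Fm + P: partial_tensor_functor C ex S D ex' S' Fo Fm \<nu> \<epsilon>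
  for C :: "('o, 'v::ab_group_add, 'k) lincat" and ex :: "'o \<Rightarrow> 'o \<Rightarrow> bool" and S :: "('o, 'v) tensor"
    and D :: "('p, 'w::ab_group_add, 'k) lincat" and ex' :: "'p \<Rightarrow> 'p \<Rightarrow> bool" and S' :: "('p, 'w) tensor"
    and Fo :: "'o \<Rightarrow> 'p" and Fm :: "'o \<Rightarrow> 'o \<Rightarrow> 'v \<Rightarrow> 'w" and \<nu> :: "'o \<Rightarrow> 'o \<Rightarrow> 'w" and \<epsilon> :: 'w
begin

abbreviation "FO \<equiv> additive_obj Fo"
abbreviation "FM \<equiv> additive_mor Fm"
abbreviation "U \<equiv> [0 \<mapsto> tunit S]"
abbreviation "U' \<equiv> [0 \<mapsto> tunit S']"

text \<open>Diagonal, because \<open>F\<close> preserves and reflects the existence of tensor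
  products, so that both families have the same index set.\<close>

definition N where
  "N X Y = monomial (S'.ten (FO X) (FO Y)) (\<lambda>k. k) (\<lambda>k. \<nu> (the (X (pd1 k))) (the (Y (pd2 k))))"

definition E where
  "E = monomial U' (\<lambda>k. k) (\<lambda>_. \<epsilon>)"

lemma mult_iso_arr:
  assumes "x \<in> Obj C" "y \<in> Obj C" "ex x y"
  shows "arr D (tobj S' (Fo x) (Fo y)) (Fo (tobj S x y)) (\<nu> x y)"
proof -
  have "tobj S' (Fo x) (Fo y) \<in> Obj D" "Fo (tobj S x y) \<in> Obj D"
    using S'.tobj_obj S.tobj_obj P.ex_iff assms F.F_obj by auto
  then show ?thesis using P.mult_iso[OF assms] S'.iso_iff by blast
qed

lemma unit_iso_arr: "arr D (tunit S') (Fo (tunit S)) \<epsilon>"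
  using P.unit_iso S'.iso_iff S'.unit_obj F.F_obj[OF S.unit_obj] by blast

lemma dom_ten:
  assumes "X \<in> Obj (additive C)" "Y \<in> Obj (additive C)"
  shows "dom (S'.ten (FO X) (FO Y)) = dom (S.ten X Y)"
proof (intro set_eqI)
  fix k
  show "k \<in> dom (S'.ten (FO X) (FO Y)) \<longleftrightarrow> k \<in> dom (S.ten X Y)"
    unfolding fam_tensor_dom F.dom_additive_obj
    using P.ex_iff S.additive_objD(2)[OF assms(1), of "pd1 k"] S.additive_objD(2)[OF assms(2), of "pd2 k"]
      F.the_additive_obj[of "pd1 k" X Fo] F.the_additive_obj[of "pd2 k" Y Fo] by metis
qed

lemma ten_entry:
  assumes "X \<in> Obj (additive C)" "Y \<in> Obj (additive C)" "k \<in> dom (S.ten X Y)"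
  shows "pd1 k \<in> dom X" "pd2 k \<in> dom Y" "the (X (pd1 k)) \<in> Obj C" "the (Y (pd2 k)) \<in> Obj C"
    "ex (the (X (pd1 k))) (the (Y (pd2 k)))"
    "the (S.ten X Y k) = tobj S (the (X (pd1 k))) (the (Y (pd2 k)))"
    "the (S'.ten (FO X) (FO Y) k) = tobj S' (Fo (the (X (pd1 k)))) (Fo (the (Y (pd2 k))))"
    "the (FO (S.ten X Y) k) = Fo (tobj S (the (X (pd1 k))) (the (Y (pd2 k))))"
proof -
  show 1: "pd1 k \<in> dom X" "pd2 k \<in> dom Y" "ex (the (X (pd1 k))) (the (Y (pd2 k)))"
    using assms(3) by (simp_all add: fam_tensor_dom)
  show "the (X (pd1 k)) \<in> Obj C" "the (Y (pd2 k)) \<in> Obj C"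
    using S.additive_objD(2)[OF assms(1) 1(1)] S.additive_objD(2)[OF assms(2) 1(2)] .
  show 2: "the (S.ten X Y k) = tobj S (the (X (pd1 k))) (the (Y (pd2 k)))" by (rule fam_tensor_the[OF assms(3)])
  have "k \<in> dom (S'.ten (FO X) (FO Y))" using assms by (simp add: dom_ten)
  then show "the (S'.ten (FO X) (FO Y) k) = tobj S' (Fo (the (X (pd1 k)))) (Fo (the (Y (pd2 k))))"
    by (simp add: fam_tensor_the F.the_additive_obj 1)
  show "the (FO (S.ten X Y) k) = Fo (tobj S (the (X (pd1 k))) (the (Y (pd2 k))))"
    by (simp add: F.the_additive_obj assms(3) 2)
qed

lemma N_entry:
  assumes o: "X \<in> Obj (additive C)" "Y \<in> Obj (additive C)" and k: "k \<in> dom (S'.ten (FO X) (FO Y))"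
  shows "k \<in> dom (FO (S.ten X Y)) \<and>
    arr D (the (S'.ten (FO X) (FO Y) k)) (the (FO (S.ten X Y) k)) (\<nu> (the (X (pd1 k))) (the (Y (pd2 k))))"
proof -
  have k': "k \<in> dom (S.ten X Y)" using k by (simp add: dom_ten o)
  note e = ten_entry[OF o k']
  show ?thesis using k' mult_iso_arr[OF e(3,4,5)] by (simp add: e(7,8) F.dom_additive_obj)
qed

lemma objs:
  assumes "X \<in> Obj (additive C)" "Y \<in> Obj (additive C)"
  shows "S'.ten (FO X) (FO Y) \<in> Obj (additive D)" "FO (S.ten X Y) \<in> Obj (additive D)" "FO X \<in> Obj (additive D)"
  using F.additive_obj_obj S.ten_obj S'.ten_obj assms by blast+

lemma N_arr:
  assumes "X \<in> Obj (additive C)" "Y \<in> Obj (additive C)"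
  shows "arr (additive D) (S'.ten (FO X) (FO Y)) (FO (S.ten X Y)) (N X Y)"
  unfolding N_def by (rule S'.monomial_arr[OF objs(1,2)[OF assms]]) (rule N_entry[OF assms])

lemma E_arr: "arr (additive D) U' (FO U) E"
  unfolding E_def
  by (rule S'.monomial_arr[OF S'.unit_family F.additive_obj_obj[OF S.unit_family]])
    (use unit_iso_arr in \<open>simp add: F.dom_additive_obj F.the_additive_obj\<close>)

lemma N_natural:
  assumes f: "arr (additive C) X X' f" and g: "arr (additive C) Y Y' g"
  shows "Cmp (additive D) (S'.ten (FO X) (FO Y)) (S'.ten (FO X') (FO Y')) (FO (S.ten X' Y'))
      (N X' Y') (tmor S'.AT (FO X) (FO X') (FO Y) (FO Y') (FM X X' f) (FM Y Y' g))
    = Cmp (additive D) (S'.ten (FO X) (FO Y)) (FO (S.ten X Y)) (FO (S.ten X' Y'))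
      (FM (S.ten X Y) (S.ten X' Y') (tmor S.AT X X' Y Y' f g)) (N X Y)" (is "?l = ?r")
proof (intro ext)
  fix k l
  interpret FA: cat_functor "additive C" "additive D" FO FM by (rule F.cat_functor_additive)
  have o: "X \<in> Obj (additive C)" "Y \<in> Obj (additive C)" and o': "X' \<in> Obj (additive C)" "Y' \<in> Obj (additive C)"
    using f g by (auto simp: arr_def)
  note O = objs[OF o] objs[OF o'] note d = dom_ten[OF o] dom_ten[OF o']
  show "?l k l = ?r k l"
  proof (cases "k \<in> dom (S.ten X Y) \<and> l \<in> dom (S.ten X' Y')")
    case True
    then have k: "k \<in> dom (S.ten X Y)" and l: "l \<in> dom (S.ten X' Y')" by auto
    note K = ten_entry[OF o k] and L = ten_entry[OF o' l]
    note e = S.additive_arr_entry[OF f K(1) L(1)] S.additive_arr_entry[OF g K(2) L(2)]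
    have t: "tmor S'.AT (FO X) (FO X') (FO Y) (FO Y') (FM X X' f) (FM Y Y' g) k l
      = tmor S' (Fo (the (X (pd1 k)))) (Fo (the (X' (pd1 l)))) (Fo (the (Y (pd2 k)))) (Fo (the (Y' (pd2 l))))
        (Fm (the (X (pd1 k))) (the (X' (pd1 l))) (f (pd1 k) (pd1 l))) (Fm (the (Y (pd2 k))) (the (Y' (pd2 l))) (g (pd2 k) (pd2 l)))"
      by (simp add: S'.additive_tmor d k l F.the_additive_obj K(1,2) L(1,2) additive_mor_def)
    have s: "FM (S.ten X Y) (S.ten X' Y') (tmor S.AT X X' Y Y' f g) k l
      = Fm (tobj S (the (X (pd1 k))) (the (Y (pd2 k)))) (tobj S (the (X' (pd1 l))) (the (Y' (pd2 l))))
        (tmor S (the (X (pd1 k))) (the (X' (pd1 l))) (the (Y (pd2 k))) (the (Y' (pd2 l))) (f (pd1 k) (pd1 l)) (g (pd2 k) (pd2 l)))"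
      by (simp add: additive_mor_def k l S.additive_tmor K(6) L(6))
    have "?l k l = (if k \<in> dom (S'.ten (FO X) (FO Y)) \<and> l \<in> dom (FO (S.ten X' Y'))
      then Cmp D (the (S'.ten (FO X) (FO Y) k)) (the (S'.ten (FO X') (FO Y') l)) (the (FO (S.ten X' Y') l))
        (\<nu> (the (X' (pd1 l))) (the (Y' (pd2 l)))) (tmor S'.AT (FO X) (FO X') (FO Y) (FO Y') (FM X X' f) (FM Y Y' g) k l) else 0)"
      unfolding N_def
      by (rule S'.comp_diagonal_left[OF O(5) S'.additive_tmor_arr[OF FA.F_arr[OF f] FA.F_arr[OF g]]])
        (use N_entry[OF o'] d in \<open>auto simp: F.dom_additive_obj simp del: domIff\<close>)
    then have L1: "?l k l = Cmp D (tobj S' (Fo (the (X (pd1 k)))) (Fo (the (Y (pd2 k))))) (tobj S' (Fo (the (X' (pd1 l)))) (Fo (the (Y' (pd2 l)))))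
        (Fo (tobj S (the (X' (pd1 l))) (the (Y' (pd2 l))))) (\<nu> (the (X' (pd1 l))) (the (Y' (pd2 l))))
        (tmor S'.AT (FO X) (FO X') (FO Y) (FO Y') (FM X X' f) (FM Y Y' g) k l)"
      by (simp add: d k l F.dom_additive_obj K(7) L(7,8))
    have "?r k l = (if k \<in> dom (S'.ten (FO X) (FO Y)) \<and> l \<in> dom (FO (S.ten X' Y'))
      then Cmp D (the (S'.ten (FO X) (FO Y) k)) (the (FO (S.ten X Y) k)) (the (FO (S.ten X' Y') l))
        (FM (S.ten X Y) (S.ten X' Y') (tmor S.AT X X' Y Y' f g) k l) (\<nu> (the (X (pd1 k))) (the (Y (pd2 k)))) else 0)"
      unfolding N_def
      by (rule S'.comp_monomial_right[OF O(1) FA.F_arr[OF S.additive_tmor_arr[OF f g]]]) (rule N_entry[OF o])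
    then have R1: "?r k l = Cmp D (tobj S' (Fo (the (X (pd1 k)))) (Fo (the (Y (pd2 k))))) (Fo (tobj S (the (X (pd1 k))) (the (Y (pd2 k)))))
        (Fo (tobj S (the (X' (pd1 l))) (the (Y' (pd2 l)))))
        (FM (S.ten X Y) (S.ten X' Y') (tmor S.AT X X' Y Y' f g) k l) (\<nu> (the (X (pd1 k))) (the (Y (pd2 k))))"
      by (simp add: d k l F.dom_additive_obj K(7,8) L(8))
    show ?thesis unfolding L1 R1 t s by (rule P.mult_natural[OF e K(5) L(5)])
  qed (auto simp: S'.additive_comp d F.dom_additive_obj simp del: domIff)
qed

lemma N_iso:
  assumes "X \<in> Obj (additive C)" "Y \<in> Obj (additive C)"
  shows "iso (additive D) (S'.ten (FO X) (FO Y)) (FO (S.ten X Y)) (N X Y)"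
  unfolding N_def
proof (rule S'.diagonal_iso[OF objs(1,2)[OF assms]])
  show "dom (S'.ten (FO X) (FO Y)) = dom (FO (S.ten X Y))" by (simp add: dom_ten assms F.dom_additive_obj)
  fix k assume "k \<in> dom (S'.ten (FO X) (FO Y))"
  then have k: "k \<in> dom (S.ten X Y)" by (simp add: dom_ten assms)
  note K = ten_entry[OF assms k]
  show "iso D (the (S'.ten (FO X) (FO Y) k)) (the (FO (S.ten X Y) k)) (\<nu> (the (X (pd1 k))) (the (Y (pd2 k))))"
    unfolding K(7,8) by (rule P.mult_iso[OF K(3,4,5)])
qed

lemma E_iso: "iso (additive D) U' (FO U) E"
  unfolding E_def
  by (rule S'.diagonal_iso[OF S'.unit_family F.additive_obj_obj[OF S.unit_family]])
    (use P.unit_iso in \<open>simp_all add: F.dom_additive_obj F.the_additive_obj\<close>)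

text \<open>The inner index sets agree by \<open>ex_iff\<close>, the outer condition by
  \<open>ex_iff_left\<close>.\<close>

lemma dom_triple:
  assumes "X \<in> Obj (additive C)" "Y \<in> Obj (additive C)" "Z \<in> Obj (additive C)"
  shows "dom (S'.ten (S'.ten (FO X) (FO Y)) (FO Z)) = dom (S.ten (S.ten X Y) Z)"
proof (intro set_eqI)
  fix k
  show "k \<in> dom (S'.ten (S'.ten (FO X) (FO Y)) (FO Z)) \<longleftrightarrow> k \<in> dom (S.ten (S.ten X Y) Z)"
  proof (cases "pd1 k \<in> dom (S.ten X Y) \<and> pd2 k \<in> dom Z")
    case True
    then have k: "pd1 k \<in> dom (S.ten X Y)" "pd2 k \<in> dom Z" by auto
    note K = ten_entry[OF assms(1,2) k(1)]
    show ?thesis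
      using k P.ex_iff_left[OF K(3,4) S.additive_objD(2)[OF assms(3) k(2)] K(5)]
      by (simp add: fam_tensor_dom[of k] dom_ten assms F.dom_additive_obj F.the_additive_obj K(6,7))
  next
    case False
    then show ?thesis by (auto simp: fam_tensor_dom[of k] dom_ten assms F.dom_additive_obj simp del: domIff)
  qed
qed

lemma triple_entry:
  assumes o: "X \<in> Obj (additive C)" "Y \<in> Obj (additive C)" "Z \<in> Obj (additive C)" and k: "k \<in> dom (S.ten (S.ten X Y) Z)"
  defines "x \<equiv> the (X (pd1 (pd1 k)))" and "y \<equiv> the (Y (pd2 (pd1 k)))" and "z \<equiv> the (Z (pd2 k))"
  shows "x \<in> Obj C" "y \<in> Obj C" "z \<in> Obj C" "ex x y" "ex (tobj S x y) z"
    "the (S.ten (S.ten X Y) Z k) = tobj S (tobj S x y) z"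
    "the (S.ten X (S.ten Y Z) (assoc_index k)) = tobj S x (tobj S y z)"
    "the (S'.ten (S'.ten (FO X) (FO Y)) (FO Z) k) = tobj S' (tobj S' (Fo x) (Fo y)) (Fo z)"
    "the (S'.ten (FO (S.ten X Y)) (FO Z) k) = tobj S' (Fo (tobj S x y)) (Fo z)"
    "the (S'.ten (FO X) (FO (S.ten Y Z)) (assoc_index k)) = tobj S' (Fo x) (Fo (tobj S y z))"
    "the (S'.ten (FO X) (S'.ten (FO Y) (FO Z)) (assoc_index k)) = tobj S' (Fo x) (tobj S' (Fo y) (Fo z))"
    "the (FO (S.ten (S.ten X Y) Z) k) = Fo (tobj S (tobj S x y) z)"
    "the (FO (S.ten X (S.ten Y Z)) (assoc_index k)) = Fo (tobj S x (tobj S y z))"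
    "the (FO X (pd1 (pd1 k))) = Fo x" "the (FO Y (pd2 (pd1 k))) = Fo y" "the (FO Z (pd2 k)) = Fo z"
    "the (S'.ten (FO X) (FO Y) (pd1 k)) = tobj S' (Fo x) (Fo y)" "the (FO (S.ten X Y) (pd1 k)) = Fo (tobj S x y)"
    "the (S'.ten (FO Y) (FO Z) (pd2 (assoc_index k))) = tobj S' (Fo y) (Fo z)"
    "the (FO (S.ten Y Z) (pd2 (assoc_index k))) = Fo (tobj S y z)"
    "the (S.ten X Y (pd1 k)) = tobj S x y" "the (S.ten Y Z (pd2 (assoc_index k))) = tobj S y z"
    "assoc_index k \<in> dom (S.ten X (S.ten Y Z))"
    "assoc_index k \<in> dom (S'.ten (FO X) (S'.ten (FO Y) (FO Z)))"
proof -
  note A = S.assoc_entry[OF o k, folded x_def y_def z_def]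
  show "x \<in> Obj C" "y \<in> Obj C" "z \<in> Obj C"
    unfolding x_def y_def z_def using S.additive_objD(2)[OF o(1) A(1)] S.additive_objD(2)[OF o(2) A(2)] S.additive_objD(2)[OF o(3) A(3)] .
  show "ex x y" "ex (tobj S x y) z" "the (S.ten (S.ten X Y) Z k) = tobj S (tobj S x y) z"
    "the (S.ten X (S.ten Y Z) (assoc_index k)) = tobj S x (tobj S y z)" "assoc_index k \<in> dom (S.ten X (S.ten Y Z))"
    by (rule A)+
  note XY = S.ten_obj[OF o(1,2)] and YZ = S.ten_obj[OF o(2,3)]
  note e = ten_entry[OF o(1,2) A(4), folded x_def y_def] and e' = ten_entry[OF o(2,3) A(9)]
  show yz: "the (S.ten Y Z (pd2 (assoc_index k))) = tobj S y z" using e'(6) by (simp add: y_def z_def)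
  show "the (S.ten X Y (pd1 k)) = tobj S x y" by (rule e)
  show "the (FO X (pd1 (pd1 k))) = Fo x" "the (FO Y (pd2 (pd1 k))) = Fo y" "the (FO Z (pd2 k)) = Fo z"
    using A(1,2,3) by (simp_all add: F.the_additive_obj x_def y_def z_def)
  show "the (S'.ten (FO X) (FO Y) (pd1 k)) = tobj S' (Fo x) (Fo y)" "the (FO (S.ten X Y) (pd1 k)) = Fo (tobj S x y)" by (rule e)+
  show 1: "the (S'.ten (FO Y) (FO Z) (pd2 (assoc_index k))) = tobj S' (Fo y) (Fo z)"
    "the (FO (S.ten Y Z) (pd2 (assoc_index k))) = Fo (tobj S y z)"
    using e'(7,8) by (simp_all add: y_def z_def)
  show "the (S'.ten (FO (S.ten X Y)) (FO Z) k) = tobj S' (Fo (tobj S x y)) (Fo z)"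
    "the (FO (S.ten (S.ten X Y) Z) k) = Fo (tobj S (tobj S x y) z)"
    using ten_entry(7,8)[OF XY o(3) k] by (simp_all add: e(6) z_def)
  show "the (S'.ten (FO X) (FO (S.ten Y Z)) (assoc_index k)) = tobj S' (Fo x) (Fo (tobj S y z))"
    "the (FO (S.ten X (S.ten Y Z)) (assoc_index k)) = Fo (tobj S x (tobj S y z))"
    using ten_entry(7,8)[OF o(1) YZ A(8)] yz by (simp_all add: x_def)
  note FX = F.additive_obj_obj[OF o(1)] and FY = F.additive_obj_obj[OF o(2)] and FZ = F.additive_obj_obj[OF o(3)]
  have k': "k \<in> dom (S'.ten (S'.ten (FO X) (FO Y)) (FO Z))" using k by (simp add: dom_triple[OF o])
  note B = S'.assoc_entry[OF FX FY FZ k']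
  show "assoc_index k \<in> dom (S'.ten (FO X) (S'.ten (FO Y) (FO Z)))" by (rule B)
  show "the (S'.ten (S'.ten (FO X) (FO Y)) (FO Z) k) = tobj S' (tobj S' (Fo x) (Fo y)) (Fo z)"
    "the (S'.ten (FO X) (S'.ten (FO Y) (FO Z)) (assoc_index k)) = tobj S' (Fo x) (tobj S' (Fo y) (Fo z))"
    using B(7,10) A(1,2,3) by (simp_all add: F.the_additive_obj x_def y_def z_def)
qed

text \<open>Every factor is monomial: all are diagonal except the associators, which follow
  \<open>assoc_index\<close>. Both composites are thus monomial along the same index map, and the
  claim becomes \<open>mult_assoc\<close> for each triple of summands.\<close>

lemma N_assoc:
  assumes o: "X \<in> Obj (additive C)" "Y \<in> Obj (additive C)" "Z \<in> Obj (additive C)"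
  shows "Cmp (additive D) (S'.ten (S'.ten (FO X) (FO Y)) (FO Z)) (FO (S.ten (S.ten X Y) Z)) (FO (S.ten X (S.ten Y Z)))
      (FM (S.ten (S.ten X Y) Z) (S.ten X (S.ten Y Z)) (tassoc S.AT X Y Z))
      (Cmp (additive D) (S'.ten (S'.ten (FO X) (FO Y)) (FO Z)) (S'.ten (FO (S.ten X Y)) (FO Z)) (FO (S.ten (S.ten X Y) Z))
        (N (S.ten X Y) Z)
        (tmor S'.AT (S'.ten (FO X) (FO Y)) (FO (S.ten X Y)) (FO Z) (FO Z) (N X Y) (Idn (additive D) (FO Z))))
    = Cmp (additive D) (S'.ten (S'.ten (FO X) (FO Y)) (FO Z)) (S'.ten (FO X) (FO (S.ten Y Z))) (FO (S.ten X (S.ten Y Z)))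
      (N X (S.ten Y Z))
      (Cmp (additive D) (S'.ten (S'.ten (FO X) (FO Y)) (FO Z)) (S'.ten (FO X) (S'.ten (FO Y) (FO Z))) (S'.ten (FO X) (FO (S.ten Y Z)))
        (tmor S'.AT (FO X) (FO X) (S'.ten (FO Y) (FO Z)) (FO (S.ten Y Z)) (Idn (additive D) (FO X)) (N Y Z))
        (tassoc S'.AT (FO X) (FO Y) (FO Z)))" (is "?L = ?R")
proof -
  interpret S'AC: category "additive D" by (rule S'.category_additive)
  note XY = S.ten_obj[OF o(1,2)] and YZ = S.ten_obj[OF o(2,3)]
  note FX = F.additive_obj_obj[OF o(1)] and FY = F.additive_obj_obj[OF o(2)] and FZ = F.additive_obj_obj[OF o(3)]
  note O = objs[OF o(1,2)] objs[OF o(2,3)] objs[OF XY o(3)] objs[OF o(1) YZ]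
  let ?T = "S'.ten (S'.ten (FO X) (FO Y)) (FO Z)" and ?T' = "S'.ten (FO X) (S'.ten (FO Y) (FO Z))"
  have T: "?T \<in> Obj (additive D)" "?T' \<in> Obj (additive D)" by (intro S'.ten_obj FX FY FZ)+
  have dT: "dom ?T = dom (S.ten (S.ten X Y) Z)" by (rule dom_triple[OF o])
  let ?x = "\<lambda>k. the (X (pd1 (pd1 k)))" and ?y = "\<lambda>k. the (Y (pd2 (pd1 k)))" and ?z = "\<lambda>k. the (Z (pd2 k))"
  let ?A = "tmor S'.AT (S'.ten (FO X) (FO Y)) (FO (S.ten X Y)) (FO Z) (FO Z) (N X Y) (Idn (additive D) (FO Z))"
  let ?B = "tmor S'.AT (FO X) (FO X) (S'.ten (FO Y) (FO Z)) (FO (S.ten Y Z)) (Idn (additive D) (FO X)) (N Y Z)"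
  have A: "arr (additive D) ?T (S'.ten (FO (S.ten X Y)) (FO Z)) ?A"
    by (rule S'.additive_tmor_arr[OF N_arr[OF o(1,2)] S'AC.arr_id[OF FZ]])
  have B: "arr (additive D) ?T' (S'.ten (FO X) (FO (S.ten Y Z))) ?B"
    by (rule S'.additive_tmor_arr[OF S'AC.arr_id[OF FX] N_arr[OF o(2,3)]])
  have id: "i \<in> dom (FO V) \<and> arr D (the (FO V i)) (the (FO V i)) (Idn D (the (FO V i)))"
    if "V \<in> Obj (additive C)" "i \<in> dom (FO V)" for V i
    using that S'.additive_objD(2)[OF F.additive_obj_obj[OF that(1)]] by simp
  have "?A = monomial ?T (\<lambda>k. prod_encode (pd1 k, pd2 k)) (\<lambda>k. tmor S' (the (S'.ten (FO X) (FO Y) (pd1 k))) (the (FO (S.ten X Y) (pd1 k)))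
      (the (FO Z (pd2 k))) (the (FO Z (pd2 k))) (\<nu> (?x k) (?y k)) (Idn D (the (FO Z (pd2 k)))))"
    unfolding N_def S'.additive_id
  proof (rule S'.additive_tmor_monomial[OF O(1,2) FZ FZ N_entry[OF o(1,2)] id[OF o(3)]])
    fix k assume "k \<in> dom ?T"
    then have k: "k \<in> dom (S.ten (S.ten X Y) Z)" by (simp only: dT)
    note e = triple_entry[OF o k]
    show "ex' (the (FO (S.ten X Y) (pd1 k))) (the (FO Z (pd2 k)))"
      unfolding e(18,16) using P.ex_iff[OF S.tobj_obj[OF e(1,2,4)] e(3)] e(5) by simp
  qed
  also have "\<dots> = monomial ?T (\<lambda>k. k) (\<lambda>k. tmor S' (tobj S' (Fo (?x k)) (Fo (?y k))) (Fo (tobj S (?x k) (?y k)))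
      (Fo (?z k)) (Fo (?z k)) (\<nu> (?x k) (?y k)) (Idn D (Fo (?z k))))" (is "_ = monomial ?T _ ?a")
  proof (rule monomial_cong)
    fix k assume "k \<in> dom ?T"
    then have k: "k \<in> dom (S.ten (S.ten X Y) Z)" by (simp only: dT)
    show "prod_encode (pd1 k, pd2 k) = k" by simp
    show "tmor S' (the (S'.ten (FO X) (FO Y) (pd1 k))) (the (FO (S.ten X Y) (pd1 k)))
      (the (FO Z (pd2 k))) (the (FO Z (pd2 k))) (\<nu> (?x k) (?y k)) (Idn D (the (FO Z (pd2 k)))) = ?a k"
      by (simp only: triple_entry[OF o k])
  qed simp
  finally have A_eq: "?A = monomial ?T (\<lambda>k. k) ?a" .
  let ?b = "\<lambda>k. tmor S' (the (FO X (pd1 k))) (the (FO X (pd1 k))) (the (S'.ten (FO Y) (FO Z) (pd2 k))) (the (FO (S.ten Y Z) (pd2 k)))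
      (Idn D (the (FO X (pd1 k)))) (\<nu> (the (Y (pd1 (pd2 k)))) (the (Z (pd2 (pd2 k)))))"
  \<comment> \<open>The right-hand bracketing is compared through the preimage \<open>j\<close>
    under \<open>assoc_index\<close>, where \<open>dom_triple\<close> applies.\<close>
  have "k \<in> dom (S.ten X (S.ten Y Z))" if "k \<in> dom ?T'" for k
  proof -
    define j where "j = prod_encode (prod_encode (pd1 k, pd1 (pd2 k)), pd2 (pd2 k))"
    have "assoc_index j = k" by (simp add: assoc_index_def j_def)
    then show ?thesis using that S'.ten_assoc_dom[OF FX FY FZ, of j] S.ten_assoc_dom[OF o, of j] dT by simp
  qed
  then have dT': "k \<in> dom (S.ten X (S.ten Y Z))" if "k \<in> dom ?T'" for k using that by blast
  have "?B = monomial ?T' (\<lambda>k. prod_encode (pd1 k, pd2 k)) ?b"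
    unfolding N_def S'.additive_id
  proof (rule S'.additive_tmor_monomial[OF FX FX O(4,5) id[OF o(1)] N_entry[OF o(2,3)]])
    fix k assume "k \<in> dom ?T'"
    then have k: "k \<in> dom (S.ten X (S.ten Y Z))" by (rule dT')
    note e = ten_entry[OF o(1) YZ k]
    show "ex' (the (FO X (pd1 k))) (the (FO (S.ten Y Z) (pd2 k)))"
      using P.ex_iff[OF e(3,4)] e(1,2,5) by (simp add: F.the_additive_obj)
  qed
  then have B_eq: "?B = monomial ?T' (\<lambda>k. k) ?b" by simp
  have a: "k \<in> dom (S'.ten (FO (S.ten X Y)) (FO Z)) \<and> arr D (the (?T k)) (the (S'.ten (FO (S.ten X Y)) (FO Z) k)) (?a k)"
    if k: "k \<in> dom ?T" for k
  proof -
    have "k \<in> dom (S'.ten (FO (S.ten X Y)) (FO Z))" using k by (simp add: dT dom_ten[OF XY o(3)])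
    then show ?thesis using S'.monomial_entry_arr[OF A[unfolded A_eq] k] by simp
  qed
  have b: "k \<in> dom (S'.ten (FO X) (FO (S.ten Y Z))) \<and> arr D (the (?T' k)) (the (S'.ten (FO X) (FO (S.ten Y Z)) k)) (?b k)"
    if k: "k \<in> dom ?T'" for k
  proof -
    have "k \<in> dom (S'.ten (FO X) (FO (S.ten Y Z)))" using dT'[OF k] by (simp add: dom_ten[OF o(1) YZ])
    then show ?thesis using S'.monomial_entry_arr[OF B[unfolded B_eq] k] by simp
  qed
  let ?M = "\<lambda>k. Cmp D (the (?T k)) (the (S'.ten (FO (S.ten X Y)) (FO Z) k)) (the (FO (S.ten (S.ten X Y) Z) k))
      (\<nu> (the (S.ten X Y (pd1 k))) (the (Z (pd2 k)))) (?a k)"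
  have M: "Cmp (additive D) ?T (S'.ten (FO (S.ten X Y)) (FO Z)) (FO (S.ten (S.ten X Y) Z)) (N (S.ten X Y) Z) ?A = monomial ?T (\<lambda>k. k) ?M"
    unfolding A_eq unfolding N_def
    by (rule S'.monomial_comp[where \<sigma> = "\<lambda>k. k" and \<tau> = "\<lambda>k. k", OF T(1) O(7,8) a N_entry[OF XY o(3)]])
  have Ma: "k \<in> dom (FO (S.ten (S.ten X Y) Z)) \<and> arr D (the (?T k)) (the (FO (S.ten (S.ten X Y) Z) k)) (?M k)" if k: "k \<in> dom ?T" for k
    using a[OF k] N_entry[OF XY o(3), of k] S'.arr_comp by blast
  let ?\<alpha> = "\<lambda>k. tassoc S (?x k) (?y k) (?z k)"
  have \<alpha>: "assoc_index k \<in> dom (S.ten X (S.ten Y Z)) \<and> arr C (the (S.ten (S.ten X Y) Z k)) (the (S.ten X (S.ten Y Z) (assoc_index k))) (?\<alpha> k)"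
    if "k \<in> dom (S.ten (S.ten X Y) Z)" for k using S.assoc_entry(8,11)[OF o that] by blast
  have F\<alpha>: "FM (S.ten (S.ten X Y) Z) (S.ten X (S.ten Y Z)) (tassoc S.AT X Y Z) = monomial (FO (S.ten (S.ten X Y) Z)) assoc_index
      (\<lambda>k. Fm (the (S.ten (S.ten X Y) Z k)) (the (S.ten X (S.ten Y Z) (assoc_index k))) (?\<alpha> k))" (is "_ = monomial _ _ ?F\<alpha>")
    unfolding S.additive_assoc by (rule F.additive_mor_monomial[OF S.ten_obj[OF XY o(3)] S.ten_obj[OF o(1) YZ] \<alpha>])
  have F\<alpha>a: "assoc_index k \<in> dom (FO (S.ten X (S.ten Y Z))) \<and>
      arr D (the (FO (S.ten (S.ten X Y) Z) k)) (the (FO (S.ten X (S.ten Y Z)) (assoc_index k))) (?F\<alpha> k)"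
    if "k \<in> dom (FO (S.ten (S.ten X Y) Z))" for k
    using that \<alpha>[of k] by (simp add: F.dom_additive_obj F.the_additive_obj F.F_arr)
  have L: "?L = monomial ?T assoc_index (\<lambda>k. Cmp D (the (?T k)) (the (FO (S.ten (S.ten X Y) Z) k)) (the (FO (S.ten X (S.ten Y Z)) (assoc_index k))) (?F\<alpha> k) (?M k))"
    unfolding M F\<alpha>
    by (rule S'.monomial_comp[where \<sigma> = "\<lambda>k. k" and \<tau> = assoc_index, OF T(1) O(8) O(11) Ma F\<alpha>a])
  let ?\<alpha>' = "\<lambda>k. tassoc S' (the (FO X (pd1 (pd1 k)))) (the (FO Y (pd2 (pd1 k)))) (the (FO Z (pd2 k)))"
  have \<alpha>': "assoc_index k \<in> dom ?T' \<and> arr D (the (?T k)) (the (?T' (assoc_index k))) (?\<alpha>' k)" if "k \<in> dom ?T" for k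
    using S'.assoc_entry(8,11)[OF FX FY FZ that] by blast
  let ?K = "\<lambda>k. Cmp D (the (?T k)) (the (?T' (assoc_index k))) (the (S'.ten (FO X) (FO (S.ten Y Z)) (assoc_index k))) (?b (assoc_index k)) (?\<alpha>' k)"
  have K: "Cmp (additive D) ?T ?T' (S'.ten (FO X) (FO (S.ten Y Z))) ?B (tassoc S'.AT (FO X) (FO Y) (FO Z)) = monomial ?T assoc_index ?K"
    unfolding B_eq S'.additive_assoc
    by (rule S'.monomial_comp[where \<sigma> = assoc_index and \<tau> = "\<lambda>k. k", OF T O(10) \<alpha>' b])
  have Ka: "assoc_index k \<in> dom (S'.ten (FO X) (FO (S.ten Y Z))) \<and> arr D (the (?T k)) (the (S'.ten (FO X) (FO (S.ten Y Z)) (assoc_index k))) (?K k)"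
    if "k \<in> dom ?T" for k
    using \<alpha>'[OF that] b[of "assoc_index k"] S'.arr_comp by blast
  have R: "?R = monomial ?T assoc_index (\<lambda>k. Cmp D (the (?T k)) (the (S'.ten (FO X) (FO (S.ten Y Z)) (assoc_index k))) (the (FO (S.ten X (S.ten Y Z)) (assoc_index k)))
      (\<nu> (the (X (pd1 (assoc_index k)))) (the (S.ten Y Z (pd2 (assoc_index k))))) (?K k))"
    unfolding K unfolding N_def
    by (rule S'.monomial_comp[where \<sigma> = assoc_index and \<tau> = "\<lambda>k. k", OF T(1) O(10,11) Ka N_entry[OF o(1) YZ]])
  show ?thesis unfolding L R
  proof (rule monomial_cong)
    fix k assume "k \<in> dom ?T"
    then have k: "k \<in> dom (S.ten (S.ten X Y) Z)" by (simp only: dT)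
    note e = triple_entry[OF o k]
    show "Cmp D (the (?T k)) (the (FO (S.ten (S.ten X Y) Z) k)) (the (FO (S.ten X (S.ten Y Z)) (assoc_index k))) (?F\<alpha> k) (?M k)
      = Cmp D (the (?T k)) (the (S'.ten (FO X) (FO (S.ten Y Z)) (assoc_index k))) (the (FO (S.ten X (S.ten Y Z)) (assoc_index k)))
      (\<nu> (the (X (pd1 (assoc_index k)))) (the (S.ten Y Z (pd2 (assoc_index k))))) (?K k)"
      unfolding e(6-22) index_simps by (rule P.mult_assoc[OF e(1-5)])
  qed simp_all
qed

end

section \<open>Unit and braiding constraints of the additive extension\<close>

context additive_partial_tensor_functor
begin

lemma unit_entry:
  assumes o: "X \<in> Obj (additive C)"
  shows "k \<in> dom (S'.ten U' (FO X)) \<longleftrightarrow> k \<in> dom (S.ten U X)" "k \<in> dom (S'.ten (FO X) U') \<longleftrightarrow> k \<in> dom (S.ten X U)"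
    "k \<in> dom (S.ten U X) \<Longrightarrow> pd1 k = 0 \<and> pd2 k \<in> dom X \<and> the (X (pd2 k)) \<in> Obj C \<and>
      the (S'.ten U' (FO X) k) = tobj S' (tunit S') (Fo (the (X (pd2 k)))) \<and>
      the (S'.ten (FO U) (FO X) k) = tobj S' (Fo (tunit S)) (Fo (the (X (pd2 k)))) \<and>
      the (FO (S.ten U X) k) = Fo (tobj S (tunit S) (the (X (pd2 k)))) \<and> the (S.ten U X k) = tobj S (tunit S) (the (X (pd2 k))) \<and>
      the (FO X (pd2 k)) = Fo (the (X (pd2 k)))"
    "k \<in> dom (S.ten X U) \<Longrightarrow> pd2 k = 0 \<and> pd1 k \<in> dom X \<and> the (X (pd1 k)) \<in> Obj C \<and>
      the (S'.ten (FO X) U' k) = tobj S' (Fo (the (X (pd1 k)))) (tunit S') \<and>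
      the (S'.ten (FO X) (FO U) k) = tobj S' (Fo (the (X (pd1 k)))) (Fo (tunit S)) \<and>
      the (FO (S.ten X U) k) = Fo (tobj S (the (X (pd1 k))) (tunit S)) \<and> the (S.ten X U k) = tobj S (the (X (pd1 k))) (tunit S) \<and>
      the (FO X (pd1 k)) = Fo (the (X (pd1 k)))"
proof -
  note FX = F.additive_obj_obj[OF o] and u = S.unit_family
  show 1: "k \<in> dom (S'.ten U' (FO X)) \<longleftrightarrow> k \<in> dom (S.ten U X)" "k \<in> dom (S'.ten (FO X) U') \<longleftrightarrow> k \<in> dom (S.ten X U)"
    unfolding S'.ten_unit_dom[OF FX] S.ten_unit_dom[OF o] F.dom_additive_obj by (rule refl)+
  show "pd1 k = 0 \<and> pd2 k \<in> dom X \<and> the (X (pd2 k)) \<in> Obj C \<and>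
      the (S'.ten U' (FO X) k) = tobj S' (tunit S') (Fo (the (X (pd2 k)))) \<and>
      the (S'.ten (FO U) (FO X) k) = tobj S' (Fo (tunit S)) (Fo (the (X (pd2 k)))) \<and>
      the (FO (S.ten U X) k) = Fo (tobj S (tunit S) (the (X (pd2 k)))) \<and> the (S.ten U X k) = tobj S (tunit S) (the (X (pd2 k))) \<and>
      the (FO X (pd2 k)) = Fo (the (X (pd2 k)))" if k: "k \<in> dom (S.ten U X)"
    using ten_entry[OF u o k] fam_tensor_the[OF 1(1)[THEN iffD2, OF k]] k[unfolded S.ten_unit_dom[OF o]] by (simp add: F.the_additive_obj)
  show "pd2 k = 0 \<and> pd1 k \<in> dom X \<and> the (X (pd1 k)) \<in> Obj C \<and>
      the (S'.ten (FO X) U' k) = tobj S' (Fo (the (X (pd1 k)))) (tunit S') \<and>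
      the (S'.ten (FO X) (FO U) k) = tobj S' (Fo (the (X (pd1 k)))) (Fo (tunit S)) \<and>
      the (FO (S.ten X U) k) = Fo (tobj S (the (X (pd1 k))) (tunit S)) \<and> the (S.ten X U k) = tobj S (the (X (pd1 k))) (tunit S) \<and>
      the (FO X (pd1 k)) = Fo (the (X (pd1 k)))" if k: "k \<in> dom (S.ten X U)"
    using ten_entry[OF o u k] fam_tensor_the[OF 1(2)[THEN iffD2, OF k]] k[unfolded S.ten_unit_dom[OF o]] by (simp add: F.the_additive_obj)
qed

lemma E_entry: "i \<in> dom U' \<Longrightarrow> i \<in> dom (FO U) \<and> arr D (the (U' i)) (the (FO U i)) \<epsilon>"
  using unit_iso_arr by (simp add: F.dom_additive_obj F.the_additive_obj)

lemma id_entry: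
  "V \<in> Obj (additive D) \<Longrightarrow> i \<in> dom V \<Longrightarrow> i \<in> dom V \<and> arr D (the (V i)) (the (V i)) (Idn D (the (V i)))"
  using S'.additive_objD(2)[of V i] by simp

text \<open>As for associativity, all factors are monomial; the unitor sends the pair
  \<open>(0, i)\<close> to \<open>i\<close>, and each entry is an instance of
  \<open>mult_lunit\<close>.\<close>

lemma N_lunit:
  assumes o: "X \<in> Obj (additive C)"
  shows "Cmp (additive D) (S'.ten U' (FO X)) (FO (S.ten U X)) (FO X) (FM (S.ten U X) X (tlunit S.AT X))
      (Cmp (additive D) (S'.ten U' (FO X)) (S'.ten (FO U) (FO X)) (FO (S.ten U X)) (N U X)
        (tmor S'.AT U' (FO U) (FO X) (FO X) E (Idn (additive D) (FO X))))
    = tlunit S'.AT (FO X)" (is "?L = _")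
proof -
  interpret DA: category "additive D" by (rule S'.category_additive)
  note u = S.unit_family note UX = S.ten_obj[OF u o] and FX = F.additive_obj_obj[OF o] and FU = F.additive_obj_obj[OF u]
  note O = objs[OF u o] note U' = S'.unit_family
  let ?T = "S'.ten U' (FO X)" and ?A = "tmor S'.AT U' (FO U) (FO X) (FO X) E (Idn (additive D) (FO X))"
  have T: "?T \<in> Obj (additive D)" by (rule S'.ten_obj[OF U' FX])
  have A: "arr (additive D) ?T (S'.ten (FO U) (FO X)) ?A" by (rule S'.additive_tmor_arr[OF E_arr DA.arr_id[OF FX]])
  let ?a = "\<lambda>k. tmor S' (the (U' (pd1 k))) (the (FO U (pd1 k))) (the (FO X (pd2 k))) (the (FO X (pd2 k))) \<epsilon> (Idn D (the (FO X (pd2 k))))"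
  have "?A = monomial ?T (\<lambda>k. prod_encode (pd1 k, pd2 k)) ?a"
    unfolding E_def S'.additive_id
  proof (rule S'.additive_tmor_monomial[OF U' FU FX FX E_entry id_entry[OF FX]])
    fix k assume "k \<in> dom ?T"
    then have k: "k \<in> dom (S.ten U X)" by (simp only: unit_entry[OF o])
    show "ex' (the (FO U (pd1 k))) (the (FO X (pd2 k)))"
      using unit_entry(3)[OF o k] P.ex_iff[OF S.unit_obj] S.ex_unit by (simp add: F.the_additive_obj)
  qed
  then have A_eq: "?A = monomial ?T (\<lambda>k. k) ?a" by simp
  have a: "k \<in> dom (S'.ten (FO U) (FO X)) \<and> arr D (the (?T k)) (the (S'.ten (FO U) (FO X) k)) (?a k)" if k: "k \<in> dom ?T" for k
  proof -
    have "k \<in> dom (S'.ten (FO U) (FO X))" using k by (simp only: dom_ten[OF u o] unit_entry[OF o])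
    then show ?thesis using S'.monomial_entry_arr[OF A[unfolded A_eq] k] by simp
  qed
  let ?M = "\<lambda>k. Cmp D (the (?T k)) (the (S'.ten (FO U) (FO X) k)) (the (FO (S.ten U X) k)) (\<nu> (the (U (pd1 k))) (the (X (pd2 k)))) (?a k)"
  have M: "Cmp (additive D) ?T (S'.ten (FO U) (FO X)) (FO (S.ten U X)) (N U X) ?A = monomial ?T (\<lambda>k. k) ?M"
    unfolding A_eq unfolding N_def
    by (rule S'.monomial_comp[where \<sigma> = "\<lambda>k. k" and \<tau> = "\<lambda>k. k", OF T O(1,2) a N_entry[OF u o]])
  have Ma: "k \<in> dom (FO (S.ten U X)) \<and> arr D (the (?T k)) (the (FO (S.ten U X) k)) (?M k)" if k: "k \<in> dom ?T" for k
    using a[OF k] N_entry[OF u o, of k] S'.arr_comp by blast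
  have F\<alpha>: "FM (S.ten U X) X (tlunit S.AT X) = monomial (FO (S.ten U X)) (\<lambda>k. pd2 k)
      (\<lambda>k. Fm (the (S.ten U X k)) (the (X (pd2 k))) (tlunit S (the (X (pd2 k)))))" (is "_ = monomial _ _ ?F\<alpha>")
    unfolding S.additive_unitors[OF o] by (rule F.additive_mor_monomial[OF UX o S.unitor_entry(1)[OF o]])
  have F\<alpha>a: "pd2 k \<in> dom (FO X) \<and> arr D (the (FO (S.ten U X) k)) (the (FO X (pd2 k))) (?F\<alpha> k)"
    if "k \<in> dom (FO (S.ten U X))" for k
    using that S.unitor_entry(1)[OF o, of k] by (simp add: F.dom_additive_obj F.the_additive_obj F.F_arr)
  have L: "?L = monomial ?T (\<lambda>k. pd2 k) (\<lambda>k. Cmp D (the (?T k)) (the (FO (S.ten U X) k)) (the (FO X (pd2 k))) (?F\<alpha> k) (?M k))"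
    unfolding M F\<alpha> by (rule S'.monomial_comp[where \<sigma> = "\<lambda>k. k" and \<tau> = "\<lambda>k. pd2 k", OF T O(2) FX Ma F\<alpha>a])
  show ?thesis unfolding L S'.additive_unitors[OF FX]
  proof (rule monomial_cong)
    fix k assume "k \<in> dom ?T"
    then have k: "k \<in> dom (S.ten U X)" by (simp only: unit_entry[OF o])
    have 0: "the (U (pd1 k)) = tunit S" "the (U' (pd1 k)) = tunit S'" "the (FO U (pd1 k)) = Fo (tunit S)"
      using unit_entry(3)[OF o k] by (simp_all add: F.the_additive_obj)
    show "Cmp D (the (?T k)) (the (FO (S.ten U X) k)) (the (FO X (pd2 k))) (?F\<alpha> k) (?M k) = tlunit S' (the (FO X (pd2 k)))"
      using unit_entry(3)[OF o k] 0 P.mult_lunit[of "the (X (pd2 k))"] by (simp only:)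
  qed simp_all
qed

lemma N_runit:
  assumes o: "X \<in> Obj (additive C)"
  shows "Cmp (additive D) (S'.ten (FO X) U') (FO (S.ten X U)) (FO X) (FM (S.ten X U) X (trunit S.AT X))
      (Cmp (additive D) (S'.ten (FO X) U') (S'.ten (FO X) (FO U)) (FO (S.ten X U)) (N X U)
        (tmor S'.AT (FO X) (FO X) U' (FO U) (Idn (additive D) (FO X)) E))
    = trunit S'.AT (FO X)" (is "?L = _")
proof -
  interpret DA: category "additive D" by (rule S'.category_additive)
  note u = S.unit_family note UX = S.ten_obj[OF o u] and FX = F.additive_obj_obj[OF o] and FU = F.additive_obj_obj[OF u]
  note O = objs[OF o u] note U' = S'.unit_family
  let ?T = "S'.ten (FO X) U'" and ?A = "tmor S'.AT (FO X) (FO X) U' (FO U) (Idn (additive D) (FO X)) E"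
  have T: "?T \<in> Obj (additive D)" by (rule S'.ten_obj[OF FX U'])
  have A: "arr (additive D) ?T (S'.ten (FO X) (FO U)) ?A" by (rule S'.additive_tmor_arr[OF DA.arr_id[OF FX] E_arr])
  let ?a = "\<lambda>k. tmor S' (the (FO X (pd1 k))) (the (FO X (pd1 k))) (the (U' (pd2 k))) (the (FO U (pd2 k))) (Idn D (the (FO X (pd1 k)))) \<epsilon>"
  have "?A = monomial ?T (\<lambda>k. prod_encode (pd1 k, pd2 k)) ?a"
    unfolding E_def S'.additive_id
  proof (rule S'.additive_tmor_monomial[OF FX FX U' FU id_entry[OF FX] E_entry])
    fix k assume "k \<in> dom ?T"
    then have k: "k \<in> dom (S.ten X U)" by (simp only: unit_entry[OF o])
    show "ex' (the (FO X (pd1 k))) (the (FO U (pd2 k)))"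
      using unit_entry(4)[OF o k] P.ex_iff[OF _ S.unit_obj] S.ex_unit by (simp add: F.the_additive_obj)
  qed
  then have A_eq: "?A = monomial ?T (\<lambda>k. k) ?a" by simp
  have a: "k \<in> dom (S'.ten (FO X) (FO U)) \<and> arr D (the (?T k)) (the (S'.ten (FO X) (FO U) k)) (?a k)" if k: "k \<in> dom ?T" for k
  proof -
    have "k \<in> dom (S'.ten (FO X) (FO U))" using k by (simp only: dom_ten[OF o u] unit_entry[OF o])
    then show ?thesis using S'.monomial_entry_arr[OF A[unfolded A_eq] k] by simp
  qed
  let ?M = "\<lambda>k. Cmp D (the (?T k)) (the (S'.ten (FO X) (FO U) k)) (the (FO (S.ten X U) k)) (\<nu> (the (X (pd1 k))) (the (U (pd2 k)))) (?a k)"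
  have M: "Cmp (additive D) ?T (S'.ten (FO X) (FO U)) (FO (S.ten X U)) (N X U) ?A = monomial ?T (\<lambda>k. k) ?M"
    unfolding A_eq unfolding N_def
    by (rule S'.monomial_comp[where \<sigma> = "\<lambda>k. k" and \<tau> = "\<lambda>k. k", OF T O(1,2) a N_entry[OF o u]])
  have Ma: "k \<in> dom (FO (S.ten X U)) \<and> arr D (the (?T k)) (the (FO (S.ten X U) k)) (?M k)" if k: "k \<in> dom ?T" for k
    using a[OF k] N_entry[OF o u, of k] S'.arr_comp by blast
  have F\<alpha>: "FM (S.ten X U) X (trunit S.AT X) = monomial (FO (S.ten X U)) (\<lambda>k. pd1 k)
      (\<lambda>k. Fm (the (S.ten X U k)) (the (X (pd1 k))) (trunit S (the (X (pd1 k)))))" (is "_ = monomial _ _ ?F\<alpha>")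
    unfolding S.additive_unitors[OF o] by (rule F.additive_mor_monomial[OF UX o S.unitor_entry(2)[OF o]])
  have F\<alpha>a: "pd1 k \<in> dom (FO X) \<and> arr D (the (FO (S.ten X U) k)) (the (FO X (pd1 k))) (?F\<alpha> k)"
    if "k \<in> dom (FO (S.ten X U))" for k
    using that S.unitor_entry(2)[OF o, of k] by (simp add: F.dom_additive_obj F.the_additive_obj F.F_arr)
  have L: "?L = monomial ?T (\<lambda>k. pd1 k) (\<lambda>k. Cmp D (the (?T k)) (the (FO (S.ten X U) k)) (the (FO X (pd1 k))) (?F\<alpha> k) (?M k))"
    unfolding M F\<alpha> by (rule S'.monomial_comp[where \<sigma> = "\<lambda>k. k" and \<tau> = "\<lambda>k. pd1 k", OF T O(2) FX Ma F\<alpha>a])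
  show ?thesis unfolding L S'.additive_unitors[OF FX]
  proof (rule monomial_cong)
    fix k assume "k \<in> dom ?T"
    then have k: "k \<in> dom (S.ten X U)" by (simp only: unit_entry[OF o])
    have 0: "the (U (pd2 k)) = tunit S" "the (U' (pd2 k)) = tunit S'" "the (FO U (pd2 k)) = Fo (tunit S)"
      using unit_entry(4)[OF o k] by (simp_all add: F.the_additive_obj)
    show "Cmp D (the (?T k)) (the (FO (S.ten X U) k)) (the (FO X (pd1 k))) (?F\<alpha> k) (?M k) = trunit S' (the (FO X (pd1 k)))"
      using unit_entry(4)[OF o k] 0 P.mult_runit[of "the (X (pd1 k))"] by (simp only:)
  qed simp_all
qed

lemma N_braid:
  assumes o: "X \<in> Obj (additive C)" "Y \<in> Obj (additive C)"
  shows "Cmp (additive D) (S'.ten (FO X) (FO Y)) (FO (S.ten X Y)) (FO (S.ten Y X))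
      (FM (S.ten X Y) (S.ten Y X) (tbraid S.AT X Y)) (N X Y)
    = Cmp (additive D) (S'.ten (FO X) (FO Y)) (S'.ten (FO Y) (FO X)) (FO (S.ten Y X)) (N Y X) (tbraid S'.AT (FO X) (FO Y))"
proof -
  note FX = F.additive_obj_obj[OF o(1)] and FY = F.additive_obj_obj[OF o(2)]
  note O = objs[OF o] objs[OF o(2,1)]
  let ?T = "S'.ten (FO X) (FO Y)"
  have F\<beta>: "FM (S.ten X Y) (S.ten Y X) (tbraid S.AT X Y) = monomial (FO (S.ten X Y)) braid_index
      (\<lambda>k. Fm (the (S.ten X Y k)) (the (S.ten Y X (braid_index k))) (tbraid S (the (X (pd1 k))) (the (Y (pd2 k)))))" (is "_ = monomial _ _ ?F\<beta>")
    unfolding S.additive_braid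
    by (rule F.additive_mor_monomial[OF S.ten_obj[OF o] S.ten_obj[OF o(2,1)]]) (use S.braid_entry(4,6)[OF o] in blast)
  have F\<beta>a: "braid_index k \<in> dom (FO (S.ten Y X)) \<and> arr D (the (FO (S.ten X Y) k)) (the (FO (S.ten Y X) (braid_index k))) (?F\<beta> k)"
    if "k \<in> dom (FO (S.ten X Y))" for k
    using that S.braid_entry(4,6)[OF o, of k] by (simp add: F.dom_additive_obj F.the_additive_obj F.F_arr)
  have L: "Cmp (additive D) ?T (FO (S.ten X Y)) (FO (S.ten Y X)) (FM (S.ten X Y) (S.ten Y X) (tbraid S.AT X Y)) (N X Y)
    = monomial ?T braid_index (\<lambda>k. Cmp D (the (?T k)) (the (FO (S.ten X Y) k)) (the (FO (S.ten Y X) (braid_index k))) (?F\<beta> k)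
        (\<nu> (the (X (pd1 k))) (the (Y (pd2 k)))))"
    unfolding F\<beta> N_def
    by (rule S'.monomial_comp[where \<sigma> = "\<lambda>k. k" and \<tau> = braid_index, OF O(1,2,5) N_entry[OF o] F\<beta>a])
  have \<beta>': "braid_index k \<in> dom (S'.ten (FO Y) (FO X)) \<and> arr D (the (?T k)) (the (S'.ten (FO Y) (FO X) (braid_index k)))
      (tbraid S' (the (FO X (pd1 k))) (the (FO Y (pd2 k))))" if "k \<in> dom ?T" for k
    using S'.braid_entry(4,6)[OF FX FY that] by blast
  have R: "Cmp (additive D) ?T (S'.ten (FO Y) (FO X)) (FO (S.ten Y X)) (N Y X) (tbraid S'.AT (FO X) (FO Y))
    = monomial ?T braid_index (\<lambda>k. Cmp D (the (?T k)) (the (S'.ten (FO Y) (FO X) (braid_index k))) (the (FO (S.ten Y X) (braid_index k)))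
        (\<nu> (the (Y (pd1 (braid_index k)))) (the (X (pd2 (braid_index k))))) (tbraid S' (the (FO X (pd1 k))) (the (FO Y (pd2 k)))))"
    unfolding S'.additive_braid N_def
    by (rule S'.monomial_comp[where \<sigma> = braid_index and \<tau> = "\<lambda>k. k", OF O(1,4,5) \<beta>' N_entry[OF o(2,1)]])
  show ?thesis unfolding L R
  proof (rule monomial_cong)
    fix k assume "k \<in> dom ?T"
    then have k: "k \<in> dom (S.ten X Y)" by (simp only: dom_ten[OF o])
    note e = ten_entry[OF o k] note b = S.braid_entry(4)[OF o k] note e' = ten_entry[OF o(2,1) b, unfolded index_simps]
    have f: "the (FO X (pd1 k)) = Fo (the (X (pd1 k)))" "the (FO Y (pd2 k)) = Fo (the (Y (pd2 k)))"
      using e(1,2) by (simp_all add: F.the_additive_obj)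
    show "Cmp D (the (?T k)) (the (FO (S.ten X Y) k)) (the (FO (S.ten Y X) (braid_index k))) (?F\<beta> k) (\<nu> (the (X (pd1 k))) (the (Y (pd2 k))))
      = Cmp D (the (?T k)) (the (S'.ten (FO Y) (FO X) (braid_index k))) (the (FO (S.ten Y X) (braid_index k)))
        (\<nu> (the (Y (pd1 (braid_index k)))) (the (X (pd2 (braid_index k))))) (tbraid S' (the (FO X (pd1 k))) (the (FO Y (pd2 k))))"
      unfolding e(6-8) e'(6-8) f index_simps by (rule P.mult_braid[OF e(3-5)])
  qed simp_all
qed

lemma partial_tensor_functor_additive:
  "partial_tensor_functor (additive C) (\<lambda>_ _. True) S.AT (additive D) (\<lambda>_ _. True) S'.AT FO FM N E"
proof (intro partial_tensor_functor.intro F.cat_functor_additive S.partial_tensor_additive S'.partial_tensor_additive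
    partial_tensor_functor_axioms.intro; (unfold S.additive_tensor_simps S'.additive_tensor_simps)?)
qed (simp_all add: E_iso N_iso N_natural N_assoc N_lunit N_runit N_braid)

end

subsection \<open>Lifting to the Karoubi completion\<close>

lemma karoubi_tensor_simps [simp]:
  "tobj (karoubi_tensor C S) (x, e) (y, d) = (tobj S x y, tmor S x x y y e d)"
  "tmor (karoubi_tensor C S) (x, e) (x', e') (y, d) (y', d') = tmor S x x' y y'"
  "tunit (karoubi_tensor C S) = (tunit S, Idn C (tunit S))"
  "tassoc (karoubi_tensor C S) (x, e) (y, d) (z, c) =
    Cmp C (tobj S (tobj S x y) z) (tobj S (tobj S x y) z) (tobj S x (tobj S y z)) (tassoc S x y z)
      (tmor S (tobj S x y) (tobj S x y) z z (tmor S x x y y e d) c)"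
  "tlunit (karoubi_tensor C S) (x, e) = Cmp C (tobj S (tunit S) x) (tobj S (tunit S) x) x (tlunit S x)
      (tmor S (tunit S) (tunit S) x x (Idn C (tunit S)) e)"
  "trunit (karoubi_tensor C S) (x, e) = Cmp C (tobj S x (tunit S)) (tobj S x (tunit S)) x (trunit S x)
      (tmor S x x (tunit S) (tunit S) e (Idn C (tunit S)))"
  "tbraid (karoubi_tensor C S) (x, e) (y, d) =
    Cmp C (tobj S x y) (tobj S x y) (tobj S y x) (tbraid S x y) (tmor S x x y y e d)"
  by (simp_all add: karoubi_tensor_def Let_def)

text \<open>An isomorphism that intertwines two idempotents restricts to their images; its inverse
  there is the old inverse cut down by \<open>g\<close>.\<close>

lemma karoubi_iso:
  fixes C :: "('o, 'v, 'k) lincat"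
  assumes "category C" "iso C a b n" "idem C a g" "idem C b h" "Cmp C a a b n g = Cmp C a b b h n"
  shows "iso (karoubi C) (a, g) (b, h) (Cmp C a a b n g)"
proof -
  interpret category C by fact
  have g: "arr C a a g" "Cmp C a a a g g = g" and h: "arr C b b h" "Cmp C b b b h h = h"
    using assms by (auto simp: idem_def)
  obtain m where n: "arr C a b n" "arr C b a m" "Cmp C a b a m n = Idn C a" "Cmp C b a b n m = Idn C b"
    by (rule isoE[OF assms(2) arr_dom[OF g(1)] arr_dom[OF h(1)]])
  let ?n = "Cmp C a a b n g" and ?m = "Cmp C b a a g m"
  note nm = arr_comp[OF g(1) n(1)] arr_comp[OF n(2) g(1)]
  have 1: "Cmp C a a b ?n g = ?n" using comp_asc[OF g(1,1) n(1)] g(2) by simp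
  have 2: "Cmp C a b b h ?n = ?n" unfolding assms(5) using comp_asc[OF n(1) h(1,1)] h(2) by simp
  have 3: "Cmp C b a a g ?m = ?m" using comp_asc[OF n(2) g(1,1)] g(2) by simp
  have nm_h: "Cmp C b a b ?n m = h"
    unfolding assms(5) using comp_asc[OF n(2,1) h(1)] n(4) h(1) by simp
  have mn_g: "Cmp C a b a m ?n = g"
    using comp_asc[OF g(1) n(1,2)] n(3) g(1) by simp
  have mh: "Cmp C b b a m h = ?m"
    using comp_asc[OF n(2) nm(1) n(2)] mn_g nm_h by simp
  have 4: "Cmp C b b a ?m h = ?m" using comp_asc[OF h(1) n(2) g(1)] mh 3 by simp
  have 5: "Cmp C a b a ?m ?n = g" using comp_asc[OF nm(1) n(2) g(1)] mn_g g(2) by simp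
  have 6: "Cmp C b a b ?n ?m = h"
    using comp_asc[OF n(2) g(1) nm(1)] 1 nm_h by simp
  show ?thesis
    unfolding iso_def
    by (intro conjI bexI[of _ ?m])
      (simp_all add: karoubi_hom_iff[OF assms(1,3,4)] karoubi_hom_iff[OF assms(1,4,3)] nm 1 2 3 4 5 6)
qed

locale tensor_functor = partial_tensor_functor C "\<lambda>_ _. True" S D "\<lambda>_ _. True" S' Fo Fm \<nu> \<epsilon>
  for C :: "('o, 'v::ab_group_add, 'k) lincat" and S :: "('o, 'v) tensor"
    and D :: "('p, 'w::ab_group_add, 'k) lincat" and S' :: "('p, 'w) tensor"
    and Fo :: "'o \<Rightarrow> 'p" and Fm :: "'o \<Rightarrow> 'o \<Rightarrow> 'v \<Rightarrow> 'w" and \<nu> \<epsilon>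
begin

abbreviation "t \<equiv> tobj S"
abbreviation "t' \<equiv> tobj S'"

lemmas S_tmor_comp = S.tmor_comp[OF _ _ _ _ TrueI TrueI, unfolded if_True]
lemmas S'_tmor_comp = S'.tmor_comp[OF _ _ _ _ TrueI TrueI, unfolded if_True]

lemma mult_arr: "x \<in> Obj C \<Longrightarrow> y \<in> Obj C \<Longrightarrow> arr D (t' (Fo x) (Fo y)) (Fo (t x y)) (\<nu> x y)"
  using mult_iso[of x y] D.iso_iff[of "t' (Fo x) (Fo y)" "Fo (t x y)"] S'.tobj_obj S.tobj_obj F_obj by simp

lemma F_idem: "idem C x e \<Longrightarrow> idem D (Fo x) (Fm x x e)"
  using F_comp_arr[of x x e x e] by (simp add: idem_def)

lemma S_idem: "idem C x e \<Longrightarrow> idem C y d \<Longrightarrow> idem C (t x y) (tmor S x x y y e d)"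
  using S_tmor_comp[of x x e x e y y d y d] by (simp add: idem_def S.tmor_arr)

lemma S'_idem: "idem D x e \<Longrightarrow> idem D y d \<Longrightarrow> idem D (t' x y) (tmor S' x x y y e d)"
  using S'_tmor_comp[of x x e x e y y d y d] by (simp add: idem_def S'.tmor_arr)

text \<open>\<open>\<nu>\<close> has to absorb the idempotents to be a morphism of the completion.
  By naturality, cutting it down at the source agrees with cutting it down at the target.\<close>

definition \<mu> where
  "\<mu> = (\<lambda>(x, e) (y, d). Cmp D (t' (Fo x) (Fo y)) (t' (Fo x) (Fo y)) (Fo (t x y)) (\<nu> x y)
     (tmor S' (Fo x) (Fo x) (Fo y) (Fo y) (Fm x x e) (Fm y y d)))"

lemma \<mu>_facts:
  assumes "idem C x e" "idem C y d"
  defines "m \<equiv> \<mu> (x, e) (y, d)"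
    and "g \<equiv> tmor S' (Fo x) (Fo x) (Fo y) (Fo y) (Fm x x e) (Fm y y d)"
    and "h \<equiv> Fm (t x y) (t x y) (tmor S x x y y e d)"
  shows "x \<in> Obj C" "y \<in> Obj C" "arr C x x e" "arr C y y d"
    "arr D (t' (Fo x) (Fo y)) (Fo (t x y)) (\<nu> x y)" "arr D (t' (Fo x) (Fo y)) (t' (Fo x) (Fo y)) g"
    "arr D (Fo (t x y)) (Fo (t x y)) h" "arr D (t' (Fo x) (Fo y)) (Fo (t x y)) m"
    "m = Cmp D (t' (Fo x) (Fo y)) (t' (Fo x) (Fo y)) (Fo (t x y)) (\<nu> x y) g"
    "m = Cmp D (t' (Fo x) (Fo y)) (Fo (t x y)) (Fo (t x y)) h (\<nu> x y)"
    "Cmp D (t' (Fo x) (Fo y)) (t' (Fo x) (Fo y)) (t' (Fo x) (Fo y)) g g = g"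
    "Cmp D (t' (Fo x) (Fo y)) (Fo (t x y)) (Fo (t x y)) h m = m"
    "Cmp D (t' (Fo x) (Fo y)) (t' (Fo x) (Fo y)) (Fo (t x y)) m g = m"
proof -
  show e: "arr C x x e" "arr C y y d" using assms by (simp_all add: idem_def)
  show o: "x \<in> Obj C" "y \<in> Obj C" using e by (simp_all add: arr_def)
  show n: "arr D (t' (Fo x) (Fo y)) (Fo (t x y)) (\<nu> x y)" by (rule mult_arr[OF o])
  have gi: "idem D (t' (Fo x) (Fo y)) g" unfolding g_def by (rule S'_idem[OF F_idem[OF assms(1)] F_idem[OF assms(2)]])
  have hi: "idem D (Fo (t x y)) h" unfolding h_def by (rule F_idem[OF S_idem[OF assms(1,2)]])
  show g: "arr D (t' (Fo x) (Fo y)) (t' (Fo x) (Fo y)) g" and gg: "Cmp D (t' (Fo x) (Fo y)) (t' (Fo x) (Fo y)) (t' (Fo x) (Fo y)) g g = g"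
    using gi by (simp_all add: idem_def)
  show h: "arr D (Fo (t x y)) (Fo (t x y)) h" using hi by (simp add: idem_def)
  show m: "m = Cmp D (t' (Fo x) (Fo y)) (t' (Fo x) (Fo y)) (Fo (t x y)) (\<nu> x y) g" by (simp add: m_def \<mu>_def g_def)
  show m': "m = Cmp D (t' (Fo x) (Fo y)) (Fo (t x y)) (Fo (t x y)) h (\<nu> x y)"
    unfolding m g_def h_def by (rule mult_natural[OF e TrueI TrueI])
  show "arr D (t' (Fo x) (Fo y)) (Fo (t x y)) m" unfolding m by (rule D.arr_comp[OF g n])
  show "Cmp D (t' (Fo x) (Fo y)) (Fo (t x y)) (Fo (t x y)) h m = m"
    using D.comp_asc[OF n h h] hi unfolding m' by (simp add: idem_def)
  show "Cmp D (t' (Fo x) (Fo y)) (t' (Fo x) (Fo y)) (Fo (t x y)) m g = m"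
    using D.comp_asc[OF g g n] gg unfolding m by simp
qed

text \<open>By naturality \<open>\<nu>\<close> intertwines the two idempotents, so
  \<open>karoubi_iso\<close> applies.\<close>

lemma karoubi_mult_iso:
  assumes "idem C x e" "idem C y d"
  shows "iso (karoubi D) (t' (Fo x) (Fo y), tmor S' (Fo x) (Fo x) (Fo y) (Fo y) (Fm x x e) (Fm y y d))
    (Fo (t x y), Fm (t x y) (t x y) (tmor S x x y y e d)) (\<mu> (x, e) (y, d))"
  unfolding \<mu>_facts(9)[OF assms]
proof (rule karoubi_iso[OF D.category_axioms mult_iso])
  show "x \<in> Obj C" "y \<in> Obj C" using \<mu>_facts(1,2)[OF assms] .
  show "Cmp D (t' (Fo x) (Fo y)) (t' (Fo x) (Fo y)) (Fo (t x y)) (\<nu> x y)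
      (tmor S' (Fo x) (Fo x) (Fo y) (Fo y) (Fm x x e) (Fm y y d))
    = Cmp D (t' (Fo x) (Fo y)) (Fo (t x y)) (Fo (t x y)) (Fm (t x y) (t x y) (tmor S x x y y e d)) (\<nu> x y)"
    using \<mu>_facts(9)[OF assms] \<mu>_facts(10)[OF assms] by (rule trans[OF sym])
qed (use assms S'_idem F_idem S_idem in auto)

text \<open>\<open>f\<close> and \<open>g\<close> absorb the idempotents of source and target, so
  \<open>\<mu>\<close> can be replaced by \<open>\<nu>\<close> on one side of the square and
  recovered on the other.\<close>

lemma karoubi_mult_natural:
  assumes f: "arr (karoubi C) (x, e) (x', e') f" and g: "arr (karoubi C) (y, d) (y', d') g"
  shows "Cmp D (t' (Fo x) (Fo y)) (t' (Fo x') (Fo y')) (Fo (t x' y')) (\<mu> (x', e') (y', d'))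
      (tmor S' (Fo x) (Fo x') (Fo y) (Fo y') (Fm x x' f) (Fm y y' g))
    = Cmp D (t' (Fo x) (Fo y)) (Fo (t x y)) (Fo (t x' y')) (Fm (t x y) (t x' y') (tmor S x x' y y' f g)) (\<mu> (x, e) (y, d))"
proof -
  have i: "idem C x e" "idem C x' e'" "idem C y d" "idem C y' d'" and a: "arr C x x' f" "arr C y y' g"
    and fe: "Cmp C x x x' f e = f" "Cmp C x x' x' e' f = f" and gd: "Cmp C y y y' g d = g" "Cmp C y y' y' d' g = g"
    using f g unfolding karoubi_arr_iff[OF C.category_axioms] by auto
  note m = \<mu>_facts[OF i(1,3)] and m' = \<mu>_facts[OF i(2,4)]
  note Fa = F_arr[OF a(1)] F_arr[OF a(2)] note T = S'.tmor_arr[OF Fa TrueI TrueI] and T0 = F_arr[OF S.tmor_arr[OF a TrueI TrueI]]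
  have "Cmp D (t' (Fo x) (Fo y)) (t' (Fo x') (Fo y')) (Fo (t x' y')) (\<mu> (x', e') (y', d')) (tmor S' (Fo x) (Fo x') (Fo y) (Fo y') (Fm x x' f) (Fm y y' g))
    = Cmp D (t' (Fo x) (Fo y)) (t' (Fo x') (Fo y')) (Fo (t x' y')) (\<nu> x' y') (tmor S' (Fo x) (Fo x') (Fo y) (Fo y') (Fm x x' f) (Fm y y' g))"
    unfolding m'(9) D.comp_asc[OF T m'(6,5)]
      S'_tmor_comp[OF Fa(1) F_arr[OF m'(3)] Fa(2) F_arr[OF m'(4)], symmetric]
      F_comp_arr[OF a(1) m'(3), symmetric] F_comp_arr[OF a(2) m'(4), symmetric] fe gd ..
  also have "\<dots> = Cmp D (t' (Fo x) (Fo y)) (t' (Fo x') (Fo y')) (Fo (t x' y')) (\<nu> x' y')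
      (tmor S' (Fo x) (Fo x') (Fo y) (Fo y') (Cmp D (Fo x) (Fo x) (Fo x') (Fm x x' f) (Fm x x e)) (Cmp D (Fo y) (Fo y) (Fo y') (Fm y y' g) (Fm y y d)))"
    unfolding F_comp_arr[OF m(3) a(1), symmetric] F_comp_arr[OF m(4) a(2), symmetric] fe gd ..
  also have "\<dots> = Cmp D (t' (Fo x) (Fo y)) (t' (Fo x) (Fo y)) (Fo (t x' y'))
      (Cmp D (t' (Fo x) (Fo y)) (t' (Fo x') (Fo y')) (Fo (t x' y')) (\<nu> x' y') (tmor S' (Fo x) (Fo x') (Fo y) (Fo y') (Fm x x' f) (Fm y y' g)))
      (tmor S' (Fo x) (Fo x) (Fo y) (Fo y) (Fm x x e) (Fm y y d))"
    unfolding S'_tmor_comp[OF F_arr[OF m(3)] Fa(1) F_arr[OF m(4)] Fa(2)] by (rule D.comp_asc[OF m(6) T m'(5), symmetric])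
  also have "\<dots> = Cmp D (t' (Fo x) (Fo y)) (Fo (t x y)) (Fo (t x' y')) (Fm (t x y) (t x' y') (tmor S x x' y y' f g)) (\<mu> (x, e) (y, d))"
    unfolding mult_natural[OF a TrueI TrueI] D.comp_asc[OF m(6,5) T0] m(9) ..
  finally show ?thesis .
qed

end

context tensor_functor
begin

text \<open>All idempotents are collected at the source as \<open>?E'\<close>, where the coherence
  law for \<open>\<nu>\<close> applies; they are then redistributed on the other side by naturality
  of the associator.\<close>

lemma karoubi_mult_assoc:
  assumes i: "idem C x e" "idem C y d" "idem C z c"
  shows "Cmp D (t' (t' (Fo x) (Fo y)) (Fo z)) (Fo (t (t x y) z)) (Fo (t x (t y z)))
      (Fm (t (t x y) z) (t x (t y z)) (Cmp C (t (t x y) z) (t (t x y) z) (t x (t y z)) (tassoc S x y z)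
        (tmor S (t x y) (t x y) z z (tmor S x x y y e d) c)))
      (Cmp D (t' (t' (Fo x) (Fo y)) (Fo z)) (t' (Fo (t x y)) (Fo z)) (Fo (t (t x y) z)) (\<mu> (t x y, tmor S x x y y e d) (z, c))
        (tmor S' (t' (Fo x) (Fo y)) (Fo (t x y)) (Fo z) (Fo z) (\<mu> (x, e) (y, d)) (Fm z z c)))
    = Cmp D (t' (t' (Fo x) (Fo y)) (Fo z)) (t' (Fo x) (Fo (t y z))) (Fo (t x (t y z))) (\<mu> (x, e) (t y z, tmor S y y z z d c))
      (Cmp D (t' (t' (Fo x) (Fo y)) (Fo z)) (t' (Fo x) (t' (Fo y) (Fo z))) (t' (Fo x) (Fo (t y z)))
        (tmor S' (Fo x) (Fo x) (t' (Fo y) (Fo z)) (Fo (t y z)) (Fm x x e) (\<mu> (y, d) (z, c)))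
        (Cmp D (t' (t' (Fo x) (Fo y)) (Fo z)) (t' (t' (Fo x) (Fo y)) (Fo z)) (t' (Fo x) (t' (Fo y) (Fo z))) (tassoc S' (Fo x) (Fo y) (Fo z))
          (tmor S' (t' (Fo x) (Fo y)) (t' (Fo x) (Fo y)) (Fo z) (Fo z)
            (tmor S' (Fo x) (Fo x) (Fo y) (Fo y) (Fm x x e) (Fm y y d)) (Fm z z c))))"
proof -
  let ?T = "t' (t' (Fo x) (Fo y)) (Fo z)" and ?T' = "t' (Fo x) (t' (Fo y) (Fo z))"
  let ?W = "t' (Fo (t x y)) (Fo z)" and ?W' = "t' (Fo x) (Fo (t y z))"
  let ?V = "Fo (t (t x y) z)" and ?V' = "Fo (t x (t y z))"
  let ?g = "tmor S' (Fo x) (Fo x) (Fo y) (Fo y) (Fm x x e) (Fm y y d)"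
  let ?g3 = "tmor S' (Fo y) (Fo y) (Fo z) (Fo z) (Fm y y d) (Fm z z c)"
  let ?E = "tmor S (t x y) (t x y) z z (tmor S x x y y e d) c"
  let ?E' = "tmor S' (t' (Fo x) (Fo y)) (t' (Fo x) (Fo y)) (Fo z) (Fo z) ?g (Fm z z c)"
  let ?\<alpha>' = "tassoc S' (Fo x) (Fo y) (Fo z)" and ?F\<alpha> = "Fm (t (t x y) z) (t x (t y z)) (tassoc S x y z)"
  note xy = S_idem[OF i(1,2)] and yz = S_idem[OF i(2,3)]
  note m = \<mu>_facts[OF i(1,2)] and M = \<mu>_facts[OF xy i(3)] and m' = \<mu>_facts[OF i(2,3)] and M' = \<mu>_facts[OF i(1) yz]
  have o: "x \<in> Obj C" "y \<in> Obj C" "z \<in> Obj C" using m(1,2) m'(2) by auto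
  note O = F_obj[OF o(1)] F_obj[OF o(2)] F_obj[OF o(3)]
  note Fe = F_arr[OF m(3)] and Fc = F_arr[OF m'(4)]
  have Fee: "Cmp D (Fo x) (Fo x) (Fo x) (Fm x x e) (Fm x x e) = Fm x x e" "Cmp D (Fo z) (Fo z) (Fo z) (Fm z z c) (Fm z z c) = Fm z z c"
    using F_idem[OF i(1)] F_idem[OF i(3)] by (simp_all add: idem_def)
  note \<alpha> = S.assoc_arr[OF o TrueI TrueI] and \<alpha>' = S'.assoc_arr[OF O TrueI TrueI] note F\<alpha> = F_arr[OF \<alpha>]
  note id = D.arr_id[OF O(1)] D.arr_id[OF O(3)]
  note E' = S'.tmor_arr[OF m(6) Fc TrueI TrueI]
  note b = S'.tmor_arr[OF m(8) Fc TrueI TrueI] and b' = S'.tmor_arr[OF Fe m'(8) TrueI TrueI]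
  note n = S'.tmor_arr[OF m(5) id(2) TrueI TrueI] and n' = S'.tmor_arr[OF id(1) m'(5) TrueI TrueI]
  let ?b = "tmor S' (t' (Fo x) (Fo y)) (Fo (t x y)) (Fo z) (Fo z) (\<mu> (x, e) (y, d)) (Fm z z c)"
  let ?b' = "tmor S' (Fo x) (Fo x) (t' (Fo y) (Fo z)) (Fo (t y z)) (Fm x x e) (\<mu> (y, d) (z, c))"
  let ?n = "tmor S' (t' (Fo x) (Fo y)) (Fo (t x y)) (Fo z) (Fo z) (\<nu> x y) (Idn D (Fo z))"
  let ?n' = "tmor S' (Fo x) (Fo x) (t' (Fo y) (Fo z)) (Fo (t y z)) (Idn D (Fo x)) (\<nu> y z)"
  let ?g2 = "tmor S' (Fo x) (Fo x) (t' (Fo y) (Fo z)) (t' (Fo y) (Fo z)) (Fm x x e) ?g3"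
  note g2 = S'.tmor_arr[OF Fe m'(6) TrueI TrueI]
  have gb: "Cmp D ?T ?W ?W (tmor S' (Fo (t x y)) (Fo (t x y)) (Fo z) (Fo z) (Fm (t x y) (t x y) (tmor S x x y y e d)) (Fm z z c)) ?b = ?b"
    unfolding S'_tmor_comp[OF m(8) m(7) Fc Fc, symmetric] m(12) Fee ..
  have gb': "Cmp D ?T' ?W' ?W' (tmor S' (Fo x) (Fo x) (Fo (t y z)) (Fo (t y z)) (Fm x x e) (Fm (t y z) (t y z) (tmor S y y z z d c))) ?b' = ?b'"
    unfolding S'_tmor_comp[OF Fe Fe m'(8) m'(7), symmetric] m'(12) Fee ..
  have bn: "?b = Cmp D ?T ?T ?W ?n ?E'"
    unfolding S'_tmor_comp[OF m(6,5) Fc id(2), symmetric] m(9) D.comp_id[OF Fc] ..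
  have bn': "?b' = Cmp D ?T' ?T' ?W' ?n' ?g2"
    unfolding S'_tmor_comp[OF Fe id(1) m'(6,5), symmetric] m'(9) D.comp_id[OF Fe] ..
  have EE: "Cmp D ?T ?T ?T ?E' ?E' = ?E'"
    unfolding S'_tmor_comp[OF m(6,6) Fc Fc, symmetric] m(11) Fee ..
  have nat: "Cmp D ?T ?T ?T' ?\<alpha>' ?E' = Cmp D ?T ?T' ?T' ?g2 ?\<alpha>'"
    by (rule S'.assoc_natural[OF Fe F_arr[OF m(4)] Fc TrueI TrueI TrueI TrueI])
  have Mb: "Cmp D ?T ?W ?V (\<mu> (t x y, tmor S x x y y e d) (z, c)) ?b = Cmp D ?T ?W ?V (\<nu> (t x y) z) ?b"
    unfolding M(9) D.comp_asc[OF b M(6,5)] gb ..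
  have "Cmp D ?T ?V ?V' (Fm (t (t x y) z) (t x (t y z)) (Cmp C (t (t x y) z) (t (t x y) z) (t x (t y z)) (tassoc S x y z) ?E))
      (Cmp D ?T ?W ?V (\<mu> (t x y, tmor S x x y y e d) (z, c)) ?b)
    = Cmp D ?T ?V ?V' ?F\<alpha> (Cmp D ?T ?V ?V (Fm (t (t x y) z) (t (t x y) z) ?E) (Cmp D ?T ?W ?V (\<mu> (t x y, tmor S x x y y e d) (z, c)) ?b))"
    unfolding F_comp_arr[OF S.tmor_arr[OF S.tmor_arr[OF m(3,4) TrueI TrueI] m'(4) TrueI TrueI] \<alpha>]
    by (rule D.comp_asc[OF D.arr_comp[OF b M(8)] M(7) F\<alpha>])
  also have "Cmp D ?T ?V ?V (Fm (t (t x y) z) (t (t x y) z) ?E) (Cmp D ?T ?W ?V (\<mu> (t x y, tmor S x x y y e d) (z, c)) ?b)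
    = Cmp D ?T ?W ?V (\<nu> (t x y) z) ?b"
    by (rule trans[OF D.comp_asc[OF b M(8) M(7), symmetric]]) (unfold M(12), rule Mb)
  also have "Cmp D ?T ?V ?V' ?F\<alpha> (Cmp D ?T ?W ?V (\<nu> (t x y) z) ?b)
    = Cmp D ?T ?T ?V' (Cmp D ?T ?V ?V' ?F\<alpha> (Cmp D ?T ?W ?V (\<nu> (t x y) z) ?n)) ?E'"
    unfolding bn D.comp_asc[OF E' D.arr_comp[OF n M(5)] F\<alpha>] D.comp_asc[OF E' n M(5)] ..
  also have "\<dots> = Cmp D ?T ?T ?V' (Cmp D ?T ?W' ?V' (\<nu> x (t y z)) (Cmp D ?T ?T' ?W' ?n' ?\<alpha>')) ?E'"
    unfolding mult_assoc[OF o TrueI TrueI] ..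
  also have "\<dots> = Cmp D ?T ?W' ?V' (\<nu> x (t y z)) (Cmp D ?T ?T' ?W' ?n' (Cmp D ?T ?T ?T' ?\<alpha>' ?E'))"
    unfolding D.comp_asc[OF E' D.arr_comp[OF \<alpha>' n'] M'(5)] D.comp_asc[OF E' \<alpha>' n'] ..
  \<comment> \<open>Idempotence of \<open>?E'\<close> creates a second copy, which naturality
    carries across the associator to supply the idempotent needed for \<open>?b'\<close>.\<close>
  also have "Cmp D ?T ?T ?T' ?\<alpha>' ?E' = Cmp D ?T ?T' ?T' ?g2 (Cmp D ?T ?T ?T' ?\<alpha>' ?E')"
    unfolding D.comp_asc[OF E' \<alpha>' g2, symmetric] nat[symmetric] D.comp_asc[OF E' E' \<alpha>'] EE ..
  also have "Cmp D ?T ?T' ?W' ?n' \<dots> = Cmp D ?T ?T' ?W' ?b' (Cmp D ?T ?T ?T' ?\<alpha>' ?E')"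
    unfolding bn' by (rule D.comp_asc[OF D.arr_comp[OF E' \<alpha>'] g2 n', symmetric])
  \<comment> \<open>\<open>\<nu>\<close> may be replaced by \<open>\<mu>\<close>, since
    \<open>?b'\<close> absorbs the idempotent in between.\<close>
  also have "Cmp D ?T ?W' ?V' (\<nu> x (t y z)) (Cmp D ?T ?T' ?W' ?b' (Cmp D ?T ?T ?T' ?\<alpha>' ?E'))
    = Cmp D ?T ?W' ?V' (\<mu> (x, e) (t y z, tmor S y y z z d c)) (Cmp D ?T ?T' ?W' ?b' (Cmp D ?T ?T ?T' ?\<alpha>' ?E'))"
    unfolding M'(9) D.comp_asc[OF D.arr_comp[OF D.arr_comp[OF E' \<alpha>'] b'] M'(6,5)]
      D.comp_asc[OF D.arr_comp[OF E' \<alpha>'] b' M'(6), symmetric] gb' ..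
  finally show ?thesis .
qed

lemma unit_arr: "arr D (tunit S') (Fo (tunit S)) \<epsilon>"
  using unit_iso D.iso_iff S'.unit_obj F_obj[OF S.unit_obj] by blast

lemma id_idem: "idem C (tunit S) (Idn C (tunit S))"
  using S.unit_obj by (simp add: idem_def)

text \<open>The idempotent of the unit object is an identity, so only \<open>F e\<close> has to be
  moved to the source, where the law for \<open>\<nu>\<close> applies.\<close>

lemma karoubi_mult_lunit:
  assumes i: "idem C x e"
  shows "Cmp D (t' (tunit S') (Fo x)) (Fo (t (tunit S) x)) (Fo x)
      (Fm (t (tunit S) x) x (Cmp C (t (tunit S) x) (t (tunit S) x) x (tlunit S x) (tmor S (tunit S) (tunit S) x x (Idn C (tunit S)) e)))
      (Cmp D (t' (tunit S') (Fo x)) (t' (Fo (tunit S)) (Fo x)) (Fo (t (tunit S) x)) (\<mu> (tunit S, Idn C (tunit S)) (x, e))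
        (tmor S' (tunit S') (Fo (tunit S)) (Fo x) (Fo x) \<epsilon> (Fm x x e)))
    = Cmp D (t' (tunit S') (Fo x)) (t' (tunit S') (Fo x)) (Fo x) (tlunit S' (Fo x))
        (tmor S' (tunit S') (tunit S') (Fo x) (Fo x) (Idn D (tunit S')) (Fm x x e))" (is "?L = ?R")
proof -
  let ?T = "t' (tunit S') (Fo x)" and ?W = "t' (Fo (tunit S)) (Fo x)" and ?V = "Fo (t (tunit S) x)"
  note M = \<mu>_facts[OF id_idem i]
  note O = F_obj[OF M(2)] F_obj[OF S.unit_obj]
  note Fe = F_arr[OF M(4)] note id = D.arr_id[OF O(1)] D.arr_id[OF S'.unit_obj]
  have Fee: "Cmp D (Fo x) (Fo x) (Fo x) (Fm x x e) (Fm x x e) = Fm x x e" using F_idem[OF i] by (simp add: idem_def)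
  note b = S'.tmor_arr[OF unit_arr Fe TrueI TrueI] and n = S'.tmor_arr[OF unit_arr id(1) TrueI TrueI]
    and g = S'.tmor_arr[OF id(2) Fe TrueI TrueI] and l = S.lunit_arr[OF M(2)] note Fl = F_arr[OF l]
  let ?b = "tmor S' (tunit S') (Fo (tunit S)) (Fo x) (Fo x) \<epsilon> (Fm x x e)"
  let ?n = "tmor S' (tunit S') (Fo (tunit S)) (Fo x) (Fo x) \<epsilon> (Idn D (Fo x))"
  let ?g = "tmor S' (tunit S') (tunit S') (Fo x) (Fo x) (Idn D (tunit S')) (Fm x x e)"
  let ?E = "tmor S (tunit S) (tunit S) x x (Idn C (tunit S)) e"
  have gb: "Cmp D ?T ?W ?W (tmor S' (Fo (tunit S)) (Fo (tunit S)) (Fo x) (Fo x) (Fm (tunit S) (tunit S) (Idn C (tunit S))) (Fm x x e)) ?b = ?b"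
    by (rule trans[OF S'_tmor_comp[OF unit_arr F_arr[OF M(3)] Fe Fe, symmetric]]) (simp only: F_id[OF S.unit_obj] D.comp_id[OF unit_arr] Fee)
  have bn: "?b = Cmp D ?T ?T ?W ?n ?g"
    unfolding S'_tmor_comp[OF id(2) unit_arr Fe id(1), symmetric] D.comp_id[OF unit_arr] D.comp_id[OF Fe] ..
  have "?L = Cmp D ?T ?V (Fo x) (Fm (t (tunit S) x) x (tlunit S x)) (Cmp D ?T ?V ?V (Fm (t (tunit S) x) (t (tunit S) x) ?E)
      (Cmp D ?T ?W ?V (\<mu> (tunit S, Idn C (tunit S)) (x, e)) ?b))"
    unfolding F_comp_arr[OF S.tmor_arr[OF M(3,4) TrueI TrueI] l] by (rule D.comp_asc[OF D.arr_comp[OF b M(8)] M(7) Fl])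
  also have "Cmp D ?T ?V ?V (Fm (t (tunit S) x) (t (tunit S) x) ?E) (Cmp D ?T ?W ?V (\<mu> (tunit S, Idn C (tunit S)) (x, e)) ?b)
    = Cmp D ?T ?W ?V (\<nu> (tunit S) x) ?b"
    unfolding D.comp_asc[OF b M(8,7), symmetric] M(12) unfolding M(9) D.comp_asc[OF b M(6,5)] gb ..
  also have "Cmp D ?T ?V (Fo x) (Fm (t (tunit S) x) x (tlunit S x)) \<dots>
    = Cmp D ?T ?T (Fo x) (Cmp D ?T ?V (Fo x) (Fm (t (tunit S) x) x (tlunit S x)) (Cmp D ?T ?W ?V (\<nu> (tunit S) x) ?n)) ?g"
    unfolding bn D.comp_asc[OF g D.arr_comp[OF n M(5)] Fl] D.comp_asc[OF g n M(5)] ..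
  also have "\<dots> = ?R" unfolding mult_lunit[OF M(2)] ..
  finally show ?thesis .
qed

lemma karoubi_mult_runit:
  assumes i: "idem C x e"
  shows "Cmp D (t' (Fo x) (tunit S')) (Fo (t x (tunit S))) (Fo x)
      (Fm (t x (tunit S)) x (Cmp C (t x (tunit S)) (t x (tunit S)) x (trunit S x) (tmor S x x (tunit S) (tunit S) e (Idn C (tunit S)))))
      (Cmp D (t' (Fo x) (tunit S')) (t' (Fo x) (Fo (tunit S))) (Fo (t x (tunit S))) (\<mu> (x, e) (tunit S, Idn C (tunit S)))
        (tmor S' (Fo x) (Fo x) (tunit S') (Fo (tunit S)) (Fm x x e) \<epsilon>))
    = Cmp D (t' (Fo x) (tunit S')) (t' (Fo x) (tunit S')) (Fo x) (trunit S' (Fo x))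
        (tmor S' (Fo x) (Fo x) (tunit S') (tunit S') (Fm x x e) (Idn D (tunit S')))" (is "?L = ?R")
proof -
  let ?T = "t' (Fo x) (tunit S')" and ?W = "t' (Fo x) (Fo (tunit S))" and ?V = "Fo (t x (tunit S))"
  note M = \<mu>_facts[OF i id_idem]
  note O = F_obj[OF M(1)] F_obj[OF S.unit_obj]
  note Fe = F_arr[OF M(3)] note id = D.arr_id[OF O(1)] D.arr_id[OF S'.unit_obj]
  have Fee: "Cmp D (Fo x) (Fo x) (Fo x) (Fm x x e) (Fm x x e) = Fm x x e" using F_idem[OF i] by (simp add: idem_def)
  note b = S'.tmor_arr[OF Fe unit_arr TrueI TrueI] and n = S'.tmor_arr[OF id(1) unit_arr TrueI TrueI]
    and g = S'.tmor_arr[OF Fe id(2) TrueI TrueI] and l = S.runit_arr[OF M(1)] note Fl = F_arr[OF l]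
  let ?b = "tmor S' (Fo x) (Fo x) (tunit S') (Fo (tunit S)) (Fm x x e) \<epsilon>"
  let ?n = "tmor S' (Fo x) (Fo x) (tunit S') (Fo (tunit S)) (Idn D (Fo x)) \<epsilon>"
  let ?g = "tmor S' (Fo x) (Fo x) (tunit S') (tunit S') (Fm x x e) (Idn D (tunit S'))"
  let ?E = "tmor S x x (tunit S) (tunit S) e (Idn C (tunit S))"
  have gb: "Cmp D ?T ?W ?W (tmor S' (Fo x) (Fo x) (Fo (tunit S)) (Fo (tunit S)) (Fm x x e) (Fm (tunit S) (tunit S) (Idn C (tunit S)))) ?b = ?b"
    by (rule trans[OF S'_tmor_comp[OF Fe Fe unit_arr F_arr[OF M(4)], symmetric]]) (simp only: F_id[OF S.unit_obj] D.comp_id[OF unit_arr] Fee)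
  have bn: "?b = Cmp D ?T ?T ?W ?n ?g"
    unfolding S'_tmor_comp[OF Fe id(1) id(2) unit_arr, symmetric] D.comp_id[OF unit_arr] D.comp_id[OF Fe] ..
  have "?L = Cmp D ?T ?V (Fo x) (Fm (t x (tunit S)) x (trunit S x)) (Cmp D ?T ?V ?V (Fm (t x (tunit S)) (t x (tunit S)) ?E)
      (Cmp D ?T ?W ?V (\<mu> (x, e) (tunit S, Idn C (tunit S))) ?b))"
    unfolding F_comp_arr[OF S.tmor_arr[OF M(3,4) TrueI TrueI] l] by (rule D.comp_asc[OF D.arr_comp[OF b M(8)] M(7) Fl])
  also have "Cmp D ?T ?V ?V (Fm (t x (tunit S)) (t x (tunit S)) ?E) (Cmp D ?T ?W ?V (\<mu> (x, e) (tunit S, Idn C (tunit S))) ?b)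
    = Cmp D ?T ?W ?V (\<nu> x (tunit S)) ?b"
    unfolding D.comp_asc[OF b M(8,7), symmetric] M(12) unfolding M(9) D.comp_asc[OF b M(6,5)] gb ..
  also have "Cmp D ?T ?V (Fo x) (Fm (t x (tunit S)) x (trunit S x)) \<dots>
    = Cmp D ?T ?T (Fo x) (Cmp D ?T ?V (Fo x) (Fm (t x (tunit S)) x (trunit S x)) (Cmp D ?T ?W ?V (\<nu> x (tunit S)) ?n)) ?g"
    unfolding bn D.comp_asc[OF g D.arr_comp[OF n M(5)] Fl] D.comp_asc[OF g n M(5)] ..
  also have "\<dots> = ?R" unfolding mult_runit[OF M(1)] ..
  finally show ?thesis .
qed

text \<open>As for associativity, the idempotent is duplicated at the source and one copy is carried
  across the braiding.\<close>

lemma karoubi_mult_braid: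
  assumes i: "idem C x e" "idem C y d"
  shows "Cmp D (t' (Fo x) (Fo y)) (Fo (t x y)) (Fo (t y x))
      (Fm (t x y) (t y x) (Cmp C (t x y) (t x y) (t y x) (tbraid S x y) (tmor S x x y y e d))) (\<mu> (x, e) (y, d))
    = Cmp D (t' (Fo x) (Fo y)) (t' (Fo y) (Fo x)) (Fo (t y x)) (\<mu> (y, d) (x, e))
      (Cmp D (t' (Fo x) (Fo y)) (t' (Fo x) (Fo y)) (t' (Fo y) (Fo x)) (tbraid S' (Fo x) (Fo y))
        (tmor S' (Fo x) (Fo x) (Fo y) (Fo y) (Fm x x e) (Fm y y d)))"
proof -
  note m = \<mu>_facts[OF i] and M = \<mu>_facts[OF i(2,1)]
  note \<beta> = S.braid_arr[OF m(1,2) TrueI] and \<beta>' = S'.braid_arr[OF F_obj[OF m(1)] F_obj[OF m(2)] TrueI]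
  note Fe = F_arr[OF m(3)] F_arr[OF m(4)]
  let ?T = "t' (Fo x) (Fo y)" and ?T' = "t' (Fo y) (Fo x)" and ?V = "Fo (t x y)" and ?V' = "Fo (t y x)"
  let ?g = "tmor S' (Fo x) (Fo x) (Fo y) (Fo y) (Fm x x e) (Fm y y d)" and ?g' = "tmor S' (Fo y) (Fo y) (Fo x) (Fo x) (Fm y y d) (Fm x x e)"
  let ?F\<beta> = "Fm (t x y) (t y x) (tbraid S x y)" and ?\<beta>' = "tbraid S' (Fo x) (Fo y)"
  have nat: "Cmp D ?T ?T ?T' ?\<beta>' ?g = Cmp D ?T ?T' ?T' ?g' ?\<beta>'" by (rule S'.braid_natural[OF Fe TrueI TrueI])
  have "Cmp D ?T ?V ?V' (Fm (t x y) (t y x) (Cmp C (t x y) (t x y) (t y x) (tbraid S x y) (tmor S x x y y e d))) (\<mu> (x, e) (y, d))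
    = Cmp D ?T ?V ?V' ?F\<beta> (\<mu> (x, e) (y, d))"
    unfolding F_comp_arr[OF S.tmor_arr[OF m(3,4) TrueI TrueI] \<beta>] D.comp_asc[OF m(8,7) F_arr[OF \<beta>]] m(12) ..
  also have "\<dots> = Cmp D ?T ?T ?V' (Cmp D ?T ?T' ?V' (\<nu> y x) ?\<beta>') ?g"
    unfolding m(9) D.comp_asc[OF m(6,5) F_arr[OF \<beta>], symmetric] mult_braid[OF m(1,2) TrueI] ..
  also have "\<dots> = Cmp D ?T ?T' ?V' (\<nu> y x) (Cmp D ?T ?T ?T' ?\<beta>' ?g)" by (rule D.comp_asc[OF m(6) \<beta>' M(5)])
  also have "Cmp D ?T ?T ?T' ?\<beta>' ?g = Cmp D ?T ?T' ?T' ?g' (Cmp D ?T ?T ?T' ?\<beta>' ?g)"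
    unfolding D.comp_asc[OF m(6) \<beta>' M(6), symmetric] nat[symmetric] D.comp_asc[OF m(6,6) \<beta>'] m(11) ..
  also have "Cmp D ?T ?T' ?V' (\<nu> y x) \<dots> = Cmp D ?T ?T' ?V' (\<mu> (y, d) (x, e)) (Cmp D ?T ?T ?T' ?\<beta>' ?g)"
    unfolding M(9) by (rule D.comp_asc[OF D.arr_comp[OF m(6) \<beta>'] M(6,5), symmetric])
  finally show ?thesis .
qed

lemma symmetric_monoidal_functor_karoubi:
  "symmetric_monoidal_functor (karoubi C) (karoubi_tensor C S) (karoubi D) (karoubi_tensor D S')
     (karoubi_obj Fo Fm) (karoubi_mor Fm) \<mu> \<epsilon>"
proof (intro symmetric_monoidal_functor.intro cat_functor_karoubi cat_functor_axioms symmetric_monoidal_functor_axioms.intro;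
    (clarify)?; unfold karoubi_tensor_simps karoubi_obj_def karoubi_mor_def prod.case karoubi_obj_iff karoubi_comp karoubi_id)
  show "iso (karoubi D) (tunit S', Idn D (tunit S')) (Fo (tunit S), Fm (tunit S) (tunit S) (Idn C (tunit S))) \<epsilon>"
  proof -
    note o = S'.unit_obj F_obj[OF S.unit_obj]
    have "iso (karoubi D) (tunit S', Idn D (tunit S')) (Fo (tunit S), Idn D (Fo (tunit S)))
        (Cmp D (tunit S') (tunit S') (Fo (tunit S)) \<epsilon> (Idn D (tunit S')))"
      by (rule karoubi_iso[OF D.category_axioms unit_iso]) (use o unit_arr in \<open>simp_all add: idem_def\<close>)
    then show ?thesis using unit_arr by (simp add: F_id[OF S.unit_obj])
  qed
qed (assumption | rule karoubi_mult_iso karoubi_mult_assoc karoubi_mult_lunit karoubi_mult_runit karoubi_mult_braid karoubi_mult_natural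
    | simp add: arr_def[of "karoubi C"] karoubi_obj_iff)+

end

text \<open>A morphism over the base into the product of the terminal object with \<open>x0\<close>
  has no freedom: its first coordinate is the map to the terminal object, its second the structure
  map.\<close>

lemma (in slice_category) terminal_base: "terminal B (Fo (terminal_of C))"
  unfolding terminal_def
proof (intro conjI ballI)
  note o = terminal_obj note P = base_obj_arr[OF o]
  show "Fo (terminal_of C) \<in> Obj B" using P by (simp add: base_obj_def sobj_iff)
  fix w assume "w \<in> Obj B"
  then obtain x p where w: "w = (x, p)" and p: "arr C x x0 p" by (cases w) (auto simp: sobj_iff)
  note h = pair_lift[OF bang_arr[OF arr_dom[OF p]] p]
  have "f = pair C x (terminal_of C) x0 (bang C x) p" if "f \<in> Hom B w (Fo (terminal_of C))" for f
  proof -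
    have "arr B (x, p) (P (terminal_of C), \<rho> (terminal_of C)) f"
      using that p P by (simp add: w base_obj_def arr_def[of B] sobj_iff)
    then have f: "arr C x (P (terminal_of C)) f" "Cmp C x (P (terminal_of C)) x0 (\<rho> (terminal_of C)) f = p"
      by (auto simp: sarr_iff)
    show ?thesis
      by (rule base_ext[OF o f(1) h(1) terminal_ext[OF arr_comp[OF f(1) P(1)] arr_comp[OF h(1) P(1)]]]) (simp only: f(2) h(3))
  qed
  moreover have "pair C x (terminal_of C) x0 (bang C x) p \<in> Hom B w (Fo (terminal_of C))"
  proof -
    have "arr B (x, p) (P (terminal_of C), \<rho> (terminal_of C)) (pair C x (terminal_of C) x0 (bang C x) p)"
      unfolding sarr_iff using h P p by simp
    then show ?thesis by (simp only: w base_obj_def arr_def[of B])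
  qed
  ultimately show "\<exists>!f. f \<in> Hom B w (Fo (terminal_of C))" by blast
qed

theorem corollary6p1p1:
  fixes A :: "('o, 'a) cat"
    and \<delta> :: "'o \<Rightarrow> 'o \<Rightarrow> 'a \<Rightarrow> 'k::field"
    and x\<^sub>0 :: 'o
  assumes "regular_category A"
    and "degree_function A \<delta>"
    and "x\<^sub>0 \<in> Obj A"
    and "\<forall>x \<in> Obj A. has_product A x x\<^sub>0"
  defines "B \<equiv> slice A x\<^sub>0"
    and "\<delta>' \<equiv> slice_degree \<delta>"
    and "Fo \<equiv> base_obj A x\<^sub>0"
    and "Fm \<equiv> base_mor A x\<^sub>0"
  shows "preserves_finite_limits A B Fo Fm \<and>
    linear_functor (T A \<delta>) (T B \<delta>') (ind_T_obj A B Fo Fm) (ind_T_mor A B Fo Fm) \<and>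
    (\<exists>\<mu> \<epsilon>. symmetric_monoidal_functor (T A \<delta>) (T_tensor A \<delta>) (T B \<delta>') (T_tensor B \<delta>')
       (ind_T_obj A B Fo Fm) (ind_T_mor A B Fo Fm) \<mu> \<epsilon>) \<and>
    preserves_finite_limits (T A \<delta>) (T B \<delta>') (ind_T_obj A B Fo Fm) (ind_T_mor A B Fo Fm)"
proof (intro conjI)
  interpret L: slice_category A \<delta> x\<^sub>0
    by (intro slice_category.intro degree_category.intro degree_category_axioms.intro slice_category_axioms.intro assms)
  \<comment> \<open>Preservation of the terminal object is what makes the induced functor
    monoidal.\<close>
  interpret F: terminal_degree_functor A B Fo Fm \<delta> \<delta>'
    unfolding B_def \<delta>'_def Fo_def Fm_def
    by (intro terminal_degree_functor.intro L.F.degree_functor_axioms terminal_degree_functor_axioms.intro L.terminal_base)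
  show "preserves_finite_limits A B Fo Fm"
    "preserves_finite_limits (T A \<delta>) (T B \<delta>') (ind_T_obj A B Fo Fm) (ind_T_mor A B Fo Fm)"
    unfolding B_def \<delta>'_def Fo_def Fm_def by (rule L.base_preserves_finite_limits)+
  show "linear_functor (T A \<delta>) (T B \<delta>') (ind_T_obj A B Fo Fm) (ind_T_mor A B Fo Fm)"
    by (rule F.linear_functor_ind)
  \<comment> \<open>The partial monoidal functor on relations becomes total on families and then
    passes to split idempotents.\<close>
  note T0 = F.partial_tensor_functor_T0 F.preadditive_functor_ind L.additive_partial_tensor_T0 degree_category.additive_partial_tensor_T0[OF F.D.degree_category_axioms]
  note additive = additive_partial_tensor_functor.partial_tensor_functor_additive[OF additive_partial_tensor_functor.intro[OF T0(3,4,2,1)]]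
  note karoubi = tensor_functor.symmetric_monoidal_functor_karoubi[OF tensor_functor.intro[OF additive]]
  show "\<exists>\<mu> \<epsilon>. symmetric_monoidal_functor (T A \<delta>) (T_tensor A \<delta>) (T B \<delta>') (T_tensor B \<delta>')
       (ind_T_obj A B Fo Fm) (ind_T_mor A B Fo Fm) \<mu> \<epsilon>"
    unfolding T_def T_tensor_def ind_T_obj_def ind_T_mor_def by (intro exI) (rule karoubi)
qed

end
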